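(* Let $L\subset S^3$ be a two-component link with $\det(L)=0$. Then for $\omega$ an arc going between the two components of $L$, $R_B(L,\omega)=\emptyset$.
   Context: Here $\omega$ is an embedded arc in $S^3$ meeting $L=L_1\cup L_2$ exactly in its endpoints, one on $L_1$ and one on $L_2$. Regard $SU(2)$ as the unit quaternions, with standard imaginary units $I,J,K$. The binary dihedral group is $BD=S^1_A\cup S^1_B\subset SU(2)$, $S^1_A=\{e^{I\theta}\}$, $S^1_B=\{Je^{I\theta}\}$. $R_B(L,\omega)=\{\rho:\pi_1(S^3\setminus(L\cup\omega))\to BD \mid \rho(\mu_{L_i})\in S^1_B \text{ for all } i,\ \rho(\mu_\omega)=-1\in S^1_A\}/\text{conjugation}$, where $\mu_{L_i}$ is a meridian around $L_i$ and $\mu_\omega$ a meridian around $\omega$ (conditions imposed for all such meridians). $\det(L)$ is the usual link determinant, $|\Delta_L(-1)|$, with $\Delta_L$ the Alexander polynomial; equivalently the absolute value of the determinant of a matrix obtained by deleting one row and one column from the Fox coloring matrix. *)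

theory Defs
  imports
    "HOL-Analysis.Analysis"
    "HOL-Algebra.Group"
    "Jordan_Normal_Form.Determinant"
begin

no_notation Matrix.vec_index (infixl "$" 100)


section \<open>Quaternions and the binary dihedral group\<close>

datatype quat = Quat (Re1: real) (ImI: real) (ImJ: real) (ImK: real)

instantiation quat :: "{one, times, uminus}"
begin

definition one_quat :: quat where
  "1 = Quat 1 0 0 0"

definition uminus_quat :: "quat \<Rightarrow> quat" where
  "- p = Quat (- Re1 p) (- ImI p) (- ImJ p) (- ImK p)"

definition times_quat :: "quat \<Rightarrow> quat \<Rightarrow> quat" where
  "p * q = Quat
     (Re1 p * Re1 q - ImI p * ImI q - ImJ p * ImJ q - ImK p * ImK q)
     (Re1 p * ImI q + ImI p * Re1 q + ImJ p * ImK q - ImK p * ImJ q)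
     (Re1 p * ImJ q - ImI p * ImK q + ImJ p * Re1 q + ImK p * ImI q)
     (Re1 p * ImK q + ImI p * ImJ q - ImJ p * ImI q + ImK p * Re1 q)"

instance ..

end

definition quatI :: quat where "quatI = Quat 0 1 0 0"
definition quatJ :: quat where "quatJ = Quat 0 0 1 0"
definition quatK :: quat where "quatK = Quat 0 0 0 1"

lemma quaternion_relations:
  "quatI * quatI = -1" "quatJ * quatJ = -1" "quatK * quatK = -1" "quatI * quatJ * quatK = -1"
  by (simp_all add: quatI_def quatJ_def quatK_def times_quat_def one_quat_def uminus_quat_def)

text \<open>The unit quaternion $e^{I\theta} = \cos\theta + I\sin\theta$.\<close>

definition exp_I :: "real \<Rightarrow> quat" where
  "exp_I \<theta> = Quat (cos \<theta>) (sin \<theta>) 0 0"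

definition S1_A :: "quat set" where
  "S1_A = range exp_I"

definition S1_B :: "quat set" where
  "S1_B = range (\<lambda>\<theta>. quatJ * exp_I \<theta>)"

definition BD :: "quat monoid" where
  "BD = \<lparr>carrier = S1_A \<union> S1_B, mult = (*), one = 1\<rparr>"


section \<open>The fundamental group\<close>

definition loops :: "'a::topological_space set \<Rightarrow> 'a \<Rightarrow> (real \<Rightarrow> 'a) set" where
  "loops S x = {p. path p \<and> path_image p \<subseteq> S \<and> pathstart p = x \<and> pathfinish p = x}"

definition loop_class :: "'a::topological_space set \<Rightarrow> (real \<Rightarrow> 'a) \<Rightarrow> (real \<Rightarrow> 'a) set" where
  "loop_class S p = {q. homotopic_paths S p q}"

definition fundamental_group ::
  "'a::topological_space set \<Rightarrow> 'a \<Rightarrow> (real \<Rightarrow> 'a) set monoid" where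
  "fundamental_group S x =
     \<lparr>carrier = loop_class S ` loops S x,
      mult = (\<lambda>A B. {r. \<exists>p\<in>A. \<exists>q\<in>B. homotopic_paths S (p +++ q) r}),
      one = loop_class S (\<lambda>_. x)\<rparr>"


section \<open>Tame links and arcs in the 3-sphere\<close>

definition S3 :: "(real^4) set" where
  "S3 = sphere 0 1"

text \<open>
  A chart at \<open>x\<close> is a homeomorphism from all of $\mathbb{R}^3$ onto an open neighbourhood of
  \<open>x\<close> in $S^3$ that sends the origin to \<open>x\<close>.
\<close>

definition chart_at :: "real^4 \<Rightarrow> (real^3 \<Rightarrow> real^4) \<Rightarrow> bool" where
  "chart_at x \<phi> \<longleftrightarrow>
     openin (top_of_set S3) (range \<phi>) \<and> (\<exists>\<psi>. homeomorphism UNIV (range \<phi>) \<phi> \<psi>) \<and> \<phi> 0 = x"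

definition z_axis :: "(real^3) set" where
  "z_axis = {v. v $ 1 = 0 \<and> v $ 2 = 0}"

definition x_ray :: "(real^3) set" where
  "x_ray = {v. v $ 1 \<ge> 0 \<and> v $ 2 = 0 \<and> v $ 3 = 0}"

definition flat_chart :: "(real^4) set \<Rightarrow> real^4 \<Rightarrow> (real^3 \<Rightarrow> real^4) \<Rightarrow> bool" where
  "flat_chart X x \<phi> \<longleftrightarrow> chart_at x \<phi> \<and> range \<phi> \<inter> X = \<phi> ` z_axis"

text \<open>
  Tameness is imposed as local flatness.  It holds for smooth and for piecewise linear links, and
  in dimension three it is equivalent to being equivalent to a polygonal link.
\<close>

definition two_component_link :: "(real^4) set \<Rightarrow> (real^4) set \<Rightarrow> bool" where
  "two_component_link L1 L2 \<longleftrightarrow>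
     L1 \<subseteq> S3 \<and> L2 \<subseteq> S3 \<and> L1 \<inter> L2 = {} \<and>
     L1 homeomorphic sphere (0::complex) 1 \<and> L2 homeomorphic sphere (0::complex) 1 \<and>
     (\<forall>x\<in>L1 \<union> L2. \<exists>\<phi>. flat_chart (L1 \<union> L2) x \<phi>)"

text \<open>
  An embedded tame arc that meets \<open>L1 \<union> L2\<close> exactly in its endpoints.  Near an endpoint the triple
  looks like a straight line from which a ray emanates.
\<close>

definition connecting_arc :: "(real^4) set \<Rightarrow> (real^4) set \<Rightarrow> (real^4) set \<Rightarrow> bool" where
  "connecting_arc L1 L2 \<omega> \<longleftrightarrow>
     \<omega> \<subseteq> S3 \<and>
     (\<exists>g. arc g \<and> path_image g = \<omega> \<and> pathstart g \<in> L1 \<and> pathfinish g \<in> L2 \<and>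
          \<omega> \<inter> (L1 \<union> L2) = {pathstart g, pathfinish g}) \<and>
     (\<forall>x\<in>\<omega> - (L1 \<union> L2). \<exists>\<phi>. flat_chart (L1 \<union> L2 \<union> \<omega>) x \<phi>) \<and>
     (\<forall>x\<in>\<omega> \<inter> (L1 \<union> L2). \<exists>\<phi>. chart_at x \<phi> \<and>
        range \<phi> \<inter> (L1 \<union> L2) = \<phi> ` z_axis \<and> range \<phi> \<inter> \<omega> = \<phi> ` x_ray)"


section \<open>Meridians and binary dihedral representations\<close>

definition unit_circle :: "real \<Rightarrow> real^3" where
  "unit_circle t = vector [cos (2 * pi * t), sin (2 * pi * t), 0]"

text \<open>
  The homotopy classes, in the complement of \<open>X\<close>, of the meridians around the part \<open>A\<close> of \<open>X\<close>:
  follow a path \<open>q\<close> from the base point to the boundary of a small disc that meets \<open>X\<close> transversely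
  in a single point, which lies on \<open>A\<close>; go once around the boundary of the disc, and return along
  \<open>q\<close>.  Charts may reverse orientation, so both directions around the disc occur.
\<close>

definition meridians :: "(real^4) set \<Rightarrow> (real^4) set \<Rightarrow> real^4 \<Rightarrow> (real \<Rightarrow> real^4) set set" where
  "meridians X A x0 =
     {loop_class (S3 - X) (q +++ (\<phi> \<circ> unit_circle) +++ reversepath q) | q \<phi> x.
        flat_chart X x \<phi> \<and> \<phi> ` z_axis \<subseteq> A \<and>
        path q \<and> path_image q \<subseteq> S3 - X \<and> pathstart q = x0 \<and> pathfinish q = \<phi> (unit_circle 0)}"

text \<open>\<open>\<L>\<close> is the set of components of the link and \<open>x0\<close> the base point.\<close>

definition BD_representations ::
  "(real^4) set set \<Rightarrow> (real^4) set \<Rightarrow> real^4 \<Rightarrow> ((real \<Rightarrow> real^4) set \<Rightarrow> quat) set" where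
  "BD_representations \<L> \<omega> x0 =
     (let X = \<Union>\<L> \<union> \<omega>; G = fundamental_group (S3 - X) x0 in
      {\<rho> \<in> hom G BD \<inter> extensional (carrier G).
         (\<forall>K\<in>\<L>. \<forall>\<mu>\<in>meridians X K x0. \<rho> \<mu> \<in> S1_B) \<and>
         (\<forall>\<mu>\<in>meridians X \<omega> x0. \<rho> \<mu> = -1)})"

definition BD_conjugation ::
  "(real^4) set set \<Rightarrow> (real^4) set \<Rightarrow> real^4 \<Rightarrow> ((real \<Rightarrow> real^4) set \<Rightarrow> quat) rel" where
  "BD_conjugation \<L> \<omega> x0 =
     {(\<rho>, \<sigma>). \<rho> \<in> BD_representations \<L> \<omega> x0 \<and> \<sigma> \<in> BD_representations \<L> \<omega> x0 \<and>
        (\<exists>b\<in>carrier BD. \<forall>g\<in>carrier (fundamental_group (S3 - (\<Union>\<L> \<union> \<omega>)) x0).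
           \<sigma> g = b \<otimes>\<^bsub>BD\<^esub> \<rho> g \<otimes>\<^bsub>BD\<^esub> inv\<^bsub>BD\<^esub> b)}"

definition R_B ::
  "(real^4) set set \<Rightarrow> (real^4) set \<Rightarrow> real^4 \<Rightarrow> ((real \<Rightarrow> real^4) set \<Rightarrow> quat) set set" where
  "R_B \<L> \<omega> x0 = BD_representations \<L> \<omega> x0 // BD_conjugation \<L> \<omega> x0"


section \<open>Polygonal link diagrams\<close>

text \<open>
  A polygonal link is a list \<open>Ps\<close> of closed polygons, each given by its cyclic list of vertices.
  The parameter \<open>(k, t)\<close> with \<open>0 \<le> t < length (Ps ! k)\<close> stands for the point on the edge from
  vertex \<open>\<lfloor>t\<rfloor>\<close> to the cyclically next vertex of the \<open>k\<close>-th polygon, at the fraction \<open>frac t\<close>.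
\<close>

type_synonym polygonal_link = "(real^3) list list"
type_synonym param = "nat \<times> real"

definition polygon_point :: "(real^3) list \<Rightarrow> real \<Rightarrow> real^3" where
  "polygon_point vs t =
     (let i = nat \<lfloor>t\<rfloor> in
      (1 - frac t) *\<^sub>R (vs ! i) + frac t *\<^sub>R (vs ! (Suc i mod length vs)))"

definition link_point :: "polygonal_link \<Rightarrow> param \<Rightarrow> real^3" where
  "link_point Ps a = polygon_point (Ps ! fst a) (snd a)"

definition params :: "polygonal_link \<Rightarrow> param set" where
  "params Ps = {(k, t). k < length Ps \<and> 0 \<le> t \<and> t < real (length (Ps ! k))}"

definition embedded_polygonal_link :: "polygonal_link \<Rightarrow> bool" where
  "embedded_polygonal_link Ps \<longleftrightarrow>
     (\<forall>vs\<in>set Ps. length vs \<ge> 3) \<and> inj_on (link_point Ps) (params Ps)"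

definition xy_proj :: "real^3 \<Rightarrow> real \<times> real" where
  "xy_proj v = (v $ 1, v $ 2)"

definition proj_fibre :: "polygonal_link \<Rightarrow> param \<Rightarrow> param set" where
  "proj_fibre Ps a =
     {b \<in> params Ps. xy_proj (link_point Ps b) = xy_proj (link_point Ps a)}"

text \<open>
  Regular position: the only multiple points of the projection are double points, and no double
  point is the image of a vertex.  For polygons this forces the double points to be finite in number
  and transverse, since parallel overlapping edges or vertical edges would produce multiple points
  at vertices.
\<close>

definition regular_position :: "polygonal_link \<Rightarrow> bool" where
  "regular_position Ps \<longleftrightarrow>
     (\<forall>a\<in>params Ps. finite (proj_fibre Ps a) \<and> card (proj_fibre Ps a) \<le> 2 \<and>
        (snd a \<in> \<int> \<longrightarrow> proj_fibre Ps a = {a}))"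

definition crosses_under :: "polygonal_link \<Rightarrow> param \<Rightarrow> param \<Rightarrow> bool" where
  "crosses_under Ps u v \<longleftrightarrow>
     u \<in> params Ps \<and> v \<in> proj_fibre Ps u \<and> link_point Ps u $ 3 < link_point Ps v $ 3"

text \<open>In regular position, crossings correspond bijectively to undercrossing points.\<close>

definition undercrossings :: "polygonal_link \<Rightarrow> param set" where
  "undercrossings Ps = {u. \<exists>v. crosses_under Ps u v}"

definition over_point :: "polygonal_link \<Rightarrow> param \<Rightarrow> param" where
  "over_point Ps u = (THE v. crosses_under Ps u v)"

text \<open>
  The arcs of the diagram run from one undercrossing to the cyclically next one on the same component.
  If every component has an undercrossing, they may be labelled by their initial points, so that
  undercrossings index both the crossings and the arcs.  \<open>arc_before Ps a\<close> is the arc on which one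
  arrives at \<open>a\<close>, that is, the last undercrossing cyclically before \<open>a\<close>.
\<close>

definition every_component_passes_under :: "polygonal_link \<Rightarrow> bool" where
  "every_component_passes_under Ps \<longleftrightarrow> (\<forall>k<length Ps. \<exists>t. (k, t) \<in> undercrossings Ps)"

definition arc_before :: "polygonal_link \<Rightarrow> param \<Rightarrow> param" where
  "arc_before Ps a =
     (let U = {s. (fst a, s) \<in> undercrossings Ps}; E = {s \<in> U. s < snd a}
      in (fst a, if E \<noteq> {} then Max E else Max U))"

text \<open>
  The row of the crossing with undercrossing point \<open>u\<close> encodes the Fox colouring relation
  \<open>2 \<cdot> over - under - under = 0\<close>; contributions add up when some of the three arcs coincide.
\<close>

definition fox_entry :: "polygonal_link \<Rightarrow> param \<Rightarrow> param \<Rightarrow> int" where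
  "fox_entry Ps u a =
     2 * of_bool (a = arc_before Ps (over_point Ps u))
     - of_bool (a = arc_before Ps u) - of_bool (a = u)"

definition fox_matrix :: "polygonal_link \<Rightarrow> param list \<Rightarrow> int mat" where
  "fox_matrix Ps us =
     Matrix.mat (length us) (length us) (\<lambda>(i, j). fox_entry Ps (us ! i) (us ! j))"


section \<open>The link determinant\<close>

text \<open>Inverse stereographic projection from $(0,0,0,1)$.\<close>

definition inv_stereographic :: "real^3 \<Rightarrow> real^4" where
  "inv_stereographic v =
     (let n = (norm v)\<^sup>2 in
      vector [2 * v $ 1 / (n + 1), 2 * v $ 2 / (n + 1), 2 * v $ 3 / (n + 1), (n - 1) / (n + 1)])"

definition ambient_isotopic :: "(real^4) set \<Rightarrow> (real^4) set \<Rightarrow> bool" where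
  "ambient_isotopic L L' \<longleftrightarrow>
     (\<exists>H. continuous_on ({0..1::real} \<times> S3) (\<lambda>(t, x). H t x) \<and>
          (\<forall>t\<in>{0..1}. \<exists>g. homeomorphism S3 S3 (H t) g) \<and>
          (\<forall>x\<in>S3. H 0 x = x) \<and> H 1 ` L = L')"

text \<open>
  \<open>is_link_det L d\<close> says that \<open>d\<close> is the determinant of \<open>L\<close>, computed from some diagram of \<open>L\<close> by
  deleting some row and some column of its Fox colouring matrix.  By the invariance of the
  determinant the value \<open>d\<close> does not depend on the choices.  Diagrams in which every component passes
  under somewhere exist for every tame link, and for them the matrix is square.
\<close>

definition is_link_det :: "(real^4) set \<Rightarrow> int \<Rightarrow> bool" where
  "is_link_det L d \<longleftrightarrow>
     (\<exists>Ps us r c.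
        embedded_polygonal_link Ps \<and> regular_position Ps \<and> every_component_passes_under Ps \<and>
        ambient_isotopic L (inv_stereographic ` link_point Ps ` params Ps) \<and>
        distinct us \<and> set us = undercrossings Ps \<and> r < length us \<and> c < length us \<and>
        d = \<bar>Determinant.det (mat_delete (fox_matrix Ps us) r c)\<bar>)"

end

theory Submission
  imports Defs
begin

text \<open>
  A representation \<open>\<rho>\<close> as in the theorem would colour the diagram of the link by elements of \<open>S1_B\<close>, that is,
  by angles.  Conjugation within \<open>S1_B\<close> reflects angles, so the Wirtinger relation at a crossing is the Fox
  relation \<open>2 \<cdot> over - under - under = 0\<close> modulo \<open>2\<pi>\<close>.  The arc \<open>\<omega>\<close> changes this in one respect.  Its meridians
  are sent to the central element \<open>-1\<close>, so it has no influence where it passes over or under the link;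
  but a meridian of the link that is pushed along the link past an end of \<open>\<omega>\<close> is multiplied by \<open>-1\<close>.
  Since \<open>\<omega>\<close> ends exactly once on each component, the angles satisfy Fox relations with right-hand sides
  \<open>\<pi> m\<close> for integers \<open>m\<close>, one for every undercrossing, of which exactly one is odd on each component.

  If the determinant vanishes, there is a relation between the rows of the colouring matrix, with
  integer coefficients that are not all even and with coefficient zero at some crossing
  (\<open>odd_row_relation\<close>).  Modulo 2 it says that the coefficients have constant parity on each component
  (\<open>parity_constant\<close>).  So, for two components, they are odd on exactly one of them.  Applying this
  relation to the Fox relations of the angles gives \<open>0\<close> on the left and an odd multiple of \<open>\<pi>\<close> on the
  right (\<open>fox_contradiction\<close>).

  The arc \<open>\<omega>\<close> is only locally flat and its position relative to the projection is arbitrary, so there is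
  no diagram of the link together with \<open>\<omega>\<close>.  Instead, \<open>\<rho>\<close> is extended to all paths in the complement and
  considered modulo sign, where \<open>\<omega>\<close> is invisible: over any open box that avoids the link, the complement
  of \<open>\<omega>\<close> has a trivialising section up to sign (\<open>sect_ibox\<close>).  Such sections glue over the region above
  the link (\<open>sky_section\<close>), and conjugating small meridians by this section of the sky defines the
  colours, with their exact signs.  Comparing the sky with a section in a tube around the link shows how
  colours change along the link (\<open>jump_visible\<close>) and below another strand (\<open>jump_under\<close>).  That the sign
  changes at an end of \<open>\<omega>\<close> is read off from a cylinder around the end (\<open>end_chart_circles\<close> and
  \<open>N_not_const_at_end\<close>).

  The theorem is reduced to this situation in \<open>\<real>\<^sup>3\<close> by the homeomorphism of the sphere at the end of the
  isotopy to a polygonal link, and by stereographic projection (\<open>link_arc_vimage\<close>).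
\<close>

section \<open>The binary dihedral group\<close>

instantiation quat :: ring_1
begin
definition zero_quat :: quat where "0 = Quat 0 0 0 0"
definition plus_quat :: "quat \<Rightarrow> quat \<Rightarrow> quat" where
  "p + q = Quat (Re1 p + Re1 q) (ImI p + ImI q) (ImJ p + ImJ q) (ImK p + ImK q)"
definition minus_quat :: "quat \<Rightarrow> quat \<Rightarrow> quat" where
  "p - q = Quat (Re1 p - Re1 q) (ImI p - ImI q) (ImJ p - ImJ q) (ImK p - ImK q)"
instance
  by standard
    (simp_all add: zero_quat_def one_quat_def plus_quat_def minus_quat_def times_quat_def
      uminus_quat_def algebra_simps)
end

abbreviation BDset :: "quat set" where "BDset \<equiv> S1_A \<union> S1_B"

definition qcnj :: "quat \<Rightarrow> quat" where
  "qcnj x = Quat (Re1 x) (- ImI x) (- ImJ x) (- ImK x)"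

lemma S1_A_iff: "x \<in> S1_A \<longleftrightarrow> ImJ x = 0 \<and> ImK x = 0 \<and> (Re1 x)\<^sup>2 + (ImI x)\<^sup>2 = 1"
proof
  assume "ImJ x = 0 \<and> ImK x = 0 \<and> (Re1 x)\<^sup>2 + (ImI x)\<^sup>2 = 1"
  then obtain t where "Re1 x = cos t" "ImI x = sin t"
    using sincos_total_2pi[of "Re1 x" "ImI x"] by metis
  then show "x \<in> S1_A"
    using \<open>ImJ x = 0 \<and> _\<close> by (auto simp: S1_A_def exp_I_def intro!: image_eqI[of _ _ t] quat.expand)
qed (auto simp: S1_A_def exp_I_def)

lemma quatJ_exp_I: "quatJ * exp_I t = Quat 0 0 (cos t) (- sin t)"
  by (simp add: quatJ_def exp_I_def times_quat_def)

lemma S1_B_iff: "x \<in> S1_B \<longleftrightarrow> Re1 x = 0 \<and> ImI x = 0 \<and> (ImJ x)\<^sup>2 + (ImK x)\<^sup>2 = 1"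
proof
  assume a: "Re1 x = 0 \<and> ImI x = 0 \<and> (ImJ x)\<^sup>2 + (ImK x)\<^sup>2 = 1"
  then obtain t where "ImJ x = cos t" "- ImK x = sin t"
    using sincos_total_2pi[of "ImJ x" "- ImK x"] by (metis power2_minus)
  then show "x \<in> S1_B"
    using a by (auto simp: S1_B_def quatJ_exp_I intro!: image_eqI[of _ _ t] quat.expand)
qed (auto simp: S1_B_def quatJ_exp_I)

definition qnorm :: "quat \<Rightarrow> real" where
  "qnorm x = (Re1 x)\<^sup>2 + (ImI x)\<^sup>2 + (ImJ x)\<^sup>2 + (ImK x)\<^sup>2"

lemma qnorm_mult: "qnorm (x * y) = qnorm x * qnorm y"
  by (simp add: qnorm_def times_quat_def power2_eq_square algebra_simps)

text \<open>
  The binary dihedral group consists of the quaternions of norm 1 in one of two complementary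
  coordinate planes; closure under products follows because the norm is multiplicative.
\<close>

lemma BD_iff_qnorm:
  "x \<in> S1_A \<longleftrightarrow> qnorm x = 1 \<and> ImJ x = 0 \<and> ImK x = 0"
  "x \<in> S1_B \<longleftrightarrow> qnorm x = 1 \<and> Re1 x = 0 \<and> ImI x = 0"
  by (auto simp: S1_A_iff S1_B_iff qnorm_def)

lemma BD_mult_closed: "x \<in> BDset \<Longrightarrow> y \<in> BDset \<Longrightarrow> x * y \<in> BDset"
  by (auto simp: BD_iff_qnorm qnorm_mult) (simp_all add: times_quat_def)

lemma one_in_BD [simp]: "1 \<in> BDset"
  by (auto simp: S1_A_iff one_quat_def)

lemma BD_uminus: "x \<in> BDset \<Longrightarrow> - x \<in> BDset"
  by (auto simp: S1_A_iff S1_B_iff uminus_quat_def)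

lemma BD_qcnj: "x \<in> BDset \<Longrightarrow> qcnj x \<in> BDset"
  by (auto simp: S1_A_iff S1_B_iff qcnj_def)

lemma BD_mult_qcnj [simp]: "x \<in> BDset \<Longrightarrow> x * qcnj x = 1" "x \<in> BDset \<Longrightarrow> qcnj x * x = 1"
  by (auto simp: S1_A_iff S1_B_iff qcnj_def times_quat_def one_quat_def power2_eq_square)

lemma BD_mult_qcnj_cancel [simp]:
  "x \<in> BDset \<Longrightarrow> x * (qcnj x * y) = y" "x \<in> BDset \<Longrightarrow> qcnj x * (x * y) = y"
  by (metis BD_mult_qcnj mult.assoc mult_1)+

lemma qcnj_mult: "qcnj (x * y) = qcnj y * qcnj x"
  by (simp add: qcnj_def times_quat_def)

lemma qcnj_simps [simp]: "qcnj (- x) = - qcnj x" "qcnj (qcnj x) = x" "qcnj 1 = 1"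
  by (simp_all add: qcnj_def uminus_quat_def one_quat_def)

lemma BD_inverse_unique: "x \<in> BDset \<Longrightarrow> x * y = 1 \<Longrightarrow> y = qcnj x"
  by (metis BD_mult_qcnj_cancel(2) mult_1_right)

lemma BD_cancel_left: "x \<in> BDset \<Longrightarrow> x * y = x * z \<longleftrightarrow> y = z"
  by (metis BD_mult_qcnj_cancel(2))

lemma BD_cancel_right: "x \<in> BDset \<Longrightarrow> y * x = z * x \<longleftrightarrow> y = z"
proof
  assume x: "x \<in> BDset" and e: "y * x = z * x"
  then have "y * x * qcnj x = z * x * qcnj x" by simp
  then show "y = z" using x by (simp add: mult.assoc)
qed simp

lemma BD_neq_uminus: "x \<in> BDset \<Longrightarrow> x \<noteq> - x"
proof
  assume "x \<in> BDset" "x = - x"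
  then have "1 = - (1::quat)"
    by (metis BD_mult_qcnj(1) mult_minus_left)
  then show False by (simp add: one_quat_def uminus_quat_def)
qed

text \<open>
  The elements of \<open>S1_B\<close> have order four, so reversing a meridian of the link changes its value by a
  sign only.  So the orientation of the upper strand does not matter at a crossing.
\<close>

lemma qcnj_S1_B: "x \<in> S1_B \<Longrightarrow> qcnj x = - x"
  by (simp add: S1_B_iff qcnj_def uminus_quat_def)

lemma S1_B_uminus: "x \<in> S1_B \<Longrightarrow> - x \<in> S1_B"
  by (simp add: S1_B_iff uminus_quat_def)

lemma S1_B_conj: "x \<in> S1_B \<Longrightarrow> g \<in> BDset \<Longrightarrow> g * x * qcnj g \<in> S1_B"
  by (auto simp: BD_iff_qnorm qnorm_mult)
    (simp_all add: times_quat_def qcnj_def, simp_all add: qnorm_def)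

text \<open>Equality modulo the central subgroup of order two, whose generator is the value on meridians of the arc.\<close>

definition eqpm :: "quat \<Rightarrow> quat \<Rightarrow> bool"  (infix "\<doteq>" 50) where
  "x \<doteq> y \<longleftrightarrow> x = y \<or> x = - y"

lemma eqpm_refl [simp]: "x \<doteq> x" by (simp add: eqpm_def)
lemma eqpm_sym: "x \<doteq> y \<Longrightarrow> y \<doteq> x" by (auto simp: eqpm_def)
lemma eqpm_trans [trans]: "x \<doteq> y \<Longrightarrow> y \<doteq> z \<Longrightarrow> x \<doteq> z" by (auto simp: eqpm_def)
lemma eqpm_mult: "x \<doteq> y \<Longrightarrow> x' \<doteq> y' \<Longrightarrow> x * x' \<doteq> y * y'" by (auto simp: eqpm_def)
lemma eqpm_qcnj: "x \<doteq> y \<Longrightarrow> qcnj x \<doteq> qcnj y" by (auto simp: eqpm_def)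
lemma eqpm_conj: "x \<doteq> y \<Longrightarrow> x * a * qcnj x = y * a * qcnj y" by (auto simp: eqpm_def)
lemma eqpm_uminus [simp]: "- x \<doteq> x" "x \<doteq> - x" by (auto simp: eqpm_def)
lemma eqpm_minus_iff [simp]: "- x \<doteq> y \<longleftrightarrow> x \<doteq> y" "x \<doteq> - y \<longleftrightarrow> x \<doteq> y"
  by (meson eqpm_trans eqpm_uminus)+
lemma eqpm_cancel_left: "x \<in> BDset \<Longrightarrow> x * y \<doteq> x * z \<longleftrightarrow> y \<doteq> z"
  unfolding eqpm_def by (metis BD_cancel_left mult_minus_right)

section \<open>Representations of path groupoids\<close>

text \<open>
  A homomorphism from the fundamental groupoid of \<open>V\<close> to the binary dihedral group.  Working with the
  groupoid makes base points and connecting paths disappear, so that the representation can be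
  restricted to open subsets and pulled back along maps.
\<close>

definition path_rep :: "'a::topological_space set \<Rightarrow> ((real \<Rightarrow> 'a) \<Rightarrow> quat) \<Rightarrow> bool" where
  "path_rep V F \<longleftrightarrow>
     (\<forall>p. path p \<and> path_image p \<subseteq> V \<longrightarrow> F p \<in> BDset) \<and>
     (\<forall>p q. path p \<and> path_image p \<subseteq> V \<and> path q \<and> path_image q \<subseteq> V \<and> pathfinish p = pathstart q
        \<longrightarrow> F (p +++ q) = F p * F q) \<and>
     (\<forall>p q. homotopic_paths V p q \<longrightarrow> F p = F q)"

lemma path_rep_BD: "path_rep V F \<Longrightarrow> path p \<Longrightarrow> path_image p \<subseteq> V \<Longrightarrow> F p \<in> BDset"
  by (auto simp: path_rep_def)

lemma path_rep_join:
  "path_rep V F \<Longrightarrow> path p \<Longrightarrow> path_image p \<subseteq> V \<Longrightarrow> path q \<Longrightarrow> path_image q \<subseteq> V \<Longrightarrow>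
    pathfinish p = pathstart q \<Longrightarrow> F (p +++ q) = F p * F q"
  by (auto simp: path_rep_def)

lemma path_rep_homotopic: "path_rep V F \<Longrightarrow> homotopic_paths V p q \<Longrightarrow> F p = F q"
  by (auto simp: path_rep_def)

lemma path_rep_const: "path_rep V F \<Longrightarrow> x \<in> V \<Longrightarrow> F (linepath x x) = 1"
proof -
  assume F: "path_rep V F" and x: "x \<in> V"
  let ?c = "linepath x x"
  have "F (?c +++ ?c) = F ?c * F ?c"
    using x by (intro path_rep_join[OF F]) auto
  moreover have "?c +++ ?c = ?c"
    by (auto simp: joinpaths_def linepath_def algebra_simps fun_eq_iff simp flip: scaleR_add_left)
  moreover have "F ?c \<in> BDset"
    using x by (intro path_rep_BD[OF F]) auto
  ultimately show ?thesis
    using BD_cancel_left[of "F ?c" "F ?c" 1] by simp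
qed

lemma path_rep_subset: "path_rep V F \<Longrightarrow> U \<subseteq> V \<Longrightarrow> path_rep U F"
  unfolding path_rep_def by (meson homotopic_paths_subset order_trans)

lemma path_rep_subpath:
  assumes F: "path_rep V F" and p: "path p" "path_image p \<subseteq> V" and abc: "0 \<le> a" "a \<le> b" "b \<le> c" "c \<le> 1"
  shows "F (subpath a b p) * F (subpath b c p) = F (subpath a c p)"
proof -
  have m: "a \<in> {0..1}" "b \<in> {0..1}" "c \<in> {0..1}" using abc by auto
  have sub: "path (subpath s t p)" "path_image (subpath s t p) \<subseteq> V" if "s \<in> {0..1}" "t \<in> {0..1}" for s t
    using that p path_image_subpath_subset[of s t p] by auto
  have "homotopic_paths V (subpath a b p +++ subpath b c p) (subpath a c p)"
    by (rule homotopic_join_subpaths1[OF p m abc(2,3)])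
  then have "F (subpath a c p) = F (subpath a b p +++ subpath b c p)"
    using path_rep_homotopic[OF F] by metis
  also have "\<dots> = F (subpath a b p) * F (subpath b c p)"
    using sub m by (intro path_rep_join[OF F]) auto
  finally show ?thesis by simp
qed

lemma path_rep_reverse:
  fixes V :: "'a::real_normed_vector set"
  assumes F: "path_rep V F" and p: "path p" "path_image p \<subseteq> V"
  shows "F (reversepath p) = qcnj (F p)"
proof -
  have "F (p +++ reversepath p) = F (linepath (pathstart p) (pathstart p))"
    using p by (intro path_rep_homotopic[OF F]) (rule homotopic_paths_rinv)
  also have "\<dots> = 1"
    using p by (intro path_rep_const[OF F]) (meson pathstart_in_path_image subsetD)
  finally have "F p * F (reversepath p) = 1"
    using p by (subst path_rep_join[OF F, symmetric]) auto
  then show ?thesis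
    using BD_inverse_unique path_rep_BD[OF F p] by blast
qed

lemma path_rep_simply_connected:
  fixes V :: "'a::real_normed_vector set"
  assumes F: "path_rep V F" and "simply_connected K" "K \<subseteq> V"
    and "path p" "path_image p \<subseteq> K" "path q" "path_image q \<subseteq> K"
    and "pathstart p = pathstart q" "pathfinish p = pathfinish q"
  shows "F p = F q"
proof -
  have "homotopic_paths K p q"
    using assms(2,4-) by (simp add: simply_connected_eq_homotopic_paths)
  then show ?thesis
    by (intro path_rep_homotopic[OF F] homotopic_paths_subset[OF _ assms(3)])
qed

lemma path_rep_convex:
  fixes V :: "'a::real_normed_vector set"
  assumes F: "path_rep V F" and "convex K" "K \<subseteq> V"
    and "path p" "path_image p \<subseteq> K" "path q" "path_image q \<subseteq> K"
    and "pathstart p = pathstart q" "pathfinish p = pathfinish q"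
  shows "F p = F q"
  by (rule path_rep_simply_connected[OF F convex_imp_simply_connected]) fact+

lemma path_rep_convex_linepath:
  fixes V :: "'a::real_normed_vector set"
  assumes F: "path_rep V F" and K: "convex K" "K \<subseteq> V" and abc: "a \<in> K" "b \<in> K" "c \<in> K"
  shows "F (linepath a b) * F (linepath b c) = F (linepath a c)"
proof -
  have *: "closed_segment a b \<subseteq> K" "closed_segment b c \<subseteq> K" "closed_segment a c \<subseteq> K"
    using K abc by (meson closed_segment_subset)+
  have "F (linepath a b +++ linepath b c) = F (linepath a c)"
    using * by (intro path_rep_convex[OF F K]) (auto simp: path_image_join)
  then show ?thesis
    using * K by (subst path_rep_join[OF F, symmetric]) auto
qed

lemma path_rep_pullback:
  assumes F: "path_rep V F" and h: "continuous_on U h" "h ` U \<subseteq> V"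
  shows "path_rep U (\<lambda>p. F (h \<circ> p))"
  unfolding path_rep_def
proof (intro conjI allI impI; (elim conjE)?)
  fix p assume p: "path p" "path_image p \<subseteq> U"
  then show "F (h \<circ> p) \<in> BDset"
    using h by (intro path_rep_BD[OF F] path_continuous_image)
      (auto simp: path_image_compose intro: continuous_on_subset)
next
  fix p q assume p: "path p" "path_image p \<subseteq> U" "path q" "path_image q \<subseteq> U"
    "pathfinish p = pathstart q"
  have "F ((h \<circ> p) +++ (h \<circ> q)) = F (h \<circ> p) * F (h \<circ> q)"
    using h p by (intro path_rep_join[OF F] path_continuous_image)
      (auto simp: path_image_compose pathfinish_compose pathstart_compose intro: continuous_on_subset)
  then show "F (h \<circ> (p +++ q)) = F (h \<circ> p) * F (h \<circ> q)"
    by (simp add: path_compose_join)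
next
  fix p q assume "homotopic_paths U p q"
  then show "F (h \<circ> p) = F (h \<circ> q)"
    using h by (intro path_rep_homotopic[OF F] homotopic_paths_continuous_image) auto
qed

lemma loop_class_eqI: "homotopic_paths S p q \<Longrightarrow> loop_class S p = loop_class S q"
  unfolding loop_class_def by (auto intro: homotopic_paths_trans homotopic_paths_sym)

lemma fundamental_group_mult:
  assumes "p \<in> loops S x" "q \<in> loops S x"
  shows "mult (fundamental_group S x) (loop_class S p) (loop_class S q) = loop_class S (p +++ q)"
proof -
  have pq: "path p" "path_image p \<subseteq> S" "path q" "path_image q \<subseteq> S" "pathfinish p = pathstart q"
    using assms by (auto simp: loops_def)
  have "(\<exists>p'\<in>loop_class S p. \<exists>q'\<in>loop_class S q. homotopic_paths S (p' +++ q') r) \<longleftrightarrow>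
     homotopic_paths S (p +++ q) r" for r
  proof
    assume "\<exists>p'\<in>loop_class S p. \<exists>q'\<in>loop_class S q. homotopic_paths S (p' +++ q') r"
    then obtain p' q' where *: "homotopic_paths S p p'" "homotopic_paths S q q'"
      "homotopic_paths S (p' +++ q') r" by (auto simp: loop_class_def)
    have "homotopic_paths S (p +++ q) (p' +++ q')"
      using * pq by (intro homotopic_paths_join) auto
    with * show "homotopic_paths S (p +++ q) r"
      by (meson homotopic_paths_trans)
  next
    assume "homotopic_paths S (p +++ q) r"
    with pq show "\<exists>p'\<in>loop_class S p. \<exists>q'\<in>loop_class S q. homotopic_paths S (p' +++ q') r"
      by (intro bexI[of _ p] bexI[of _ q]) (auto simp: loop_class_def)
  qed
  then show ?thesis
    by (simp add: fundamental_group_def loop_class_def)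
qed

text \<open>
  A homomorphism on the fundamental group extends to the groupoid of all paths, once every point
  has been joined to the base point by a chosen path \<open>\<gamma>\<close>.
\<close>

lemma path_rep_of_hom:
  fixes S :: "'a::real_normed_vector set"
  assumes \<rho>: "\<rho> \<in> hom (fundamental_group S x0) BD" and S: "path_connected S" and x0: "x0 \<in> S"
  obtains F where "path_rep S F"
    and "\<And>l. path l \<Longrightarrow> path_image l \<subseteq> S \<Longrightarrow> pathfinish l = pathstart l \<Longrightarrow>
           \<exists>q. path q \<and> path_image q \<subseteq> S \<and> pathstart q = x0 \<and> pathfinish q = pathstart l \<and>
               F l = \<rho> (loop_class S (q +++ l +++ reversepath q))"
proof -
  have "\<forall>y\<in>S. \<exists>g. path g \<and> path_image g \<subseteq> S \<and> pathstart g = x0 \<and> pathfinish g = y"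
    using S x0 by (auto simp: path_connected_def)
  then obtain \<gamma> where \<gamma>: "\<And>y. y \<in> S \<Longrightarrow> path (\<gamma> y)" "\<And>y. y \<in> S \<Longrightarrow> path_image (\<gamma> y) \<subseteq> S"
      "\<And>y. y \<in> S \<Longrightarrow> pathstart (\<gamma> y) = x0" "\<And>y. y \<in> S \<Longrightarrow> pathfinish (\<gamma> y) = y"
    by metis
  define L where "L p = \<gamma> (pathstart p) +++ p +++ reversepath (\<gamma> (pathfinish p))" for p
  define F where "F p = \<rho> (loop_class S (L p))" for p
  have mem: "pathstart p \<in> S" "pathfinish p \<in> S" if "path_image p \<subseteq> S" for p
    using that by auto
  have L: "L p \<in> loops S x0" if "path p" "path_image p \<subseteq> S" for p
    using that mem[OF that(2)] \<gamma> by (auto simp: L_def loops_def path_image_join)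
  have carr: "loop_class S p \<in> carrier (fundamental_group S x0)" if "p \<in> loops S x0" for p
    using that by (auto simp: fundamental_group_def)
  have "path_rep S F"
    unfolding path_rep_def
  proof (intro conjI allI impI; (elim conjE)?)
    fix p assume "path p" "path_image p \<subseteq> S"
    then show "F p \<in> BDset"
      using hom_in_carrier[OF \<rho> carr[OF L]] by (auto simp: F_def BD_def)
  next
    fix p q assume pq: "path p" "path_image p \<subseteq> S" "path q" "path_image q \<subseteq> S"
      "pathfinish p = pathstart q"
    let ?a = "\<gamma> (pathstart p)" and ?b = "\<gamma> (pathfinish p)" and ?c = "\<gamma> (pathfinish q)"
    note [simp] = pq(5)[symmetric]
    have m: "pathfinish p \<in> S" "pathstart p \<in> S" "pathfinish q \<in> S"
      using mem[OF pq(2)] mem[OF pq(4)] by auto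
    have \<gamma>m [simp]: "path ?a" "path ?b" "path ?c" "path_image ?a \<subseteq> S" "path_image ?b \<subseteq> S"
      "path_image ?c \<subseteq> S" "pathfinish ?a = pathstart p" "pathfinish ?b = pathfinish p"
      "pathfinish ?c = pathfinish q"
      using m \<gamma> by blast+
    have "homotopic_paths S (L p +++ L q) (L (p +++ q))"
    proof -
      let ?rb = "reversepath ?b" and ?rc = "reversepath ?c"
      have 1: "homotopic_paths S ((?a +++ p +++ ?rb) +++ (?b +++ q +++ ?rc))
                 (?a +++ ((p +++ ?rb) +++ (?b +++ q +++ ?rc)))"
        using pq by (intro homotopic_paths_sym[OF homotopic_paths_assoc]) (auto simp: path_image_join)
      have 2: "homotopic_paths S ((p +++ ?rb) +++ (?b +++ q +++ ?rc)) (p +++ (?rb +++ (?b +++ q +++ ?rc)))"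
        using pq by (intro homotopic_paths_sym[OF homotopic_paths_assoc]) (auto simp: path_image_join)
      have 3: "homotopic_paths S (?rb +++ (?b +++ q +++ ?rc)) ((?rb +++ ?b) +++ (q +++ ?rc))"
        using pq by (intro homotopic_paths_assoc) (auto simp: path_image_join)
      have 4: "homotopic_paths S ((?rb +++ ?b) +++ (q +++ ?rc)) (linepath (pathfinish p) (pathfinish p) +++ (q +++ ?rc))"
        using pq homotopic_paths_linv[of ?b S] by (intro homotopic_paths_join) (auto simp: path_image_join)
      have 5: "homotopic_paths S (linepath (pathfinish p) (pathfinish p) +++ (q +++ ?rc)) (q +++ ?rc)"
        using pq homotopic_paths_lid[of "q +++ ?rc" S] by (auto simp: path_image_join)
      have 6: "homotopic_paths S (?rb +++ (?b +++ q +++ ?rc)) (q +++ ?rc)"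
        using 3 4 5 by (meson homotopic_paths_trans)
      have 7: "homotopic_paths S (p +++ (?rb +++ (?b +++ q +++ ?rc))) (p +++ (q +++ ?rc))"
        using pq by (intro homotopic_paths_join[OF _ 6]) auto
      have 8: "homotopic_paths S (p +++ (q +++ ?rc)) ((p +++ q) +++ ?rc)"
        using pq by (intro homotopic_paths_assoc) auto
      have 9: "homotopic_paths S ((p +++ ?rb) +++ (?b +++ q +++ ?rc)) ((p +++ q) +++ ?rc)"
        using 2 7 8 by (meson homotopic_paths_trans)
      have "homotopic_paths S (?a +++ ((p +++ ?rb) +++ (?b +++ q +++ ?rc))) (?a +++ ((p +++ q) +++ ?rc))"
        using pq by (intro homotopic_paths_join[OF _ 9]) (auto simp: homotopic_paths_refl)
      from homotopic_paths_trans[OF 1 this] show ?thesis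
        unfolding L_def by simp
    qed
    then have "loop_class S (L (p +++ q)) = mult (fundamental_group S x0) (loop_class S (L p)) (loop_class S (L q))"
      using fundamental_group_mult[OF L[OF pq(1,2)] L[OF pq(3,4)]] by (metis loop_class_eqI)
    then show "F (p +++ q) = F p * F q"
      using hom_mult[OF \<rho> carr[OF L[OF pq(1,2)]] carr[OF L[OF pq(3,4)]]]
      unfolding F_def BD_def by simp
  next
    fix p q assume pq: "homotopic_paths S p q"
    have e: "pathstart q = pathstart p" "pathfinish q = pathfinish p"
      using pq homotopic_paths_imp_pathstart homotopic_paths_imp_pathfinish by metis+
    have s: "path p" "path q" "path_image p \<subseteq> S" "path_image q \<subseteq> S"
      using pq homotopic_paths_imp_path homotopic_paths_imp_subset by blast+
    have "homotopic_paths S (L p) (L q)"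
      unfolding L_def e using \<gamma>(1,2)[OF mem(1)[OF s(3)]] \<gamma>(1,2)[OF mem(2)[OF s(3)]]
        \<gamma>(4)[OF mem(1)[OF s(3)]] \<gamma>(4)[OF mem(2)[OF s(3)]] pq
      by (intro homotopic_paths_join) (simp_all add: homotopic_paths_refl)
    then show "F p = F q"
      by (simp add: F_def loop_class_eqI)
  qed
  moreover have "\<exists>q. path q \<and> path_image q \<subseteq> S \<and> pathstart q = x0 \<and> pathfinish q = pathstart l \<and>
               F l = \<rho> (loop_class S (q +++ l +++ reversepath q))"
    if "path l" "path_image l \<subseteq> S" "pathfinish l = pathstart l" for l
  proof (intro exI conjI)
    show "F l = \<rho> (loop_class S (\<gamma> (pathstart l) +++ l +++ reversepath (\<gamma> (pathstart l))))"
      by (simp add: F_def L_def that(3))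
  qed (use \<gamma> mem(1)[OF that(2)] in blast)+
  ultimately show ?thesis
    by (rule that)
qed

section \<open>Polar coordinates\<close>

abbreviation vec3 :: "real \<Rightarrow> real \<Rightarrow> real \<Rightarrow> real^3" where "vec3 x y z \<equiv> vector [x, y, z]"

lemma vec3_eta [simp]: "vec3 (x $ 1) (x $ 2) (x $ 3) = x"
  by (simp add: Finite_Cartesian_Product.vec_eq_iff forall_3)

lemma vec3_eq_iff: "(x::real^3) = y \<longleftrightarrow> x $ 1 = y $ 1 \<and> x $ 2 = y $ 2 \<and> x $ 3 = y $ 3"
  by (simp add: Finite_Cartesian_Product.vec_eq_iff forall_3)

lemma continuous_on_vec3 [continuous_intros]:
  assumes "continuous_on S f" "continuous_on S g" "continuous_on S h"
  shows "continuous_on S (\<lambda>x. vec3 (f x) (g x) (h x))"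
proof -
  have "continuous_on S (\<lambda>x. (if i = 1 then f else if i = 2 then g else h) x)" for i :: 3
    using assms by simp
  then have "continuous_on S (\<lambda>x. \<chi> i::3. (if i = 1 then f else if i = 2 then g else h) x)"
    by (rule continuous_on_vec_lambda)
  moreover have "(\<lambda>x. \<chi> i::3. (if i = 1 then f else if i = 2 then g else h) x) =
      (\<lambda>x. vec3 (f x) (g x) (h x))"
    by (simp add: fun_eq_iff vec3_eq_iff)
  ultimately show ?thesis by (simp only:)
qed

text \<open>
  Logarithmic polar coordinates around the third axis: the universal covering of the complement of
  the axis, whose deck transformations are the translations by multiples of \<open>turn\<close>.
\<close>

definition pol :: "real^3 \<Rightarrow> real^3" where
  "pol y = vec3 (exp (y $ 1) * cos (y $ 2)) (exp (y $ 1) * sin (y $ 2)) (y $ 3)"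

definition turn :: "real^3" where "turn = vec3 0 (2 * pi) 0"

lemma continuous_on_pol [continuous_intros]:
  fixes f :: "'a::t2_space \<Rightarrow> real^3"
  shows "continuous_on S f \<Longrightarrow> continuous_on S (\<lambda>x. pol (f x))"
  unfolding pol_def
  by (intro continuous_on_vec3 continuous_on_mult continuous_on_exp continuous_on_cos
      continuous_on_sin continuous_on_component)

lemma turn_nth [simp]: "turn $ 1 = 0" "turn $ 2 = 2 * pi" "turn $ 3 = 0"
  by (simp_all add: turn_def)

lemma pol_turn [simp]: "pol (y + of_int n *\<^sub>R turn) = pol y"
proof -
  have "\<exists>m::int. y $ 2 + of_int n * (2 * pi) = y $ 2 + 2 * pi * m"
    by (intro exI[of _ n]) simp
  then have "cos (y $ 2 + of_int n * (2 * pi)) = cos (y $ 2)" "sin (y $ 2 + of_int n * (2 * pi)) = sin (y $ 2)"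
    using sin_cos_eq_iff by metis+
  then show ?thesis
    by (simp add: pol_def)
qed

lemma pol_norm: "(pol y $ 1)\<^sup>2 + (pol y $ 2)\<^sup>2 = (exp (y $ 1))\<^sup>2"
proof -
  have "(pol y $ 1)\<^sup>2 + (pol y $ 2)\<^sup>2 = (exp (y $ 1))\<^sup>2 * ((cos (y $ 2))\<^sup>2 + (sin (y $ 2))\<^sup>2)"
    by (simp add: pol_def power_mult_distrib flip: distrib_left)
  then show ?thesis by simp
qed

lemma pol_notin_axis: "pol y \<notin> z_axis"
  using pol_norm[of y] by (auto simp: z_axis_def)

lemma pol_surj:
  assumes "x \<notin> z_axis"
  obtains y where "pol y = x" "a \<le> y $ 2" "y $ 2 < a + 2 * pi"
proof -
  let ?c = "Complex (x $ 1) (x $ 2)"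
  have nz: "?c \<noteq> 0"
    using assms by (auto simp: z_axis_def complex_eq_iff)
  define n where "n = \<lceil>(a - Arg ?c) / (2 * pi)\<rceil>"
  let ?y = "vec3 (ln (cmod ?c)) (Arg ?c) (x $ 3)"
  have "rcis (cmod ?c) (Arg ?c) = ?c"
    by (rule rcis_cmod_Arg)
  then have "pol ?y = x"
    using nz by (simp add: pol_def vec3_eq_iff rcis_def cis.ctr complex_eq_iff)
  then have "pol (?y + of_int n *\<^sub>R turn) = x"
    by (simp only: pol_turn)
  moreover have "(a - Arg ?c) / (2 * pi) \<le> of_int n" "of_int n < (a - Arg ?c) / (2 * pi) + 1"
    unfolding n_def by linarith+
  then have "a - Arg ?c \<le> of_int n * (2 * pi)" "of_int n * (2 * pi) < (a - Arg ?c) + 2 * pi"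
    by (simp_all add: field_simps)
  ultimately show ?thesis
    by (intro that[of "?y + of_int n *\<^sub>R turn"]) simp_all
qed

lemma pol_eqD:
  assumes "pol y = pol y'"
  shows "y $ 1 = y' $ 1" "y $ 3 = y' $ 3" "\<exists>n. y $ 2 = y' $ 2 + of_int n * (2 * pi)"
proof -
  have "(exp (y $ 1))\<^sup>2 = (exp (y' $ 1))\<^sup>2"
    using assms pol_norm by metis
  then show 1: "y $ 1 = y' $ 1" using power2_eq_imp_eq[OF _ exp_ge_zero exp_ge_zero] by simp
  show "y $ 3 = y' $ 3" using assms by (simp add: pol_def vec3_eq_iff)
  have "cos (y $ 2) = cos (y' $ 2)" "sin (y $ 2) = sin (y' $ 2)"
    using assms 1 by (simp_all add: pol_def vec3_eq_iff)
  then have "\<exists>n::int. y $ 2 = y' $ 2 + 2 * pi * n"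
    using sin_cos_eq_iff by metis
  then show "\<exists>n. y $ 2 = y' $ 2 + of_int n * (2 * pi)"
    by (metis mult.commute)
qed

lemma inj_on_pol_ball: "inj_on pol (ball c pi)"
proof
  fix y y' assume y: "y \<in> ball c pi" "y' \<in> ball c pi" and e: "pol y = pol y'"
  obtain n where n: "y $ 2 = y' $ 2 + of_int n * (2 * pi)"
    using pol_eqD(3)[OF e] by blast
  have "dist y y' < pi + pi"
    using y dist_triangle[of y y' c] by (simp add: dist_commute)
  moreover have "\<bar>y $ 2 - y' $ 2\<bar> \<le> dist y y'"
    using dist_vec_nth_le[of y 2 y'] by (simp add: dist_real_def)
  ultimately have "\<bar>of_int n * (2 * pi)\<bar> < 2 * pi"
    using n by simp
  then have "\<bar>real_of_int n\<bar> * (2 * pi) < 1 * (2 * pi)"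
    by (simp add: abs_mult)
  then have "n = 0" by (simp add: mult_less_cancel_right)
  with n pol_eqD(1,2)[OF e] show "y = y'"
    by (simp add: vec3_eq_iff)
qed

text \<open>
  The first two coordinates, read as a complex number, never vanish and so have a logarithm on a
  contractible set.
\<close>

lemma pol_lift:
  fixes c :: "'a::real_normed_vector \<Rightarrow> real^3"
  assumes c: "continuous_on K c" and K: "contractible K" and av: "\<And>x. x \<in> K \<Longrightarrow> c x \<notin> z_axis"
  obtains h where "continuous_on K h" "\<And>x. x \<in> K \<Longrightarrow> pol (h x) = c x"
proof -
  have "continuous_on K (\<lambda>x. Complex (c x $ 1) (c x $ 2))"
    using c by (intro continuous_intros)
  moreover have nz: "Complex (c x $ 1) (c x $ 2) \<noteq> 0" if "x \<in> K" for x
    using av[OF that] by (auto simp: z_axis_def complex_eq_iff)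
  ultimately obtain g where g: "continuous_on K g"
    "\<And>x. x \<in> K \<Longrightarrow> Complex (c x $ 1) (c x $ 2) = exp (g x)"
    using continuous_logarithm_on_contractible[OF _ K, of "\<lambda>x. Complex (c x $ 1) (c x $ 2)"] by blast
  show ?thesis
  proof
    show "continuous_on K (\<lambda>x. vec3 (Re (g x)) (Im (g x)) (c x $ 3))"
      using g(1) c by (intro continuous_intros)
    fix x assume "x \<in> K"
    from g(2)[OF this] show "pol (vec3 (Re (g x)) (Im (g x)) (c x $ 3)) = c x"
      by (auto simp: pol_def vec3_eq_iff complex_eq_iff Re_exp Im_exp)
  qed
qed

lemma pol_image_UNIV: "pol ` UNIV = - z_axis"
  using pol_notin_axis pol_surj by (metis (no_types, lifting) Compl_iff UNIV_I image_iff subsetI subset_antisym)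

lemma connected_Compl_z_axis: "connected (- z_axis)"
  unfolding pol_image_UNIV[symmetric]
  by (intro connected_continuous_image continuous_intros connected_UNIV)

lemma convex_vimage_nth: "convex I \<Longrightarrow> convex {x::real^3. x $ i \<in> I}"
  using convex_linear_vimage[OF bounded_linear.linear[OF bounded_linear_vec_nth], of I i]
  by (simp add: vimage_def)

lemma convex_nth: "convex {x::real^3. a < x $ i}" "convex {x::real^3. x $ i < a}"
  using convex_vimage_nth[of "{a<..}" i] convex_vimage_nth[of "{..<a}" i] by auto

text \<open>
  In polar coordinates the complement is covered by three convex sets: the angles strictly between
  \<open>0\<close> and \<open>2\<pi>\<close>, which avoid the half-plane that contains the ray, and the parts strictly above and
  strictly below the plane of the ray.
\<close>

lemma connected_Compl_z_axis_x_ray: "connected (- (z_axis \<union> x_ray))"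
proof -
  define A B C where "A = {y::real^3. 0 < y $ 2} \<inter> {y. y $ 2 < 2 * pi}"
    and "B = {y::real^3. 0 < y $ 3}" and "C = {y::real^3. y $ 3 < 0}"
  have con: "connected (pol ` X)" if "convex X" for X
    using that by (intro connected_continuous_image continuous_intros convex_connected)
  have "convex A" "convex B" "convex C"
    unfolding A_def B_def C_def by (intro convex_Int convex_nth)+
  note con3 = con[OF this(1)] con[OF this(2)] con[OF this(3)]
  have AB: "vec3 0 pi 1 \<in> A \<inter> B" "vec3 0 pi (-1) \<in> A \<inter> C"
    by (auto simp: A_def B_def C_def)
  have "connected (pol ` A \<union> pol ` B)"
    using con3 AB by (intro connected_Un) (blast intro: imageI)+
  then have "connected ((pol ` A \<union> pol ` B) \<union> pol ` C)"
    using con3 AB by (intro connected_Un) (blast intro: imageI)+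
  moreover have "(pol ` A \<union> pol ` B) \<union> pol ` C = - (z_axis \<union> x_ray)"
  proof (intro equalityI subsetI)
    fix x assume "x \<in> (pol ` A \<union> pol ` B) \<union> pol ` C"
    then obtain y where y: "x = pol y" "y \<in> A \<union> B \<union> C" by blast
    have False if "pol y \<in> x_ray"
    proof -
      have *: "y $ 3 = 0" "sin (y $ 2) = 0" "0 \<le> cos (y $ 2)"
        using that by (simp_all add: x_ray_def pol_def zero_le_mult_iff)
      then have "0 < y $ 2" "y $ 2 < 2 * pi"
        using y(2) by (auto simp: A_def B_def C_def)
      then have "y $ 2 = pi"
        using *(2) by (smt (verit) sin_eq_0_pi sin_gt_zero sin_minus sin_periodic_pi2 sin_2pi_minus)
      with *(3) show False by simp
    qed
    then show "x \<in> - (z_axis \<union> x_ray)"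
      using y pol_notin_axis by auto
  next
    fix x assume x: "x \<in> - (z_axis \<union> x_ray)"
    then obtain y where y: "pol y = x" "0 \<le> y $ 2" "y $ 2 < 0 + 2 * pi"
      using pol_surj by (metis ComplD UnCI)
    have "x \<in> x_ray" if "y $ 2 = 0" "y $ 3 = 0"
      using y(1) that by (auto simp: x_ray_def pol_def)
    then have "y $ 2 \<noteq> 0 \<or> 0 < y $ 3 \<or> y $ 3 < 0"
      using x by fastforce
    then have "y \<in> A \<union> B \<union> C"
      using y by (auto simp: A_def B_def C_def)
    with y(1) show "x \<in> (pol ` A \<union> pol ` B) \<union> pol ` C" by blast
  qed
  ultimately show ?thesis by metis
qed

section \<open>Sets that do not separate\<close>

text \<open>
  A separation of \<open>D - A\<close> extends over \<open>A\<close>: near a point of \<open>A\<close> the complement of \<open>A\<close> is connected and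
  so belongs to one of the two sides, and by density to only one.
\<close>

lemma connected_diff_thin:
  assumes D: "openin (top_of_set S) D" "connected D" and A: "closedin (top_of_set S) A"
    and nbhd: "\<And>x. x \<in> D \<inter> A \<Longrightarrow> \<exists>N. openin (top_of_set S) N \<and> x \<in> N \<and> N \<subseteq> D \<and> connected (N - A)"
    and dense: "\<And>x N. x \<in> D \<inter> A \<Longrightarrow> openin (top_of_set S) N \<Longrightarrow> x \<in> N \<Longrightarrow> N - A \<noteq> {}"
  shows "connected (D - A)"
proof (rule ccontr)
  assume "\<not> connected (D - A)"
  then obtain E1 E2 where E: "openin (top_of_set (D - A)) E1" "openin (top_of_set (D - A)) E2"
      "D - A = E1 \<union> E2" "E1 \<inter> E2 = {}" "E1 \<noteq> {}" "E2 \<noteq> {}"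
    unfolding connected_openin_eq by metis
  have oDA: "openin (top_of_set S) (D - A)"
    using D(1) A by (rule openin_diff)
  then have oE: "openin (top_of_set S) E1" "openin (top_of_set S) E2"
    using E openin_trans by blast+
  define U where "U E = \<Union>{N. openin (top_of_set S) N \<and> N \<subseteq> D \<and> N - A \<subseteq> E}" for E
  have U: "openin (top_of_set S) (U E)" "U E \<subseteq> D" for E
    unfolding U_def by (auto intro!: openin_Union)
  have sub: "E1 \<subseteq> U E1" "E2 \<subseteq> U E2"
    unfolding U_def using oE E(3) by blast+
  have "x \<in> U E1 \<union> U E2" if "x \<in> D" for x
  proof (cases "x \<in> A")
    case True
    with that have "x \<in> D \<inter> A" by simp
    from nbhd[OF this] obtain N where N: "openin (top_of_set S) N" "x \<in> N" "N \<subseteq> D" "connected (N - A)"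
      by metis
    have loc: "openin (top_of_set (N - A)) ((N - A) \<inter> E)" if E': "openin (top_of_set S) E" for E
    proof -
      obtain T where "open T" "E = S \<inter> T"
        using E' unfolding openin_open by metis
      then have "(N - A) \<inter> E = (N - A) \<inter> T"
        using openin_imp_subset[OF N(1)] by blast
      then show ?thesis
        using \<open>open T\<close> by (simp add: openin_open_Int)
    qed
    note loc[OF oE(1)] loc[OF oE(2)]
    moreover have "N - A = ((N - A) \<inter> E1) \<union> ((N - A) \<inter> E2)"
      using N(3) E(3) by blast
    moreover have "((N - A) \<inter> E1) \<inter> ((N - A) \<inter> E2) = {}"
      using E(4) by blast
    ultimately have "(N - A) \<inter> E1 = {} \<or> (N - A) \<inter> E2 = {}"
      using N(4) unfolding connected_openin_eq by metis
    then have "N - A \<subseteq> E1 \<or> N - A \<subseteq> E2"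
      using N(3) E(3) by blast
    then show ?thesis
      unfolding U_def using N by blast
  next
    case False
    then show ?thesis
      using that sub E(3) by blast
  qed
  then have cover: "U E1 \<union> U E2 = D"
    using U(2) by blast
  have "U E1 \<inter> U E2 = {}"
  proof (rule ccontr)
    assume "U E1 \<inter> U E2 \<noteq> {}"
    then obtain x N1 N2 where x: "x \<in> N1 \<inter> N2" "openin (top_of_set S) N1" "openin (top_of_set S) N2"
      "N1 \<subseteq> D" "N2 \<subseteq> D" "N1 - A \<subseteq> E1" "N2 - A \<subseteq> E2"
      unfolding U_def by auto
    have "N1 \<inter> N2 - A \<noteq> {}"
    proof (cases "x \<in> A")
      case True
      then show ?thesis
        using x dense[of x "N1 \<inter> N2"] by (auto intro: openin_Int)
    next
      case False
      then show ?thesis using x by auto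
    qed
    with x E(4) show False by auto
  qed
  moreover have "openin (top_of_set D) (U E1)" "openin (top_of_set D) (U E2)"
    by (rule openin_subset_trans[OF U(1) U(2) openin_imp_subset[OF D(1)]])+
  ultimately show False
    using D(2) cover E(5,6) sub unfolding connected_openin_eq by (metis subset_empty)
qed

section \<open>Sections up to sign\<close>

text \<open>
  A loop that links only the arc is sent to a sign, since the meridians of the arc are sent to the
  central element \<open>-1\<close>.  Where this holds for all loops, the representation is trivial modulo sign, and
  a section is a trivialisation: a function whose ratio at the two ends of any path is, up to sign,
  the value of the path.  Sections carry the values on distant loops to a common frame.
\<close>

definition sign_only :: "'a::topological_space set \<Rightarrow> ((real \<Rightarrow> 'a) \<Rightarrow> quat) \<Rightarrow> bool" where
  "sign_only D F \<longleftrightarrow> (\<forall>p. path p \<and> path_image p \<subseteq> D \<and> pathfinish p = pathstart p \<longrightarrow> F p \<doteq> 1)"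

definition sect :: "'a::topological_space set \<Rightarrow> ((real \<Rightarrow> 'a) \<Rightarrow> quat) \<Rightarrow> ('a \<Rightarrow> quat) \<Rightarrow> bool" where
  "sect D F f \<longleftrightarrow> (\<forall>x\<in>D. f x \<in> BDset) \<and>
     (\<forall>p. path p \<and> path_image p \<subseteq> D \<longrightarrow> f (pathfinish p) \<doteq> f (pathstart p) * F p)"

lemma sign_onlyD: "sign_only D F \<Longrightarrow> path p \<Longrightarrow> path_image p \<subseteq> D \<Longrightarrow> pathfinish p = pathstart p \<Longrightarrow> F p \<doteq> 1"
  by (simp add: sign_only_def)

lemma sign_only_subset: "sign_only D F \<Longrightarrow> D' \<subseteq> D \<Longrightarrow> sign_only D' F"
  unfolding sign_only_def by (meson order_trans)

lemma sect_BD: "sect D F f \<Longrightarrow> x \<in> D \<Longrightarrow> f x \<in> BDset"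
  by (simp add: sect_def)

lemma sectD: "sect D F f \<Longrightarrow> path p \<Longrightarrow> path_image p \<subseteq> D \<Longrightarrow> f (pathfinish p) \<doteq> f (pathstart p) * F p"
  by (simp add: sect_def)

lemma sect_subset: "sect D F f \<Longrightarrow> D' \<subseteq> D \<Longrightarrow> sect D' F f"
  unfolding sect_def by (meson order_trans subsetD)

lemma sect_left_mult: "sect D F f \<Longrightarrow> k \<in> BDset \<Longrightarrow> sect D F (\<lambda>x. k * f x)"
  unfolding sect_def by (metis BD_mult_closed eqpm_cancel_left mult.assoc)

lemma sect_cong:
  assumes f: "sect D F f" and g: "\<And>x. x \<in> D \<Longrightarrow> g x \<doteq> f x"
  shows "sect D F g"
  unfolding sect_def
proof (intro conjI allI impI ballI)
  fix x assume "x \<in> D"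
  then show "g x \<in> BDset"
    using g[of x] sect_BD[OF f, of x] BD_uminus[of "f x"] by (auto simp: eqpm_def)
next
  fix p assume p: "path p \<and> path_image p \<subseteq> D"
  then have "pathstart p \<in> D" "pathfinish p \<in> D"
    by auto
  then have "g (pathfinish p) \<doteq> f (pathfinish p)" "f (pathstart p) * F p \<doteq> g (pathstart p) * F p"
    using g[of "pathfinish p"] eqpm_mult[OF eqpm_sym[OF g[of "pathstart p"]] eqpm_refl] by simp_all
  then show "g (pathfinish p) \<doteq> g (pathstart p) * F p"
    using sectD[OF f] p by (meson eqpm_trans)
qed

lemma sect_exists:
  fixes D :: "'a::real_normed_vector set"
  assumes F: "path_rep D F" and D: "sign_only D F" "path_connected D"
  obtains f where "sect D F f"
proof (cases "D = {}")
  case True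
  then have "sect D F (\<lambda>_. 1)"
    by (simp add: sect_def)
  then show ?thesis by (rule that)
next
  case False
  then obtain y0 where y0: "y0 \<in> D" by blast
  have "\<forall>y\<in>D. \<exists>g. path g \<and> path_image g \<subseteq> D \<and> pathstart g = y0 \<and> pathfinish g = y"
    using D(2) y0 by (auto simp: path_connected_def)
  then obtain \<gamma> where \<gamma>: "\<And>y. y \<in> D \<Longrightarrow> path (\<gamma> y)" "\<And>y. y \<in> D \<Longrightarrow> path_image (\<gamma> y) \<subseteq> D"
      "\<And>y. y \<in> D \<Longrightarrow> pathstart (\<gamma> y) = y0" "\<And>y. y \<in> D \<Longrightarrow> pathfinish (\<gamma> y) = y"
    by metis
  have "sect D F (\<lambda>y. F (\<gamma> y))"
    unfolding sect_def
  proof (intro conjI allI impI ballI)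
    fix x assume "x \<in> D"
    then show "F (\<gamma> x) \<in> BDset"
      by (intro path_rep_BD[OF F] \<gamma>)
  next
    fix p assume p: "path p \<and> path_image p \<subseteq> D"
    let ?a = "pathstart p" and ?b = "pathfinish p"
    have ab: "?a \<in> D" "?b \<in> D" using p by auto
    note \<gamma>a = \<gamma>[OF ab(1)] and \<gamma>b = \<gamma>[OF ab(2)]
    let ?l = "\<gamma> ?a +++ (p +++ reversepath (\<gamma> ?b))"
    have "F ?l = F (\<gamma> ?a) * F (p +++ reversepath (\<gamma> ?b))"
      by (rule path_rep_join[OF F]) (use p \<gamma>a \<gamma>b in \<open>simp_all add: path_image_join\<close>)
    also have "F (p +++ reversepath (\<gamma> ?b)) = F p * qcnj (F (\<gamma> ?b))"
      unfolding path_rep_reverse[OF F \<gamma>b(1,2), symmetric]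
      by (rule path_rep_join[OF F]) (use p \<gamma>a \<gamma>b in simp_all)
    finally have "F ?l = F (\<gamma> ?a) * F p * qcnj (F (\<gamma> ?b))"
      by (simp add: mult.assoc)
    moreover have "F ?l \<doteq> 1"
      by (rule sign_onlyD[OF D(1)]) (use p \<gamma>a \<gamma>b in \<open>simp_all add: path_image_join\<close>)
    ultimately have "F (\<gamma> ?a) * F p * qcnj (F (\<gamma> ?b)) * F (\<gamma> ?b) \<doteq> 1 * F (\<gamma> ?b)"
      by (metis eqpm_mult eqpm_refl)
    moreover have "F (\<gamma> ?b) \<in> BDset"
      by (rule path_rep_BD[OF F \<gamma>b(1,2)])
    ultimately show "F (\<gamma> ?b) \<doteq> F (\<gamma> ?a) * F p"
      by (simp add: mult.assoc eqpm_sym)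
  qed
  then show ?thesis by (rule that)
qed

lemma sign_only_of_sect:
  assumes F: "path_rep D F" and f: "sect D F f"
  shows "sign_only D F"
  unfolding sign_only_def
proof (intro allI impI; elim conjE)
  fix p assume p: "path p" "path_image p \<subseteq> D" "pathfinish p = pathstart p"
  then have "f (pathstart p) * 1 \<doteq> f (pathstart p) * F p"
    using sectD[OF f p(1,2)] by simp
  moreover have "f (pathstart p) \<in> BDset"
    using p by (intro sect_BD[OF f]) auto
  ultimately show "F p \<doteq> 1"
    using eqpm_cancel_left eqpm_sym by blast
qed

text \<open>
  Along every path the ratio of two sections is constant, up to sign.
\<close>

lemma sect_unique:
  assumes D: "path_connected D" and f: "sect D F f" and g: "sect D F g"
    and y: "y0 \<in> D" "y \<in> D" and eq: "g y0 \<doteq> k * f y0"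
  shows "g y \<doteq> k * f y"
proof -
  obtain p where p: "path p" "path_image p \<subseteq> D" "pathstart p = y0" "pathfinish p = y"
    using D y unfolding path_connected_def by metis
  have "g y \<doteq> g y0 * F p" "f y \<doteq> f y0 * F p"
    using sectD[OF f p(1,2)] sectD[OF g p(1,2)] p(3,4) by auto
  then have "g y \<doteq> k * f y0 * F p" "k * (f y0 * F p) \<doteq> k * f y"
    using eq by (meson eqpm_mult eqpm_refl eqpm_trans eqpm_sym)+
  then show ?thesis
    by (metis eqpm_trans mult.assoc)
qed

lemma sect_compare:
  assumes D: "path_connected D" "D \<noteq> {}" and f: "sect D F f" and g: "sect D F g"
  obtains k where "k \<in> BDset" "\<And>y. y \<in> D \<Longrightarrow> g y \<doteq> k * f y"
proof -
  obtain y0 where y0: "y0 \<in> D" using D(2) by blast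
  have BD: "f y0 \<in> BDset" "g y0 \<in> BDset" using sect_BD[OF f y0] sect_BD[OF g y0] by auto
  show ?thesis
  proof (rule that)
    show "g y0 * qcnj (f y0) \<in> BDset" by (intro BD_mult_closed BD_qcnj BD)
    fix y assume "y \<in> D"
    then show "g y \<doteq> (g y0 * qcnj (f y0)) * f y"
      using sect_unique[OF D(1) f g y0, of y "g y0 * qcnj (f y0)"] BD(1) by (simp add: mult.assoc)
  qed
qed

lemma sect_pullback:
  assumes f: "sect D F f" and q: "continuous_on D' q" "q ` D' \<subseteq> D"
  shows "sect D' (\<lambda>p. F (q \<circ> p)) (\<lambda>x. f (q x))"
  unfolding sect_def
proof (intro conjI ballI allI impI)
  fix x assume "x \<in> D'"
  then show "f (q x) \<in> BDset" using q by (intro sect_BD[OF f]) blast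
next
  fix p assume p: "path p \<and> path_image p \<subseteq> D'"
  then have "path (q \<circ> p)"
    by (intro path_continuous_image continuous_on_subset[OF q(1)]) auto
  moreover have "path_image (q \<circ> p) \<subseteq> D"
    using p q(2) by (auto simp: path_image_compose)
  ultimately show "f (q (pathfinish p)) \<doteq> f (q (pathstart p)) * F (q \<circ> p)"
    using sectD[OF f, of "q \<circ> p"] unfolding pathfinish_compose pathstart_compose by blast
qed

text \<open>
  A path can be subdivided until each piece lies in an open set over which the function is a section.
\<close>

lemma sect_glue:
  fixes D :: "'a::real_normed_vector set"
  assumes F: "path_rep D F" and loc: "\<And>x. x \<in> D \<Longrightarrow> \<exists>U. open U \<and> x \<in> U \<and> sect (D \<inter> U) F f"
  shows "sect D F f"
  unfolding sect_def
proof (intro conjI allI impI ballI)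
  fix x assume x: "x \<in> D"
  with loc obtain U where "x \<in> U" "sect (D \<inter> U) F f" by metis
  with x show "f x \<in> BDset" by (metis IntI sect_BD)
next
  fix p assume "path p \<and> path_image p \<subseteq> D"
  then have p: "path p" "path_image p \<subseteq> D" by auto
  define P where "P a b \<longleftrightarrow> (0 \<le> a \<and> a \<le> b \<and> b \<le> 1 \<longrightarrow> f (p b) \<doteq> f (p a) * F (subpath a b p))" for a b
  have sub: "path (subpath a b p)" "path_image (subpath a b p) \<subseteq> D" if "0 \<le> a" "a \<le> b" "b \<le> 1" for a b
    using that p path_image_subpath_subset[of a b p] by auto
  have "(0::real) \<le> 1" by simp
  then have "P 0 1"
  proof (induction rule: Bolzano)
    case (trans a b c)
    show ?case
      unfolding P_def
    proof (intro impI; elim conjE)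
      assume ac: "0 \<le> a" "a \<le> c" "c \<le> 1"
      have e: "f (p a) * F (subpath a c p) = (f (p a) * F (subpath a b p)) * F (subpath b c p)"
        using path_rep_subpath[OF F p ac(1) trans(3,4) ac(3)] by (simp add: mult.assoc)
      have 1: "f (p b) \<doteq> f (p a) * F (subpath a b p)" and 2: "f (p c) \<doteq> f (p b) * F (subpath b c p)"
        using trans(1,2,3,4) ac by (auto simp: P_def)
      show "f (p c) \<doteq> f (p a) * F (subpath a c p)"
        unfolding e using 2 eqpm_mult[OF 1 eqpm_refl] by (rule eqpm_trans)
    qed
  next
    case (local x)
    then have "p x \<in> D" using p(2) by (auto simp: path_image_def)
    from loc[OF this] obtain U where U: "open U" "p x \<in> U" "sect (D \<inter> U) F f" by metis
    have "continuous_on {0..1} p" using p(1) by (simp add: path_def)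
    then obtain d where d: "d > 0" "\<And>t. t \<in> {0..1} \<Longrightarrow> \<bar>t - x\<bar> < d \<Longrightarrow> p t \<in> U"
    proof -
      obtain e where e: "e > 0" "ball (p x) e \<subseteq> U"
        using U open_contains_ball by metis
      obtain d where d: "d > 0" "\<And>t. t \<in> {0..1} \<Longrightarrow> dist t x < d \<Longrightarrow> dist (p t) (p x) < e"
        using \<open>continuous_on {0..1} p\<close> e(1) local unfolding continuous_on_iff
        by (metis atLeastAtMost_iff)
      show thesis
      proof (rule that[OF d(1)])
        fix t assume "t \<in> {0..1::real}" "\<bar>t - x\<bar> < d"
        then have "dist (p t) (p x) < e" by (intro d(2)) (auto simp: dist_real_def)
        then show "p t \<in> U" using e(2) by (auto simp: dist_commute)
      qed
    qed
    have "P a b" if ab: "a \<le> x" "x \<le> b" "b - a < d" for a b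
      unfolding P_def
    proof (intro impI; elim conjE)
      assume *: "0 \<le> a" "a \<le> b" "b \<le> 1"
      have "path_image (subpath a b p) = p ` {a..b}"
        using * by (simp add: path_image_subpath)
      moreover have "p ` {a..b} \<subseteq> U"
        using * ab by (auto intro!: d(2))
      ultimately have "path_image (subpath a b p) \<subseteq> D \<inter> U"
        using sub[OF *] by auto
      from sectD[OF U(3) sub(1)[OF *] this]
      show "f (p b) \<doteq> f (p a) * F (subpath a b p)" by simp
    qed
    with d(1) show ?case by blast
  qed
  then show "f (pathfinish p) \<doteq> f (pathstart p) * F p"
    by (simp add: P_def pathfinish_def pathstart_def)
qed

text \<open>
  The statement is of van Kampen type: sections over the two pieces differ by a constant on the
  connected overlap, so one of them can be multiplied by it and glued to the other.
\<close>

lemma sign_only_Un: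
  fixes D1 D2 :: "'a::real_normed_vector set"
  assumes F: "path_rep (D1 \<union> D2) F" and o: "open D1" "open D2" and g: "sign_only D1 F" "sign_only D2 F"
    and pc: "path_connected D1" "path_connected D2" "path_connected (D1 \<inter> D2)" and ne: "D1 \<inter> D2 \<noteq> {}"
  shows "sign_only (D1 \<union> D2) F"
proof -
  have F12: "path_rep D1 F" "path_rep D2 F"
    using path_rep_subset[OF F] by auto
  obtain f1 where f1: "sect D1 F f1" using sect_exists[OF F12(1) g(1) pc(1)] .
  obtain f2 where f2: "sect D2 F f2" using sect_exists[OF F12(2) g(2) pc(2)] .
  obtain k where k: "k \<in> BDset" and 12: "\<And>x. x \<in> D1 \<inter> D2 \<Longrightarrow> f1 x \<doteq> k * f2 x"
    by (rule sect_compare[OF pc(3) ne sect_subset[OF f2 Int_lower2] sect_subset[OF f1 Int_lower1]]) blast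
  define f where "f x = (if x \<in> D1 then f1 x else k * f2 x)" for x
  have s1: "sect D1 F f"
    by (rule sect_cong[OF f1]) (simp add: f_def)
  have s2: "sect D2 F f"
    by (rule sect_cong[OF sect_left_mult[OF f2 k]]) (use 12 in \<open>auto simp: f_def\<close>)
  have "sect (D1 \<union> D2) F f"
  proof (rule sect_glue[OF F])
    fix x assume "x \<in> D1 \<union> D2"
    moreover have "(D1 \<union> D2) \<inter> D1 = D1" "(D1 \<union> D2) \<inter> D2 = D2" by auto
    ultimately show "\<exists>U. open U \<and> x \<in> U \<and> sect ((D1 \<union> D2) \<inter> U) F f"
      using o s1 s2 by (metis UnE)
  qed
  with F show ?thesis by (rule sign_only_of_sect)
qed

section \<open>Deck transformations\<close>

text \<open>
  A representation of the complement of an axis, pulled back to polar coordinates, is a representation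
  \<open>G\<close> of a convex set that is invariant under a translation \<open>c\<close>.  Its value on the segment from \<open>y\<close> to
  \<open>y + c\<close> is the value on a circle around the axis.
\<close>

lemma deck_step:
  fixes K :: "'a::real_normed_vector set"
  assumes G: "path_rep K G" and K: "convex K" and y: "y \<in> K"
    and sh: "\<And>x n. x \<in> K \<Longrightarrow> x + of_int n *\<^sub>R c \<in> K"
    and inv: "\<And>p n. G (\<lambda>t. p t + of_int n *\<^sub>R c) = G p"
  shows "G (linepath y (y + of_int (n + 1) *\<^sub>R c)) =
         G (linepath y (y + of_int n *\<^sub>R c)) * G (linepath y (y + c))"
proof -
  let ?z = "y + of_int n *\<^sub>R c"
  have "G (linepath y ?z) * G (linepath ?z (y + of_int (n + 1) *\<^sub>R c)) =
        G (linepath y (y + of_int (n + 1) *\<^sub>R c))"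
    using y sh by (intro path_rep_convex_linepath[OF G K]) blast+
  moreover have "linepath ?z (y + of_int (n + 1) *\<^sub>R c) = (\<lambda>t. linepath y (y + c) t + of_int n *\<^sub>R c)"
    by (simp add: fun_eq_iff linepath_def algebra_simps)
  ultimately show ?thesis
    using inv by metis
qed

text \<open>
  The segments form the boundary of a parallelogram of which two opposite sides are translates of each
  other: circles at different places are conjugate.
\<close>

lemma deck_conj:
  fixes K :: "'a::real_normed_vector set"
  assumes G: "path_rep K G" and K: "convex K" and y: "y \<in> K" "y' \<in> K"
    and sh: "\<And>x n. x \<in> K \<Longrightarrow> x + of_int n *\<^sub>R c \<in> K"
    and inv: "\<And>p n. G (\<lambda>t. p t + of_int n *\<^sub>R c) = G p"
  shows "G (linepath y y') * G (linepath y' (y' + c)) = G (linepath y (y + c)) * G (linepath y y')"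
proof -
  have c: "y + c \<in> K" "y' + c \<in> K"
    using sh[OF y(1), of 1] sh[OF y(2), of 1] by auto
  have "G (linepath y y') * G (linepath y' (y' + c)) = G (linepath y (y' + c))"
    by (intro path_rep_convex_linepath[OF G K] y c subset_refl)
  also have "\<dots> = G (linepath y (y + c)) * G (linepath (y + c) (y' + c))"
    by (intro path_rep_convex_linepath[OF G K, symmetric] y c subset_refl)
  also have "linepath (y + c) (y' + c) = (\<lambda>t. linepath y y' t + of_int 1 *\<^sub>R c)"
    by (simp add: fun_eq_iff linepath_def algebra_simps)
  finally show ?thesis
    by (metis inv)
qed

lemma path_rep_cong:
  assumes F: "path_rep V F" and p: "path p" "path_image p \<subseteq> V" "\<And>t. t \<in> {0..1} \<Longrightarrow> p t = q t"
  shows "F p = F q"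
  using p by (intro path_rep_homotopic[OF F] homotopic_paths_eq) auto

lemma pol_linepath_turn: "pol \<circ> linepath y (y + turn) =
    (\<lambda>t. vec3 (exp (y $ 1) * cos (y $ 2 + 2 * pi * t)) (exp (y $ 1) * sin (y $ 2 + 2 * pi * t)) (y $ 3))"
  by (simp add: fun_eq_iff pol_def linepath_def algebra_simps)

lemma path_rep_pol: "path_rep (- z_axis) F \<Longrightarrow> path_rep UNIV (\<lambda>p. F (pol \<circ> p))"
  using pol_notin_axis by (intro path_rep_pullback continuous_intros) auto

lemma unit_circle_pol: "unit_circle = pol \<circ> linepath 0 (0 + turn)"
  unfolding pol_linepath_turn by (simp add: fun_eq_iff unit_circle_def)

text \<open>
  All circles around the axis are conjugate, and \<open>-1\<close> is central.
\<close>

lemma path_rep_turn: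
  assumes F: "path_rep (- z_axis) F" and u: "F (pol \<circ> linepath y0 (y0 + turn)) = - 1"
  shows "F (pol \<circ> linepath y (y + turn)) = - 1"
proof -
  define G where "G p = F (pol \<circ> p)" for p
  have G: "path_rep UNIV G"
    unfolding G_def by (rule path_rep_pol[OF F])
  have inv: "G (\<lambda>t. p t + of_int n *\<^sub>R turn) = G p" for p n
    by (simp add: G_def comp_def)
  have "G (linepath y0 y) * G (linepath y (y + turn)) =
      G (linepath y0 (y0 + turn)) * G (linepath y0 y)"
    by (rule deck_conj[OF G convex_UNIV]) (use inv in auto)
  also have "\<dots> = G (linepath y0 y) * (- 1)"
    using u by (simp add: G_def)
  finally have "G (linepath y0 y) * G (linepath y (y + turn)) = G (linepath y0 y) * (- 1)" .
  moreover have "G (linepath y0 y) \<in> BDset"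
    by (rule path_rep_BD[OF G]) auto
  ultimately show ?thesis
    unfolding G_def[symmetric] using BD_cancel_left by metis
qed

text \<open>
  A loop lifts to a path that ends some number of turns away from where it starts, and each turn
  contributes the factor \<open>-1\<close>.
\<close>

lemma sign_only_Compl_z_axis:
  assumes F: "path_rep (- z_axis) F" and u: "F unit_circle = - 1"
  shows "sign_only (- z_axis) F"
  unfolding sign_only_def
proof (intro allI impI; elim conjE)
  fix c assume c: "path c" "path_image c \<subseteq> - z_axis" "pathfinish c = pathstart c"
  define G where "G p = F (pol \<circ> p)" for p
  have G: "path_rep UNIV G"
    unfolding G_def by (rule path_rep_pol[OF F])
  have inv: "G (\<lambda>t. p t + of_int n *\<^sub>R turn) = G p" for p n
    by (simp add: G_def comp_def)
  have "c t \<notin> z_axis" if "t \<in> {0..1}" for t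
    using that c(2) unfolding path_image_def by blast
  then obtain h where h: "continuous_on {0..1} h" "\<And>t. t \<in> {0..1} \<Longrightarrow> pol (h t) = c t"
    using pol_lift[OF c(1)[unfolded path_def]] convex_imp_contractible[OF convex_real_interval(5)] by metis
  have "F c = G h"
    unfolding G_def using h(2) by (intro path_rep_cong[OF F c(1,2)]) auto
  have "pol (h 1) = pol (h 0)"
    using h(2)[of 0] h(2)[of 1] c(3) by (simp add: pathfinish_def pathstart_def)
  then obtain n where n: "h 1 = h 0 + of_int n *\<^sub>R turn"
    using pol_eqD[of "h 1" "h 0"] by (auto simp: vec3_eq_iff)
  have Gh: "G h = G (linepath (h 0) (h 1))"
    using h(1) by (intro path_rep_convex[OF G convex_UNIV])
      (auto simp: path_def[of h] pathstart_def[of h] pathfinish_def[of h])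
  have one: "G (linepath y (y + turn)) = - 1" for y
    unfolding G_def by (rule path_rep_turn[OF F u[unfolded unit_circle_pol]])
  have step: "G (linepath (h 0) (h 0 + of_int (m + 1) *\<^sub>R turn)) = - G (linepath (h 0) (h 0 + of_int m *\<^sub>R turn))" for m
    using deck_step[OF G convex_UNIV, of "h 0" turn m] inv one by auto
  have "G (linepath (h 0) (h 0 + of_int n *\<^sub>R turn)) \<doteq> 1"
  proof (induction n rule: int_induct[where k = 0])
    case base
    show ?case
      unfolding of_int_0 scaleR_zero_left add_0_right path_rep_const[OF G UNIV_I] by (rule eqpm_refl)
  next
    case (step1 i)
    then show ?case using step[of i] by simp
  next
    case (step2 i)
    then show ?case using step[of "i - 1"] by simp
  qed
  then show "F c \<doteq> 1"
    using \<open>F c = G h\<close> Gh n by metis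
qed

section \<open>Arcs with meridian minus one\<close>

lemma path_image_mem: "path_image p \<subseteq> D \<Longrightarrow> t \<in> {0..1} \<Longrightarrow> p t \<in> D"
  unfolding path_image_def by blast

text \<open>
  \<open>A\<close> is a locally flat curve, closed in the open set \<open>V\<close>, whose meridians are sent to \<open>-1\<close>.  Charts are
  only required to be continuous injections of \<open>\<real>\<^sup>3\<close>, which are open by invariance of domain; they come
  in arbitrarily small sizes.
\<close>

definition arc_sys :: "(real^3) set \<Rightarrow> (real^3) set \<Rightarrow> ((real \<Rightarrow> real^3) \<Rightarrow> quat) \<Rightarrow> bool" where
  "arc_sys V A F \<longleftrightarrow> open V \<and> closedin (top_of_set V) A \<and> path_rep (V - A) F \<and>
     (\<forall>x\<in>A. \<forall>W. open W \<and> x \<in> W \<and> W \<subseteq> V \<longrightarrow>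
        (\<exists>\<phi>. continuous_on UNIV \<phi> \<and> inj \<phi> \<and> \<phi> 0 = x \<and> range \<phi> \<subseteq> W \<and> \<phi> -` A = z_axis \<and>
             F (\<phi> \<circ> unit_circle) = - 1))"

lemma arc_sysD:
  assumes "arc_sys V A F"
  shows "open V" "closedin (top_of_set V) A" "path_rep (V - A) F" "A \<subseteq> V"
  using assms closedin_imp_subset unfolding arc_sys_def by auto

lemma arc_sys_chart:
  assumes "arc_sys V A F" "x \<in> A" "open W" "x \<in> W" "W \<subseteq> V"
  obtains \<phi> where "continuous_on UNIV \<phi>" "inj \<phi>" "\<phi> 0 = x" "range \<phi> \<subseteq> W" "\<phi> -` A = z_axis"
    "F (\<phi> \<circ> unit_circle) = - 1" "open (range \<phi>)"
proof -
  obtain \<phi> where \<phi>: "continuous_on UNIV \<phi>" "inj \<phi>" "\<phi> 0 = x" "range \<phi> \<subseteq> W" "\<phi> -` A = z_axis"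
    "F (\<phi> \<circ> unit_circle) = - 1"
    using assms unfolding arc_sys_def by metis
  moreover have "open (range \<phi>)"
    using \<phi>(1,2) by (intro invariance_of_domain) auto
  ultimately show ?thesis by (rule that)
qed

lemma arc_sys_open_diff: "arc_sys V A F \<Longrightarrow> open D \<Longrightarrow> D \<subseteq> V \<Longrightarrow> open (D - A)"
proof -
  assume A: "arc_sys V A F" and D: "open D" "D \<subseteq> V"
  obtain T where "closed T" "A = V \<inter> T"
    using arc_sysD(2)[OF A] closedin_closed by metis
  then have "D - A = D - T" using D by blast
  then show "open (D - A)" using D \<open>closed T\<close> by auto
qed

lemma z_axis_0 [simp]: "0 \<in> z_axis"
  by (simp add: z_axis_def)

lemma arc_sys_diff_nonempty:
  assumes A: "arc_sys V A F" and D: "open D" "D \<subseteq> V" "D \<noteq> {}"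
  shows "D - A \<noteq> {}"
proof (cases "D \<inter> A = {}")
  case True
  then show ?thesis using D by blast
next
  case False
  then obtain x where x: "x \<in> D" "x \<in> A" by blast
  obtain \<phi> where \<phi>: "range \<phi> \<subseteq> D" "\<phi> -` A = z_axis"
    using arc_sys_chart[OF A x(2) D(1) x(1) D(2)] by metis
  have "\<phi> (vec3 1 0 0) \<notin> A"
    using \<phi>(2) by (auto simp: z_axis_def set_eq_iff)
  then show ?thesis using \<phi>(1) by auto
qed

lemma arc_sys_path_connected:
  assumes A: "arc_sys V A F" and D: "open D" "D \<subseteq> V" "connected D"
  shows "path_connected (D - A)"
proof (rule connected_open_path_connected)
  show "open (D - A)" by (rule arc_sys_open_diff[OF A D(1,2)])
  show "connected (D - A)"
  proof (rule connected_diff_thin)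
    show "openin (top_of_set V) D" using D by (simp add: open_subset)
    show "connected D" by fact
    show "closedin (top_of_set V) A" by (rule arc_sysD(2)[OF A])
    fix x assume x: "x \<in> D \<inter> A"
    then obtain \<phi> where \<phi>: "continuous_on UNIV \<phi>" "inj \<phi>" "\<phi> 0 = x" "range \<phi> \<subseteq> D" "\<phi> -` A = z_axis"
      "F (\<phi> \<circ> unit_circle) = - 1" "open (range \<phi>)"
      using arc_sys_chart[OF A _ D(1) _ D(2)] by (metis IntD1 IntD2)
    have "range \<phi> - A = \<phi> ` (- z_axis)"
      unfolding \<phi>(5)[symmetric] by auto
    then have "connected (range \<phi> - A)"
      using connected_continuous_image[OF continuous_on_subset[OF \<phi>(1)] connected_Compl_z_axis] by simp
    then show "\<exists>N. openin (top_of_set V) N \<and> x \<in> N \<and> N \<subseteq> D \<and> connected (N - A)"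
      using \<phi>(3,4,7) D(2) by (intro exI[of _ "range \<phi>"]) (auto simp: open_subset)
  next
    fix x N assume "openin (top_of_set V) N" "x \<in> N"
    then show "N - A \<noteq> {}"
      using arc_sys_diff_nonempty[OF A, of N] arc_sysD(1)[OF A]
      by (metis openin_open_eq empty_iff)
  qed
qed

text \<open>
  Systems of this kind pull back along local homeomorphisms, in particular to the polar covering of a
  neighbourhood of the link.
\<close>

lemma arc_sys_pullback:
  assumes A: "arc_sys V A F" and V': "open V'" and q: "continuous_on V' q" "q ` V' \<subseteq> V"
    and li: "\<And>y. y \<in> V' \<Longrightarrow> \<exists>N. open N \<and> y \<in> N \<and> N \<subseteq> V' \<and> inj_on q N"
  shows "arc_sys V' {y \<in> V'. q y \<in> A} (\<lambda>p. F (q \<circ> p))"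
  unfolding arc_sys_def
proof (intro conjI ballI allI impI; (elim conjE)?)
  let ?A = "{y \<in> V'. q y \<in> A}"
  show "open V'" by fact
  obtain T where T: "closed T" "A = V \<inter> T"
    using arc_sysD(2)[OF A] closedin_closed by metis
  have "?A = V' \<inter> q -` T"
    using T q(2) by auto
  then show "closedin (top_of_set V') ?A"
    using continuous_closedin_preimage[OF q(1) T(1)] by simp
  show "path_rep (V' - ?A) (\<lambda>p. F (q \<circ> p))"
    using q by (intro path_rep_pullback[OF arc_sysD(3)[OF A]] continuous_on_subset[OF q(1)]) auto
  fix y W assume y: "y \<in> ?A" and W: "open W" "y \<in> W" "W \<subseteq> V'"
  obtain N where N: "open N" "y \<in> N" "N \<subseteq> V'" "inj_on q N"
    using li y by auto
  let ?N = "N \<inter> W"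
  have N': "open ?N" "continuous_on ?N q" "inj_on q ?N" "y \<in> ?N"
    using N W by (auto intro: inj_on_subset continuous_on_subset[OF q(1)])
  obtain r where r: "homeomorphism ?N (q ` ?N) q r"
    using invariance_of_domain_homeomorphism[OF N'(1,2) _ N'(3)] by auto
  have "open (q ` ?N)" using N' by (intro invariance_of_domain)
  moreover have "q y \<in> A" "q y \<in> q ` ?N" "q ` ?N \<subseteq> V"
    using y N' N(3) q(2) by auto
  ultimately obtain \<phi> where \<phi>: "continuous_on UNIV \<phi>" "inj \<phi>" "\<phi> 0 = q y" "range \<phi> \<subseteq> q ` ?N" "\<phi> -` A = z_axis"
      "F (\<phi> \<circ> unit_circle) = - 1"
    using arc_sys_chart[OF A] by metis
  have qr: "q (r (\<phi> v)) = \<phi> v" "r (\<phi> v) \<in> ?N" for v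
  proof -
    have "\<phi> v \<in> q ` ?N" using \<phi>(4) by blast
    then show "q (r (\<phi> v)) = \<phi> v" "r (\<phi> v) \<in> ?N"
      using r unfolding homeomorphism_def by blast+
  qed
  show "\<exists>\<phi>. continuous_on UNIV \<phi> \<and> inj \<phi> \<and> \<phi> 0 = y \<and> range \<phi> \<subseteq> W \<and> \<phi> -` ?A = z_axis \<and>
             F (q \<circ> (\<phi> \<circ> unit_circle)) = - 1"
  proof (intro exI conjI)
    show "continuous_on UNIV (r \<circ> \<phi>)"
      using \<phi>(1,4) r by (intro continuous_on_compose) (auto simp: homeomorphism_def intro: continuous_on_subset)
    show "inj (r \<circ> \<phi>)"
      by (rule injI) (metis comp_apply qr(1) injD[OF \<phi>(2)])
    show "(r \<circ> \<phi>) 0 = y"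
      using r N'(4) \<phi>(3) by (auto simp: homeomorphism_def)
    show "range (r \<circ> \<phi>) \<subseteq> W"
      using qr(2) by auto
    show "(r \<circ> \<phi>) -` ?A = z_axis"
      unfolding \<phi>(5)[symmetric] using qr N(3) by auto
    have "q \<circ> (r \<circ> \<phi> \<circ> unit_circle) = \<phi> \<circ> unit_circle"
      using qr by (auto simp: fun_eq_iff)
    then show "F (q \<circ> (r \<circ> \<phi> \<circ> unit_circle)) = - 1"
      using \<phi>(6) by simp
  qed
qed

text \<open>
  Near a point of the curve a loop is a loop in the complement of an axis; elsewhere small loops are
  contractible.
\<close>

lemma arc_sys_local_sign_only:
  assumes A: "arc_sys V A F" and x: "x \<in> V"
  shows "\<exists>N. open N \<and> x \<in> N \<and> N \<subseteq> V \<and> sign_only (N - A) F"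
proof (cases "x \<in> A")
  case False
  then have "x \<in> V - A" "open (V - A)"
    using x arc_sys_open_diff[OF A arc_sysD(1)[OF A] subset_refl] by auto
  then obtain e where e: "e > 0" "ball x e \<subseteq> V - A"
    using open_contains_ball by metis
  note F = path_rep_subset[OF arc_sysD(3)[OF A] e(2)]
  have "sign_only (ball x e - A) F"
    unfolding sign_only_def
  proof (intro allI impI; elim conjE)
    fix p assume p: "path p" "path_image p \<subseteq> ball x e - A" "pathfinish p = pathstart p"
    then have p': "path_image p \<subseteq> ball x e" "pathstart p \<in> ball x e"
      using pathstart_in_path_image[of p] by blast+
    have "F p = F (linepath (pathstart p) (pathstart p))"
      using p p' by (intro path_rep_convex[OF F convex_ball]) auto
    also have "\<dots> = 1"
      using p' by (intro path_rep_const[OF F]) simp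
    finally show "F p \<doteq> 1" by simp
  qed
  then show ?thesis
    using e by (intro exI[of _ "ball x e"]) auto
next
  case True
  obtain \<phi> where \<phi>: "continuous_on UNIV \<phi>" "inj \<phi>" "\<phi> 0 = x" "range \<phi> \<subseteq> V" "\<phi> -` A = z_axis"
      "F (\<phi> \<circ> unit_circle) = - 1" "open (range \<phi>)"
    using arc_sys_chart[OF A True arc_sysD(1)[OF A] x subset_refl] by metis
  have im: "\<phi> ` (- z_axis) \<subseteq> V - A"
    using \<phi>(4,5) by auto
  have F: "path_rep (- z_axis) (\<lambda>p. F (\<phi> \<circ> p))"
    by (rule path_rep_pullback[OF arc_sysD(3)[OF A] continuous_on_subset[OF \<phi>(1)] im]) simp
  have g: "sign_only (- z_axis) (\<lambda>p. F (\<phi> \<circ> p))"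
    by (rule sign_only_Compl_z_axis[OF F \<phi>(6)])
  obtain r where r: "homeomorphism UNIV (range \<phi>) \<phi> r"
    using invariance_of_domain_homeomorphism[OF open_UNIV \<phi>(1) _ \<phi>(2)] by auto
  have "sign_only (range \<phi> - A) F"
    unfolding sign_only_def
  proof (intro allI impI; elim conjE)
    fix p assume p: "path p" "path_image p \<subseteq> range \<phi> - A" "pathfinish p = pathstart p"
    have rp: "\<phi> (r (p t)) = p t" "p t \<in> range \<phi> - A" if "t \<in> {0..1}" for t
    proof -
      show "p t \<in> range \<phi> - A" by (rule path_image_mem[OF p(2) that])
      then show "\<phi> (r (p t)) = p t" using r by (auto simp: homeomorphism_def)
    qed
    have "path (r \<circ> p)"
      using p(1,2) r by (intro path_continuous_image) (auto simp: homeomorphism_def intro: continuous_on_subset)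
    moreover have "path_image (r \<circ> p) \<subseteq> - z_axis"
      unfolding \<phi>(5)[symmetric] path_image_def using rp by auto
    moreover have "pathfinish (r \<circ> p) = pathstart (r \<circ> p)"
      using p(3) by (simp add: pathfinish_def pathstart_def)
    ultimately have "F (\<phi> \<circ> (r \<circ> p)) \<doteq> 1"
      by (rule sign_onlyD[OF g])
    moreover have "F p = F (\<phi> \<circ> (r \<circ> p))"
      using p \<phi>(4) rp by (intro path_rep_cong[OF arc_sysD(3)[OF A]]) auto
    ultimately show "F p \<doteq> 1" by simp
  qed
  then show ?thesis
    using \<phi>(3,4,7) by (intro exI[of _ "range \<phi>"]) auto
qed

subsection \<open>Boxes\<close>

definition ibox :: "(3 \<Rightarrow> real set) \<Rightarrow> (real^3) set" where
  "ibox I = {x. \<forall>i. x $ i \<in> I i}"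

lemma ibox_Int: "ibox I \<inter> ibox J = ibox (\<lambda>i. I i \<inter> J i)"
  by (auto simp: ibox_def)

lemma convex_ibox: "(\<And>i. convex (I i)) \<Longrightarrow> convex (ibox I)"
proof -
  assume "\<And>i. convex (I i)"
  moreover have "ibox I = (\<Inter>i. {x. x $ i \<in> I i})"
    by (auto simp: ibox_def)
  ultimately show "convex (ibox I)"
    by (auto intro!: convex_INT convex_vimage_nth)
qed

lemma open_ibox: "(\<And>i. open (I i)) \<Longrightarrow> open (ibox I)"
proof -
  assume I: "\<And>i. open (I i)"
  have "ibox I = (\<Inter>i\<in>UNIV. (\<lambda>x. x $ i) -` I i)"
    by (auto simp: ibox_def)
  moreover have "open ((\<lambda>x::real^3. x $ i) -` I i)" for i
    by (intro open_vimage I continuous_on_component continuous_on_id)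
  ultimately show "open (ibox I)"
    by (simp add: open_INT)
qed

abbreviation fat_box :: "real^3 \<Rightarrow> real^3 \<Rightarrow> real \<Rightarrow> (real^3) set" where
  "fat_box l u d \<equiv> ibox (\<lambda>i. {l $ i - d <..< u $ i + d})"

definition vupd :: "real^3 \<Rightarrow> 3 \<Rightarrow> real \<Rightarrow> real^3" where
  "vupd l j t = (\<chi> i. if i = j then t else l $ i)"

lemma vupd_nth: "vupd l j t $ i = (if i = j then t else l $ i)"
  by (simp add: vupd_def)

text \<open>
  The box is thickened by \<open>d\<close> on all sides, so that neighbouring boxes overlap in an open set and
  degenerate boxes make sense.
\<close>

definition sign_only_box where
  "sign_only_box V A F l u d \<longleftrightarrow> fat_box l u d \<subseteq> V \<and> sign_only (fat_box l u d - A) F"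

lemma sign_only_box_mono: "sign_only_box V A F l u d \<Longrightarrow> fat_box l' u' d' \<subseteq> fat_box l u d \<Longrightarrow> sign_only_box V A F l' u' d'"
  unfolding sign_only_box_def by (meson sign_only_subset Diff_mono order_trans order_refl)

lemma fat_box_mono: "d \<le> d' \<Longrightarrow> fat_box l u d \<subseteq> fat_box l u d'"
proof
  fix x assume d: "d \<le> d'" and x: "x \<in> fat_box l u d"
  have "l $ i - d' < x $ i \<and> x $ i < u $ i + d'" for i
  proof -
    have "l $ i - d < x $ i" "x $ i < u $ i + d" using x by (auto simp: ibox_def)
    with d show ?thesis by linarith
  qed
  then show "x \<in> fat_box l u d'" by (simp add: ibox_def)
qed

text \<open>
  The property passes from the slices of a box perpendicular to the coordinate \<open>j\<close> to the box: adjacent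
  slabs can be glued, because the curve does not disconnect their overlap, and bisection does the rest.
\<close>

lemma sign_only_box_slab:
  assumes A: "arc_sys V A F" and lu: "\<And>i. l $ i \<le> u $ i"
    and sl: "\<And>t. l $ j \<le> t \<Longrightarrow> t \<le> u $ j \<Longrightarrow> \<exists>d>0. sign_only_box V A F (vupd l j t) (vupd u j t) d"
  shows "\<exists>d>0. sign_only_box V A F l u d"
proof -
  define P where "P a b \<longleftrightarrow> (l $ j \<le> a \<and> a \<le> b \<and> b \<le> u $ j \<longrightarrow>
      (\<exists>d>0. sign_only_box V A F (vupd l j a) (vupd u j b) d))" for a b
  have "l $ j \<le> u $ j" by (rule lu)
  then have "P (l $ j) (u $ j)"
  proof (induction rule: Bolzano)
    case (trans a b c)
    show ?case
      unfolding P_def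
    proof (intro impI; elim conjE)
      assume *: "l $ j \<le> a" "a \<le> c" "c \<le> u $ j"
      obtain d1 where d1: "d1 > 0" "sign_only_box V A F (vupd l j a) (vupd u j b) d1"
        using trans * by (auto simp: P_def)
      obtain d2 where d2: "d2 > 0" "sign_only_box V A F (vupd l j b) (vupd u j c) d2"
        using trans * by (auto simp: P_def)
      define d where "d = min d1 d2"
      have d: "d > 0" "d \<le> d1" "d \<le> d2" using d1 d2 by (auto simp: d_def)
      let ?B1 = "fat_box (vupd l j a) (vupd u j b) d" and ?B2 = "fat_box (vupd l j b) (vupd u j c) d"
      have "?B1 \<subseteq> fat_box (vupd l j a) (vupd u j b) d1" "?B2 \<subseteq> fat_box (vupd l j b) (vupd u j c) d2"
        by (rule fat_box_mono[OF d(2)], rule fat_box_mono[OF d(3)])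
      then have g: "?B1 \<subseteq> V" "sign_only (?B1 - A) F" "?B2 \<subseteq> V" "sign_only (?B2 - A) F"
        using sign_only_box_mono[OF d1(2)] sign_only_box_mono[OF d2(2)] by (auto simp: sign_only_box_def)
      have un: "?B1 \<union> ?B2 = fat_box (vupd l j a) (vupd u j c) d"
      proof (intro equalityI subsetI)
        fix x assume x: "x \<in> ?B1 \<union> ?B2"
        then have "vupd l j a $ i - d < x $ i \<and> x $ i < vupd u j c $ i + d" for i
          using trans(3,4) by (auto simp: ibox_def vupd_nth dest!: spec[of _ i])
        then show "x \<in> fat_box (vupd l j a) (vupd u j c) d" by (simp add: ibox_def)
      next
        fix x assume "x \<in> fat_box (vupd l j a) (vupd u j c) d"
        then have x: "vupd l j a $ i - d < x $ i \<and> x $ i < vupd u j c $ i + d" for i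
          by (simp add: ibox_def)
        show "x \<in> ?B1 \<union> ?B2"
        proof (cases "x $ j < b + d")
          case True
          have "vupd l j a $ i - d < x $ i \<and> x $ i < vupd u j b $ i + d" for i
            using x[of i] True by (auto simp: vupd_nth split: if_splits)
          then show ?thesis by (simp add: ibox_def)
        next
          case False
          have "vupd l j b $ i - d < x $ i \<and> x $ i < vupd u j c $ i + d" for i
            using x[of i] False d(1) by (auto simp: vupd_nth split: if_splits)
          then show ?thesis by (simp add: ibox_def)
        qed
      qed
      have "vupd l j b \<in> ?B1 \<inter> ?B2"
      proof -
        have "l $ i < u $ i + d" for i using lu[of i] d(1) by linarith
        then show ?thesis
          using d(1) trans(3,4) by (auto simp: ibox_def vupd_nth)
      qed
      then have ne: "?B1 \<inter> ?B2 \<noteq> {}" by blast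
      have op: "open ?B1" "open ?B2" "open (?B1 \<inter> ?B2)" and co: "convex ?B1" "convex ?B2" "convex (?B1 \<inter> ?B2)"
        by (intro open_ibox convex_ibox open_Int convex_Int convex_real_interval open_greaterThanLessThan)+
      have eq: "?B1 - A \<union> (?B2 - A) = fat_box (vupd l j a) (vupd u j c) d - A"
         "(?B1 - A) \<inter> (?B2 - A) = (?B1 \<inter> ?B2) - A"
        using un by blast+
      have "sign_only (?B1 - A \<union> (?B2 - A)) F"
      proof (rule sign_only_Un)
        show "path_rep (?B1 - A \<union> (?B2 - A)) F"
          using g by (intro path_rep_subset[OF arc_sysD(3)[OF A]]) auto
        show "open (?B1 - A)" "open (?B2 - A)"
          using arc_sys_open_diff[OF A] op g by auto
        show "path_connected (?B1 - A)" "path_connected (?B2 - A)"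
          using arc_sys_path_connected[OF A] op co g convex_connected by auto
        have "path_connected ((?B1 \<inter> ?B2) - A)"
          using g by (intro arc_sys_path_connected[OF A op(3)] convex_connected co) auto
        then show "path_connected ((?B1 - A) \<inter> (?B2 - A))" using eq by simp
        have "(?B1 \<inter> ?B2) - A \<noteq> {}"
          using g ne by (intro arc_sys_diff_nonempty[OF A op(3)]) auto
        then show "(?B1 - A) \<inter> (?B2 - A) \<noteq> {}" using eq by simp
      qed (use g in auto)
      then have "sign_only_box V A F (vupd l j a) (vupd u j c) d"
        unfolding sign_only_box_def eq using un g by auto
      then show "\<exists>d>0. sign_only_box V A F (vupd l j a) (vupd u j c) d"
        using d(1) by blast
    qed
  next
    case (local x)
    then obtain d where d: "d > 0" "sign_only_box V A F (vupd l j x) (vupd u j x) d"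
      using sl by blast
    have "P a b" if ab: "a \<le> x" "x \<le> b" "b - a < d / 2" for a b
      unfolding P_def
    proof (intro impI exI conjI)
      show "d / 2 > 0" using d by simp
      show "sign_only_box V A F (vupd l j a) (vupd u j b) (d / 2)"
      proof (rule sign_only_box_mono[OF d(2)], rule subsetI)
        fix y assume "y \<in> fat_box (vupd l j a) (vupd u j b) (d / 2)"
        then have y: "vupd l j a $ i - d / 2 < y $ i \<and> y $ i < vupd u j b $ i + d / 2" for i
          by (simp add: ibox_def)
        have "vupd l j x $ i - d < y $ i \<and> y $ i < vupd u j x $ i + d" for i
          using y[of i] ab d(1) by (auto simp: vupd_nth split: if_splits)
        then show "y \<in> fat_box (vupd l j x) (vupd u j x) d" by (simp add: ibox_def)
      qed
    qed
    then show ?case using d(1) by (intro exI[of _ "d / 2"]) auto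
  qed
  moreover have "vupd l j (l $ j) = l" "vupd u j (u $ j) = u"
    by (auto simp: Finite_Cartesian_Product.vec_eq_iff vupd_nth)
  ultimately show ?thesis
    using lu[of j] by (simp add: P_def)
qed

lemma fat_box_in_open:
  assumes "open N" "x \<in> N"
  obtains d where "d > 0" "fat_box x x d \<subseteq> N"
proof -
  obtain e where e: "e > 0" "ball x e \<subseteq> N"
    using assms open_contains_ball by metis
  have "fat_box x x (e / 3) \<subseteq> ball x e"
  proof
    fix y assume "y \<in> fat_box x x (e / 3)"
    then have "x $ i - e / 3 < y $ i" "y $ i < x $ i + e / 3" for i
      by (auto simp: ibox_def)
    then have *: "\<bar>(y - x) $ i\<bar> < e / 3" for i
      unfolding abs_less_iff vector_minus_component by (smt (verit))
    have "(\<Sum>i\<in>UNIV. \<bar>(y - x) $ i\<bar>) < e"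
      using *[of 1] *[of 2] *[of 3] unfolding sum_3 by linarith
    then show "y \<in> ball x e"
      using norm_le_l1_cart[of "y - x"] by (simp add: dist_norm norm_minus_commute)
  qed
  then show ?thesis
    using e by (intro that[of "e / 3"]) auto
qed

text \<open>
  Slicing in the three coordinate directions reduces a compact box to its points.
\<close>

lemma sign_only_box_cbox:
  assumes A: "arc_sys V A F" and lu: "\<And>i. l $ i \<le> u $ i" and sub: "cbox l u \<subseteq> V"
  shows "\<exists>d>0. sign_only_box V A F l u d"
proof (rule sign_only_box_slab[OF A lu, where j = 1])
  fix t1 assume t1: "l $ 1 \<le> t1" "t1 \<le> u $ 1"
  show "\<exists>d>0. sign_only_box V A F (vupd l 1 t1) (vupd u 1 t1) d"
  proof (rule sign_only_box_slab[OF A, where j = 2])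
    fix t2 assume t2: "vupd l 1 t1 $ 2 \<le> t2" "t2 \<le> vupd u 1 t1 $ 2"
    show "\<exists>d>0. sign_only_box V A F (vupd (vupd l 1 t1) 2 t2) (vupd (vupd u 1 t1) 2 t2) d"
    proof (rule sign_only_box_slab[OF A, where j = 3])
      fix t3 assume t3: "vupd (vupd l 1 t1) 2 t2 $ 3 \<le> t3" "t3 \<le> vupd (vupd u 1 t1) 2 t2 $ 3"
      have e: "vupd (vupd (vupd w 1 t1) 2 t2) 3 t3 = vec3 t1 t2 t3" for w
        by (simp add: vec3_eq_iff vupd_nth)
      have "vec3 t1 t2 t3 \<in> cbox l u"
        using t1 t2 t3 by (auto simp: mem_box_cart forall_3 vupd_nth)
      then obtain N where N: "open N" "vec3 t1 t2 t3 \<in> N" "N \<subseteq> V" "sign_only (N - A) F"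
        using arc_sys_local_sign_only[OF A] sub by blast
      obtain d where "d > 0" "fat_box (vec3 t1 t2 t3) (vec3 t1 t2 t3) d \<subseteq> N"
        using fat_box_in_open[OF N(1,2)] by metis
      then show "\<exists>d>0. sign_only_box V A F (vupd (vupd (vupd l 1 t1) 2 t2) 3 t3)
          (vupd (vupd (vupd u 1 t1) 2 t2) 3 t3) d"
        unfolding e sign_only_box_def
        by (intro exI[of _ d] conjI sign_only_subset[OF N(4)]) (use N(3) in blast)+
    qed (use lu in \<open>auto simp: vupd_nth\<close>)
  qed (use lu in \<open>auto simp: vupd_nth\<close>)
qed

lemma sign_only_ibox:
  assumes A: "arc_sys V A F" and I: "\<And>i. convex (I i)" and sub: "ibox I \<subseteq> V"
  shows "sign_only (ibox I - A) F"
  unfolding sign_only_def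
proof (intro allI impI; elim conjE)
  fix p assume p: "path p" "path_image p \<subseteq> ibox I - A" "pathfinish p = pathstart p"
  let ?K = "path_image p"
  have K: "compact ?K" "?K \<noteq> {}"
    using p(1) by (auto simp: compact_path_image)
  have Ki: "compact ((\<lambda>x. x $ i) ` ?K)" for i
    by (intro compact_continuous_image K continuous_on_component continuous_on_id)
  have "\<exists>m M. m \<in> (\<lambda>x. x $ i) ` ?K \<and> M \<in> (\<lambda>x. x $ i) ` ?K \<and> (\<forall>x\<in>?K. m \<le> x $ i \<and> x $ i \<le> M)" for i
  proof -
    obtain m where m: "m \<in> (\<lambda>x. x $ i) ` ?K" "\<forall>t\<in>(\<lambda>x. x $ i) ` ?K. m \<le> t"
      using compact_attains_inf[OF Ki[of i]] K(2) by auto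
    obtain M where M: "M \<in> (\<lambda>x. x $ i) ` ?K" "\<forall>t\<in>(\<lambda>x. x $ i) ` ?K. t \<le> M"
      using compact_attains_sup[OF Ki[of i]] K(2) by auto
    show ?thesis
      by (rule exI[of _ m], rule exI[of _ M]) (use m M in \<open>simp add: ball_simps\<close>)
  qed
  then obtain m M where mM: "\<And>i. m i \<in> (\<lambda>x. x $ i) ` ?K" "\<And>i. M i \<in> (\<lambda>x. x $ i) ` ?K"
    "\<And>i x. x \<in> ?K \<Longrightarrow> m i \<le> x $ i \<and> x $ i \<le> M i"
    by metis
  define l u where "l = (\<chi> i. m i)" and "u = (\<chi> i. M i)"
  have lu: "l $ i \<le> u $ i" for i
    using mM(3)[of _ i] K(2) by (auto simp: l_def u_def intro: order_trans)
  have "m i \<in> I i" "M i \<in> I i" for i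
    using mM(1,2)[of i] p(2) by (auto simp: ibox_def)
  then have "{m i..M i} \<subseteq> I i" for i
    using I[of i] unfolding is_interval_convex_1[symmetric] is_interval_1
    by (meson atLeastAtMost_iff subsetI)
  then have I': "t \<in> I i" if "m i \<le> t" "t \<le> M i" for i t
    using that by (meson atLeastAtMost_iff subsetD)
  have "cbox l u \<subseteq> ibox I"
    by (auto simp: ibox_def mem_box_cart l_def u_def intro: I')
  then obtain d where d: "d > 0" "sign_only_box V A F l u d"
    using sign_only_box_cbox[OF A lu] sub by blast
  have "m i - d < x $ i \<and> x $ i < M i + d" if "x \<in> ?K" for i x
    using mM(3)[OF that, of i] d(1) by auto
  then have "?K \<subseteq> fat_box l u d"
    by (auto simp: ibox_def l_def u_def)
  then show "F p \<doteq> 1"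
    using d(2) p by (intro sign_onlyD[of "fat_box l u d - A" F]) (auto simp: sign_only_box_def)
qed

text \<open>
  However the curve runs through an open box, which may be unbounded, there is a section over the
  complement of the curve in it.  This replaces moving the curve into general position.
\<close>

lemma sect_ibox:
  assumes A: "arc_sys V A F" and I: "\<And>i. convex (I i)" "\<And>i. open (I i)" and sub: "ibox I \<subseteq> V"
  obtains f where "sect (ibox I - A) F f" "path_connected (ibox I - A)"
proof -
  have pc: "path_connected (ibox I - A)"
    by (intro arc_sys_path_connected[OF A] open_ibox convex_connected convex_ibox I sub)
  have F: "path_rep (ibox I - A) F"
    using sub by (intro path_rep_subset[OF arc_sysD(3)[OF A]]) auto
  obtain f where "sect (ibox I - A) F f"
    using sect_exists[OF F sign_only_ibox[OF A I(1) sub] pc] .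
  with pc show ?thesis using that by blast
qed

section \<open>A link and an arc\<close>

subsection \<open>Squashing space into a ball\<close>

text \<open>
  A homeomorphism onto the open unit ball that fixes all directions.  It shrinks charts of \<open>\<real>\<^sup>3\<close> into
  small neighbourhoods without changing what lies on the axis or on the ray.
\<close>

definition squash :: "real^3 \<Rightarrow> real^3" where
  "squash v = (1 / sqrt (1 + (norm v)\<^sup>2)) *\<^sub>R v"

lemma squash_factor_pos: "1 / sqrt (1 + (norm v)\<^sup>2) > 0"
  by (simp add: add_pos_nonneg)

lemma continuous_on_squash: "continuous_on UNIV squash"
proof -
  have "sqrt (1 + (norm v)\<^sup>2) \<noteq> 0" for v :: "real^3"
    using squash_factor_pos[of v] by auto
  then show ?thesis
    unfolding squash_def by (intro continuous_intros) auto
qed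

lemma norm_squash_sq: "(norm (squash v))\<^sup>2 = 1 - 1 / (1 + (norm v)\<^sup>2)"
proof -
  have *: "0 < 1 + (norm v)\<^sup>2" by (simp add: add_pos_nonneg)
  then have "(norm (squash v))\<^sup>2 = (norm v)\<^sup>2 / (1 + (norm v)\<^sup>2)"
    by (simp add: squash_def power_mult_distrib power_divide)
  then show ?thesis using * by (simp add: field_simps)
qed

lemma norm_squash: "norm (squash v) < 1"
proof -
  have "0 < 1 + (norm v)\<^sup>2" by (simp add: add_pos_nonneg)
  then have "(norm (squash v))\<^sup>2 < 1\<^sup>2"
    unfolding norm_squash_sq by simp
  then show ?thesis by (rule power2_less_imp_less) simp
qed

lemma inj_squash: "inj squash"
proof (rule injI)
  fix v w assume e: "squash v = squash w"
  then have "1 / (1 + (norm v)\<^sup>2) = 1 / (1 + (norm w)\<^sup>2)"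
    using norm_squash_sq[of v] norm_squash_sq[of w] by simp
  then have "(norm v)\<^sup>2 = (norm w)\<^sup>2" by simp
  with e squash_factor_pos[of w] show "v = w"
    by (simp add: squash_def)
qed

lemma squash_0 [simp]: "squash 0 = 0"
  by (simp add: squash_def)

lemma squash_nth: "squash v $ i = v $ i / sqrt (1 + (norm v)\<^sup>2)"
  by (simp add: squash_def)

lemma squash_z_axis [simp]: "c \<noteq> 0 \<Longrightarrow> c *\<^sub>R squash v \<in> z_axis \<longleftrightarrow> v \<in> z_axis"
  using squash_factor_pos[of v] by (auto simp: z_axis_def squash_nth)

lemma squash_x_ray [simp]: "c > 0 \<Longrightarrow> c *\<^sub>R squash v \<in> x_ray \<longleftrightarrow> v \<in> x_ray"
proof -
  assume "c > 0"
  have "0 < sqrt (1 + (norm v)\<^sup>2)"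
    using squash_factor_pos[of v] by simp
  with \<open>c > 0\<close> show ?thesis
    by (auto simp: x_ray_def squash_nth zero_le_mult_iff zero_le_divide_iff)
qed

lemma norm_unit_circle: "norm (unit_circle t) = 1"
proof -
  have "(norm (unit_circle t))\<^sup>2 = (cos (2*pi*t))\<^sup>2 + (sin (2*pi*t))\<^sup>2"
    unfolding power2_norm_eq_inner inner_vec_def sum_3 unit_circle_def by (simp add: power2_eq_square)
  then show ?thesis
    using norm_ge_zero[of "unit_circle t"] by (simp add: power2_eq_1_iff)
qed

lemma squash_unit_circle: "squash (unit_circle t) = (1 / sqrt 2) *\<^sub>R unit_circle t"
  by (simp add: squash_def norm_unit_circle)

subsection \<open>A loop around a square\<close>

lemma path_rep_half_plane:
  assumes G: "path_rep (- z_axis) G" and K: "convex K" "K \<inter> z_axis = {}"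
    and p: "path_image (pol \<circ> linepath a b) \<subseteq> K"
  shows "G (pol \<circ> linepath a b) = G (linepath (pol a) (pol b))"
proof (rule path_rep_convex[OF G K(1)])
  show "K \<subseteq> - z_axis" using K by blast
  show "path (pol \<circ> linepath a b)"
    by (intro path_continuous_image path_linepath continuous_intros)
  have "pol a \<in> K" "pol b \<in> K"
    using p path_image_mem[OF p, of 0] path_image_mem[OF p, of 1] by (auto simp: linepath_def)
  then show "path_image (linepath (pol a) (pol b)) \<subseteq> K"
    using K by (simp add: closed_segment_subset)
qed (use p in \<open>simp_all add: pathstart_compose pathfinish_compose\<close>)

text \<open>
  The boundary of the square with corners \<open>(\<plusminus>1, \<plusminus>1)\<close> runs once around the axis, so the two ways along it
  from one corner to the opposite one differ by the factor \<open>-1\<close>.  The four sides are compared with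
  quarters of the circumscribed circle, each within a half-plane.
\<close>

lemma path_rep_square:
  assumes G: "path_rep (- z_axis) G" and u: "G unit_circle = - 1"
  shows "G (linepath (vec3 (-1) 1 0) (vec3 1 1 0)) * G (linepath (vec3 1 1 0) (vec3 1 (-1) 0)) =
    - (G (linepath (vec3 (-1) 1 0) (vec3 (-1) (-1) 0)) * G (linepath (vec3 (-1) (-1) 0) (vec3 1 (-1) 0)))"
proof -
  define H where "H p = G (pol \<circ> p)" for p
  have H: "path_rep UNIV H"
    unfolding H_def by (rule path_rep_pol[OF G])
  define y where "y k = vec3 (ln (sqrt 2)) (k * (pi / 4)) 0" for k :: real
  have e: "exp (ln (sqrt 2)) = sqrt 2" by simp
  have s2: "sqrt 2 * (sqrt 2 / 2) = 1" by simp
  have c3: "cos (3 * (pi/4)) = - (sqrt 2 / 2)" "sin (3 * (pi/4)) = sqrt 2 / 2"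
    using cos_add[of "pi/2" "pi/4"] sin_add[of "pi/2" "pi/4"] by (simp_all add: cos_45 sin_45 field_simps)
  have c5: "cos (5 * (pi/4)) = - (sqrt 2 / 2)" "sin (5 * (pi/4)) = - (sqrt 2 / 2)"
    using cos_add[of "pi" "pi/4"] sin_add[of "pi" "pi/4"] by (simp_all add: cos_45 sin_45 field_simps)
  have c7: "cos (7 * (pi/4)) = sqrt 2 / 2" "sin (7 * (pi/4)) = - (sqrt 2 / 2)"
    using cos_add[of "2*pi" "-pi/4"] sin_add[of "2*pi" "-pi/4"] by (simp_all add: cos_45 sin_45 field_simps)
  have pol_y: "pol (y 3) = vec3 (-1) 1 0" "pol (y 1) = vec3 1 1 0" "pol (y (-1)) = vec3 1 (-1) 0"
     "pol (y 5) = vec3 (-1) (-1) 0" "pol (y 7) = vec3 1 (-1) 0"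
    unfolding pol_def y_def vector_3 e c3 c5 c7 mult_1 by (simp_all add: cos_45 sin_45 vec3_eq_iff)
  have trig: "pol (linepath (y a) (y b) t) $ 1 = sqrt 2 * cos ((a + t * (b - a)) * (pi/4))"
     "pol (linepath (y a) (y b) t) $ 2 = sqrt 2 * sin ((a + t * (b - a)) * (pi/4))" for a b t
  proof -
    have l: "linepath (y a) (y b) t $ 2 = (a + t * (b - a)) * (pi/4)" "linepath (y a) (y b) t $ 1 = ln (sqrt 2)"
      by (simp_all add: y_def linepath_def field_simps)
    show "pol (linepath (y a) (y b) t) $ 1 = sqrt 2 * cos ((a + t * (b - a)) * (pi/4))"
     "pol (linepath (y a) (y b) t) $ 2 = sqrt 2 * sin ((a + t * (b - a)) * (pi/4))"
      unfolding pol_def vector_3 l e by simp_all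
  qed
  have btw: "min a b \<le> a + t * (b - a) \<and> a + t * (b - a) \<le> max a b" if "t \<in> {0..1}" for a b t :: real
  proof -
    have "a + t * (b - a) \<in> closed_segment a b"
      using that by (auto simp: closed_segment_def intro!: exI[of _ t] simp: algebra_simps)
    then show ?thesis by (auto simp: closed_segment_eq_real_ivl split: if_splits)
  qed
  have side: "H (linepath (y a) (y b)) = G (linepath (pol (y a)) (pol (y b)))"
    if K: "convex K" "K \<inter> z_axis = {}"
      and im: "\<And>c. min a b \<le> c \<Longrightarrow> c \<le> max a b \<Longrightarrow>
         vec3 (sqrt 2 * cos (c * (pi/4))) (sqrt 2 * sin (c * (pi/4))) 0 \<in> K" for K a b
    unfolding H_def
  proof (rule path_rep_half_plane[OF G K])
    have "pol (linepath (y a) (y b) t) \<in> K" if t: "t \<in> {0..1}" for t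
    proof -
      have "pol (linepath (y a) (y b) t) $ 3 = 0"
        by (simp add: pol_def y_def linepath_def)
      then have "pol (linepath (y a) (y b) t) =
          vec3 (sqrt 2 * cos ((a + t * (b - a)) * (pi/4))) (sqrt 2 * sin ((a + t * (b - a)) * (pi/4))) 0"
        by (simp add: vec3_eq_iff trig)
      then show ?thesis using im[of "a + t * (b - a)"] btw[OF t, of a b] by simp
    qed
    then show "path_image (pol \<circ> linepath (y a) (y b)) \<subseteq> K"
      unfolding path_image_def by auto
  qed
  have AB: "H (linepath (y 3) (y 1)) = G (linepath (vec3 (-1) 1 0) (vec3 1 1 0))"
    unfolding pol_y[symmetric]
  proof (rule side[of "{x. 0 < x $ 2}"])
    fix c :: real assume "min 3 1 \<le> c" "c \<le> max 3 1"
    then have "0 < c * (pi/4)" "c * (pi/4) < pi" by auto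
    then show "vec3 (sqrt 2 * cos (c * (pi/4))) (sqrt 2 * sin (c * (pi/4))) 0 \<in> {x. 0 < x $ 2}"
      by (simp add: sin_gt_zero)
  qed (auto simp: z_axis_def convex_nth)
  have BC: "H (linepath (y 1) (y (-1))) = G (linepath (vec3 1 1 0) (vec3 1 (-1) 0))"
    unfolding pol_y[symmetric]
  proof (rule side[of "{x. 0 < x $ 1}"])
    fix c :: real assume "min 1 (-1) \<le> c" "c \<le> max 1 (-1)"
    then have "- 1 * (pi/4) \<le> c * (pi/4)" "c * (pi/4) \<le> 1 * (pi/4)"
      by (intro mult_right_mono; simp)+
    then have "-(pi/2) < c * (pi/4)" "c * (pi/4) < pi/2" using pi_gt_zero by linarith+
    then show "vec3 (sqrt 2 * cos (c * (pi/4))) (sqrt 2 * sin (c * (pi/4))) 0 \<in> {x. 0 < x $ 1}"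
      by (simp add: cos_gt_zero_pi)
  qed (auto simp: z_axis_def convex_nth)
  have AD: "H (linepath (y 3) (y 5)) = G (linepath (vec3 (-1) 1 0) (vec3 (-1) (-1) 0))"
    unfolding pol_y[symmetric]
  proof (rule side[of "{x. x $ 1 < 0}"])
    fix c :: real assume "min 3 5 \<le> c" "c \<le> max 3 5"
    then have "3 * (pi/4) \<le> c * (pi/4)" "c * (pi/4) \<le> 5 * (pi/4)"
      by (intro mult_right_mono; simp)+
    then have "-(pi/2) < c * (pi/4) - pi" "c * (pi/4) - pi < pi/2" using pi_gt_zero by linarith+
    then have "cos (c * (pi/4) - pi) > 0" by (intro cos_gt_zero_pi)
    then show "vec3 (sqrt 2 * cos (c * (pi/4))) (sqrt 2 * sin (c * (pi/4))) 0 \<in> {x. x $ 1 < 0}"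
      by (simp add: cos_diff mult_less_0_iff)
  qed (auto simp: z_axis_def convex_nth)
  have DC: "H (linepath (y 5) (y 7)) = G (linepath (vec3 (-1) (-1) 0) (vec3 1 (-1) 0))"
  proof -
   have "H (linepath (y 5) (y 7)) = G (linepath (pol (y 5)) (pol (y 7)))"
   proof (rule side[of "{x. x $ 2 < 0}"])
    fix c :: real assume "min 5 7 \<le> c" "c \<le> max 5 7"
    then have "5 * (pi/4) \<le> c * (pi/4)" "c * (pi/4) \<le> 7 * (pi/4)"
      by (intro mult_right_mono; simp)+
    then have "0 < c * (pi/4) - pi" "c * (pi/4) - pi < pi" using pi_gt_zero by linarith+
    then have "sin (c * (pi/4) - pi) > 0" by (intro sin_gt_zero)
    then show "vec3 (sqrt 2 * cos (c * (pi/4))) (sqrt 2 * sin (c * (pi/4))) 0 \<in> {x. x $ 2 < 0}"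
      by (simp add: sin_diff mult_less_0_iff)
   qed (auto simp: z_axis_def convex_nth)
   then show ?thesis by (simp only: pol_y)
  qed
  have tr: "H (linepath a b) * H (linepath b c) = H (linepath a c)" for a b c
    by (rule path_rep_convex_linepath[OF H convex_UNIV]) auto
  have "y 7 = y (-1) + turn"
    by (simp add: y_def vec3_eq_iff)
  then have "H (linepath (y (-1)) (y 7)) = - 1"
    unfolding H_def by (simp only: path_rep_turn[OF G u[unfolded unit_circle_pol]])
  then have "H (linepath (y 3) (y 7)) = - H (linepath (y 3) (y (-1)))"
    using tr[of "y 3" "y (-1)" "y 7"] by simp
  then show ?thesis
    unfolding AB[symmetric] BC[symmetric] AD[symmetric] DC[symmetric] tr by simp
qed

subsection \<open>The local system of a link with an arc\<close>

text \<open>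
  The situation seen in \<open>\<real>\<^sup>3\<close>: the link \<open>P\<close>, the part \<open>Om\<close> of the connecting arc that lies there, and the
  representation \<open>F\<close> of their complement.  The ends of the arc are locally standard.
\<close>

locale link_arc =
  fixes P Om :: "(real^3) set" and F :: "(real \<Rightarrow> real^3) \<Rightarrow> quat"
  assumes P_compact: "compact P" and Om_closed: "closed Om"
    and F: "path_rep (- (P \<union> Om)) F"
    and arc_chart: "x \<in> Om - P \<Longrightarrow> open W \<Longrightarrow> x \<in> W \<Longrightarrow> W \<inter> P = {} \<Longrightarrow>
      \<exists>\<phi>. continuous_on UNIV \<phi> \<and> inj \<phi> \<and> \<phi> 0 = x \<and> range \<phi> \<subseteq> W \<and> \<phi> -` Om = z_axis"
    and end_chart: "x \<in> P \<inter> Om \<Longrightarrow> open W \<Longrightarrow> x \<in> W \<Longrightarrow>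
      \<exists>\<phi>. continuous_on UNIV \<phi> \<and> inj \<phi> \<and> \<phi> 0 = x \<and> range \<phi> \<subseteq> W \<and> \<phi> -` P = z_axis \<and> \<phi> -` Om = x_ray"
    and arc_meridian: "continuous_on UNIV \<phi> \<Longrightarrow> inj \<phi> \<Longrightarrow> \<phi> -` P = {} \<Longrightarrow> \<phi> -` Om = z_axis \<Longrightarrow>
      F (\<phi> \<circ> unit_circle) = - 1"
    and link_meridian: "continuous_on UNIV \<phi> \<Longrightarrow> inj \<phi> \<Longrightarrow> \<phi> -` P = z_axis \<Longrightarrow> \<phi> -` Om = {} \<Longrightarrow>
      F (\<phi> \<circ> unit_circle) \<in> S1_B"
begin

lemma arc_sys: "arc_sys (- P) (Om - P) F"
  unfolding arc_sys_def
proof (intro conjI ballI allI impI)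
  show "open (- P)" using compact_imp_closed[OF P_compact] by blast
  have "Om - P = - P \<inter> Om" by blast
  then show "closedin (top_of_set (- P)) (Om - P)"
    using Om_closed by (simp add: closedin_closed_Int)
  have "- P - (Om - P) = - (P \<union> Om)" by blast
  then show "path_rep (- P - (Om - P)) F" using F by simp
  fix x W assume x: "x \<in> Om - P" and W: "open W \<and> x \<in> W \<and> W \<subseteq> - P"
  then have "W \<inter> P = {}" by blast
  with arc_chart[OF x] W obtain \<phi> where \<phi>: "continuous_on UNIV \<phi>" "inj \<phi>" "\<phi> 0 = x" "range \<phi> \<subseteq> W"
    "\<phi> -` Om = z_axis"
    by metis
  have P: "\<phi> -` P = {}" using \<phi>(4) W by blast
  then have "\<phi> -` (Om - P) = z_axis" using \<phi>(5) by blast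
  then show "\<exists>\<phi>. continuous_on UNIV \<phi> \<and> inj \<phi> \<and> \<phi> 0 = x \<and> range \<phi> \<subseteq> W \<and> \<phi> -` (Om - P) = z_axis \<and>
      F (\<phi> \<circ> unit_circle) = - 1"
    using \<phi> arc_meridian[OF \<phi>(1,2) P \<phi>(5)] by metis
qed

text \<open>
  The first two coordinates are wrapped around the cylinder of radius \<open>r\<close>.  The angle ranges over the
  open interval from \<open>-2\<pi>\<close> to \<open>2\<pi>\<close>, so only the third axis is mapped to the ray, while the lines with
  first coordinate \<open>-1\<close> and \<open>1\<close> are both mapped to the line opposite to the ray.
\<close>

definition cyl_map :: "real \<Rightarrow> real^3 \<Rightarrow> real^3" where
  "cyl_map r w = pol (vec3 (ln r + w $ 3) (4 * arctan (w $ 1)) (w $ 2))"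

lemma continuous_on_cyl_map [continuous_intros]:
  fixes f :: "'a::t2_space \<Rightarrow> real^3"
  shows "continuous_on S f \<Longrightarrow> continuous_on S (\<lambda>x. cyl_map r (f x))"
  unfolding cyl_map_def by (intro continuous_intros)

lemma four_arctan_bounds: "- (2 * pi) < 4 * arctan t" "4 * arctan t < 2 * pi"
  using arctan_lbound[of t] arctan_ubound[of t] by linarith+

lemma int_2pi_small:
  assumes "- (2 * pi) < of_int n * (2 * pi)" "of_int n * (2 * pi) < 2 * pi"
  shows "n = 0"
proof -
  have "- 1 * (2 * pi) < of_int n * (2 * pi)" "of_int n * (2 * pi) < 1 * (2 * pi)"
    using assms by simp_all
  then have "- 1 < real_of_int n" "real_of_int n < 1"
    by (simp_all only: mult_less_cancel_right_pos[of "2 * pi"] pi_gt_zero zero_less_mult_iff zero_less_numeral simp_thms)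
  then show ?thesis by linarith
qed

lemma cyl_map_x_ray: "cyl_map r w \<in> x_ray \<longleftrightarrow> w \<in> z_axis"
proof
  assume "cyl_map r w \<in> x_ray"
  then have *: "w $ 2 = 0" "sin (4 * arctan (w $ 1)) = 0" "0 \<le> cos (4 * arctan (w $ 1))"
    by (simp_all add: x_ray_def cyl_map_def pol_def zero_le_mult_iff)
  then have "cos (4 * arctan (w $ 1)) = 1"
    using sin_cos_squared_add[of "4 * arctan (w $ 1)"] by (auto simp: power2_eq_1_iff)
  then obtain n :: int where n: "4 * arctan (w $ 1) = of_int n * 2 * pi"
    using cos_one_2pi_int by metis
  then have "n = 0"
    using four_arctan_bounds[of "w $ 1"] by (intro int_2pi_small) linarith+
  with n * show "w \<in> z_axis" by (simp add: z_axis_def)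
qed (simp add: z_axis_def x_ray_def cyl_map_def pol_def)

lemma inj_on_cyl_map: "inj_on (cyl_map r) {w. \<bar>w $ 1\<bar> < 1}"
proof
  fix w w' assume w: "w \<in> {w. \<bar>w $ 1\<bar> < 1}" "w' \<in> {w. \<bar>w $ 1\<bar> < 1}" and e: "cyl_map r w = cyl_map r w'"
  have b: "\<bar>4 * arctan (u $ 1)\<bar> < pi" if "\<bar>u $ 1\<bar> < 1" for u :: "real^3"
    using arctan_bounded[of "u $ 1"] arctan_less_pi4_pos[of "\<bar>u $ 1\<bar>"] that arctan_minus[of "u $ 1"]
      arctan_one arctan_monotone[of "u $ 1" 1] arctan_monotone[of "-1" "u $ 1"] arctan_minus[of 1]
    by (auto simp: abs_less_iff)
  note d = pol_eqD[OF e[unfolded cyl_map_def], unfolded vector_3]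
  obtain n where n: "4 * arctan (w $ 1) = 4 * arctan (w' $ 1) + of_int n * (2 * pi)"
    using d(3) by blast
  have "\<bar>4 * arctan (w $ 1)\<bar> < pi" "\<bar>4 * arctan (w' $ 1)\<bar> < pi"
    using b w by blast+
  with n have "n = 0"
    by (intro int_2pi_small) linarith+
  with n have "w $ 1 = w' $ 1" by (simp add: arctan_eq_iff)
  with d show "w = w'" by (simp add: vec3_eq_iff)
qed

lemma cyl_map_turn: "cyl_map r (vec3 1 h s) = cyl_map r (vec3 (-1) h s)"
proof -
  have "vec3 (ln r + s) pi h = vec3 (ln r + s) (-pi) h + of_int 1 *\<^sub>R turn"
    by (simp add: vec3_eq_iff)
  then show ?thesis
    unfolding cyl_map_def vector_3 by (simp only: pol_turn arctan_one arctan_minus) (simp add: pol_def)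
qed

text \<open>
  In an end chart, consider the circles around the link just above and just below the arc.  Together
  with a vertical segment opposite to the arc they bound the cylinder cut open, which is a square
  around the point where the arc leaves the cylinder.  Hence they are conjugate along the vertical
  segment up to the value \<open>-1\<close> of a meridian of the arc.
\<close>

lemma end_chart_circles:
  fixes r :: real
  assumes \<phi>: "continuous_on UNIV \<phi>" "inj \<phi>" "\<phi> -` P = z_axis" "\<phi> -` Om = x_ray"
  fixes c defines "c \<equiv> \<lambda>a b. F (\<phi> \<circ> cyl_map r \<circ> linepath a b)"
  shows "c (vec3 (-1) 1 0) (vec3 1 1 0) * c (vec3 (-1) 1 0) (vec3 (-1) (-1) 0) =
    - (c (vec3 (-1) 1 0) (vec3 (-1) (-1) 0) * c (vec3 (-1) (-1) 0) (vec3 1 (-1) 0))"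
proof -
  define G where "G p = F (\<phi> \<circ> cyl_map r \<circ> p)" for p
  have Gc: "c a b = G (linepath a b)" for a b
    by (simp add: c_def G_def)
  have av: "\<phi> (cyl_map r w) \<notin> P" "\<phi> (cyl_map r w) \<in> Om \<longleftrightarrow> w \<in> z_axis" for w
    using \<phi>(3,4) pol_notin_axis cyl_map_x_ray[of r w] unfolding cyl_map_def by blast+
  have "continuous_on UNIV (\<phi> \<circ> cyl_map r)"
    by (intro continuous_on_compose continuous_intros continuous_on_subset[OF \<phi>(1)]) auto
  then have cont: "continuous_on S (\<phi> \<circ> cyl_map r)" for S
    by (rule continuous_on_subset) simp
  have G: "path_rep (- z_axis) G"
    unfolding G_def by (rule path_rep_pullback[OF F cont]) (use av in auto)
  have "G unit_circle = - 1"
  proof -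
    \<comment> \<open>the factor makes the image of the unit circle the circle of radius 1/2\<close>
    define m where "m v = (sqrt 2 / 2) *\<^sub>R squash v" for v
    have small: "\<bar>m v $ 1\<bar> < 1" for v
    proof -
      have "\<bar>m v $ 1\<bar> \<le> norm (m v)" by (rule component_le_norm_cart)
      also have "\<dots> = sqrt 2 / 2 * norm (squash v)" by (simp add: m_def)
      also have "\<dots> \<le> sqrt 2 / 2 * 1" by (intro mult_left_mono less_imp_le[OF norm_squash]) simp
      also have "\<dots> < 1" using sqrt2_less_2 by simp
      finally show ?thesis .
    qed
    have "F (\<phi> \<circ> cyl_map r \<circ> m \<circ> unit_circle) = - 1"
    proof (rule arc_meridian)
      have "continuous_on UNIV m"
        unfolding m_def by (intro continuous_intros continuous_on_squash)
      then show "continuous_on UNIV (\<phi> \<circ> cyl_map r \<circ> m)"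
        by (intro continuous_on_compose cont)
      have "inj m"
        using inj_squash by (auto simp: m_def inj_def)
      have "inj (cyl_map r \<circ> m)"
        using \<open>inj m\<close> by (intro comp_inj_on inj_on_subset[OF inj_on_cyl_map]) (use small in auto)
      then show "inj (\<phi> \<circ> cyl_map r \<circ> m)"
        unfolding comp_assoc using \<phi>(2) by (rule inj_compose[rotated])
      show "(\<phi> \<circ> cyl_map r \<circ> m) -` P = {}"
        using av by auto
      have "m v \<in> z_axis \<longleftrightarrow> v \<in> z_axis" for v
        by (simp add: m_def)
      then show "(\<phi> \<circ> cyl_map r \<circ> m) -` Om = z_axis"
        using av by auto
    qed
    moreover have "m \<circ> unit_circle = pol \<circ> linepath (vec3 (ln (1/2)) 0 0) (vec3 (ln (1/2)) 0 0 + turn)"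
    proof -
      have "sqrt 2 * (1 / sqrt 2) = 1" by simp
      then have "m (unit_circle t) = (1/2) *\<^sub>R unit_circle t" for t
        by (simp add: m_def squash_unit_circle)
      then show ?thesis
        unfolding pol_linepath_turn by (simp add: fun_eq_iff unit_circle_def vec3_eq_iff)
    qed
    ultimately have "G (pol \<circ> linepath (vec3 (ln (1/2)) 0 0) (vec3 (ln (1/2)) 0 0 + turn)) = - 1"
      unfolding G_def by (metis comp_assoc)
    from path_rep_turn[OF G this, of 0] show ?thesis unfolding unit_circle_pol .
  qed
  from path_rep_square[OF G this]
  have "c (vec3 (-1) 1 0) (vec3 1 1 0) * c (vec3 1 1 0) (vec3 1 (-1) 0) =
    - (c (vec3 (-1) 1 0) (vec3 (-1) (-1) 0) * c (vec3 (-1) (-1) 0) (vec3 1 (-1) 0))"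
    unfolding Gc .
  moreover have "cyl_map r \<circ> linepath (vec3 1 1 0) (vec3 1 (-1) 0) = cyl_map r \<circ> linepath (vec3 (-1) 1 0) (vec3 (-1) (-1) 0)"
  proof -
    have "linepath (vec3 a 1 0) (vec3 a (-1) 0) t = vec3 a (1 - 2 * t) 0" for a t
      by (simp add: linepath_def vec3_eq_iff algebra_simps)
    then show ?thesis by (simp add: fun_eq_iff cyl_map_turn)
  qed
  then have "c (vec3 1 1 0) (vec3 1 (-1) 0) = c (vec3 (-1) 1 0) (vec3 (-1) (-1) 0)"
    unfolding c_def by (simp add: comp_assoc)
  ultimately show ?thesis by simp
qed

end

section \<open>Tubes around the link\<close>

definition cyl :: "real \<Rightarrow> real \<Rightarrow> (real^3) set" where
  "cyl \<rho> \<epsilon> = {x. (x $ 1)\<^sup>2 + (x $ 2)\<^sup>2 < \<rho>\<^sup>2 \<and> \<bar>x $ 3\<bar> < \<epsilon>}"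

lemma open_cyl: "open (cyl \<rho> \<epsilon>)"
  unfolding cyl_def
  by (intro open_Collect_conj open_Collect_less continuous_intros)

definition log_box :: "real \<Rightarrow> real \<Rightarrow> 3 \<Rightarrow> real set" where
  "log_box \<rho> \<epsilon> i = (if i = 1 then {..<ln \<rho>} else if i = 2 then UNIV else {-\<epsilon><..<\<epsilon>})"

lemma log_box_interval: "convex (log_box \<rho> \<epsilon> i)" "open (log_box \<rho> \<epsilon> i)"
  by (auto simp: log_box_def)

lemma mem_log_box: "y \<in> ibox (log_box \<rho> \<epsilon>) \<longleftrightarrow> y $ 1 < ln \<rho> \<and> \<bar>y $ 3\<bar> < \<epsilon>"
  by (auto simp: ibox_def log_box_def forall_3 abs_less_iff)

lemma pol_in_cyl: "\<rho> > 0 \<Longrightarrow> pol y \<in> cyl \<rho> \<epsilon> \<longleftrightarrow> y \<in> ibox (log_box \<rho> \<epsilon>)"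
proof -
  assume \<rho>: "\<rho> > 0"
  have "(exp (y $ 1))\<^sup>2 < \<rho>\<^sup>2 \<longleftrightarrow> exp (y $ 1) < \<rho>"
    using \<rho> by (metis exp_ge_zero less_imp_le power2_less_imp_less power_strict_mono zero_less_numeral)
  also have "\<dots> \<longleftrightarrow> y $ 1 < ln \<rho>"
    using \<rho> by (metis exp_less_cancel_iff exp_ln)
  finally show ?thesis
    unfolding cyl_def mem_Collect_eq pol_norm mem_log_box by (simp add: pol_def)
qed

text \<open>
  The first polar coordinate is the logarithm of the radius, so this is a piece of a thin solid cylinder
  without its axis.
\<close>

definition slice :: "real \<Rightarrow> real \<Rightarrow> real \<Rightarrow> (real^3) set" where
  "slice s a b = {y. y $ 1 < s \<and> a \<le> y $ 3 \<and> y $ 3 \<le> b}"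

lemma convex_slice: "convex (slice s a b)"
proof -
  have "slice s a b = {y. y $ 1 \<in> {..<s}} \<inter> {y. y $ 3 \<in> {a..b}}"
    by (auto simp: slice_def)
  then show ?thesis
    by (simp only:) (intro convex_Int convex_vimage_nth convex_real_interval)
qed

lemma slice_turn: "y \<in> slice s a b \<Longrightarrow> y + of_int n *\<^sub>R turn \<in> slice s a b"
  by (simp add: slice_def)

lemma slice_linepath_turn: "y \<in> slice s a b \<Longrightarrow> path_image (linepath y (y + turn)) \<subseteq> slice s a b"
  using slice_turn[of y s a b 1] by (simp add: closed_segment_subset convex_slice)

text \<open>
  A solid cylinder around a piece of the link, along which the arc meets the link at most at the
  origin.
\<close>

locale tube = link_arc +
  fixes \<psi> :: "real^3 \<Rightarrow> real^3" and \<rho> \<epsilon> :: real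
  assumes pos: "\<rho> > 0" "\<epsilon> > 0"
    and cont: "continuous_on (cyl \<rho> \<epsilon>) \<psi>" and inj: "inj_on \<psi> (cyl \<rho> \<epsilon>)"
    and P_iff: "x \<in> cyl \<rho> \<epsilon> \<Longrightarrow> \<psi> x \<in> P \<longleftrightarrow> x \<in> z_axis"
    and Om_axis: "x \<in> cyl \<rho> \<epsilon> \<Longrightarrow> x \<in> z_axis \<Longrightarrow> \<psi> x \<in> Om \<Longrightarrow> x = 0"
begin

text \<open>
  The cylinder without its axis is covered by \<open>B\<close> through polar coordinates, \<open>A\<close> is the preimage of the
  arc, and \<open>G\<close> is the representation pulled back to the covering.
\<close>

definition B where "B = ibox (log_box \<rho> \<epsilon>)"
definition q where "q = \<psi> \<circ> pol"
definition A where "A = {y \<in> B. q y \<in> Om - P}"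
definition G where "G p = F (q \<circ> p)"

lemma open_B: "open B" and convex_B: "convex B"
  unfolding B_def by (intro open_ibox convex_ibox log_box_interval)+

lemma mem_B: "y \<in> B \<longleftrightarrow> y $ 1 < ln \<rho> \<and> \<bar>y $ 3\<bar> < \<epsilon>"
  by (simp add: B_def mem_log_box)

lemma pol_B: "y \<in> B \<Longrightarrow> pol y \<in> cyl \<rho> \<epsilon>"
  using pol_in_cyl[OF pos(1)] by (simp add: B_def)

lemma q_notin_P: "y \<in> B \<Longrightarrow> q y \<notin> P"
  using P_iff[OF pol_B] pol_notin_axis by (simp add: q_def)

lemma BA_eq: "B - A = {y \<in> B. q y \<notin> Om}"
  using q_notin_P by (auto simp: A_def)

lemma cont_q: "continuous_on B q"
  unfolding q_def using pol_B
  by (intro continuous_on_compose continuous_intros continuous_on_subset[OF cont]) auto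

lemma q_turn [simp]: "q (y + of_int n *\<^sub>R turn) = q y"
  by (simp add: q_def)

lemma q_turn1 [simp]: "q (y + turn) = q y"
  using q_turn[of y 1] by simp

lemma B_turn [simp]: "y + of_int n *\<^sub>R turn \<in> B \<longleftrightarrow> y \<in> B" "y + turn \<in> B \<longleftrightarrow> y \<in> B"
  by (simp_all add: mem_B)

lemma A_turn [simp]: "y + turn \<in> A \<longleftrightarrow> y \<in> A"
  by (simp add: A_def)

lemma G_turn: "G (\<lambda>t. p t + of_int n *\<^sub>R turn) = G p"
  by (simp add: G_def comp_def)

lemma arc_sys_G: "arc_sys B A G"
  unfolding A_def G_def[abs_def]
proof (rule arc_sys_pullback[OF arc_sys open_B cont_q])
  show "q ` B \<subseteq> - P" using q_notin_P by blast
  fix y assume y: "y \<in> B"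
  have "inj_on q (B \<inter> ball y pi)"
    unfolding q_def
    by (intro comp_inj_on inj_on_subset[OF inj_on_pol_ball] inj_on_subset[OF inj]) (use pol_B in auto)
  then show "\<exists>N. open N \<and> y \<in> N \<and> N \<subseteq> B \<and> inj_on q N"
    using y open_B by (intro exI[of _ "B \<inter> ball y pi"]) auto
qed

lemma G_rep: "path_rep (B - A) G"
  by (rule arc_sysD(3)[OF arc_sys_G])

definition f where "f = (SOME f. sect (B - A) G f)"

lemma f_sect: "sect (B - A) G f" and BA_path_connected: "path_connected (B - A)"
proof -
  obtain f' where "sect (B - A) G f'" and pc: "path_connected (B - A)"
    using sect_ibox[OF arc_sys_G, of "log_box \<rho> \<epsilon>"] log_box_interval unfolding B_def by blast
  then show "sect (B - A) G f"
    unfolding f_def by (metis someI)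
  show "path_connected (B - A)" by (rule pc)
qed

text \<open>
  The value on the circle around the link through \<open>y\<close>, transported by the section \<open>f\<close>.  It does not
  depend on the sign of \<open>f y\<close>.
\<close>

definition N where "N y = f y * G (linepath y (y + turn)) * qcnj (f y)"

lemma f_BD: "y \<in> B - A \<Longrightarrow> f y \<in> BDset"
  by (rule sect_BD[OF f_sect])

text \<open>By compactness, close enough to a segment of the link off the arc there is no point of the arc.\<close>

lemma slice_exists:
  assumes ab: "- \<epsilon> < a" "b < \<epsilon>" and av: "\<And>z. a \<le> z \<Longrightarrow> z \<le> b \<Longrightarrow> \<psi> (vec3 0 0 z) \<notin> Om"
  obtains s where "s \<le> ln \<rho>" "slice s a b \<subseteq> B - A"
    "\<And>x. (x $ 1)\<^sup>2 + (x $ 2)\<^sup>2 < (exp s)\<^sup>2 \<Longrightarrow> a \<le> x $ 3 \<Longrightarrow> x $ 3 \<le> b \<Longrightarrow> x \<in> cyl \<rho> \<epsilon> \<and> \<psi> x \<notin> Om"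
proof -
  let ?S = "(\<lambda>z. vec3 0 0 z) ` {a..b}"
  have S: "compact ?S"
    by (intro compact_continuous_image continuous_intros compact_Icc)
  have Sc: "?S \<subseteq> cyl \<rho> \<epsilon>"
    using ab pos by (auto simp: cyl_def)
  have "closedin (top_of_set (cyl \<rho> \<epsilon>)) (cyl \<rho> \<epsilon> \<inter> \<psi> -` Om)"
    by (rule continuous_closedin_preimage[OF cont Om_closed])
  then obtain T where T: "closed T" "cyl \<rho> \<epsilon> \<inter> \<psi> -` Om = cyl \<rho> \<epsilon> \<inter> T"
    using closedin_closed by metis
  have "?S \<inter> T = {}"
    using T(2) Sc av by fastforce
  then obtain d where d: "d > 0" "\<And>x y. x \<in> ?S \<Longrightarrow> y \<in> T \<Longrightarrow> d \<le> dist x y"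
    using separate_compact_closed[OF S T(1)] by metis
  define s where "s = min (ln d) (ln \<rho>)"
  have s: "s \<le> ln \<rho>" "exp s \<le> d"
    using d(1) by (auto simp: s_def) (metis exp_le_cancel_iff exp_ln min.cobounded1)
  have es: "exp s \<le> \<rho>"
    using s(1) pos(1) by (metis exp_le_cancel_iff exp_ln)
  have main: "x \<in> cyl \<rho> \<epsilon> \<and> \<psi> x \<notin> Om"
    if x: "(x $ 1)\<^sup>2 + (x $ 2)\<^sup>2 < (exp s)\<^sup>2" "a \<le> x $ 3" "x $ 3 \<le> b" for x
  proof -
    have "(exp s)\<^sup>2 \<le> \<rho>\<^sup>2" using es by (simp add: power_mono)
    then have c: "x \<in> cyl \<rho> \<epsilon>"
      using x ab by (auto simp: cyl_def)
    have "(dist (vec3 0 0 (x $ 3)) x)\<^sup>2 = (x $ 1)\<^sup>2 + (x $ 2)\<^sup>2"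
      unfolding dist_norm power2_norm_eq_inner inner_vec_def sum_3 by (simp add: power2_eq_square)
    then have "(dist (vec3 0 0 (x $ 3)) x)\<^sup>2 < (exp s)\<^sup>2" using x(1) by simp
    then have "dist (vec3 0 0 (x $ 3)) x < d"
      using s(2) power2_less_imp_less[OF _ exp_ge_zero] by fastforce
    moreover have "vec3 0 0 (x $ 3) \<in> ?S" using x by auto
    ultimately have "x \<notin> T" using d(2) by fastforce
    with T(2) c show ?thesis by blast
  qed
  have "slice s a b \<subseteq> B - A"
  proof
    fix y assume y: "y \<in> slice s a b"
    have "(exp (y $ 1))\<^sup>2 < (exp s)\<^sup>2"
      using y by (simp add: slice_def power_strict_mono)
    then have "pol y \<in> cyl \<rho> \<epsilon> \<and> \<psi> (pol y) \<notin> Om"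
      using y by (intro main) (simp_all only: pol_norm, simp_all add: pol_def slice_def)
    then show "y \<in> B - A"
      using pol_in_cyl[OF pos(1)] by (simp add: A_def q_def B_def)
  qed
  with s main show ?thesis using that by blast
qed

text \<open>
  The conjugation between different circles of a slice is cancelled by the transport.
\<close>

lemma N_const_slice:
  assumes K: "slice s a b \<subseteq> B - A" and y: "y \<in> slice s a b" "y' \<in> slice s a b"
  shows "N y' = N y"
proof -
  have G: "path_rep (slice s a b) G" by (rule path_rep_subset[OF G_rep K])
  let ?g = "G (linepath y y')"
  have sub: "path_image (linepath y y') \<subseteq> B - A"
    using y K convex_slice by (metis closed_segment_subset order_trans path_image_linepath)
  have g: "?g \<in> BDset"
    by (rule path_rep_BD[OF G_rep _ sub]) simp
  have "f y' \<doteq> f y * ?g"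
    using sectD[OF f_sect path_linepath sub] by simp
  then have "N y' = (f y * ?g) * G (linepath y' (y' + turn)) * qcnj (f y * ?g)"
    unfolding N_def by (rule eqpm_conj)
  also have "\<dots> = f y * (?g * G (linepath y' (y' + turn))) * qcnj ?g * qcnj (f y)"
    by (simp add: qcnj_mult mult.assoc)
  also have "?g * G (linepath y' (y' + turn)) = G (linepath y (y + turn)) * ?g"
    using y slice_turn by (intro deck_conj[OF G convex_slice] G_turn) auto
  finally show ?thesis
    using g unfolding N_def by (simp add: mult.assoc)
qed

text \<open>
  The translate of a section by a turn is again a section.
\<close>

lemma f_turn:
  obtains c where "\<And>y. y \<in> B - A \<Longrightarrow> f (y + turn) \<doteq> c * f y"
proof (cases "B - A = {}")
  case True
  then show ?thesis using that by blast
next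
  case False
  have s: "sect (B - A) G (\<lambda>y. f (y + turn))"
    unfolding sect_def
  proof (intro conjI allI impI ballI)
    fix y assume "y \<in> B - A"
    then show "f (y + turn) \<in> BDset" by (intro f_BD) simp
  next
    fix p assume p: "path p \<and> path_image p \<subseteq> B - A"
    let ?p = "\<lambda>t. p t + turn"
    have "path ?p"
      using p unfolding path_def by (intro continuous_intros) auto
    moreover have "path_image ?p \<subseteq> B - A"
      using p by (auto simp: path_image_def)
    ultimately have "f (pathfinish ?p) \<doteq> f (pathstart ?p) * G ?p"
      by (rule sectD[OF f_sect])
    moreover have "G ?p = G p"
      using G_turn[of p 1] by simp
    ultimately show "f (pathfinish p + turn) \<doteq> f (pathstart p + turn) * G p"
      by (simp add: pathfinish_def pathstart_def)
  qed
  show ?thesis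
    by (rule sect_compare[OF BA_path_connected False f_sect s]) (rule that)
qed

text \<open>
  Modulo sign the value on a circle is the factor by which the section changes under a turn, and this
  is the same everywhere in the tube.
\<close>

lemma N_const_pm:
  assumes "slice s a b \<subseteq> B - A" "y \<in> slice s a b" "slice s' a' b' \<subseteq> B - A" "y' \<in> slice s' a' b'"
  shows "N y' \<doteq> N y"
proof -
  obtain c where c: "\<And>y. y \<in> B - A \<Longrightarrow> f (y + turn) \<doteq> c * f y"
    using f_turn by blast
  have "N y \<doteq> c" if K: "slice s a b \<subseteq> B - A" and y: "y \<in> slice s a b" for s a b y
  proof -
    have "path_image (linepath y (y + turn)) \<subseteq> B - A"
      using slice_linepath_turn[OF y] K by blast
    from sectD[OF f_sect path_linepath this]
    have "f (y + turn) \<doteq> f y * G (linepath y (y + turn))" by simp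
    then have "f y * G (linepath y (y + turn)) \<doteq> c * f y"
      using c[of y] K y by (meson eqpm_sym eqpm_trans subsetD)
    then have "N y \<doteq> c * f y * qcnj (f y)"
      unfolding N_def by (intro eqpm_mult[OF _ eqpm_refl])
    moreover have "f y \<in> BDset" using K y by (intro f_BD) blast
    ultimately show ?thesis
      by (simp add: mult.assoc)
  qed
  from this[OF assms(1,2)] this[OF assms(3,4)] show ?thesis
    by (meson eqpm_sym eqpm_trans)
qed

text \<open>A circle of an end chart might wind around the link more than once in the tube.\<close>

lemma N_multiple:
  assumes K: "slice s a b \<subseteq> B - A" and y: "y \<in> slice s a b"
    and K': "slice s' a' b' \<subseteq> B - A" and y': "y' \<in> slice s' a' b'" and eq: "N y = N y'"
  shows "f y * G (linepath y (y + of_int n *\<^sub>R turn)) * qcnj (f y) =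
         f y' * G (linepath y' (y' + of_int n *\<^sub>R turn)) * qcnj (f y')"
proof -
  have zero: "f y * G (linepath y (y + of_int 0 *\<^sub>R turn)) * qcnj (f y) = 1"
    if K: "slice s a b \<subseteq> B - A" and y: "y \<in> slice s a b" for s a b y
  proof -
    have yB: "y \<in> B - A" using K y by blast
    show ?thesis
      unfolding of_int_0 scaleR_zero_left add_0_right path_rep_const[OF G_rep yB] mult_1_right
      by (rule BD_mult_qcnj(1)[OF f_BD[OF yB]])
  qed
  have succ: "f y * G (linepath y (y + of_int (n + 1) *\<^sub>R turn)) * qcnj (f y) =
      f y * G (linepath y (y + of_int n *\<^sub>R turn)) * qcnj (f y) * N y"
    if K: "slice s a b \<subseteq> B - A" and y: "y \<in> slice s a b" for s a b y n
  proof -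
    have G: "path_rep (slice s a b) G" by (rule path_rep_subset[OF G_rep K])
    have "G (linepath y (y + of_int (n + 1) *\<^sub>R turn)) =
        G (linepath y (y + of_int n *\<^sub>R turn)) * G (linepath y (y + turn))"
      using y slice_turn by (intro deck_step[OF G convex_slice] G_turn) auto
    moreover have "f y \<in> BDset" using K y by (intro f_BD) blast
    ultimately show ?thesis
      unfolding N_def by (simp add: mult.assoc)
  qed
  have NB: "N y \<in> BDset"
  proof -
    have "path_image (linepath y (y + turn)) \<subseteq> B - A"
      using slice_linepath_turn[OF y] K by blast
    then have "G (linepath y (y + turn)) \<in> BDset"
      by (rule path_rep_BD[OF G_rep path_linepath])
    moreover have "f y \<in> BDset" using K y by (intro f_BD) blast
    ultimately show ?thesis
      unfolding N_def by (intro BD_mult_closed BD_qcnj)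
  qed
  show ?thesis
  proof (induction n rule: int_induct[where k = 0])
    case base
    show ?case by (rule trans[OF zero[OF K y] zero[OF K' y', symmetric]])
  next
    case (step1 i)
    then show ?case using succ[OF K y, of i] succ[OF K' y', of i] eq by simp
  next
    case (step2 i)
    then have "f y * G (linepath y (y + of_int (i - 1) *\<^sub>R turn)) * qcnj (f y) * N y =
      f y' * G (linepath y' (y' + of_int (i - 1) *\<^sub>R turn)) * qcnj (f y') * N y"
      using succ[OF K y, of "i - 1"] succ[OF K' y', of "i - 1"] eq by simp
    then show ?case using BD_cancel_right[OF NB] by simp
  qed
qed

text \<open>
  The slice contains a standard small meridian of the link.
\<close>

lemma N_S1_B:
  assumes ab: "a < b" and K: "slice s a b \<subseteq> B - A" and y: "y \<in> slice s a b"
    and nb: "\<And>x. (x $ 1)\<^sup>2 + (x $ 2)\<^sup>2 < (exp s)\<^sup>2 \<Longrightarrow> a \<le> x $ 3 \<Longrightarrow> x $ 3 \<le> b \<Longrightarrow> x \<in> cyl \<rho> \<epsilon> \<and> \<psi> x \<notin> Om"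
  shows "N y \<in> S1_B"
proof -
  define z where "z = (a + b) / 2"
  define c where "c = min (exp s) ((b - a) / 2)"
  have c: "c > 0" "c \<le> exp s" "a \<le> z - c" "z + c \<le> b"
  proof -
    show "c > 0" "c \<le> exp s" using ab by (simp_all add: c_def)
    have "c \<le> (b - a) / 2" unfolding c_def by (rule min.cobounded2)
    then show "a \<le> z - c" "z + c \<le> b" by (simp_all add: z_def field_simps)
  qed
  define h where "h v = vec3 0 0 z + c *\<^sub>R squash v" for v
  have h: "h v \<in> cyl \<rho> \<epsilon> \<and> \<psi> (h v) \<notin> Om" for v
  proof (rule nb)
    have le: "norm (c *\<^sub>R squash v) < c"
      using c(1) norm_squash[of v] by simp
    have "((h v) $ 1)\<^sup>2 + ((h v) $ 2)\<^sup>2 \<le> (norm (c *\<^sub>R squash v))\<^sup>2"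
      unfolding power2_norm_eq_inner inner_vec_def sum_3 by (simp add: h_def power2_eq_square)
    also have "\<dots> < c\<^sup>2"
      using le by (intro power_strict_mono) auto
    also have "\<dots> \<le> (exp s)\<^sup>2"
      using c by (intro power_mono) auto
    finally show "((h v) $ 1)\<^sup>2 + ((h v) $ 2)\<^sup>2 < (exp s)\<^sup>2" .
    have "\<bar>(c *\<^sub>R squash v) $ 3\<bar> < c"
      using component_le_norm_cart[of "c *\<^sub>R squash v" 3] le by linarith
    moreover have "h v $ 3 = z + (c *\<^sub>R squash v) $ 3" by (simp add: h_def)
    ultimately show "a \<le> h v $ 3" "h v $ 3 \<le> b"
      using c unfolding abs_less_iff by linarith+
  qed
  have "F (\<psi> \<circ> h \<circ> unit_circle) \<in> S1_B"
  proof (rule link_meridian)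
    have "continuous_on UNIV h"
      unfolding h_def by (intro continuous_intros continuous_on_squash)
    then show "continuous_on UNIV (\<psi> \<circ> h)"
      using h by (intro continuous_on_compose continuous_on_subset[OF cont]) auto
    have "inj h"
      using c(1) inj_squash by (auto simp: h_def inj_def)
    then show "inj (\<psi> \<circ> h)"
      using h by (intro comp_inj_on inj_on_subset[OF inj]) auto
    have "h v \<in> z_axis \<longleftrightarrow> v \<in> z_axis" for v
      using squash_z_axis[of c v] c(1) by (simp add: h_def z_axis_def)
    then show "(\<psi> \<circ> h) -` P = z_axis"
      using P_iff h by auto
    show "(\<psi> \<circ> h) -` Om = {}"
      using h by auto
  qed
  moreover define y0 where "y0 = vec3 (ln (c / sqrt 2)) 0 z"
  have "h (unit_circle t) = vec3 0 0 z + (c / sqrt 2) *\<^sub>R unit_circle t" for t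
    by (simp add: h_def squash_unit_circle)
  then have "h \<circ> unit_circle = pol \<circ> linepath y0 (y0 + turn)"
    unfolding pol_linepath_turn using c(1)
    by (simp add: fun_eq_iff unit_circle_def vec3_eq_iff y0_def)
  ultimately have S: "G (linepath y0 (y0 + turn)) \<in> S1_B"
    unfolding G_def q_def by (simp add: comp_assoc)
  have "c / sqrt 2 < c"
    using c(1) by (simp add: divide_less_eq)
  then have "c / sqrt 2 < exp s" using c(2) by linarith
  then have "ln (c / sqrt 2) < s"
    using c(1) by (metis divide_pos_pos exp_less_cancel_iff exp_ln real_sqrt_gt_zero zero_less_numeral)
  moreover have "a \<le> z" "z \<le> b" using c by linarith+
  ultimately have y0: "y0 \<in> slice s a b"
    by (simp add: slice_def y0_def)
  have "N y = N y0" by (rule N_const_slice[OF K y0 y])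
  moreover have "f y0 \<in> BDset" using y0 K by (intro f_BD) blast
  ultimately show ?thesis
    using S unfolding N_def by (metis S1_B_conj)
qed

lemma N_const_between:
  assumes K: "slice s a b \<subseteq> B - A" "y \<in> slice s a b" and K': "slice s' a' b' \<subseteq> B - A" "y' \<in> slice s' a' b'"
    and av: "\<And>z. min (y $ 3) (y' $ 3) \<le> z \<Longrightarrow> z \<le> max (y $ 3) (y' $ 3) \<Longrightarrow> \<psi> (vec3 0 0 z) \<notin> Om"
  shows "N y = N y'"
proof -
  have yB: "y \<in> B" "y' \<in> B" using K K' by blast+
  then have "- \<epsilon> < min (y $ 3) (y' $ 3)" "max (y $ 3) (y' $ 3) < \<epsilon>"
    by (auto simp: mem_B abs_less_iff)
  then obtain t where t: "slice t (min (y $ 3) (y' $ 3)) (max (y $ 3) (y' $ 3)) \<subseteq> B - A"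
    using slice_exists av by metis
  define u where "u = min (min s s') t - 1"
  have u: "u < s" "u < s'" "u < t" by (auto simp: u_def)
  have "N y = N (vec3 u 0 (y $ 3))"
    using K u by (intro N_const_slice[OF K(1)]) (auto simp: slice_def)
  also have "\<dots> = N (vec3 u 0 (y' $ 3))"
    using u by (intro N_const_slice[OF t]) (auto simp: slice_def)
  also have "\<dots> = N y'"
    using K' u by (intro N_const_slice[OF K'(1)]) (auto simp: slice_def)
  finally show ?thesis .
qed

text \<open>
  At an end of the arc the value of \<open>N\<close> cannot be the same on both sides.  The cylinder in an end chart
  between the circles just above and just below the arc is cut open and lifted to the covering.  Its
  top and bottom edges make the same number of turns, so with equal values of \<open>N\<close> they would have equal
  transported values; but these are opposite by the comparison of the two circles.
\<close>

lemma N_not_const_at_end: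
  assumes e: "\<psi> 0 \<in> Om"
    and const: "\<And>s a b y s' a' b' y'. slice s a b \<subseteq> B - A \<Longrightarrow> y \<in> slice s a b \<Longrightarrow>
       y $ 3 \<noteq> 0 \<Longrightarrow> slice s' a' b' \<subseteq> B - A \<Longrightarrow> y' \<in> slice s' a' b' \<Longrightarrow> y' $ 3 \<noteq> 0 \<Longrightarrow> N y = N y'"
  shows False
proof -
  let ?C = "cyl \<rho> \<epsilon>"
  have zero: "0 \<in> ?C" "(0::real^3) \<in> z_axis"
    using pos by (auto simp: cyl_def z_axis_def)
  have "open (\<psi> ` ?C)"
    by (rule invariance_of_domain[OF cont open_cyl inj])
  moreover have "\<psi> 0 \<in> P \<inter> Om" "\<psi> 0 \<in> \<psi> ` ?C"
    using P_iff zero e by auto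
  ultimately obtain \<phi> where \<phi>: "continuous_on UNIV \<phi>" "inj \<phi>" "\<phi> 0 = \<psi> 0" "range \<phi> \<subseteq> \<psi> ` ?C"
    "\<phi> -` P = z_axis" "\<phi> -` Om = x_ray"
    using end_chart by metis
  obtain r0 where r0: "homeomorphism ?C (\<psi> ` ?C) \<psi> r0"
    using invariance_of_domain_homeomorphism[OF open_cyl cont _ inj] by auto
  define \<xi> where "\<xi> = r0 \<circ> \<phi>"
  have \<xi>: "\<xi> v \<in> ?C" "\<psi> (\<xi> v) = \<phi> v" for v
  proof -
    have "\<phi> v \<in> \<psi> ` ?C" using \<phi>(4) by blast
    then show "\<xi> v \<in> ?C" "\<psi> (\<xi> v) = \<phi> v"
      using r0 unfolding homeomorphism_def \<xi>_def by auto
  qed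
  have cont_\<xi>: "continuous_on UNIV \<xi>"
    unfolding \<xi>_def using \<phi>(1,4) r0
    by (intro continuous_on_compose) (auto simp: homeomorphism_def intro: continuous_on_subset)
  have inj_\<xi>: "\<xi> v = \<xi> w \<Longrightarrow> v = w" for v w
    by (metis \<xi>(2) \<phi>(2) injD)
  have \<xi>0: "\<xi> 0 = 0"
    using \<xi>[of 0] \<phi>(3) zero(1) inj by (metis inj_onD)
  have \<xi>_axis: "\<xi> v \<in> z_axis \<longleftrightarrow> v \<in> z_axis" for v
    using P_iff[OF \<xi>(1), of v] \<xi>(2)[of v] \<phi>(5) by (metis vimage_eq)
  have neg_one_neq_zero: "(- 1 :: real) \<noteq> 0" by simp
  have near: "\<exists>s a b \<delta>. 0 \<notin> {a..b} \<and> slice s a b \<subseteq> B - A \<and> \<delta> > 0 \<and>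
      (\<forall>v y. dist v (vec3 0 0 \<sigma>) < \<delta> \<longrightarrow> pol y = \<xi> v \<longrightarrow> y \<in> slice s a b)" if \<sigma>: "\<sigma> \<noteq> 0" for \<sigma>
  proof -
    let ?v = "vec3 0 0 \<sigma>"
    define z where "z = \<xi> ?v $ 3"
    have ax: "\<xi> ?v \<in> z_axis" using \<xi>_axis by (simp add: z_axis_def)
    then have xv: "\<xi> ?v = vec3 0 0 z" by (simp add: z_axis_def z_def vec3_eq_iff)
    have "z \<noteq> 0"
    proof
      assume "z = 0"
      then have "\<xi> ?v = \<xi> 0" using xv \<xi>0 by (simp add: vec3_eq_iff)
      then have "?v = 0" by (rule inj_\<xi>)
      then show False using \<sigma> by (simp add: vec3_eq_iff)
    qed
    have z\<epsilon>: "\<bar>z\<bar> < \<epsilon>" using \<xi>(1)[of ?v] by (simp add: cyl_def z_def)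
    define \<eta> where "\<eta> = min \<bar>z\<bar> (\<epsilon> - \<bar>z\<bar>) / 2"
    have \<eta>: "\<eta> > 0" "\<eta> < \<bar>z\<bar>" "\<bar>z\<bar> + \<eta> < \<epsilon>"
      using \<open>z \<noteq> 0\<close> z\<epsilon> by (auto simp: \<eta>_def min_def field_simps)
    have av: "\<psi> (vec3 0 0 w) \<notin> Om" if w: "z - \<eta> \<le> w" "w \<le> z + \<eta>" for w
    proof
      assume "\<psi> (vec3 0 0 w) \<in> Om"
      moreover have "vec3 0 0 w \<in> ?C" using w \<eta> pos by (auto simp: cyl_def)
      ultimately have "vec3 0 0 w = 0" by (intro Om_axis) (auto simp: z_axis_def)
      then show False using w \<eta> by (auto simp: vec3_eq_iff)
    qed
    have "- \<epsilon> < z - \<eta>" "z + \<eta> < \<epsilon>" using \<eta>(3) by linarith+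
    then obtain s where s: "slice s (z - \<eta>) (z + \<eta>) \<subseteq> B - A"
      by (rule slice_exists) (use av in blast)+
    define U where "U = {x::real^3. (x $ 1)\<^sup>2 + (x $ 2)\<^sup>2 < (exp s)\<^sup>2 \<and> z - \<eta> < x $ 3 \<and> x $ 3 < z + \<eta>}"
    have "open U"
      unfolding U_def by (intro open_Collect_conj open_Collect_less continuous_intros)
    then have "open (\<xi> -` U)"
      by (rule open_vimage[OF _ cont_\<xi>])
    moreover have "?v \<in> \<xi> -` U"
      unfolding vimage_eq xv using \<eta> by (simp add: U_def)
    ultimately obtain \<delta> where \<delta>: "\<delta> > 0" "ball ?v \<delta> \<subseteq> \<xi> -` U"
      using open_contains_ball by metis
    have "y \<in> slice s (z - \<eta>) (z + \<eta>)" if v: "dist v ?v < \<delta>" and y: "pol y = \<xi> v" for v y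
    proof -
      have "pol y \<in> U" using \<delta>(2) v unfolding y by (auto simp: dist_commute)
      then have "(exp (y $ 1))\<^sup>2 < (exp s)\<^sup>2" "z - \<eta> < y $ 3" "y $ 3 < z + \<eta>"
        unfolding U_def mem_Collect_eq pol_norm by (auto simp: pol_def)
      then show ?thesis
        using power2_less_imp_less[OF _ exp_ge_zero] by (fastforce simp: slice_def)
    qed
    moreover have "0 \<notin> {z - \<eta>..z + \<eta>}" using \<eta>(1,2) by (auto simp: abs_if split: if_splits)
    ultimately show ?thesis
      using s \<delta>(1) by blast
  qed
  \<comment> \<open>slices on the two sides of the end that contain all lifts of points near the heights 1 and -1 of the end chart\<close>
  obtain s a b \<delta> where K0: "0 \<notin> {a..b}" and K: "slice s a b \<subseteq> B - A" "\<delta> > 0"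
      "\<And>v y. dist v (vec3 0 0 1) < \<delta> \<Longrightarrow> pol y = \<xi> v \<Longrightarrow> y \<in> slice s a b"
    using near[OF one_neq_zero] by blast
  obtain s' a' b' \<delta>' where K'0: "0 \<notin> {a'..b'}" and K': "slice s' a' b' \<subseteq> B - A" "\<delta>' > 0"
      "\<And>v y. dist v (vec3 0 0 (-1)) < \<delta>' \<Longrightarrow> pol y = \<xi> v \<Longrightarrow> y \<in> slice s' a' b'"
    using near[of "-1", OF neg_one_neq_zero] by blast
  define r where "r = min \<delta> \<delta>' / 2"
  have r: "r > 0" "r < \<delta>" "r < \<delta>'" using K(2) K'(2) by (auto simp: r_def)
  have dist_r: "dist (cyl_map r (vec3 t h 0)) (vec3 0 0 h) = r" for t h
  proof -
    have "(dist (cyl_map r (vec3 t h 0)) (vec3 0 0 h))\<^sup>2 = (pol (vec3 (ln r) (4 * arctan t) h) $ 1)\<^sup>2 + (pol (vec3 (ln r) (4 * arctan t) h) $ 2)\<^sup>2"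
      unfolding dist_norm power2_norm_eq_inner inner_vec_def sum_3 cyl_map_def
      by (simp add: power2_eq_square pol_def)
    also have "\<dots> = r\<^sup>2" using r(1) by (simp only: pol_norm vector_3 exp_ln)
    finally show ?thesis using r(1) by (metis less_imp_le power2_eq_imp_eq zero_le_dist)
  qed
  \<comment> \<open>the cylinder cut open, parametrised by a rectangle and read in the tube\<close>
  define \<kappa> where "\<kappa> u = \<xi> (cyl_map r (vec3 (2 * fst u - 1) (snd u) 0))" for u :: "real \<times> real"
  let ?K = "{0..1::real} \<times> {-1..1::real}"
  have "continuous_on ?K \<kappa>"
    unfolding \<kappa>_def
    by (intro continuous_on_compose2[OF cont_\<xi>] continuous_intros) auto
  moreover have "contractible ?K"
    by (intro convex_imp_contractible convex_Times) auto
  moreover have "\<kappa> u \<notin> z_axis" for u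
    unfolding \<kappa>_def \<xi>_axis cyl_map_def by (rule pol_notin_axis)
  ultimately obtain \<eta> where \<eta>: "continuous_on ?K \<eta>" "\<And>u. u \<in> ?K \<Longrightarrow> pol (\<eta> u) = \<kappa> u"
    using pol_lift[of ?K \<kappa>] by metis
  \<comment> \<open>the number of turns does not depend on the height\<close>
  define D where "D h = (\<eta> (1, h) $ 2 - \<eta> (0, h) $ 2) / (2 * pi)" for h
  have \<kappa>1: "\<kappa> (1, h) = \<kappa> (0, h)" for h
    by (simp add: \<kappa>_def cyl_map_turn)
  have Dn: "\<exists>n::int. D h = of_int n \<and> \<eta> (1, h) = \<eta> (0, h) + of_int n *\<^sub>R turn" if h: "h \<in> {-1..1}" for h
  proof -
    have "pol (\<eta> (1, h)) = pol (\<eta> (0, h))"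
      using h \<eta>(2)[of "(1, h)"] \<eta>(2)[of "(0, h)"] \<kappa>1 by auto
    from pol_eqD[OF this] obtain n where n: "\<eta> (1, h) $ 2 = \<eta> (0, h) $ 2 + of_int n * (2 * pi)"
      and "\<eta> (1, h) $ 1 = \<eta> (0, h) $ 1" "\<eta> (1, h) $ 3 = \<eta> (0, h) $ 3"
      by blast
    then show ?thesis
      by (intro exI[of _ n]) (simp add: D_def vec3_eq_iff)
  qed
  have "continuous_on {-1..1} D"
    unfolding D_def
    by (intro continuous_intros continuous_on_component continuous_on_compose2[OF \<eta>(1)]) auto
  then have "D constant_on {-1..1}"
  proof (rule continuous_discrete_range_constant[rotated])
    fix h assume h: "h \<in> {-1..1::real}"
    have "1 \<le> norm (D y - D h)" if y: "y \<in> {-1..1}" "D y \<noteq> D h" for y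
    proof -
      obtain m n :: int where "D y = of_int m" "D h = of_int n"
        using Dn[OF y(1)] Dn[OF h] by metis
      then show ?thesis using y(2) by (simp flip: of_int_diff of_int_abs)
    qed
    then show "\<exists>e>0. \<forall>y. y \<in> {-1..1} \<and> D y \<noteq> D h \<longrightarrow> e \<le> norm (D y - D h)"
      by (intro exI[of _ 1]) auto
  qed simp
  then obtain d where d: "\<And>h. h \<in> {-1..1} \<Longrightarrow> D h = d"
    unfolding constant_on_def by auto
  obtain n where n: "d = of_int n" "\<eta> (1, 1) = \<eta> (0, 1) + of_int n *\<^sub>R turn"
    using Dn[of 1] d[of 1] by auto
  have n': "\<eta> (1, -1) = \<eta> (0, -1) + of_int n *\<^sub>R turn"
    using Dn[of "-1"] d[of "-1"] n(1) by auto
  define c where "c x y = F (\<phi> \<circ> cyl_map r \<circ> linepath x y)" for x y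
  have q\<eta>: "q (\<eta> (t, h)) = \<phi> (cyl_map r (vec3 (2 * t - 1) h 0))" if "(t, h) \<in> ?K" for t h
    using \<eta>(2)[OF that] \<xi>(2) by (simp add: q_def \<kappa>_def)
  have c_eq: "G p = c x y"
    if p: "path p" "path_image p \<subseteq> B - A" and e: "\<And>t. t \<in> {0..1} \<Longrightarrow> q (p t) = \<phi> (cyl_map r (linepath x y t))" for p x y
    unfolding G_def c_def
  proof (rule path_rep_cong[OF F])
    have "continuous_on (path_image p) q"
      using p(2) by (intro continuous_on_subset[OF cont_q]) auto
    with p(1) show "path (q \<circ> p)" by (rule path_continuous_image)
    show "path_image (q \<circ> p) \<subseteq> - (P \<union> Om)"
      using p(2) q_notin_P unfolding BA_eq path_image_compose by blast
  qed (use e in simp)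
  have path_row: "path (\<lambda>t. \<eta> (t, h))" if "h \<in> {-1..1}" for h
    unfolding path_def using that by (intro continuous_on_compose2[OF \<eta>(1)] continuous_intros) auto
  have row_in: "\<eta> (t, 1) \<in> slice s a b" "\<eta> (t, -1) \<in> slice s' a' b'" if "t \<in> {0..1}" for t
    using that \<eta>(2)[of "(t, 1)"] \<eta>(2)[of "(t, -1)"] dist_r r
    by (auto intro!: K(3)[of "cyl_map r (vec3 (2 * t - 1) 1 0)"] K'(3)[of "cyl_map r (vec3 (2 * t - 1) (-1) 0)"] simp: \<kappa>_def)
  have G1: "G (linepath (\<eta> (0,1)) (\<eta> (0,1) + of_int n *\<^sub>R turn)) = c (vec3 (-1) 1 0) (vec3 1 1 0)"
  proof -
    have im: "path_image (\<lambda>t. \<eta> (t, 1)) \<subseteq> slice s a b"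
      using row_in(1) by (auto simp: path_image_def)
    have "G (linepath (\<eta> (0,1)) (\<eta> (0,1) + of_int n *\<^sub>R turn)) = G (\<lambda>t. \<eta> (t, 1))"
      using row_in(1)[of 0] slice_turn[of "\<eta> (0,1)" s a b n] im n(2)
      by (intro path_rep_convex[OF G_rep convex_slice K(1)] path_row)
        (auto simp: closed_segment_subset convex_slice pathstart_def[of "\<lambda>t. \<eta> (t, 1)"] pathfinish_def[of "\<lambda>t. \<eta> (t, 1)"])
    also have "\<dots> = c (vec3 (-1) 1 0) (vec3 1 1 0)"
    proof (rule c_eq[OF path_row])
      fix t :: real assume "t \<in> {0..1}"
      moreover have "linepath (vec3 (-1) 1 0) (vec3 1 1 0) t = vec3 (2 * t - 1) 1 0"
        by (simp add: linepath_def vec3_eq_iff)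
      ultimately show "q (\<eta> (t, 1)) = \<phi> (cyl_map r (linepath (vec3 (-1) 1 0) (vec3 1 1 0) t))"
        using q\<eta>[of t 1] by simp
    qed (use im K(1) in auto)
    finally show ?thesis .
  qed
  have G2: "G (linepath (\<eta> (0,-1)) (\<eta> (0,-1) + of_int n *\<^sub>R turn)) = c (vec3 (-1) (-1) 0) (vec3 1 (-1) 0)"
  proof -
    have im: "path_image (\<lambda>t. \<eta> (t, -1)) \<subseteq> slice s' a' b'"
      using row_in(2) by (auto simp: path_image_def)
    have "G (linepath (\<eta> (0,-1)) (\<eta> (0,-1) + of_int n *\<^sub>R turn)) = G (\<lambda>t. \<eta> (t, -1))"
      using row_in(2)[of 0] slice_turn[of "\<eta> (0,-1)" s' a' b' n] im n'
      by (intro path_rep_convex[OF G_rep convex_slice K'(1)] path_row)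
        (auto simp: closed_segment_subset convex_slice pathstart_def[of "\<lambda>t. \<eta> (t, -1)"] pathfinish_def[of "\<lambda>t. \<eta> (t, -1)"])
    also have "\<dots> = c (vec3 (-1) (-1) 0) (vec3 1 (-1) 0)"
    proof (rule c_eq[OF path_row])
      fix t :: real assume "t \<in> {0..1}"
      moreover have "linepath (vec3 (-1) (-1) 0) (vec3 1 (-1) 0) t = vec3 (2 * t - 1) (-1) 0"
        by (simp add: linepath_def vec3_eq_iff)
      ultimately show "q (\<eta> (t, -1)) = \<phi> (cyl_map r (linepath (vec3 (-1) (-1) 0) (vec3 1 (-1) 0) t))"
        using q\<eta>[of t "-1"] by simp
    qed (use im K'(1) in auto)
    finally show ?thesis .
  qed
  \<comment> \<open>the vertical edge, opposite to the arc\<close>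
  let ?v = "\<lambda>t. \<eta> (0, 1 - 2 * t)"
  have pv: "path ?v"
    unfolding path_def by (intro continuous_on_compose2[OF \<eta>(1)] continuous_intros) auto
  have qv: "q (?v t) = \<phi> (cyl_map r (vec3 (-1) (1 - 2 * t) 0))" if "t \<in> {0..1}" for t
    using q\<eta>[of 0 "1 - 2 * t"] that by simp
  have iv: "path_image ?v \<subseteq> B - A"
  proof -
    have "?v t \<in> B - A" if t: "t \<in> {0..1}" for t
    proof -
      have "pol (?v t) \<in> ?C"
        using \<eta>(2)[of "(0, 1 - 2 * t)"] \<xi>(1) t by (simp add: \<kappa>_def)
      then have "?v t \<in> B" using pol_in_cyl[OF pos(1)] by (simp add: B_def)
      moreover have "q (?v t) \<notin> Om"
        unfolding qv[OF t] using \<phi>(6) cyl_map_x_ray[of r "vec3 (-1) (1 - 2 * t) 0"]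
        by (auto simp: z_axis_def)
      ultimately show ?thesis by (simp add: BA_eq)
    qed
    then show ?thesis by (auto simp: path_image_def)
  qed
  have Gv: "G ?v = c (vec3 (-1) 1 0) (vec3 (-1) (-1) 0)"
  proof (rule c_eq[OF pv iv])
    fix t :: real assume "t \<in> {0..1}"
    moreover have "linepath (vec3 (-1) 1 0) (vec3 (-1) (-1) 0) t = vec3 (-1) (1 - 2 * t) 0"
      by (simp add: linepath_def vec3_eq_iff)
    ultimately show "q (?v t) = \<phi> (cyl_map r (linepath (vec3 (-1) 1 0) (vec3 (-1) (-1) 0) t))"
      using qv by simp
  qed
  have VB: "G ?v \<in> BDset" by (rule path_rep_BD[OF G_rep pv iv])
  have fv: "f (\<eta> (0,-1)) \<doteq> f (\<eta> (0,1)) * G ?v"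
    using sectD[OF f_sect pv iv] by (simp add: pathstart_def pathfinish_def)
  have B1: "\<eta> (0,1) \<in> B - A" and B2: "\<eta> (0,-1) \<in> B - A"
    using row_in[of 0] K(1) K'(1) by auto
  let ?X = "G (linepath (\<eta> (0,1)) (\<eta> (0,1) + of_int n *\<^sub>R turn))"
  let ?Y = "G (linepath (\<eta> (0,-1)) (\<eta> (0,-1) + of_int n *\<^sub>R turn))"
  have XV: "?X * G ?v = - (G ?v * ?Y)"
    unfolding G1 G2 Gv c_def by (rule end_chart_circles[OF \<phi>(1,2,5,6)])
  have "?X = ?X * G ?v * qcnj (G ?v)"
    unfolding mult.assoc BD_mult_qcnj(1)[OF VB] by (rule mult_1_right[symmetric])
  also have "\<dots> = - (G ?v * ?Y * qcnj (G ?v))"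
    unfolding XV by (rule mult_minus_left)
  finally have X: "?X = - (G ?v * ?Y * qcnj (G ?v))" .
  let ?E = "f (\<eta> (0,1)) * ?X * qcnj (f (\<eta> (0,1)))"
  have "f (\<eta> (0,-1)) * ?Y * qcnj (f (\<eta> (0,-1))) = (f (\<eta> (0,1)) * G ?v) * ?Y * qcnj (f (\<eta> (0,1)) * G ?v)"
    by (rule eqpm_conj[OF fv])
  also have "\<dots> = - ?E"
    unfolding X by (simp add: qcnj_mult mult.assoc)
  finally have "f (\<eta> (0,-1)) * ?Y * qcnj (f (\<eta> (0,-1))) = - ?E" .
  moreover have "?E = f (\<eta> (0,-1)) * ?Y * qcnj (f (\<eta> (0,-1)))"
  proof (rule N_multiple[OF K(1) _ K'(1)])
    show r1: "\<eta> (0,1) \<in> slice s a b" and r2: "\<eta> (0,-1) \<in> slice s' a' b'" using row_in[of 0] by auto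
    have "\<eta> (0,1) $ 3 \<noteq> 0" "\<eta> (0,-1) $ 3 \<noteq> 0"
      using K0 K'0 r1 r2 by (auto simp: slice_def)
    then show "N (\<eta> (0,1)) = N (\<eta> (0,-1))"
      by (intro const[OF K(1) r1 _ K'(1) r2])
  qed
  moreover have "?E \<in> BDset"
  proof -
    have "path_image (linepath (\<eta> (0,1)) (\<eta> (0,1) + of_int n *\<^sub>R turn)) \<subseteq> B - A"
    proof -
      have "\<eta> (0,1) \<in> slice s a b" by (rule row_in(1)) simp
      then have "closed_segment (\<eta> (0,1)) (\<eta> (0,1) + of_int n *\<^sub>R turn) \<subseteq> slice s a b"
        by (intro closed_segment_subset convex_slice slice_turn)
      then show ?thesis using K(1) unfolding path_image_linepath by (rule order_trans)
    qed
    then have "?X \<in> BDset" by (intro path_rep_BD[OF G_rep path_linepath])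
    then show ?thesis using f_BD[OF B1] by (intro BD_mult_closed BD_qcnj)
  qed
  ultimately show False using BD_neq_uminus[of ?E] by simp
qed

end

context tube
begin

text \<open>
  On either side of the origin the values on small circles are constant.  If the arc ends at the
  origin, they agree up to sign but are different, so they are opposite.  The circles start at angle
  \<open>0\<close>, which will be the direction vertically above the link.
\<close>

lemma tube_values:
  obtains N1 N2 where "N1 \<in> S1_B" "N2 \<in> S1_B" "N2 = (if \<psi> 0 \<in> Om then - N1 else N1)"
    "\<And>z. 0 < \<bar>z\<bar> \<Longrightarrow> \<bar>z\<bar> < \<epsilon> \<Longrightarrow>
       \<exists>r0>0. \<forall>r. 0 < r \<and> r < r0 \<longrightarrow>
         path_image (linepath (vec3 (ln r) 0 z) (vec3 (ln r) 0 z + turn)) \<subseteq> B - A \<and>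
         N (vec3 (ln r) 0 z) = (if z < 0 then N1 else N2)"
proof -
  have off: "\<psi> (vec3 0 0 z) \<notin> Om" if z: "\<bar>z\<bar> < \<epsilon>" "z \<noteq> 0 \<or> \<psi> 0 \<notin> Om" for z
  proof
    assume "\<psi> (vec3 0 0 z) \<in> Om"
    moreover have "vec3 0 0 z \<in> cyl \<rho> \<epsilon>" "vec3 0 0 z \<in> z_axis"
      using z pos by (auto simp: cyl_def z_axis_def)
    ultimately have e: "vec3 0 0 z = 0" and "\<psi> (vec3 0 0 z) \<in> Om" using Om_axis by blast+
    then have "\<psi> 0 \<in> Om" by (simp only: e)
    moreover from e have "z = 0" by (simp add: vec3_eq_iff)
    ultimately show False using z by blast
  qed
  have sl: "\<exists>s a b. a < z \<and> z < b \<and> slice s a b \<subseteq> B - A \<and> N (vec3 (s - 1) 0 z) \<in> S1_B"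
    if z: "0 < \<bar>z\<bar>" "\<bar>z\<bar> < \<epsilon>" for z
  proof -
    define \<eta> where "\<eta> = min \<bar>z\<bar> (\<epsilon> - \<bar>z\<bar>) / 2"
    have \<eta>: "\<eta> > 0" "\<eta> < \<bar>z\<bar>" "\<bar>z\<bar> + \<eta> < \<epsilon>"
      using z by (auto simp: \<eta>_def min_def field_simps)
    have e: "- \<epsilon> < z - \<eta>" "z + \<eta> < \<epsilon>" using \<eta>(3) by linarith+
    have av: "\<psi> (vec3 0 0 w) \<notin> Om" if "z - \<eta> \<le> w" "w \<le> z + \<eta>" for w
    proof -
      have "\<bar>w\<bar> < \<epsilon>" "w \<noteq> 0" using that \<eta> e by linarith+
      then show ?thesis by (intro off) auto
    qed
    obtain s where s: "s \<le> ln \<rho>" "slice s (z - \<eta>) (z + \<eta>) \<subseteq> B - A"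
      "\<And>x. (x $ 1)\<^sup>2 + (x $ 2)\<^sup>2 < (exp s)\<^sup>2 \<Longrightarrow> z - \<eta> \<le> x $ 3 \<Longrightarrow> x $ 3 \<le> z + \<eta> \<Longrightarrow> x \<in> cyl \<rho> \<epsilon> \<and> \<psi> x \<notin> Om"
      by (rule slice_exists[OF e]) (use av in blast)+
    have "vec3 (s - 1) 0 z \<in> slice s (z - \<eta>) (z + \<eta>)"
      using \<eta> by (simp add: slice_def)
    then have "N (vec3 (s - 1) 0 z) \<in> S1_B"
      using \<eta>(1) s by (intro N_S1_B[of "z - \<eta>" "z + \<eta>" s]) auto
    with s(2) \<eta>(1) show ?thesis
      by (intro exI[of _ s] exI[of _ "z - \<eta>"] exI[of _ "z + \<eta>"]) auto
  qed
  have hm: "0 < \<bar>- \<epsilon> / 2\<bar>" "\<bar>- \<epsilon> / 2\<bar> < \<epsilon>" "0 < \<bar>\<epsilon> / 2\<bar>" "\<bar>\<epsilon> / 2\<bar> < \<epsilon>"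
    using pos by auto
  obtain s1 a1 b1 where 1: "a1 < - \<epsilon> / 2" "- \<epsilon> / 2 < b1" "slice s1 a1 b1 \<subseteq> B - A" "N (vec3 (s1 - 1) 0 (- \<epsilon> / 2)) \<in> S1_B"
    using sl[OF hm(1,2)] by blast
  obtain s2 a2 b2 where 2: "a2 < \<epsilon> / 2" "\<epsilon> / 2 < b2" "slice s2 a2 b2 \<subseteq> B - A" "N (vec3 (s2 - 1) 0 (\<epsilon> / 2)) \<in> S1_B"
    using sl[OF hm(3,4)] by blast
  define y1 y2 where "y1 = vec3 (s1 - 1) 0 (- \<epsilon> / 2)" and "y2 = vec3 (s2 - 1) 0 (\<epsilon> / 2)"
  have y1: "y1 \<in> slice s1 a1 b1" "y1 $ 3 < 0" and y2: "y2 \<in> slice s2 a2 b2" "0 < y2 $ 3"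
    using 1 2 pos by (auto simp: y1_def y2_def slice_def)
  have yB: "y1 \<in> B" "y2 \<in> B" using 1(3) 2(3) y1 y2 by blast+
  have val1: "N y = N y1" if K: "slice s a b \<subseteq> B - A" "y \<in> slice s a b" and y: "y $ 3 < 0 \<or> \<psi> 0 \<notin> Om" for s a b y
  proof (rule N_const_between[OF K 1(3) y1(1)])
    fix z assume z: "min (y $ 3) (y1 $ 3) \<le> z" "z \<le> max (y $ 3) (y1 $ 3)"
    have "y \<in> B" using K by blast
    then show "\<psi> (vec3 0 0 z) \<notin> Om"
      using z y y1(2) yB(1) by (intro off) (auto simp: mem_B abs_less_iff)
  qed
  have val2: "N y = N y2" if K: "slice s a b \<subseteq> B - A" "y \<in> slice s a b" and y: "0 < y $ 3 \<or> \<psi> 0 \<notin> Om" for s a b y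
  proof (rule N_const_between[OF K 2(3) y2(1)])
    fix z assume z: "min (y $ 3) (y2 $ 3) \<le> z" "z \<le> max (y $ 3) (y2 $ 3)"
    have "y \<in> B" using K by blast
    then show "\<psi> (vec3 0 0 z) \<notin> Om"
      using z y y2(2) yB(2) by (intro off) (auto simp: mem_B abs_less_iff)
  qed
  have sign: "N y2 = (if \<psi> 0 \<in> Om then - N y1 else N y1)"
  proof (cases "\<psi> 0 \<in> Om")
    case False
    then show ?thesis using val1[OF 2(3) y2(1)] by simp
  next
    case True
    have "N y2 \<doteq> N y1" by (rule N_const_pm[OF 1(3) y1(1) 2(3) y2(1)])
    moreover have "N y2 \<noteq> N y1"
    proof
      assume e: "N y2 = N y1"
      have all: "N y = N y1" if K: "slice s a b \<subseteq> B - A" "y \<in> slice s a b" "y $ 3 \<noteq> 0" for s a b y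
        using val1[OF K(1,2)] val2[OF K(1,2)] e K(3) by (cases "y $ 3 < 0") auto
      show False
        by (rule N_not_const_at_end[OF True]) (metis all)
    qed
    ultimately show ?thesis using True by (auto simp: eqpm_def)
  qed
  show ?thesis
  proof (rule that)
    show "N y1 \<in> S1_B" "N y2 \<in> S1_B" using 1 2 by (simp_all add: y1_def y2_def)
    show "N y2 = (if \<psi> 0 \<in> Om then - N y1 else N y1)" by (rule sign)
    fix z assume z: "0 < \<bar>z\<bar>" "\<bar>z\<bar> < \<epsilon>"
    obtain s a b where s: "a < z" "z < b" "slice s a b \<subseteq> B - A"
      using sl[OF z] by blast
    show "\<exists>r0>0. \<forall>r. 0 < r \<and> r < r0 \<longrightarrow>
         path_image (linepath (vec3 (ln r) 0 z) (vec3 (ln r) 0 z + turn)) \<subseteq> B - A \<and>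
         N (vec3 (ln r) 0 z) = (if z < 0 then N y1 else N y2)"
    proof (intro exI conjI allI impI; (elim conjE)?)
      show "0 < exp s" by simp
      fix r assume r: "0 < r" "r < exp s"
      then have "ln r < s" by (metis exp_less_cancel_iff exp_ln)
      then have y: "vec3 (ln r) 0 z \<in> slice s a b" using s by (simp add: slice_def)
      show "path_image (linepath (vec3 (ln r) 0 z) (vec3 (ln r) 0 z + turn)) \<subseteq> B - A"
        using slice_linepath_turn[OF y] s(3) by blast
      show "N (vec3 (ln r) 0 z) = (if z < 0 then N y1 else N y2)"
        using val1[OF s(3) y] val2[OF s(3) y] z(1) by auto
    qed
  qed
qed

end

section \<open>The view from above\<close>

abbreviation e3 :: "real^3" where "e3 \<equiv> vec3 0 0 1"

definition det2 :: "real^3 \<Rightarrow> real^3 \<Rightarrow> real" where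
  "det2 v w = v $ 1 * w $ 2 - v $ 2 * w $ 1"

context link_arc
begin

text \<open>
  The points that lie strictly above everything that the link has on their vertical line.
\<close>

definition T :: "(real^3) set" where
  "T = {x. \<forall>p\<in>P. p $ 1 = x $ 1 \<and> p $ 2 = x $ 2 \<longrightarrow> p $ 3 < x $ 3}"

lemma T_disjoint: "T \<inter> P = {}"
  by (auto simp: T_def)

lemma T_up: "x \<in> T \<Longrightarrow> y $ 1 = x $ 1 \<Longrightarrow> y $ 2 = x $ 2 \<Longrightarrow> x $ 3 \<le> y $ 3 \<Longrightarrow> y \<in> T"
  by (force simp: T_def)

lemma open_T: "open T"
proof -
  let ?R = "{v::real^3. v $ 1 = 0} \<inter> {v. v $ 2 = 0} \<inter> {v. v $ 3 \<le> 0}"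
  have R: "closed ?R"
    by (intro closed_Int closed_Collect_eq closed_Collect_le continuous_intros)
  have "- T = (\<Union>x\<in>P. \<Union>y\<in>?R. {x + y})"
  proof (intro equalityI subsetI)
    fix x assume "x \<in> - T"
    then obtain p where p: "p \<in> P" "p $ 1 = x $ 1" "p $ 2 = x $ 2" "x $ 3 \<le> p $ 3"
      by (auto simp: T_def not_less)
    then have "x - p \<in> ?R" "x = p + (x - p)" by auto
    then show "x \<in> (\<Union>x\<in>P. \<Union>y\<in>?R. {x + y})" using p(1) by blast
  qed (force simp: T_def)
  then have "closed (- T)"
    using compact_closed_sums[OF P_compact R] by simp
  then show ?thesis by (simp add: open_closed)
qed

definition col :: "real^3 \<Rightarrow> real \<Rightarrow> 3 \<Rightarrow> real set" where
  "col x d i = (if i = 3 then {x $ 3 - d<..} else {x $ i - d<..<x $ i + d})"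

lemma col_interval: "convex (col x d i)" "open (col x d i)"
  by (auto simp: col_def)

lemma mem_col: "y \<in> ibox (col x d) \<longleftrightarrow> \<bar>y $ 1 - x $ 1\<bar> < d \<and> \<bar>y $ 2 - x $ 2\<bar> < d \<and> x $ 3 - d < y $ 3"
  by (auto simp: ibox_def col_def forall_3 abs_less_iff)

lemma col_in_T:
  assumes "x \<in> T" obtains d where "d > 0" "ibox (col x d) \<subseteq> T"
proof -
  obtain d where d: "d > 0" "fat_box x x d \<subseteq> T"
    using fat_box_in_open[OF open_T assms] by metis
  have "ibox (col x d) \<subseteq> T"
  proof
    fix y assume y: "y \<in> ibox (col x d)"
    let ?y = "vec3 (y $ 1) (y $ 2) (min (x $ 3) (y $ 3))"
    have "?y \<in> fat_box x x d"
      using y[unfolded mem_col] d(1) by (auto simp: ibox_def forall_3 abs_less_iff)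
    then have "?y \<in> T" using d(2) by blast
    then show "y \<in> T" by (rule T_up) auto
  qed
  with d(1) show ?thesis by (rule that)
qed

lemma sect_box:
  assumes I: "\<And>i. convex (I i)" "\<And>i. open (I i)" and sub: "ibox I \<inter> P = {}"
  obtains f where "sect (ibox I - Om) F f" "path_connected (ibox I - Om)"
proof -
  have "ibox I - (Om - P) = ibox I - Om" using sub by blast
  moreover have "ibox I \<subseteq> - P" using sub by blast
  ultimately show ?thesis
    using sect_ibox[OF arc_sys, of I] I that by metis
qed

lemma box_path_connected:
  assumes I: "\<And>i. convex (I i)" "\<And>i. open (I i)" and sub: "ibox I \<inter> P = {}"
  shows "path_connected (ibox I - Om)"
  using sect_box[of I] assms by metis

lemma box_nonempty:
  assumes I: "\<And>i. open (I i)" and sub: "ibox I \<inter> P = {}" and ne: "ibox I \<noteq> {}"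
  shows "ibox I - Om \<noteq> {}"
proof -
  have "ibox I - (Om - P) = ibox I - Om" using sub by blast
  then show ?thesis
    using arc_sys_diff_nonempty[OF arc_sys open_ibox, of I] I sub ne by auto
qed

text \<open>
  The region \<open>T\<close> is a union of columns, each of which has a section.  Normalise these sections to agree
  with a fixed section over a half-space above the whole link.  Two columns that meet have in common
  a column that reaches into the half-space, so the normalised sections agree on it up to sign.
\<close>

lemma sky_section: obtains f where "sect (T - Om) F f"
proof -
  obtain H where H: "\<And>p. p \<in> P \<Longrightarrow> p $ 3 < H"
  proof -
    have "bounded ((\<lambda>p. p $ 3) ` P)"
      by (intro compact_imp_bounded compact_continuous_image P_compact continuous_on_component continuous_on_id)
    then obtain H where "\<And>p. p \<in> P \<Longrightarrow> \<bar>p $ 3\<bar> \<le> H"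
      unfolding bounded_iff by auto
    then have "\<And>p. p \<in> P \<Longrightarrow> p $ 3 < H + 1" by force
    then show thesis by (rule that)
  qed
  \<comment> \<open>the half-space above the link\<close>
  define W where "W = (\<lambda>i::3. if i = 3 then {H<..} else UNIV)"
  have W: "convex (W i)" "open (W i)" for i by (auto simp: W_def)
  have mem_W: "y \<in> ibox W \<longleftrightarrow> H < y $ 3" for y
    by (auto simp: ibox_def W_def)
  have W_P: "ibox W \<inter> P = {}" using H by (force simp: mem_W)
  obtain fW where fW: "sect (ibox W - Om) F fW" "path_connected (ibox W - Om)"
    using sect_box[OF W W_P] .
  have colW: "ibox (col x d) \<inter> ibox (col x' d') \<inter> ibox W - Om \<noteq> {}"
    if ne: "ibox (col x d) \<inter> ibox (col x' d') \<noteq> {}" for x x' d d'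
  proof -
    obtain y where y: "y \<in> ibox (col x d) \<inter> ibox (col x' d')" using ne by blast
    let ?I = "\<lambda>i. col x d i \<inter> col x' d' i \<inter> W i"
    have "vec3 (y $ 1) (y $ 2) (max (y $ 3) (H + 1)) \<in> ibox (col x d) \<inter> ibox (col x' d') \<inter> ibox W"
      using y by (auto simp: mem_col mem_W)
    moreover have e: "ibox (col x d) \<inter> ibox (col x' d') \<inter> ibox W = ibox ?I"
      by (simp add: ibox_Int)
    moreover have "ibox ?I \<inter> P = {}" using W_P unfolding e[symmetric] by blast
    moreover have "open (?I i)" for i by (intro open_Int col_interval W)
    ultimately show ?thesis using box_nonempty[of ?I] by (metis empty_iff)
  qed
  have "\<exists>d g. d > 0 \<and> ibox (col x d) \<subseteq> T \<and> sect (ibox (col x d) - Om) F g \<and>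
      (\<forall>y\<in>ibox (col x d) \<inter> ibox W - Om. g y \<doteq> fW y)" if x: "x \<in> T" for x
  proof -
    obtain d where d: "d > 0" "ibox (col x d) \<subseteq> T" using col_in_T[OF x] .
    have dP: "ibox (col x d) \<inter> P = {}" using d(2) T_disjoint by blast
    obtain g where g: "sect (ibox (col x d) - Om) F g"
      using sect_box[OF col_interval dP] by metis
    let ?D = "ibox (col x d) \<inter> ibox W - Om"
    have e: "ibox (col x d) \<inter> ibox W = ibox (\<lambda>i. col x d i \<inter> W i)" by (rule ibox_Int)
    have pc: "path_connected ?D"
    proof -
      have "ibox (\<lambda>i. col x d i \<inter> W i) \<inter> P = {}" using dP unfolding e[symmetric] by blast
      then show ?thesis unfolding e
        by (intro box_path_connected convex_Int open_Int col_interval W)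
    qed
    have "x \<in> ibox (col x d) \<inter> ibox (col x d)" using d(1) by (simp add: mem_col)
    then have ne: "?D \<noteq> {}" using colW[of x d x d] by blast
    have s: "sect ?D F g" "sect ?D F fW"
      by (rule sect_subset[OF g], blast) (rule sect_subset[OF fW(1)], blast)
    obtain k where k: "k \<in> BDset" "\<And>y. y \<in> ?D \<Longrightarrow> fW y \<doteq> k * g y"
      by (rule sect_compare[OF pc ne s]) blast
    then show ?thesis
      using d sect_left_mult[OF g k(1)] by (intro exI[of _ d] exI[of _ "\<lambda>y. k * g y"]) (auto intro: eqpm_sym)
  qed
  then obtain d g where dg: "\<And>x. x \<in> T \<Longrightarrow> 0 < d x" "\<And>x. x \<in> T \<Longrightarrow> ibox (col x (d x)) \<subseteq> T"
    "\<And>x. x \<in> T \<Longrightarrow> sect (ibox (col x (d x)) - Om) F (g x)"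
    "\<And>x y. x \<in> T \<Longrightarrow> y \<in> ibox (col x (d x)) \<inter> ibox W - Om \<Longrightarrow> g x y \<doteq> fW y"
    by metis
  define f where "f x = g x x" for x
  let ?C = "\<lambda>x. ibox (col x (d x))"
  have self: "x \<in> ?C x" if "x \<in> T" for x
    using dg(1)[OF that] by (simp add: mem_col)
  have agree: "f y \<doteq> g x y" if x: "x \<in> T" and y: "y \<in> ?C x - Om" for x y
  proof -
    have yT: "y \<in> T" using dg(2)[OF x] y by blast
    let ?D = "?C x \<inter> ?C y - Om"
    have e: "?C x \<inter> ?C y = ibox (\<lambda>i. col x (d x) i \<inter> col y (d y) i)" by (rule ibox_Int)
    have pc: "path_connected ?D"
    proof -
      have "ibox (\<lambda>i. col x (d x) i \<inter> col y (d y) i) \<inter> P = {}"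
        using dg(2)[OF x] T_disjoint unfolding e[symmetric] by blast
      then show ?thesis unfolding e
        by (intro box_path_connected convex_Int open_Int col_interval)
    qed
    have yD: "y \<in> ?D" using y self[OF yT] by blast
    obtain w where w: "w \<in> ?C x \<inter> ?C y \<inter> ibox W - Om"
      using colW[of x "d x" y "d y"] yD by blast
    have "g y w \<doteq> fW w" "g x w \<doteq> fW w"
      using w dg(4)[OF yT, of w] dg(4)[OF x, of w] by blast+
    then have "g y w \<doteq> 1 * g x w" by (metis eqpm_sym eqpm_trans mult_1)
    moreover have "sect ?D F (g x)" "sect ?D F (g y)" "w \<in> ?D"
      using w by (auto intro: sect_subset[OF dg(3)[OF x]] sect_subset[OF dg(3)[OF yT]])
    ultimately have "g y y \<doteq> 1 * g x y"
      by (intro sect_unique[OF pc _ _ _ yD])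
    then show ?thesis by (simp add: f_def)
  qed
  have "T - Om \<subseteq> - (P \<union> Om)" using T_disjoint by blast
  then have FT: "path_rep (T - Om) F" by (rule path_rep_subset[OF F])
  have "sect (T - Om) F f"
  proof (rule sect_glue[OF FT])
    fix x assume x: "x \<in> T - Om"
    have "sect (?C x - Om) F f"
      by (rule sect_cong[OF dg(3)]) (use x agree in auto)
    moreover have "(T - Om) \<inter> ?C x = ?C x - Om" using dg(2)[of x] x by blast
    moreover have "open (?C x)" by (intro open_ibox col_interval)
    ultimately show "\<exists>U. open U \<and> x \<in> U \<and> sect ((T - Om) \<inter> U) F f"
      using self[of x] x by (intro exI[of _ "?C x"]) auto
  qed
  then show ?thesis by (rule that)
qed

definition sky :: "real^3 \<Rightarrow> quat" where "sky = (SOME f. sect (T - Om) F f)"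

lemma sky_sect: "sect (T - Om) F sky"
  unfolding sky_def using sky_section by (metis someI)

text \<open>
  The colour of the diagram at a point \<open>b\<close> of the link is the value of the representation on a small
  circle around \<open>b\<close> that starts vertically above \<open>b\<close>, transported by the section over the sky.  Again
  the sign of the section cancels.  The circle lies in the plane spanned by the vertical direction and
  \<open>u\<close>, and \<open>mer\<close> says that the value is the same for all sufficiently small radii.
\<close>

definition small_circle :: "real^3 \<Rightarrow> real^3 \<Rightarrow> real \<Rightarrow> real \<Rightarrow> real^3" where
  "small_circle b u r t = b + (r * cos (2 * pi * t)) *\<^sub>R e3 - (r * sin (2 * pi * t)) *\<^sub>R u"

lemma small_circle_dist: "r \<ge> 0 \<Longrightarrow> norm (small_circle b u r t - b) \<le> r * (1 + norm u)"
proof -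
  assume r: "r \<ge> 0"
  have "norm (small_circle b u r t - b) \<le> norm ((r * cos (2 * pi * t)) *\<^sub>R e3) + norm ((r * sin (2 * pi * t)) *\<^sub>R u)"
    using norm_triangle_ineq4[of "(r * cos (2 * pi * t)) *\<^sub>R e3" "(r * sin (2 * pi * t)) *\<^sub>R u"]
    by (simp add: small_circle_def)
  also have "\<dots> = r * (\<bar>cos (2 * pi * t)\<bar> * norm e3) + r * (\<bar>sin (2 * pi * t)\<bar> * norm u)"
    using r by (simp add: abs_mult)
  also have "\<dots> \<le> r * 1 + r * norm u"
  proof (intro add_mono mult_left_mono)
    have "(norm e3)\<^sup>2 = 1" unfolding power2_norm_eq_inner inner_vec_def sum_3 by simp
    then have "norm e3 = 1" using norm_ge_zero[of e3] by (auto simp: power2_eq_1_iff)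
    then show "\<bar>cos (2 * pi * t)\<bar> * norm e3 \<le> 1" by simp
    show "\<bar>sin (2 * pi * t)\<bar> * norm u \<le> norm u"
      using mult_right_mono[OF abs_sin_le_one norm_ge_zero, of "2 * pi * t" u] by simp
  qed (use r in auto)
  finally show ?thesis by (simp add: distrib_left)
qed

definition mval :: "real^3 \<Rightarrow> real^3 \<Rightarrow> real \<Rightarrow> quat" where
  "mval b u r = sky (b + r *\<^sub>R e3) * F (small_circle b u r) * qcnj (sky (b + r *\<^sub>R e3))"

definition mer :: "real^3 \<Rightarrow> real^3 \<Rightarrow> quat \<Rightarrow> bool" where
  "mer b u x \<longleftrightarrow> (\<forall>\<^sub>F r in at_right 0. mval b u r = x)"

lemma merI: "r0 > 0 \<Longrightarrow> (\<And>r. 0 < r \<Longrightarrow> r < r0 \<Longrightarrow> mval b u r = x) \<Longrightarrow> mer b u x"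
  unfolding mer_def eventually_at_right_field by auto

lemma mer_unique: "mer b u x \<Longrightarrow> mer b u y \<Longrightarrow> x = y"
proof -
  assume "mer b u x" "mer b u y"
  then have "\<forall>\<^sub>F r in at_right (0::real). x = y"
    unfolding mer_def by eventually_elim auto
  then show ?thesis by simp
qed

text \<open>
  Two circles on the same side of the link are homotopic by interpolation of \<open>u\<close>: a point on the line
  of the link would have horizontal part both parallel to \<open>d\<close> and on the positive side of \<open>d\<close>, so it
  could only be vertically above or below \<open>b\<close>.
\<close>

lemma mer_direction:
  assumes b: "b \<notin> Om" and W: "open W" "b \<in> W" "\<And>x. x \<in> W \<Longrightarrow> x \<in> P \<Longrightarrow> \<exists>t. x = b + t *\<^sub>R d"
    and u: "det2 d u > 0" "det2 d u' > 0" and m: "mer b u x"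
  shows "mer b u' x"
proof -
  have "open (W - Om)" "b \<in> W - Om" using W b Om_closed by auto
  then obtain e where e: "e > 0" "cball b e \<subseteq> W - Om"
    using open_contains_cball by metis
  define r0 where "r0 = e / (1 + norm u + norm u')"
  have n: "1 + norm u + norm u' > 0" by (simp add: add_pos_nonneg)
  have r0: "r0 > 0" using e(1) n by (simp add: r0_def)
  obtain r1 where r1: "r1 > 0" "\<And>r. 0 < r \<Longrightarrow> r < r1 \<Longrightarrow> mval b u r = x"
    using m unfolding mer_def eventually_at_right_field by auto
  have path: "path (small_circle b w r)" for w r
    unfolding path_def small_circle_def by (intro continuous_intros)
  show ?thesis
  proof (rule merI)
    show "min r0 r1 > 0" using r0 r1 by simp
    fix r assume r: "0 < r" "r < min r0 r1"
    have "homotopic_paths (- (P \<union> Om)) (small_circle b u r) (small_circle b u' r)"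
    proof (rule homotopic_paths_linear)
      fix t :: real assume "t \<in> {0..1}"
      show "closed_segment (small_circle b u r t) (small_circle b u' r t) \<subseteq> - (P \<union> Om)"
      proof
        fix x assume "x \<in> closed_segment (small_circle b u r t) (small_circle b u' r t)"
        then obtain s where s: "0 \<le> s" "s \<le> 1" "x = (1 - s) *\<^sub>R small_circle b u r t + s *\<^sub>R small_circle b u' r t"
          by (auto simp: closed_segment_def)
        define us where "us = (1 - s) *\<^sub>R u + s *\<^sub>R u'"
        have x: "x = small_circle b us r t"
          unfolding s(3) us_def small_circle_def by (simp add: algebra_simps)
        have "norm us \<le> norm ((1 - s) *\<^sub>R u) + norm (s *\<^sub>R u')" unfolding us_def by (rule norm_triangle_ineq)
        also have "\<dots> \<le> 1 * norm u + 1 * norm u'"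
          using s by (simp only: norm_scaleR) (intro add_mono mult_right_mono, auto)
        finally have nus: "1 + norm us \<le> 1 + norm u + norm u'" by simp
        have "norm (x - b) \<le> r * (1 + norm us)" unfolding x using r by (intro small_circle_dist) simp
        also have "\<dots> \<le> r * (1 + norm u + norm u')" using nus r by (intro mult_left_mono) auto
        also have "\<dots> < r0 * (1 + norm u + norm u')"
          using r n by (intro mult_strict_right_mono) auto
        also have "\<dots> = e" using n by (simp add: r0_def)
        finally have "x \<in> cball b e" by (simp add: dist_norm norm_minus_commute)
        then have xW: "x \<in> W - Om" using e(2) by blast
        moreover have "x \<notin> P"
        proof
          assume "x \<in> P"
          then obtain \<tau> where \<tau>: "x = b + \<tau> *\<^sub>R d" using W(3) xW by blast
          have us: "det2 d us > 0"
          proof -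
            have "det2 d us = (1 - s) * det2 d u + s * det2 d u'"
              by (simp add: det2_def us_def algebra_simps)
            also have "\<dots> > 0"
              using s u by (cases "s = 1") (auto intro: add_pos_nonneg)
            finally show ?thesis .
          qed
          have *: "(r * cos (2 * pi * t)) *\<^sub>R e3 - (r * sin (2 * pi * t)) *\<^sub>R us = \<tau> *\<^sub>R d"
            using \<tau> unfolding x small_circle_def by (simp add: algebra_simps)
          then have 1: "- (r * sin (2 * pi * t)) * us $ 1 = \<tau> * d $ 1"
            and 2: "- (r * sin (2 * pi * t)) * us $ 2 = \<tau> * d $ 2"
            and 3: "r * cos (2 * pi * t) - (r * sin (2 * pi * t)) * us $ 3 = \<tau> * d $ 3"
            by (auto simp: vec3_eq_iff)
          have "r * sin (2 * pi * t) * det2 d us = d $ 2 * (- (r * sin (2 * pi * t)) * us $ 1) - d $ 1 * (- (r * sin (2 * pi * t)) * us $ 2)"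
            by (simp add: det2_def algebra_simps)
          also have "\<dots> = 0" unfolding 1 2 by simp
          finally have s0: "sin (2 * pi * t) = 0" using us r by simp
          then have "\<tau> = 0" using 1 2 u by (auto simp: det2_def)
          then have "cos (2 * pi * t) = 0" using 3 s0 r by simp
          with s0 show False using sin_cos_squared_add[of "2 * pi * t"] by simp
        qed
        ultimately show "x \<in> - (P \<union> Om)" by blast
      qed
    qed (auto simp: path pathstart_def pathfinish_def small_circle_def)
    then have "F (small_circle b u r) = F (small_circle b u' r)"
      by (rule path_rep_homotopic[OF F])
    then have "mval b u' r = mval b u r" by (simp add: mval_def)
    also have "\<dots> = x" using r r1(2) by simp
    finally show "mval b u' r = x" .
  qed
qed

end

lemma conj_eqpm_section:
  assumes "s' \<doteq> k * s" shows "s' * m * qcnj s' = k * (s * m * qcnj s) * qcnj k"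
proof -
  have "s' * m * qcnj s' = (k * s) * m * qcnj (k * s)" by (rule eqpm_conj[OF assms])
  then show ?thesis by (simp add: qcnj_mult mult.assoc)
qed

lemma cyl_bounds:
  assumes "\<rho> > 0" "x \<in> cyl \<rho> \<epsilon>"
  shows "\<bar>x $ 1\<bar> < \<rho>" "\<bar>x $ 2\<bar> < \<rho>" "\<bar>x $ 3\<bar> < \<epsilon>"
proof -
  have "\<bar>x $ 1\<bar>\<^sup>2 < \<rho>\<^sup>2" "\<bar>x $ 2\<bar>\<^sup>2 < \<rho>\<^sup>2"
    using assms(2) zero_le_power2[of "x $ 1"] zero_le_power2[of "x $ 2"]
    unfolding cyl_def mem_Collect_eq power2_abs by linarith+
  then show "\<bar>x $ 1\<bar> < \<rho>" "\<bar>x $ 2\<bar> < \<rho>"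
    using power2_less_imp_less assms(1) less_imp_le by blast+
  show "\<bar>x $ 3\<bar> < \<epsilon>" using assms(2) by (simp add: cyl_def)
qed

section \<open>Jumps along the link\<close>

text \<open>
  A chart that follows the link through a vertex at \<open>a\<close>: the first coordinate is the height above the
  link, the second one runs sideways, and the third one follows the link, with direction \<open>d1\<close> before
  and \<open>d2\<close> after the vertex.
\<close>

definition bent_chart :: "real^3 \<Rightarrow> real^3 \<Rightarrow> real^3 \<Rightarrow> real^3 \<Rightarrow> real^3 \<Rightarrow> real^3" where
  "bent_chart a d1 d2 u v = a + v $ 1 *\<^sub>R e3 - v $ 2 *\<^sub>R u + min (v $ 3) 0 *\<^sub>R d1 + max (v $ 3) 0 *\<^sub>R d2"

lemma continuous_on_bent_chart: "continuous_on S (bent_chart a d1 d2 u)"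
  unfolding bent_chart_def by (intro continuous_intros)

lemma bent_chart_0 [simp]: "bent_chart a d1 d2 u 0 = a"
  by (simp add: bent_chart_def)

lemma inj_bent_chart:
  assumes "det2 d1 u > 0" "det2 d2 u > 0"
  shows "inj (bent_chart a d1 d2 u)"
proof (rule injI)
  fix v w assume e: "bent_chart a d1 d2 u v = bent_chart a d1 d2 u w"
  define D where "D z = min z 0 * det2 d1 u + max z 0 * det2 d2 u" for z
  have e': "bent_chart a d1 d2 u v $ i = bent_chart a d1 d2 u w $ i" for i
    using e by simp
  have det: "det2 (bent_chart a d1 d2 u x - a) u = D (x $ 3)" for x
    by (simp add: det2_def bent_chart_def D_def algebra_simps)
  then have "D (v $ 3) = D (w $ 3)" using e by metis
  moreover have "D s < D t" if "s < t" for s t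
  proof -
    have "min s 0 * det2 d1 u \<le> min t 0 * det2 d1 u" "max s 0 * det2 d2 u \<le> max t 0 * det2 d2 u"
      using that assms by (auto intro!: mult_right_mono)
    moreover have "min s 0 < min t 0 \<or> max s 0 < max t 0" using that by auto
    then have "min s 0 * det2 d1 u < min t 0 * det2 d1 u \<or> max s 0 * det2 d2 u < max t 0 * det2 d2 u"
      using assms by (auto intro: mult_strict_right_mono)
    ultimately show ?thesis unfolding D_def by linarith
  qed
  ultimately have 3: "v $ 3 = w $ 3" by (metis linorder_neqE less_irrefl)
  have "u $ 1 \<noteq> 0 \<or> u $ 2 \<noteq> 0" using assms by (auto simp: det2_def)
  moreover have "v $ 2 * u $ 1 = w $ 2 * u $ 1" "v $ 2 * u $ 2 = w $ 2 * u $ 2"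
    using e'[of 1] e'[of 2] 3 by (simp_all add: bent_chart_def)
  ultimately have 2: "v $ 2 = w $ 2" by auto
  then have "v $ 1 = w $ 1" using e'[of 3] 3 by (simp add: bent_chart_def)
  with 2 3 show "v = w" by (simp add: vec3_eq_iff)
qed

context link_arc
begin

lemma small_circle_chart:
  assumes "r > 0"
  shows "bent_chart a d1 d2 u \<circ> pol \<circ> linepath (vec3 (ln r) 0 z) (vec3 (ln r) 0 z + turn) =
      small_circle (bent_chart a d1 d2 u (vec3 0 0 z)) u r"
  unfolding comp_assoc pol_linepath_turn using assms
  by (simp add: fun_eq_iff small_circle_def bent_chart_def)

lemma top_chart: "r > 0 \<Longrightarrow> bent_chart a d1 d2 u (pol (vec3 (ln r) 0 z)) = bent_chart a d1 d2 u (vec3 0 0 z) + r *\<^sub>R e3"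
  by (simp add: pol_def bent_chart_def)

end

text \<open>The part of the covering of the tube that lies above the link, over an interval of the link.\<close>

definition upper :: "real \<Rightarrow> real \<Rightarrow> real \<Rightarrow> 3 \<Rightarrow> real set" where
  "upper \<delta> z1 z2 i = (if i = 1 then {..<ln \<delta>} else if i = 2 then {-(pi/2)<..<pi/2} else {z1<..<z2})"

lemma upper_interval: "convex (upper \<delta> z1 z2 i)" "open (upper \<delta> z1 z2 i)"
  by (auto simp: upper_def)

lemma mem_upper: "y \<in> ibox (upper \<delta> z1 z2) \<longleftrightarrow>
    y $ 1 < ln \<delta> \<and> - (pi/2) < y $ 2 \<and> y $ 2 < pi/2 \<and> z1 < y $ 3 \<and> y $ 3 < z2"
  by (auto simp: ibox_def upper_def forall_3)

lemma pol_upper: "y \<in> ibox (upper \<delta> z1 z2) \<Longrightarrow> pol y $ 1 > 0"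
  by (simp add: mem_upper pol_def cos_gt_zero_pi)

context tube
begin

lemma mval_tube:
  assumes \<psi>: "\<psi> = bent_chart a d1 d2 u" and r: "r > 0"
    and k: "sky (q (vec3 (ln r) 0 z)) \<doteq> k * f (vec3 (ln r) 0 z)"
  shows "mval (\<psi> (vec3 0 0 z)) u r = k * N (vec3 (ln r) 0 z) * qcnj k"
proof -
  let ?y = "vec3 (ln r) 0 z"
  have "sky (q ?y) * G (linepath ?y (?y + turn)) * qcnj (sky (q ?y)) = k * N ?y * qcnj k"
    unfolding N_def by (rule conj_eqpm_section[OF k])
  moreover have "\<psi> \<circ> pol \<circ> linepath ?y (?y + turn) = small_circle (\<psi> (vec3 0 0 z)) u r"
    unfolding \<psi> by (rule small_circle_chart[OF r])
  then have "G (linepath ?y (?y + turn)) = F (small_circle (\<psi> (vec3 0 0 z)) u r)"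
    by (simp add: G_def q_def)
  moreover have "q ?y = \<psi> (vec3 0 0 z) + r *\<^sub>R e3"
    unfolding q_def comp_apply unfolding \<psi> by (rule top_chart[OF r])
  ultimately show ?thesis by (simp add: mval_def)
qed

text \<open>
  Transport by the sky is transport by the section in the tube followed by conjugation with the factor
  \<open>k\<close> between the two sections.
\<close>

lemma mer_tube:
  assumes \<psi>: "\<psi> = bent_chart a d1 d2 u" and z: "z1 < z" "z < z2" "- \<epsilon> \<le> z1" "z2 \<le> \<epsilon>"
    and k: "\<And>y. y \<in> ibox (upper \<rho> z1 z2) - A \<Longrightarrow> sky (q y) \<doteq> k * f y"
    and val: "\<exists>r0>0. \<forall>r. 0 < r \<and> r < r0 \<longrightarrow>
         path_image (linepath (vec3 (ln r) 0 z) (vec3 (ln r) 0 z + turn)) \<subseteq> B - A \<and> N (vec3 (ln r) 0 z) = x"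
  shows "mer (\<psi> (vec3 0 0 z)) u (k * x * qcnj k)"
proof -
  obtain r0 where r0: "r0 > 0" "\<And>r. 0 < r \<Longrightarrow> r < r0 \<Longrightarrow>
       path_image (linepath (vec3 (ln r) 0 z) (vec3 (ln r) 0 z + turn)) \<subseteq> B - A \<and> N (vec3 (ln r) 0 z) = x"
    using val by metis
  show ?thesis
  proof (rule merI[OF r0(1)])
    fix r assume r: "0 < r" "r < r0"
    let ?y = "vec3 (ln r) 0 z"
    have y: "?y \<in> B - A"
      using r0(2)[OF r] pathstart_in_path_image[of "linepath ?y (?y + turn)"] by (auto simp del: path_image_linepath)
    then have "?y \<in> ibox (upper \<rho> z1 z2) - A"
      using z by (auto simp: mem_upper mem_B)
    from mval_tube[OF \<psi> r(1) k[OF this]] show "mval (\<psi> (vec3 0 0 z)) u r = k * x * qcnj k"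
      using r0(2)[OF r] by simp
  qed
qed

lemma upper_in_B: "- \<epsilon> \<le> z1 \<Longrightarrow> z2 \<le> \<epsilon> \<Longrightarrow> ibox (upper \<rho> z1 z2) \<subseteq> B"
  by (auto simp: mem_upper mem_B)

lemma upper_connected:
  assumes "- \<epsilon> \<le> z1" "z1 < z2" "z2 \<le> \<epsilon>"
  shows "path_connected (ibox (upper \<rho> z1 z2) - A)" "ibox (upper \<rho> z1 z2) - A \<noteq> {}"
proof -
  have sub: "ibox (upper \<rho> z1 z2) \<subseteq> B" using assms by (intro upper_in_B)
  show "path_connected (ibox (upper \<rho> z1 z2) - A)"
    by (intro arc_sys_path_connected[OF arc_sys_G] open_ibox convex_connected convex_ibox upper_interval sub)
  have "vec3 (ln \<rho> - 1) 0 ((z1 + z2) / 2) \<in> ibox (upper \<rho> z1 z2)"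
    using assms by (simp add: mem_upper)
  then show "ibox (upper \<rho> z1 z2) - A \<noteq> {}"
    by (intro arc_sys_diff_nonempty[OF arc_sys_G] open_ibox upper_interval sub) auto
qed

lemma upper_sky:
  assumes z: "- \<epsilon> \<le> z1" "z1 < z2" "z2 \<le> \<epsilon>"
    and T: "\<And>y. y \<in> ibox (upper \<rho> z1 z2) \<Longrightarrow> q y \<in> T"
  shows "\<exists>k. k \<in> BDset \<and> (\<forall>y \<in> ibox (upper \<rho> z1 z2) - A. sky (q y) \<doteq> k * f y)"
proof -
  let ?U = "ibox (upper \<rho> z1 z2)"
  have sub: "?U - A \<subseteq> B - A" using upper_in_B z by blast
  have "q ` (?U - A) \<subseteq> T - Om" using T sub unfolding BA_eq by blast
  moreover have "continuous_on (?U - A) q" using sub by (intro continuous_on_subset[OF cont_q]) blast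
  ultimately have "sect (?U - A) G (\<lambda>y. sky (q y))"
    unfolding G_def[abs_def] by (intro sect_pullback[OF sky_sect])
  then show ?thesis
    by (rule sect_compare[OF upper_connected[OF z] sect_subset[OF f_sect sub]]) (intro exI conjI ballI)
qed

end

context link_arc
begin

text \<open>
  Where nothing lies above the link, a single factor \<open>k\<close> compares the sky with the section in the tube
  on both sides, so the colour changes exactly as the value in the tube does.
\<close>

lemma jump_visible:
  fixes a d1 d2 u \<delta>
  defines "\<psi> \<equiv> bent_chart a d1 d2 u"
  assumes det: "det2 d1 u > 0" "det2 d2 u > 0" and \<delta>: "\<delta> > 0"
    and P: "\<And>v. v \<in> cyl \<delta> \<delta> \<Longrightarrow> \<psi> v \<in> P \<longleftrightarrow> v \<in> z_axis"
    and Om: "\<And>v. v \<in> cyl \<delta> \<delta> \<Longrightarrow> v \<in> z_axis \<Longrightarrow> \<psi> v \<in> Om \<Longrightarrow> v = 0"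
    and vis: "\<And>v. v \<in> cyl \<delta> \<delta> \<Longrightarrow> v $ 1 > 0 \<Longrightarrow> \<psi> v \<in> T"
  obtains x x' where "x \<in> S1_B" "x' \<in> S1_B" "x' = (if a \<in> Om then - x else x)"
    "\<And>z. - \<delta> < z \<Longrightarrow> z < 0 \<Longrightarrow> mer (\<psi> (vec3 0 0 z)) u x"
    "\<And>z. 0 < z \<Longrightarrow> z < \<delta> \<Longrightarrow> mer (\<psi> (vec3 0 0 z)) u x'"
proof -
  interpret tube P Om F \<psi> \<delta> \<delta>
  proof unfold_locales
    show "continuous_on (cyl \<delta> \<delta>) \<psi>" unfolding \<psi>_def by (rule continuous_on_bent_chart)
    show "inj_on \<psi> (cyl \<delta> \<delta>)" unfolding \<psi>_def by (rule inj_on_subset[OF inj_bent_chart[OF det]]) simp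
  qed (use \<delta> P Om in auto)
  have \<psi>_eq: "\<psi> = bent_chart a d1 d2 u" by (simp add: \<psi>_def)
  have "\<exists>k. k \<in> BDset \<and> (\<forall>y \<in> ibox (upper \<delta> (-\<delta>) \<delta>) - A. sky (q y) \<doteq> k * f y)"
  proof (rule upper_sky)
    fix y assume y: "y \<in> ibox (upper \<delta> (-\<delta>) \<delta>)"
    then have "y \<in> B" using upper_in_B by blast
    then show "q y \<in> T" using pol_upper[OF y] pol_B by (simp add: q_def vis)
  qed (use \<delta> in auto)
  then obtain k where k: "k \<in> BDset" "\<And>y. y \<in> ibox (upper \<delta> (-\<delta>) \<delta>) - A \<Longrightarrow> sky (q y) \<doteq> k * f y"
    by metis
  show ?thesis
  proof (rule tube_values)
  fix N1 N2 assume N12: "N1 \<in> S1_B" "N2 \<in> S1_B" "N2 = (if \<psi> 0 \<in> Om then - N1 else N1)"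
    and val: "\<And>z. 0 < \<bar>z\<bar> \<Longrightarrow> \<bar>z\<bar> < \<delta> \<Longrightarrow>
       \<exists>r0>0. \<forall>r. 0 < r \<and> r < r0 \<longrightarrow>
         path_image (linepath (vec3 (ln r) 0 z) (vec3 (ln r) 0 z + turn)) \<subseteq> B - A \<and>
         N (vec3 (ln r) 0 z) = (if z < 0 then N1 else N2)"
  have "mer (\<psi> (vec3 0 0 z)) u (k * (if z < 0 then N1 else N2) * qcnj k)" if z: "0 < \<bar>z\<bar>" "\<bar>z\<bar> < \<delta>" for z
    by (rule mer_tube[OF \<psi>_eq _ _ _ _ k(2) val[OF z]]) (use z in auto)
  note m = this
  show ?thesis
  proof (rule that)
    show "k * N1 * qcnj k \<in> S1_B" "k * N2 * qcnj k \<in> S1_B" using N12 k(1) by (simp_all add: S1_B_conj)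
    show "k * N2 * qcnj k = (if a \<in> Om then - (k * N1 * qcnj k) else k * N1 * qcnj k)"
      using N12(3) by (simp add: \<psi>_def)
    show "mer (\<psi> (vec3 0 0 z)) u (k * N1 * qcnj k)" if "- \<delta> < z" "z < 0" for z
      using m[of z] that by simp
    show "mer (\<psi> (vec3 0 0 z)) u (k * N2 * qcnj k)" if "0 < z" "z < \<delta>" for z
      using m[of z] that by simp
  qed
  qed
qed

lemma small_circle_in_open:
  assumes "open W" "b \<in> W"
  obtains r0 where "r0 > 0" "\<And>r t. 0 < r \<Longrightarrow> r < r0 \<Longrightarrow> small_circle b u r t \<in> W"
proof -
  obtain e where e: "e > 0" "ball b e \<subseteq> W"
    using assms open_contains_ball by metis
  have n: "1 + norm u > 0" by (simp add: add_pos_nonneg)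
  show ?thesis
  proof (rule that)
    show "e / (1 + norm u) > 0" using e n by simp
    fix r t assume r: "0 < r" "r < e / (1 + norm u)"
    have "norm (small_circle b u r t - b) \<le> r * (1 + norm u)" using r by (intro small_circle_dist) simp
    also have "\<dots> < e" using r(2) n by (simp add: pos_less_divide_eq)
    finally have "small_circle b u r t \<in> ball b e" by (simp add: dist_norm norm_minus_commute)
    then show "small_circle b u r t \<in> W" using e(2) by blast
  qed
qed

lemma bent_chart_straight: "bent_chart a d d u v = a + v $ 1 *\<^sub>R e3 - v $ 2 *\<^sub>R u + v $ 3 *\<^sub>R d"
proof -
  have "min (v $ 3) 0 *\<^sub>R d + max (v $ 3) 0 *\<^sub>R d = v $ 3 *\<^sub>R d"
    by (cases "v $ 3 \<le> 0") (simp_all add: min_def max_def)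
  then show ?thesis
    unfolding bent_chart_def by (simp only: add.assoc)
qed

text \<open>The slab between the two strands of a crossing.\<close>

definition slab :: "real \<Rightarrow> real \<Rightarrow> real \<Rightarrow> real \<Rightarrow> 3 \<Rightarrow> real set" where
  "slab h \<delta> z1 z2 i = (if i = 1 then {0<..<h} else if i = 2 then {-\<delta><..<\<delta>} else {z1<..<z2})"

lemma slab_interval: "convex (slab h \<delta> z1 z2 i)" "open (slab h \<delta> z1 z2 i)"
  by (auto simp: slab_def)

lemma mem_slab: "y \<in> ibox (slab h \<delta> z1 z2) \<longleftrightarrow> 0 < y $ 1 \<and> y $ 1 < h \<and> \<bar>y $ 2\<bar> < \<delta> \<and> z1 < y $ 3 \<and> y $ 3 < z2"
  by (auto simp: ibox_def slab_def forall_3 abs_less_iff)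

text \<open>
  On the meridian loop of the upper strand, parametrised by \<open>[0, 1]\<close> from the top, the middle quarter
  \<open>[3/8, 5/8]\<close> runs below the height of the upper strand, and the rest meets the vertical plane through
  the upper strand only at the top.
\<close>

lemma crossing_trig:
  fixes t :: real
  shows "0 < t \<Longrightarrow> t \<le> 3/8 \<Longrightarrow> sin (2 * pi * t) > 0"
    and "5/8 \<le> t \<Longrightarrow> t < 1 \<Longrightarrow> sin (2 * pi * t) < 0"
    and "3/8 \<le> t \<Longrightarrow> t \<le> 5/8 \<Longrightarrow> cos (2 * pi * t) < 0"
proof -
  have e: "sin (2 * pi * t) = - sin (2 * pi * (t - 1/2))" "cos (2 * pi * t) = - cos (2 * pi * (t - 1/2))"
    by (simp_all add: right_diff_distrib sin_diff cos_diff)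
  show "sin (2 * pi * t) > 0" if "0 < t" "t \<le> 3/8"
  proof (rule sin_gt_zero)
    show "0 < 2 * pi * t" using that by simp
    have "pi * (2 * t) < pi * 1" using that by (intro mult_strict_left_mono) auto
    then show "2 * pi * t < pi" by (simp add: ac_simps)
  qed
  show "sin (2 * pi * t) < 0" if "5/8 \<le> t" "t < 1"
  proof -
    have "sin (2 * pi * (t - 1/2)) > 0"
    proof (rule sin_gt_zero)
      show "0 < 2 * pi * (t - 1/2)" using that by simp
      have "pi * (2 * (t - 1/2)) < pi * 1" using that by (intro mult_strict_left_mono) auto
      then show "2 * pi * (t - 1/2) < pi" by (simp add: ac_simps)
    qed
    then show ?thesis using e by simp
  qed
  show "cos (2 * pi * t) < 0" if "3/8 \<le> t" "t \<le> 5/8"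
  proof -
    have "cos (2 * pi * (t - 1/2)) > 0"
    proof (rule cos_gt_zero_pi)
      have "pi * (- 1/2) < pi * (2 * (t - 1/2))" using that by (intro mult_strict_left_mono) auto
      then show "- (pi/2) < 2 * pi * (t - 1/2)" by (simp add: ac_simps)
      have "pi * (2 * (t - 1/2)) < pi * (1/2)" using that by (intro mult_strict_left_mono) auto
      then show "2 * pi * (t - 1/2) < pi/2" by (simp add: ac_simps)
    qed
    then show ?thesis using e by simp
  qed
qed

text \<open>
  An undercrossing, in a chart with one coordinate axis along each of the two strands.  The meridian
  loop of the upper strand passes through the slab between the strands; this compares the sky on the
  two sides of the upper strand.
\<close>

context
  fixes a d u :: "real^3" and h \<delta> :: real and \<psi>
  assumes \<psi>_def: "\<psi> = bent_chart a d d u"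
    and det: "det2 d u > 0" and \<delta>: "\<delta> > 0" "\<delta> < h"
    and P: "\<And>v. - \<delta> < v $ 1 \<Longrightarrow> \<bar>v $ 2\<bar> < \<delta> \<Longrightarrow> \<bar>v $ 3\<bar> < \<delta> \<Longrightarrow>
       \<psi> v \<in> P \<longleftrightarrow> v $ 1 = 0 \<and> v $ 2 = 0 \<or> v $ 1 = h \<and> v $ 3 = 0"
begin

lemma crossing_T:
  assumes v: "\<bar>v $ 2\<bar> < \<delta>" "\<bar>v $ 3\<bar> < \<delta>" "0 < v $ 1" "h < v $ 1 \<or> v $ 3 \<noteq> 0"
  shows "\<psi> v \<in> T"
proof -
  have False if p: "p \<in> P" "p $ 1 = \<psi> v $ 1" "p $ 2 = \<psi> v $ 2" "\<psi> v $ 3 \<le> p $ 3" for p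
  proof -
    let ?v = "vec3 (v $ 1 + (p $ 3 - \<psi> v $ 3)) (v $ 2) (v $ 3)"
    have "\<psi> ?v = \<psi> v + (p $ 3 - \<psi> v $ 3) *\<^sub>R e3"
      unfolding \<psi>_def bent_chart_straight by (simp add: algebra_simps)
    then have "\<psi> ?v = p"
      using p(2,3) by (simp add: vec3_eq_iff)
    then have "\<psi> ?v \<in> P" using p(1) by simp
    then have "?v $ 1 = 0 \<and> ?v $ 2 = 0 \<or> ?v $ 1 = h \<and> ?v $ 3 = 0"
      using v p(4) \<delta> by (subst (asm) P) auto
    then show False using v p(4) by auto
  qed
  then show ?thesis unfolding T_def by (force simp: not_less)
qed

lemma crossing_cont: "continuous_on X \<psi>"
  unfolding \<psi>_def by (rule continuous_on_bent_chart)

lemma crossing_arc_sys: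
  assumes "- \<delta> \<le> z1" "z2 \<le> \<delta>"
  shows "arc_sys (ibox (slab h \<delta> z1 z2)) {x \<in> ibox (slab h \<delta> z1 z2). \<psi> x \<in> Om - P} (\<lambda>p. F (\<psi> \<circ> p))"
proof (rule arc_sys_pullback[OF arc_sys open_ibox crossing_cont])
  show "open (slab h \<delta> z1 z2 i)" for i by (rule slab_interval)
  show "\<psi> ` ibox (slab h \<delta> z1 z2) \<subseteq> - P"
  proof
    fix x assume "x \<in> \<psi> ` ibox (slab h \<delta> z1 z2)"
    then obtain v where v: "x = \<psi> v" "v \<in> ibox (slab h \<delta> z1 z2)" by blast
    then show "x \<in> - P"
      using P[of v] assms \<delta> by (auto simp: mem_slab abs_less_iff)
  qed
  fix y assume "y \<in> ibox (slab h \<delta> z1 z2)"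
  then show "\<exists>N. open N \<and> y \<in> N \<and> N \<subseteq> ibox (slab h \<delta> z1 z2) \<and> inj_on \<psi> N"
    using inj_on_subset[OF inj_bent_chart[OF det det], of _ a] slab_interval
    by (intro exI[of _ "ibox (slab h \<delta> z1 z2)"]) (auto simp: \<psi>_def intro: open_ibox)
qed

lemma crossing_slab_eq:
  assumes "- \<delta> \<le> z1" "z2 \<le> \<delta>"
  shows "ibox (slab h \<delta> z1 z2) - {x \<in> ibox (slab h \<delta> z1 z2). \<psi> x \<in> Om - P} = {x \<in> ibox (slab h \<delta> z1 z2). \<psi> x \<notin> Om}"
proof -
  have "\<psi> x \<notin> P" if "x \<in> ibox (slab h \<delta> z1 z2)" for x
    using that P[of x] assms \<delta> by (auto simp: mem_slab abs_less_iff)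
  then show ?thesis by blast
qed

text \<open>
  On each side of the upper strand the slab is open to the sky.
\<close>

lemma crossing_side:
  assumes z: "- \<delta> \<le> z1" "z1 < z2" "z2 \<le> \<delta>" and n0: "0 \<notin> {z1<..<z2}"
    and g: "sect {x \<in> ibox (slab h \<delta> (-\<delta>) \<delta>). \<psi> x \<notin> Om} (\<lambda>p. F (\<psi> \<circ> p)) g"
  shows "\<exists>k. k \<in> BDset \<and> (\<forall>x \<in> {x \<in> ibox (slab h \<delta> z1 z2). \<psi> x \<notin> Om}. sky (\<psi> x) \<doteq> k * g x)"
proof -
  let ?S = "ibox (slab h \<delta> z1 z2)"
  let ?D = "{x \<in> ?S. \<psi> x \<notin> Om}"
  note sys = crossing_arc_sys[OF z(1,3)] and eq = crossing_slab_eq[OF z(1,3)]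
  have o: "open ?S" "connected ?S"
    by (intro open_ibox slab_interval) (intro convex_connected convex_ibox slab_interval)
  have "vec3 (h / 2) 0 ((z1 + z2) / 2) \<in> ?S"
    using \<delta> z by (simp add: mem_slab)
  then have ne: "?D \<noteq> {}"
    using arc_sys_diff_nonempty[OF sys o(1) subset_refl] eq by blast
  have pc: "path_connected ?D"
    using arc_sys_path_connected[OF sys o(1) subset_refl o(2)] eq by simp
  have sub: "?D \<subseteq> {x \<in> ibox (slab h \<delta> (-\<delta>) \<delta>). \<psi> x \<notin> Om}"
    using z by (auto simp: mem_slab)
  have "\<psi> x \<in> T" if "x \<in> ?S" for x
    using that z n0 by (intro crossing_T) (auto simp: mem_slab abs_less_iff)
  then have im: "\<psi> ` ?D \<subseteq> T - Om" by blast
  have sk: "sect ?D (\<lambda>p. F (\<psi> \<circ> p)) (\<lambda>x. sky (\<psi> x))"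
    by (rule sect_pullback[OF sky_sect crossing_cont im])
  show ?thesis
    by (rule sect_compare[OF pc ne sect_subset[OF g sub] sk]) (intro exI conjI ballI)
qed

text \<open>
  The meridian loop of the upper strand starts in the sky, comes down on one side of the strand, passes
  through the slab, and goes up on the other side.  So the colour \<open>w\<close> of the strand is what the factor
  between the sky and a section over the whole slab changes by, from one side to the other.
\<close>

lemma crossing_sky:
  assumes c: "\<bar>c\<bar> < \<delta>" "\<psi> (vec3 h c 0) \<notin> Om" and \<tau>: "\<tau> = 1 \<or> \<tau> = - 1"
    and m: "mer (\<psi> (vec3 h c 0)) (\<tau> *\<^sub>R d) w" "w \<in> S1_B"
  shows "\<exists>g k1 k2. sect {x \<in> ibox (slab h \<delta> (-\<delta>) \<delta>). \<psi> x \<notin> Om} (\<lambda>p. F (\<psi> \<circ> p)) g \<and>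
    k1 \<in> BDset \<and> k2 \<in> BDset \<and> k2 \<doteq> w * k1 \<and>
    (\<forall>x \<in> {x \<in> ibox (slab h \<delta> (-\<delta>) 0). \<psi> x \<notin> Om}. sky (\<psi> x) \<doteq> k1 * g x) \<and>
    (\<forall>x \<in> {x \<in> ibox (slab h \<delta> 0 \<delta>). \<psi> x \<notin> Om}. sky (\<psi> x) \<doteq> k2 * g x)"
proof -
  let ?D = "{x \<in> ibox (slab h \<delta> (-\<delta>) \<delta>). \<psi> x \<notin> Om}"
  have "- \<delta> \<le> - \<delta>" "\<delta> \<le> \<delta>" by auto
  note sys = crossing_arc_sys[OF this] and eq = crossing_slab_eq[OF this]
  have "\<exists>g. sect ?D (\<lambda>p. F (\<psi> \<circ> p)) g"
    by (rule sect_ibox[OF sys slab_interval subset_refl, unfolded eq]) (rule exI)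
  then obtain g where g: "sect ?D (\<lambda>p. F (\<psi> \<circ> p)) g" ..
  obtain k1 where k1: "k1 \<in> BDset" "\<And>x. x \<in> ibox (slab h \<delta> (-\<delta>) 0) \<Longrightarrow> \<psi> x \<notin> Om \<Longrightarrow> sky (\<psi> x) \<doteq> k1 * g x"
  proof -
    have "\<exists>k. k \<in> BDset \<and> (\<forall>x \<in> {x \<in> ibox (slab h \<delta> (-\<delta>) 0). \<psi> x \<notin> Om}. sky (\<psi> x) \<doteq> k * g x)"
      by (rule crossing_side[OF _ _ _ _ g]) (use \<delta>(1) in auto)
    then show thesis using that by blast
  qed
  obtain k2 where k2: "k2 \<in> BDset" "\<And>x. x \<in> ibox (slab h \<delta> 0 \<delta>) \<Longrightarrow> \<psi> x \<notin> Om \<Longrightarrow> sky (\<psi> x) \<doteq> k2 * g x"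
  proof -
    have "\<exists>k. k \<in> BDset \<and> (\<forall>x \<in> {x \<in> ibox (slab h \<delta> 0 \<delta>). \<psi> x \<notin> Om}. sky (\<psi> x) \<doteq> k * g x)"
      by (rule crossing_side[OF _ _ _ _ g]) (use \<delta>(1) in auto)
    then show thesis using that by blast
  qed
  let ?b = "\<psi> (vec3 h c 0)"
  have "open (- Om)" "?b \<in> - Om" using Om_closed c(2) by auto
  then obtain r0 where r0: "r0 > 0" "\<And>r t. 0 < r \<Longrightarrow> r < r0 \<Longrightarrow> small_circle ?b (\<tau> *\<^sub>R d) r t \<in> - Om"
    by (rule small_circle_in_open[where u = "\<tau> *\<^sub>R d"]) blast
  obtain r1 where r1: "r1 > 0" "\<And>r. 0 < r \<Longrightarrow> r < r1 \<Longrightarrow> mval ?b (\<tau> *\<^sub>R d) r = w"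
    using m(1) unfolding mer_def eventually_at_right_field by auto
  define r where "r = min (min r0 r1) \<delta> / 2"
  have r: "0 < r" "r < r0" "r < r1" "r < \<delta>" using r0(1) r1(1) \<delta> by (auto simp: r_def)
  define pt where "pt t = vec3 (h + r * cos (2 * pi * t)) c (- (\<tau> * r * sin (2 * pi * t)))" for t
  have circ: "small_circle ?b (\<tau> *\<^sub>R d) r = \<psi> \<circ> pt"
    unfolding \<psi>_def by (simp add: fun_eq_iff small_circle_def bent_chart_straight pt_def algebra_simps)
  have off: "\<psi> (pt t) \<notin> Om" for t
    using r0(2)[OF r(1,2), of t] unfolding circ by simp
  have pt_path: "path pt"
    unfolding path_def pt_def by (intro continuous_intros)
  have pt1: "0 < pt t $ 1" for t
  proof -
    have "- 1 * r \<le> cos (2 * pi * t) * r" using r by (intro mult_right_mono) auto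
    then show ?thesis using r \<delta> by (simp add: pt_def mult.commute)
  qed
  have pt23: "\<bar>pt t $ 2\<bar> < \<delta>" "\<bar>pt t $ 3\<bar> < \<delta>" for t
  proof -
    show "\<bar>pt t $ 2\<bar> < \<delta>" using c by (simp add: pt_def)
    have "\<bar>pt t $ 3\<bar> = r * \<bar>sin (2 * pi * t)\<bar>" using \<tau> r by (auto simp: pt_def abs_mult)
    also have "\<dots> \<le> r * 1" using r by (intro mult_left_mono) auto
    finally show "\<bar>pt t $ 3\<bar> < \<delta>" using r by simp
  qed
  have inT: "\<psi> (pt t) \<in> T" if tt: "0 \<le> t \<and> t \<le> 3/8 \<or> 5/8 \<le> t \<and> t \<le> 1" for t
  proof (rule crossing_T[OF pt23 pt1])
    consider "t = 0 \<or> t = 1" | "sin (2 * pi * t) \<noteq> 0"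
      using tt crossing_trig(1)[of t] crossing_trig(2)[of t] by linarith
    then show "h < pt t $ 1 \<or> pt t $ 3 \<noteq> 0"
      using r(1) \<tau> by cases (auto simp: pt_def)
  qed
  have inD: "pt t \<in> ?D" if "3/8 \<le> t" "t \<le> 5/8" for t
    using pt1[of t] pt23[of t] off[of t] crossing_trig(3)[OF that] r(1)
    by (auto simp: mem_slab abs_less_iff pt_def mult_less_0_iff)
  have av: "path_image (\<psi> \<circ> pt) \<subseteq> - (P \<union> Om)"
  proof -
    have "\<psi> (pt t) \<notin> P" if "t \<in> {0..1}" for t
      using inT[of t] inD[of t] T_disjoint that P[of "pt t"] \<delta> pt1[of t] pt23[of t] by (force simp: mem_slab)
    then show ?thesis using off by (auto simp: path_image_def)
  qed
  have path: "path (\<psi> \<circ> pt)" by (intro path_continuous_image pt_path crossing_cont)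
  let ?s = "\<lambda>a b. subpath a b (\<psi> \<circ> pt)"
  have "F (?s 0 (3/8)) * F (?s (3/8) (5/8)) = F (?s 0 (5/8))"
    by (rule path_rep_subpath[OF F path av]) auto
  moreover have "F (?s 0 (5/8)) * F (?s (5/8) 1) = F (?s 0 1)"
    by (rule path_rep_subpath[OF F path av]) auto
  ultimately have loop: "F (\<psi> \<circ> pt) = F (?s 0 (3/8)) * F (?s (3/8) (5/8)) * F (?s (5/8) 1)"
    by simp
  have skyp: "sky (\<psi> (pt t)) \<doteq> sky (\<psi> (pt s)) * F (?s s t)"
    if st: "0 \<le> s" "s \<le> t" "t \<le> 1" "t \<le> 3/8 \<or> 5/8 \<le> s" for s t
  proof -
    have "path_image (?s s t) = (\<psi> \<circ> pt) ` {s..t}" using st by (simp add: path_image_subpath)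
    also have "\<dots> \<subseteq> T - Om" using inT off st by auto
    finally have "path_image (?s s t) \<subseteq> T - Om" .
    moreover have "path (?s s t)" using st by (intro path_subpath path) auto
    ultimately show ?thesis using sectD[OF sky_sect, of "?s s t"] by simp
  qed
  have gp: "g (pt (5/8)) \<doteq> g (pt (3/8)) * F (?s (3/8) (5/8))"
  proof -
    let ?p = "subpath (3/8) (5/8) pt"
    have "path_image ?p = pt ` {3/8..5/8}" by (simp add: path_image_subpath)
    also have "\<dots> \<subseteq> ?D" using inD by auto
    finally have "path_image ?p \<subseteq> ?D" .
    moreover have "path ?p" by (intro path_subpath pt_path) auto
    moreover have "\<psi> \<circ> ?p = ?s (3/8) (5/8)" by (simp add: subpath_def fun_eq_iff)
    ultimately show ?thesis using sectD[OF g, of ?p] by simp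
  qed
  let ?s1 = "sky (\<psi> (pt (3/8)))" and ?s2 = "sky (\<psi> (pt (5/8)))" and ?top = "sky (\<psi> (pt 0))"
  let ?F1 = "F (?s 0 (3/8))" and ?F2 = "F (?s (3/8) (5/8))" and ?F3 = "F (?s (5/8) 1)"
  have pt_top: "pt 1 = pt 0" by (simp add: pt_def)
  have s1: "?s1 \<doteq> ?top * ?F1" by (rule skyp) auto
  have s3: "?top \<doteq> ?s2 * ?F3" using skyp[of "5/8" 1] pt_top by simp
  have topB: "?top \<in> BDset" using inT[of 0] off[of 0] by (intro sect_BD[OF sky_sect]) auto
  have side: "pt (3/8) $ 3 * \<tau> < 0" "0 < pt (5/8) $ 3 * \<tau>"
    using \<tau> r(1) crossing_trig(1)[of "3/8"] crossing_trig(2)[of "5/8"] by (auto simp: pt_def mult_less_0_iff zero_less_mult_iff)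
  have D38: "pt (3/8) \<in> ?D" "pt (5/8) \<in> ?D" using inD[of "3/8"] inD[of "5/8"] by auto
  \<comment> \<open>the factor picked up by the loop, up to sign and inversion\<close>
  have key: "w \<doteq> j1 * qcnj j2" if j: "j1 \<in> BDset" "j2 \<in> BDset" "?s1 \<doteq> j1 * g (pt (3/8))" "?s2 \<doteq> j2 * g (pt (5/8))" for j1 j2
  proof -
    have "qcnj j1 * ?s1 \<doteq> qcnj j1 * (j1 * g (pt (3/8)))" by (rule eqpm_mult[OF eqpm_refl j(3)])
    then have g1: "g (pt (3/8)) \<doteq> qcnj j1 * ?s1" using j(1) eqpm_sym by simp
    have "?s2 \<doteq> j2 * (g (pt (3/8)) * ?F2)"
      using j(4) eqpm_mult[OF eqpm_refl gp] by (rule eqpm_trans)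
    also have "\<dots> \<doteq> j2 * ((qcnj j1 * ?s1) * ?F2)"
      by (intro eqpm_mult eqpm_refl g1)
    also have "\<dots> \<doteq> j2 * ((qcnj j1 * (?top * ?F1)) * ?F2)"
      by (intro eqpm_mult eqpm_refl s1)
    finally have s2: "?s2 \<doteq> j2 * ((qcnj j1 * (?top * ?F1)) * ?F2)" .
    have "?top \<doteq> j2 * ((qcnj j1 * (?top * ?F1)) * ?F2) * ?F3"
      using s3 eqpm_mult[OF s2 eqpm_refl] by (rule eqpm_trans)
    also have "\<dots> = j2 * (qcnj j1 * (?top * F (\<psi> \<circ> pt)))"
      unfolding loop by (simp add: mult.assoc)
    finally have "(j1 * qcnj j2) * ?top \<doteq> (j1 * qcnj j2) * (j2 * (qcnj j1 * (?top * F (\<psi> \<circ> pt))))"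
      by (rule eqpm_mult[OF eqpm_refl])
    then have "(j1 * qcnj j2) * ?top \<doteq> ?top * F (\<psi> \<circ> pt)"
      using j(1,2) by (simp add: mult.assoc)
    then have "(j1 * qcnj j2) * ?top * qcnj ?top \<doteq> ?top * F (\<psi> \<circ> pt) * qcnj ?top"
      by (rule eqpm_mult[OF _ eqpm_refl])
    then have "j1 * qcnj j2 \<doteq> ?top * F (\<psi> \<circ> pt) * qcnj ?top"
      using topB by (simp add: mult.assoc)
    moreover have "\<psi> (pt 0) = ?b + r *\<^sub>R e3"
      using fun_cong[OF circ, of 0] by (simp add: small_circle_def)
    then have "mval ?b (\<tau> *\<^sub>R d) r = ?top * F (\<psi> \<circ> pt) * qcnj ?top"
      by (simp add: mval_def circ)
    ultimately show ?thesis using r1(2)[OF r(1,3)] eqpm_sym by simp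
  qed
  have "k2 \<doteq> w * k1"
  proof (cases "\<tau> = 1")
    case True
    then have "pt (3/8) \<in> ibox (slab h \<delta> (-\<delta>) 0)" "pt (5/8) \<in> ibox (slab h \<delta> 0 \<delta>)"
      using side D38 by (auto simp: mem_slab)
    then have "w \<doteq> k1 * qcnj k2"
      using k1 k2 off by (intro key) auto
    then have "qcnj w \<doteq> qcnj (k1 * qcnj k2)" by (rule eqpm_qcnj)
    then have "w \<doteq> k2 * qcnj k1" using qcnj_S1_B[OF m(2)] by (simp add: qcnj_mult)
    then have "w * k1 \<doteq> k2 * qcnj k1 * k1" by (rule eqpm_mult[OF _ eqpm_refl])
    then show ?thesis using k1(1) eqpm_sym by (simp add: mult.assoc)
  next
    case False
    then have "pt (3/8) \<in> ibox (slab h \<delta> 0 \<delta>)" "pt (5/8) \<in> ibox (slab h \<delta> (-\<delta>) 0)"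
      using side D38 \<tau> by (auto simp: mem_slab)
    then have "w \<doteq> k2 * qcnj k1"
      using k1 k2 off by (intro key) auto
    then have "w * k1 \<doteq> k2 * qcnj k1 * k1" by (rule eqpm_mult[OF _ eqpm_refl])
    then show ?thesis using k1(1) eqpm_sym by (simp add: mult.assoc)
  qed
  then show ?thesis
    using g k1 k2 by (intro exI[of _ g] exI[of _ k1] exI[of _ k2]) blast
qed

text \<open>
  At an undercrossing the factor that compares the sky with the section in the tube changes by the
  colour \<open>w\<close> of the upper strand, so the colour is conjugated by \<open>w\<close>; if the arc ends there, the sign of
  the value in the tube changes as well.
\<close>

lemma jump_under:
  assumes Om: "\<And>v. v \<in> cyl \<delta> \<delta> \<Longrightarrow> v \<in> z_axis \<Longrightarrow> \<psi> v \<in> Om \<Longrightarrow> v = 0"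
    and c: "\<bar>c\<bar> < \<delta>" "\<psi> (vec3 h c 0) \<notin> Om" and \<tau>: "\<tau> = 1 \<or> \<tau> = - 1"
    and m: "mer (\<psi> (vec3 h c 0)) (\<tau> *\<^sub>R d) w" "w \<in> S1_B"
  shows "\<exists>x. x \<in> S1_B \<and> (\<forall>z. - \<delta> < z \<and> z < 0 \<longrightarrow> mer (\<psi> (vec3 0 0 z)) u x) \<and>
    (\<forall>z. 0 < z \<and> z < \<delta> \<longrightarrow> mer (\<psi> (vec3 0 0 z)) u (if a \<in> Om then - (w * x * qcnj w) else w * x * qcnj w))"
proof -
  interpret tube P Om F \<psi> \<delta> \<delta>
  proof unfold_locales
    show "continuous_on (cyl \<delta> \<delta>) \<psi>" by (rule crossing_cont)
    show "inj_on \<psi> (cyl \<delta> \<delta>)" unfolding \<psi>_def by (rule inj_on_subset[OF inj_bent_chart[OF det det]]) simp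
    fix x assume x: "x \<in> cyl \<delta> \<delta>"
    have "\<bar>x $ 1\<bar> < \<delta>" "\<bar>x $ 2\<bar> < \<delta>"
      using cyl_bounds[OF \<delta>(1) x] by auto
    then show "\<psi> x \<in> P \<longleftrightarrow> x \<in> z_axis"
      using x P[of x] \<delta> by (auto simp: cyl_def z_axis_def abs_less_iff)
  qed (use \<delta> Om in auto)
  let ?D = "{x \<in> ibox (slab h \<delta> (-\<delta>) \<delta>). \<psi> x \<notin> Om}"
  obtain g k1 k2 where g: "sect ?D (\<lambda>p. F (\<psi> \<circ> p)) g" and k: "k1 \<in> BDset" "k2 \<in> BDset" "k2 \<doteq> w * k1"
    and k1: "\<forall>x \<in> {x \<in> ibox (slab h \<delta> (-\<delta>) 0). \<psi> x \<notin> Om}. sky (\<psi> x) \<doteq> k1 * g x"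
    and k2: "\<forall>x \<in> {x \<in> ibox (slab h \<delta> 0 \<delta>). \<psi> x \<notin> Om}. sky (\<psi> x) \<doteq> k2 * g x"
    using crossing_sky[OF c \<tau> m] by (elim exE conjE)
  have up_slab: "pol y \<in> ibox (slab h \<delta> z1 z2) \<and> \<psi> (pol y) \<notin> Om"
    if y: "y \<in> ibox (upper \<delta> z1 z2) - A" "- \<delta> \<le> z1" "z2 \<le> \<delta>" for y z1 z2
  proof -
    have yB: "y \<in> B - A" using y upper_in_B by blast
    then have "pol y \<in> cyl \<delta> \<delta>" using pol_B by blast
    then have "\<bar>pol y $ 1\<bar> < \<delta>" "\<bar>pol y $ 2\<bar> < \<delta>"
      using cyl_bounds[OF \<delta>(1)] by blast+
    moreover have "pol y $ 1 > 0" using y(1) by (intro pol_upper) blast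
    moreover have "z1 < pol y $ 3" "pol y $ 3 < z2" using y(1) by (auto simp: mem_upper pol_def)
    moreover have "\<psi> (pol y) \<notin> Om" using yB by (auto simp: BA_eq q_def)
    ultimately show ?thesis using \<delta> by (simp add: mem_slab)
  qed
  let ?U = "ibox (upper \<delta> (-\<delta>) \<delta>)"
  have U: "path_connected (?U - A)" "?U - A \<noteq> {}" using upper_connected[of "-\<delta>" \<delta>] \<delta> by auto
  have subU: "?U - A \<subseteq> B - A" using upper_in_B by blast
  have "sect (?U - A) (\<lambda>p. F (\<psi> \<circ> (pol \<circ> p))) (\<lambda>y. g (pol y))"
    by (rule sect_pullback[OF g]) (use up_slab in \<open>auto intro!: continuous_intros\<close>)
  then have gs: "sect (?U - A) G (\<lambda>y. g (pol y))"
    by (simp add: G_def[abs_def] q_def comp_assoc)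
  obtain k0 where k0: "k0 \<in> BDset" "\<And>y. y \<in> ?U - A \<Longrightarrow> g (pol y) \<doteq> k0 * f y"
    by (rule sect_compare[OF U sect_subset[OF f_sect subU] gs]) blast
  have s1: "sky (q y) \<doteq> (k1 * k0) * f y" if y: "y \<in> ibox (upper \<delta> (-\<delta>) 0) - A" for y
  proof -
    have "sky (\<psi> (pol y)) \<doteq> k1 * g (pol y)"
      using up_slab[OF y] k1 \<delta> by auto
    also have "\<dots> \<doteq> k1 * (k0 * f y)"
      using y \<delta> by (intro eqpm_mult eqpm_refl k0) (auto simp: mem_upper)
    finally show ?thesis by (simp add: q_def mult.assoc)
  qed
  have s2: "sky (q y) \<doteq> (k2 * k0) * f y" if y: "y \<in> ibox (upper \<delta> 0 \<delta>) - A" for y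
  proof -
    have "sky (\<psi> (pol y)) \<doteq> k2 * g (pol y)"
      using up_slab[OF y] k2 \<delta> by auto
    also have "\<dots> \<doteq> k2 * (k0 * f y)"
      using y \<delta> by (intro eqpm_mult eqpm_refl k0) (auto simp: mem_upper)
    finally show ?thesis by (simp add: q_def mult.assoc)
  qed
  let ?j = "k1 * k0"
  have j: "?j \<in> BDset" by (intro BD_mult_closed k k0)
  have k2j: "k2 * k0 \<doteq> w * ?j"
    using eqpm_mult[OF k(3) eqpm_refl] by (simp add: mult.assoc)
  show ?thesis
  proof (rule tube_values)
    fix N1 N2 assume N12: "N1 \<in> S1_B" "N2 \<in> S1_B" "N2 = (if \<psi> 0 \<in> Om then - N1 else N1)"
      and val: "\<And>z. 0 < \<bar>z\<bar> \<Longrightarrow> \<bar>z\<bar> < \<delta> \<Longrightarrow>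
       \<exists>r0>0. \<forall>r. 0 < r \<and> r < r0 \<longrightarrow>
         path_image (linepath (vec3 (ln r) 0 z) (vec3 (ln r) 0 z + turn)) \<subseteq> B - A \<and>
         N (vec3 (ln r) 0 z) = (if z < 0 then N1 else N2)"
    let ?x = "?j * N1 * qcnj ?j"
    have "mer (\<psi> (vec3 0 0 z)) u ?x" if z: "- \<delta> < z" "z < 0" for z
      by (rule mer_tube[OF \<psi>_def z _ _ s1]) (use val[of z] z \<delta> in auto)
    moreover have "mer (\<psi> (vec3 0 0 z)) u (if a \<in> Om then - (w * ?x * qcnj w) else w * ?x * qcnj w)"
      if z: "0 < z" "z < \<delta>" for z
    proof -
      have "mer (\<psi> (vec3 0 0 z)) u ((k2 * k0) * N2 * qcnj (k2 * k0))"
        by (rule mer_tube[OF \<psi>_def z _ _ s2]) (use val[of z] z \<delta> in auto)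
      moreover have "(k2 * k0) * N2 * qcnj (k2 * k0) = (w * ?j) * N2 * qcnj (w * ?j)"
        by (rule eqpm_conj[OF k2j])
      moreover have "\<psi> 0 = a" by (simp add: \<psi>_def)
      ultimately show ?thesis using N12(3) by (simp add: qcnj_mult mult.assoc split: if_splits)
    qed
    moreover have "?x \<in> S1_B" by (rule S1_B_conj[OF N12(1) j])
    ultimately show ?thesis by blast
  qed
qed

end

end

section \<open>Polygonal links\<close>

locale poly_link =
  fixes Ps :: polygonal_link
  assumes emb: "embedded_polygonal_link Ps" and reg: "regular_position Ps"
begin

definition len :: "nat \<Rightarrow> int" where "len k = int (length (Ps ! k))"

definition vert :: "nat \<Rightarrow> int \<Rightarrow> real^3" where "vert k i = Ps ! k ! nat (i mod len k)"

text \<open>The closed polygon, parametrised periodically by the whole line.\<close>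

definition pt :: "nat \<Rightarrow> real \<Rightarrow> real^3" where
  "pt k t = (1 - frac t) *\<^sub>R vert k \<lfloor>t\<rfloor> + frac t *\<^sub>R vert k (\<lfloor>t\<rfloor> + 1)"

definition edge :: "nat \<Rightarrow> int \<Rightarrow> real^3" where "edge k i = vert k (i + 1) - vert k i"

text \<open>
  Two parameters of the same point, since the polygons are embedded.
\<close>

definition same_param :: "nat \<Rightarrow> real \<Rightarrow> nat \<Rightarrow> real \<Rightarrow> bool" where
  "same_param k s l t \<longleftrightarrow> k = l \<and> (\<exists>m::int. s = t + of_int (m * len k))"

definition red :: "nat \<Rightarrow> real \<Rightarrow> real" where "red k t = t - of_int (\<lfloor>t / of_int (len k)\<rfloor> * len k)"

lemma len_ge: "k < length Ps \<Longrightarrow> len k \<ge> 3"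
  using emb by (auto simp: embedded_polygonal_link_def len_def)

lemma vert_period: "vert k (i + m * len k) = vert k i"
  by (simp add: vert_def)

lemma floor_shift: "\<lfloor>t + of_int m\<rfloor> = \<lfloor>t\<rfloor> + m" and frac_shift: "frac (t + of_int m) = frac t"
  by (simp_all add: frac_def)

lemma pt_period: "pt k (t + of_int (m * len k)) = pt k t"
proof -
  have "\<lfloor>t\<rfloor> + m * len k + 1 = (\<lfloor>t\<rfloor> + 1) + m * len k" by simp
  then show ?thesis
    unfolding pt_def floor_shift frac_shift by (simp only: vert_period)
qed

lemma same_paramD: "same_param k s l t \<Longrightarrow> k = l \<and> pt k s = pt l t"
  unfolding same_param_def using pt_period by auto

lemma same_param_sym: "same_param k s l t \<Longrightarrow> same_param l t k s"
proof -
  assume "same_param k s l t"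
  then obtain m :: int where m: "k = l" "s = t + of_int (m * len k)" by (auto simp: same_param_def)
  then have "t = s + of_int (- m * len l)" by simp
  then show ?thesis using m(1) unfolding same_param_def by blast
qed

lemma same_param_trans: "same_param k s l t \<Longrightarrow> same_param l t m u \<Longrightarrow> same_param k s m u"
proof -
  assume "same_param k s l t" "same_param l t m u"
  then obtain i j :: int where "k = l" "l = m" "s = t + of_int (i * len k)" "t = u + of_int (j * len l)"
    by (auto simp: same_param_def)
  then have "s = u + of_int ((i + j) * len k)" by (simp add: distrib_right)
  then show ?thesis using \<open>k = l\<close> \<open>l = m\<close> unfolding same_param_def by blast
qed

lemma red_bounds: "k < length Ps \<Longrightarrow> 0 \<le> red k t \<and> red k t < of_int (len k)"
proof -
  assume "k < length Ps"
  then have n: "real_of_int (len k) > 0" using len_ge[of k] by simp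
  have "of_int \<lfloor>t / of_int (len k)\<rfloor> \<le> t / of_int (len k)" "t / of_int (len k) < of_int \<lfloor>t / of_int (len k)\<rfloor> + 1"
    by linarith+
  then have "of_int \<lfloor>t / of_int (len k)\<rfloor> * of_int (len k) \<le> t" "t < (of_int \<lfloor>t / of_int (len k)\<rfloor> + 1) * of_int (len k)"
    using n by (simp_all only: pos_le_divide_eq pos_divide_less_eq)
  then show ?thesis
    by (simp add: red_def distrib_right)
qed

lemma red_same: "same_param k (red k t) k t"
  unfolding same_param_def red_def by (auto intro!: exI[of _ "- _"])

lemma same_param_range:
  assumes "k < length Ps" "same_param k s k t" "\<bar>s - t\<bar> < of_int (len k)"
  shows "s = t"
proof -
  obtain m :: int where m: "s = t + of_int (m * len k)"
    using assms(2) by (auto simp: same_param_def)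
  then have "\<bar>m * len k\<bar> < len k" using assms(3) by (simp flip: of_int_abs of_int_mult)
  then have "\<bar>m\<bar> * len k < 1 * len k" using len_ge[OF assms(1)] by (simp add: abs_mult)
  then have "m = 0" using len_ge[OF assms(1)] by (simp add: mult_less_cancel_right)
  with m show ?thesis by simp
qed

lemma pt_link_point:
  assumes "k < length Ps" "0 \<le> t" "t < of_int (len k)"
  shows "pt k t = link_point Ps (k, t)"
proof -
  have "\<lfloor>t\<rfloor> < len k" using assms(3) by (simp add: floor_less_iff)
  then have f: "0 \<le> \<lfloor>t\<rfloor>" "\<lfloor>t\<rfloor> mod len k = \<lfloor>t\<rfloor>" using assms(2) by auto
  have "nat ((\<lfloor>t\<rfloor> + 1) mod len k) = Suc (nat \<lfloor>t\<rfloor>) mod length (Ps ! k)"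
    using f(1) by (simp add: len_def nat_mod_distrib Suc_nat_eq_nat_zadd1 add.commute)
  then show ?thesis
    using f by (simp add: pt_def link_point_def polygon_point_def vert_def Let_def)
qed

lemma params_iff: "(k, t) \<in> params Ps \<longleftrightarrow> k < length Ps \<and> 0 \<le> t \<and> t < of_int (len k)"
  by (auto simp: params_def len_def)

lemma image_link_point: "link_point Ps ` params Ps = (\<Union>k<length Ps. range (pt k))"
proof (intro equalityI subsetI)
  fix x assume "x \<in> link_point Ps ` params Ps"
  then obtain k t where "(k, t) \<in> params Ps" "x = link_point Ps (k, t)" by auto
  then show "x \<in> (\<Union>k<length Ps. range (pt k))"
    using pt_link_point params_iff by (metis UN_iff lessThan_iff rangeI)
next
  fix x assume "x \<in> (\<Union>k<length Ps. range (pt k))"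
  then obtain k t where kt: "k < length Ps" "x = pt k t" by auto
  have "x = link_point Ps (k, red k t)"
    using pt_link_point[OF kt(1)] red_bounds[OF kt(1)] same_paramD[OF red_same] kt(2) by metis
  moreover have "(k, red k t) \<in> params Ps" using red_bounds[OF kt(1)] kt(1) by (simp add: params_iff)
  ultimately show "x \<in> link_point Ps ` params Ps" by blast
qed

lemma pt_inj: "k < length Ps \<Longrightarrow> l < length Ps \<Longrightarrow> pt k s = pt l t \<Longrightarrow> same_param k s l t"
proof -
  assume kl: "k < length Ps" "l < length Ps" and e: "pt k s = pt l t"
  have "link_point Ps (k, red k s) = link_point Ps (l, red l t)"
    using pt_link_point[OF kl(1)] pt_link_point[OF kl(2)] red_bounds[OF kl(1)] red_bounds[OF kl(2)]
      same_paramD[OF red_same] e by metis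
  moreover have "(k, red k s) \<in> params Ps" "(l, red l t) \<in> params Ps"
    using red_bounds kl by (simp_all add: params_iff)
  ultimately have "(k, red k s) = (l, red l t)"
    using emb unfolding embedded_polygonal_link_def by (blast dest: inj_onD)
  then show ?thesis
    using same_param_trans[OF same_param_sym[OF red_same[of k s]]] red_same[of l t] by auto
qed

definition same_proj :: "nat \<Rightarrow> real \<Rightarrow> nat \<Rightarrow> real \<Rightarrow> bool" where
  "same_proj k s l t \<longleftrightarrow> pt k s $ 1 = pt l t $ 1 \<and> pt k s $ 2 = pt l t $ 2"

lemma fibre_mem:
  assumes "k < length Ps" "l < length Ps"
  shows "(l, red l t) \<in> proj_fibre Ps (k, red k s) \<longleftrightarrow> same_proj k s l t"
proof -
  have "pt k s = link_point Ps (k, red k s)" "pt l t = link_point Ps (l, red l t)"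
    using assms red_bounds same_paramD[OF red_same] pt_link_point by metis+
  then show ?thesis
    using red_bounds assms by (auto simp: proj_fibre_def params_iff xy_proj_def same_proj_def)
qed

lemma red_in_params: "k < length Ps \<Longrightarrow> (k, red k s) \<in> params Ps"
  using red_bounds by (simp add: params_iff)

lemma vertex_fibre:
  assumes kl: "k < length Ps" "l < length Ps" and s: "s \<in> \<int>" and e: "same_proj k s l t"
  shows "same_param k s l t"
proof -
  have "red k s \<in> \<int>" using s by (simp add: red_def)
  then have "proj_fibre Ps (k, red k s) = {(k, red k s)}"
    using reg red_in_params[OF kl(1)] unfolding regular_position_def by fastforce
  then have "(l, red l t) = (k, red k s)"
    using e fibre_mem[OF kl] by auto
  then show ?thesis
    using same_param_trans[OF same_param_sym[OF red_same[of k s]]] red_same[of l t] by auto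
qed

text \<open>
  Besides a given point a fibre contains at most one further point.
\<close>

lemma fibre_two:
  assumes klm: "k < length Ps" "l < length Ps" "m < length Ps"
    and e: "same_proj k s l t" "same_proj k s m r" and n: "\<not> same_param k s l t" "\<not> same_param k s m r"
  shows "same_param l t m r"
proof (rule ccontr)
  assume "\<not> same_param l t m r"
  let ?X = "{(k, red k s), (l, red l t), (m, red m r)}"
  have neq: "(a, red a x) \<noteq> (b, red b y)" if "\<not> same_param a x b y" for a b x y
    using that same_param_trans[OF same_param_sym[OF red_same[of a x]]] red_same[of b y] by auto
  have "card ?X = 3"
    using neq[OF n(1)] neq[OF n(2)] neq[OF \<open>\<not> same_param l t m r\<close>] by auto
  moreover have "same_proj k s k s" by (simp add: same_proj_def)
  then have "?X \<subseteq> proj_fibre Ps (k, red k s)"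
    using fibre_mem klm e by auto
  moreover have "finite (proj_fibre Ps (k, red k s))" "card (proj_fibre Ps (k, red k s)) \<le> 2"
    using reg red_in_params[OF klm(1)] unfolding regular_position_def by auto
  ultimately show False
    using card_mono[of "proj_fibre Ps (k, red k s)" ?X] by simp
qed

subsection \<open>Edges\<close>

lemma pt_int: "pt k (of_int i) = vert k i"
  by (simp add: pt_def)

lemma pt_edge: "0 \<le> x \<Longrightarrow> x \<le> 1 \<Longrightarrow> pt k (of_int i + x) = vert k i + x *\<^sub>R edge k i"
proof (cases "x = 1")
  case True
  then show ?thesis using pt_int[of k "i + 1"] by (simp add: edge_def)
next
  case False
  assume "0 \<le> x" "x \<le> 1"
  with False have "\<lfloor>of_int i + x\<rfloor> = i" "frac (of_int i + x) = x"
    by (auto simp: floor_eq_iff frac_eq frac_def)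
  then show ?thesis
    by (simp add: pt_def edge_def algebra_simps)
qed

lemma edge_not_vertical:
  assumes k: "k < length Ps" shows "\<not> (edge k i $ 1 = 0 \<and> edge k i $ 2 = 0)"
proof
  assume "edge k i $ 1 = 0 \<and> edge k i $ 2 = 0"
  then have "same_proj k (of_int i) k (of_int i + 1/2)"
    using pt_edge[of "1/2" k i] pt_int[of k i] by (simp add: same_proj_def)
  then have "same_param k (of_int i) k (of_int i + 1/2)"
    by (intro vertex_fibre k) auto
  then have "of_int i = of_int i + (1/2 :: real)"
    by (rule same_param_range[OF k]) (use len_ge[OF k] in auto)
  then show False by simp
qed

text \<open>
  Two different edges that meet in the projection away from a common vertex are not parallel:
  otherwise their projections overlap in a segment, whose two ends would both be common vertices.
  If the edges had the same direction, they would be the same edge; if they had opposite directions,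
  each would follow the other and the polygon would be a 2-gon.
\<close>

lemma edges_not_parallel:
  assumes kl: "k < length Ps" "l < length Ps" and xy: "0 \<le> x" "x \<le> 1" "0 \<le> y" "y \<le> 1"
    and e: "same_proj k (of_int i + x) l (of_int j + y)" and n: "\<not> same_param k (of_int i + x) l (of_int j + y)"
    and ne: "\<not> (k = l \<and> (\<exists>m. i = j + m * len k))"
  shows "det2 (edge k i) (edge l j) \<noteq> 0"
proof
  assume par: "det2 (edge k i) (edge l j) = 0"
  let ?A = "edge k i" and ?B = "edge l j"
  obtain c where c: "?B $ 1 = c * ?A $ 1" "?B $ 2 = c * ?A $ 2"
  proof (cases "?A $ 1 = 0")
    case True
    then have "?A $ 2 \<noteq> 0" using edge_not_vertical[OF kl(1)] by blast
    then show thesis using par True that[of "?B $ 2 / ?A $ 2"] by (simp add: det2_def)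
  next
    case False
    then show thesis using par that[of "?B $ 1 / ?A $ 1"] by (simp add: det2_def field_simps)
  qed
  have c0: "c \<noteq> 0" using c edge_not_vertical[OF kl(2), of j] by auto
  have move: "same_proj k (of_int i + (x + c * r)) l (of_int j + (y + r))"
    if "0 \<le> x + c * r" "x + c * r \<le> 1" "0 \<le> y + r" "y + r \<le> 1" for r
    using e pt_edge[OF xy(1,2), of k i] pt_edge[OF xy(3,4), of l j] pt_edge[OF that(1,2), of k i] pt_edge[OF that(3,4), of l j] c
    by (auto simp: same_proj_def algebra_simps)
  have x': "0 < x" "x < 1"
  proof -
    have "x \<noteq> 0" "x \<noteq> 1" using n vertex_fibre[OF kl _ e] by auto
    then show "0 < x" "x < 1" using xy by auto
  qed
  have y': "0 < y" "y < 1"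
  proof -
    have e': "same_proj l (of_int j + y) k (of_int i + x)" using e by (auto simp: same_proj_def)
    have "y \<noteq> 0" "y \<noteq> 1" using n vertex_fibre[OF kl(2,1) _ e'] same_param_sym by auto
    then show "0 < y" "y < 1" using xy by auto
  qed
  \<comment> \<open>an end of the overlap: both parameters have reached a vertex\<close>
  have stop: "x + c * r \<in> {0, 1} \<and> y + r \<in> {0, 1} \<and> same_param k (of_int i + (x + c * r)) l (of_int j + (y + r))"
    if r: "0 \<le> x + c * r" "x + c * r \<le> 1" "0 \<le> y + r" "y + r \<le> 1"
      and v: "x + c * r \<in> {0, 1} \<or> y + r \<in> {0, 1}" for r
  proof -
    note p = move[OF r]
    have p': "same_proj l (of_int j + (y + r)) k (of_int i + (x + c * r))" using p by (auto simp: same_proj_def)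
    have int: "of_int i + (x + c * r) \<in> \<int> \<or> of_int j + (y + r) \<in> \<int>" using v by auto
    then have sp: "same_param k (of_int i + (x + c * r)) l (of_int j + (y + r))"
      using vertex_fibre[OF kl _ p] vertex_fibre[OF kl(2,1) _ p'] same_param_sym by blast
    then obtain m :: int where "of_int i + (x + c * r) = of_int j + (y + r) + of_int (m * len k)"
      by (auto simp: same_param_def)
    then have both: "x + c * r = (y + r) + of_int (j + m * len k - i)" by simp
    have "x + c * r \<in> \<int> \<and> y + r \<in> \<int>"
    proof (cases "y + r \<in> {0, 1}")
      case True
      then have "y + r \<in> \<int>" by auto
      then show ?thesis unfolding both by simp
    next
      case False
      then have i: "x + c * r \<in> \<int>" using v by auto
      have "y + r = (x + c * r) - of_int (j + m * len k - i)" using both by simp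
      also have "\<dots> \<in> \<int>" using i by (intro Ints_diff) auto
      finally show ?thesis using i by blast
    qed
    moreover have "z = 0 \<or> z = 1" if "z \<in> \<int>" "0 \<le> z" "z \<le> 1" for z :: real
      using that by (auto elim!: Ints_cases)
    ultimately show ?thesis using r sp by auto
  qed
  have same_edge: False if "k = l" "of_int i + (of_int a :: real) = of_int j + of_int a + of_int (m * len k)" for a m
  proof -
    have "real_of_int i = of_int (j + m * len k)" using that(2) by simp
    then have "i = j + m * len k" by (simp only: of_int_eq_iff)
    then show False using ne that(1) by blast
  qed
  have two: False if "k = l" "of_int i + (1::real) = of_int j + of_int (m * len k)" "of_int i = of_int j + (1::real) + of_int (m' * len k)" for m m'
  proof -
    have "real_of_int 2 = of_int ((m - m') * len k)" using that(2,3) by (simp add: algebra_simps)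
    then have "2 = (m - m') * len k" by (simp only: of_int_eq_iff)
    then have "len k dvd 2" by (metis dvd_triv_right)
    then show False using len_ge[OF kl(1)] zdvd_imp_le by fastforce
  qed
  show False
  proof (cases "c > 0")
    case True
    \<comment> \<open>follow the overlap forward along the second edge until an edge ends\<close>
    define r1 where "r1 = min (1 - y) ((1 - x) / c)"
    have r1: "c * r1 \<le> 1 - x" "r1 \<le> 1 - y" "0 \<le> r1" "r1 = 1 - y \<or> c * r1 = 1 - x"
      using True x' y' by (auto simp: r1_def min_def field_simps)
    have p: "0 \<le> c * r1" using True r1(3) by simp
    have b: "0 \<le> x + c * r1" "x + c * r1 \<le> 1" "0 \<le> y + r1" "y + r1 \<le> 1"
      using r1(1,2,3) p x' y' by linarith+
    have v: "x + c * r1 \<in> {0, 1} \<or> y + r1 \<in> {0, 1}"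
      using r1(4) by (elim disjE) simp_all
    have "y + r1 = 0 \<or> y + r1 = 1" "x + c * r1 = 0 \<or> x + c * r1 = 1"
      using stop[OF b v] by auto
    then have "y + r1 = 1" "x + c * r1 = 1"
      using r1(3) p x' y' by linarith+
    then have "same_param k (of_int i + 1) l (of_int j + 1)" using stop[OF b v] by simp
    then show False using same_edge[of 1] by (auto simp: same_param_def)
  next
    case False
    then have c: "c < 0" using c0 by simp
    \<comment> \<open>follow the overlap forward along the second edge, and then backward\<close>
    define r1 where "r1 = min (1 - y) (- x / c)"
    have "- x / c > 0" using c x' by (simp add: divide_pos_neg zero_less_divide_iff)
    moreover have "c * (- x / c) = - x" using c by simp
    moreover have "c * r1 \<ge> c * (- x / c)" using c unfolding r1_def by (intro mult_left_mono_neg) auto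
    moreover have "r1 = 1 - y \<or> r1 = - x / c" by (auto simp: r1_def min_def)
    ultimately have r1: "- x \<le> c * r1" "r1 \<le> 1 - y" "0 < r1" "r1 = 1 - y \<or> c * r1 = - x"
      using y' by (auto simp: r1_def)
    have p: "c * r1 < 0" using c r1(3) by (simp add: mult_neg_pos)
    have b: "0 \<le> x + c * r1" "x + c * r1 \<le> 1" "0 \<le> y + r1" "y + r1 \<le> 1"
      using r1(1,2,3) p x' y' by linarith+
    have v: "x + c * r1 \<in> {0, 1} \<or> y + r1 \<in> {0, 1}"
      using r1(4) by (elim disjE) simp_all
    have "y + r1 = 0 \<or> y + r1 = 1" "x + c * r1 = 0 \<or> x + c * r1 = 1"
      using stop[OF b v] by auto
    then have "y + r1 = 1" "x + c * r1 = 0"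
      using r1(3) p x' y' by linarith+
    then have 1: "same_param k (of_int i) l (of_int j + 1)" using stop[OF b v] by simp
    define r2 where "r2 = max (- y) ((1 - x) / c)"
    have "(1 - x) / c < 0" using c x' by (simp add: divide_pos_neg)
    moreover have "c * ((1 - x) / c) = 1 - x" using c by simp
    moreover have "c * r2 \<le> c * ((1 - x) / c)" using c unfolding r2_def by (intro mult_left_mono_neg) auto
    moreover have "r2 = - y \<or> r2 = (1 - x) / c" by (auto simp: r2_def max_def)
    ultimately have r2: "c * r2 \<le> 1 - x" "- y \<le> r2" "r2 < 0" "r2 = - y \<or> c * r2 = 1 - x"
      using y' by (auto simp: r2_def)
    have p2: "c * r2 > 0" using c r2(3) by (simp add: mult_neg_neg)
    have b2: "0 \<le> x + c * r2" "x + c * r2 \<le> 1" "0 \<le> y + r2" "y + r2 \<le> 1"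
      using r2(1,2,3) p2 x' y' by linarith+
    have v2: "x + c * r2 \<in> {0, 1} \<or> y + r2 \<in> {0, 1}"
      using r2(4) by (elim disjE) simp_all
    have "y + r2 = 0 \<or> y + r2 = 1" "x + c * r2 = 0 \<or> x + c * r2 = 1"
      using stop[OF b2 v2] by auto
    then have "y + r2 = 0" "x + c * r2 = 1"
      using r2(3) p2 x' y' by linarith+
    then have 2: "same_param k (of_int i + 1) l (of_int j)" using stop[OF b2 v2] by simp
    obtain m1 :: int where "k = l" "of_int i = of_int j + (1::real) + of_int (m1 * len k)"
      using 1 unfolding same_param_def by blast
    moreover obtain m2 :: int where "of_int i + (1::real) = of_int j + of_int (m2 * len k)"
      using 2 unfolding same_param_def by blast
    ultimately show False using two by blast
  qed
qed

subsection \<open>Local structure\<close>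

text \<open>
  The directions of the polygon just after and just before \<open>t\<close>.
\<close>

definition dR :: "nat \<Rightarrow> real \<Rightarrow> real^3" where "dR k t = edge k \<lfloor>t\<rfloor>"
definition dL :: "nat \<Rightarrow> real \<Rightarrow> real^3" where "dL k t = edge k (\<lceil>t\<rceil> - 1)"

lemma dL_eq_dR: "t \<notin> \<int> \<Longrightarrow> dL k t = dR k t"
  unfolding dL_def dR_def by (metis add_diff_cancel_right' ceiling_altdef of_int_floor_cancel Ints_of_int)

lemma pt_local:
  obtains e where "e > 0"
    "\<And>z. \<bar>z\<bar> < e \<Longrightarrow> pt k (t + z) = pt k t + min z 0 *\<^sub>R dL k t + max z 0 *\<^sub>R dR k t"
    "\<And>z. 0 < z \<Longrightarrow> z < e \<Longrightarrow> dR k (t + z) = dR k t \<and> t + z \<notin> \<int>"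
    "\<And>z. - e < z \<Longrightarrow> z < 0 \<Longrightarrow> dR k (t + z) = dL k t \<and> t + z \<notin> \<int>"
proof -
  define e where "e = min (of_int \<lfloor>t\<rfloor> + 1 - t) (t - (of_int \<lceil>t\<rceil> - 1))"
  have e: "e > 0" "e \<le> of_int \<lfloor>t\<rfloor> + 1 - t" "e \<le> t - (of_int \<lceil>t\<rceil> - 1)"
    unfolding e_def by (auto, linarith+)
  have between: "x \<notin> \<int>" if "of_int i < x" "x < of_int i + 1" for x :: real and i :: int
    using that by (auto elim!: Ints_cases)
  show ?thesis
  proof (rule that[OF e(1)])
    fix z assume z: "\<bar>z\<bar> < e"
    show "pt k (t + z) = pt k t + min z 0 *\<^sub>R dL k t + max z 0 *\<^sub>R dR k t"
    proof (cases "z \<ge> 0")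
      case True
      have "pt k (of_int \<lfloor>t\<rfloor> + (frac t + z)) = vert k \<lfloor>t\<rfloor> + (frac t + z) *\<^sub>R edge k \<lfloor>t\<rfloor>"
        using True z e by (intro pt_edge) (auto simp: frac_def)
      moreover have "pt k (of_int \<lfloor>t\<rfloor> + frac t) = vert k \<lfloor>t\<rfloor> + frac t *\<^sub>R edge k \<lfloor>t\<rfloor>"
        using frac_lt_1[of t] by (intro pt_edge) auto
      moreover have "of_int \<lfloor>t\<rfloor> + (frac t + z) = t + z" "of_int \<lfloor>t\<rfloor> + frac t = t" by (simp_all add: frac_def)
      ultimately show ?thesis
        using True by (simp add: dR_def scaleR_add_left)
    next
      case False
      let ?i = "\<lceil>t\<rceil> - 1"
      have "pt k (of_int ?i + (t - of_int ?i + z)) = vert k ?i + (t - of_int ?i + z) *\<^sub>R edge k ?i"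
        using False z e by (intro pt_edge) (auto, linarith)
      moreover have "pt k (of_int ?i + (t - of_int ?i)) = vert k ?i + (t - of_int ?i) *\<^sub>R edge k ?i"
        by (intro pt_edge) (simp, linarith)+
      moreover have "of_int ?i + (t - of_int ?i + z) = t + z" "of_int ?i + (t - of_int ?i) = t" by simp_all
      ultimately have "pt k (t + z) = pt k t + z *\<^sub>R edge k ?i" by (simp only: scaleR_add_left add.assoc)
      then show ?thesis
        using False by (simp add: dL_def)
    qed
  next
    fix z assume z: "0 < z" "z < e"
    have b: "of_int \<lfloor>t\<rfloor> < t + z" "t + z < of_int \<lfloor>t\<rfloor> + 1" using z e by linarith+
    then have "\<lfloor>t + z\<rfloor> = \<lfloor>t\<rfloor>" by (simp add: floor_eq_iff)
    then show "dR k (t + z) = dR k t \<and> t + z \<notin> \<int>" using between[OF b] by (simp add: dR_def)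
  next
    fix z assume z: "- e < z" "z < 0"
    have b: "of_int (\<lceil>t\<rceil> - 1) < t + z" "t + z < of_int (\<lceil>t\<rceil> - 1) + 1"
      using z e le_of_int_ceiling[of t] unfolding of_int_diff of_int_1 by linarith+
    then have "\<lfloor>t + z\<rfloor> = \<lceil>t\<rceil> - 1" by (simp add: floor_eq_iff)
    then show "dR k (t + z) = dL k t \<and> t + z \<notin> \<int>" using between[OF b] by (simp add: dR_def dL_def)
  qed
qed

lemma isCont_pt: "isCont (pt k) t"
proof -
  obtain e where e: "e > 0"
    "\<And>z. \<bar>z\<bar> < e \<Longrightarrow> pt k (t + z) = pt k t + min z 0 *\<^sub>R dL k t + max z 0 *\<^sub>R dR k t"
    using pt_local by metis
  have ev: "\<forall>\<^sub>F s in nhds t. pt k s = pt k t + min (s - t) 0 *\<^sub>R dL k t + max (s - t) 0 *\<^sub>R dR k t"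
    unfolding eventually_nhds_metric
  proof (intro exI[of _ e] conjI allI impI e(1))
    fix s assume "dist s t < e"
    then show "pt k s = pt k t + min (s - t) 0 *\<^sub>R dL k t + max (s - t) 0 *\<^sub>R dR k t"
      using e(2)[of "s - t"] by (simp add: dist_real_def)
  qed
  have c: "isCont (\<lambda>s. pt k t + min (s - t) 0 *\<^sub>R dL k t + max (s - t) 0 *\<^sub>R dR k t) t"
    by (intro continuous_intros)
  show ?thesis by (rule iffD2[OF isCont_cong[OF ev] c])
qed

lemma continuous_on_pt: "continuous_on S (pt k)"
  by (simp add: continuous_at_imp_continuous_on isCont_pt)

text \<open>
  Crossings are transversal double points of interiors of edges.
\<close>

lemma transversal:
  assumes kl: "k < length Ps" "l < length Ps" and e: "same_proj k s l t" and n: "\<not> same_param k s l t"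
  shows "s \<notin> \<int>" "t \<notin> \<int>" "det2 (dR k s) (dR l t) \<noteq> 0"
proof -
  have e': "same_proj l t k s" using e by (simp add: same_proj_def)
  show "s \<notin> \<int>" using vertex_fibre[OF kl _ e] n by blast
  show "t \<notin> \<int>" using vertex_fibre[OF kl(2,1) _ e'] n same_param_sym by blast
  have st: "s = of_int \<lfloor>s\<rfloor> + frac s" "t = of_int \<lfloor>t\<rfloor> + frac t" by (simp_all add: frac_def)
  have ne: "\<not> (k = l \<and> (\<exists>m. \<lfloor>s\<rfloor> = \<lfloor>t\<rfloor> + m * len k))"
  proof
    assume "k = l \<and> (\<exists>m. \<lfloor>s\<rfloor> = \<lfloor>t\<rfloor> + m * len k)"
    then obtain m where m: "k = l" "\<lfloor>s\<rfloor> = \<lfloor>t\<rfloor> + m * len k" by blast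
    let ?t = "t + of_int (m * len k)"
    have t': "same_param k ?t k t" by (auto simp: same_param_def)
    have A: "pt k s = vert k \<lfloor>s\<rfloor> + frac s *\<^sub>R edge k \<lfloor>s\<rfloor>"
      using pt_edge[of "frac s" k "\<lfloor>s\<rfloor>"] st(1) frac_lt_1[of s] by simp
    have "?t = of_int \<lfloor>s\<rfloor> + frac t" using m by (simp add: frac_def)
    then have "pt k ?t = vert k \<lfloor>s\<rfloor> + frac t *\<^sub>R edge k \<lfloor>s\<rfloor>"
      using pt_edge[of "frac t" k "\<lfloor>s\<rfloor>"] frac_lt_1[of t] by simp
    then have B: "pt l t = vert k \<lfloor>s\<rfloor> + frac t *\<^sub>R edge k \<lfloor>s\<rfloor>"
      using pt_period[of k t m] m(1) by simp
    have "frac s * edge k \<lfloor>s\<rfloor> $ 1 = frac t * edge k \<lfloor>s\<rfloor> $ 1" "frac s * edge k \<lfloor>s\<rfloor> $ 2 = frac t * edge k \<lfloor>s\<rfloor> $ 2"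
      using e unfolding same_proj_def A B by simp_all
    then have "frac s = frac t" using edge_not_vertical[OF kl(1)] by auto
    then have "s = ?t" using m(2) by (simp add: frac_def)
    then show False using t' n m(1) by simp
  qed
  show "det2 (dR k s) (dR l t) \<noteq> 0"
    unfolding dR_def
    by (rule edges_not_parallel[OF kl, of "frac s" "frac t"])
      (use st e n ne frac_lt_1[of s] frac_lt_1[of t] in auto)
qed

text \<open>
  If the projection turned straight back at a vertex, the two edges would overlap near it.
\<close>

lemma not_folded:
  assumes k: "k < length Ps" and c: "c > 0" "dL k t $ 1 = - c * dR k t $ 1" "dL k t $ 2 = - c * dR k t $ 2"
  shows False
proof (cases "t \<in> \<int>")
  case False
  then have "(1 + c) * dR k t $ 1 = 0" "(1 + c) * dR k t $ 2 = 0"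
    using c dL_eq_dR by (simp_all add: algebra_simps)
  then show False using c(1) edge_not_vertical[OF k] by (auto simp: dR_def)
next
  case True
  then obtain i where i: "t = of_int i" by (auto elim: Ints_cases)
  have d: "dL k t = edge k (i - 1)" "dR k t = edge k i" by (simp_all add: dL_def dR_def i)
  define s where "s = min (1/2) (1 / (2 * c))"
  have s: "0 < s" "s \<le> 1/2" "s * c \<le> 1/2" "0 < s * c"
    using c(1) by (auto simp: s_def min_def field_simps)
  have 1: "pt k (of_int (i - 1) + (1 - s)) = vert k (i - 1) + (1 - s) *\<^sub>R edge k (i - 1)"
    using s by (intro pt_edge) auto
  have 2: "pt k (of_int i + s * c) = vert k i + (s * c) *\<^sub>R edge k i"
    using s by (intro pt_edge) auto
  have 3: "vert k i = vert k (i - 1) + edge k (i - 1)" by (simp add: edge_def)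
  have sp: "same_proj k (of_int (i - 1) + (1 - s)) k (of_int i + s * c)"
    unfolding same_proj_def 1 2 using c(2,3) unfolding d 3 by (simp add: algebra_simps)
  have "det2 (edge k (i - 1)) (edge k i) \<noteq> 0"
  proof (rule edges_not_parallel[OF k k _ _ _ _ sp])
    show "\<not> same_param k (of_int (i - 1) + (1 - s)) k (of_int i + s * c)"
    proof
      assume "same_param k (of_int (i - 1) + (1 - s)) k (of_int i + s * c)"
      then have "of_int (i - 1) + (1 - s) = of_int i + s * c"
        by (rule same_param_range[OF k]) (use s len_ge[OF k] in auto)
      then show False using s by simp
    qed
    show "\<not> (k = k \<and> (\<exists>m. i - 1 = i + m * len k))"
    proof
      assume "k = k \<and> (\<exists>m. i - 1 = i + m * len k)"
      then obtain m where "i - 1 = i + m * len k" by blast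
      then have "m * len k = - 1" by linarith
      then have "len k dvd 1" by (metis dvd_minus_iff dvd_triv_right)
      then show False using len_ge[OF k] zdvd_imp_le by fastforce
    qed
  qed (use s in auto)
  then show False using c(2,3) unfolding d det2_def by (simp add: algebra_simps)
qed

end

text \<open>
  Two plane directions that are not opposite have a common positive side, to which the bisector turned
  by a right angle points.
\<close>

lemma side_vector:
  fixes p q :: "real^3"
  assumes p: "\<not> (p $ 1 = 0 \<and> p $ 2 = 0)" and q: "\<not> (q $ 1 = 0 \<and> q $ 2 = 0)"
    and n: "\<And>c. c > 0 \<Longrightarrow> p $ 1 = - c * q $ 1 \<Longrightarrow> p $ 2 = - c * q $ 2 \<Longrightarrow> False"
  obtains u where "det2 p u > 0" "det2 q u > 0"
proof -
  define a b where "a = sqrt ((p $ 1)\<^sup>2 + (p $ 2)\<^sup>2)" and "b = sqrt ((q $ 1)\<^sup>2 + (q $ 2)\<^sup>2)"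
  have a: "a > 0" "a\<^sup>2 = (p $ 1)\<^sup>2 + (p $ 2)\<^sup>2" and b: "b > 0" "b\<^sup>2 = (q $ 1)\<^sup>2 + (q $ 2)\<^sup>2"
    using p q by (auto simp: a_def b_def sum_power2_gt_zero_iff)
  define m where "m = b *\<^sub>R p + a *\<^sub>R q"
  define s where "s = p $ 1 * q $ 1 + p $ 2 * q $ 2"
  have mm: "(m $ 1)\<^sup>2 + (m $ 2)\<^sup>2 = 2 * (a * b) * (a * b + s)"
  proof -
    have "(m $ 1)\<^sup>2 + (m $ 2)\<^sup>2 = b\<^sup>2 * ((p $ 1)\<^sup>2 + (p $ 2)\<^sup>2) + a\<^sup>2 * ((q $ 1)\<^sup>2 + (q $ 2)\<^sup>2) + 2 * (a * b) * s"
      by (simp add: m_def s_def power2_eq_square algebra_simps)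
    also have "\<dots> = 2 * (a * b) * (a * b + s)"
      unfolding a(2)[symmetric] b(2)[symmetric] by (simp add: power2_eq_square algebra_simps)
    finally show ?thesis .
  qed
  have "m $ 1 \<noteq> 0 \<or> m $ 2 \<noteq> 0"
  proof (rule ccontr)
    assume "\<not> ?thesis"
    then have "p $ 1 = - (a / b) * q $ 1" "p $ 2 = - (a / b) * q $ 2"
      using b(1) by (simp_all add: m_def field_simps add_eq_0_iff)
    then show False using n[of "a / b"] a b by simp
  qed
  then have "2 * (a * b) * (a * b + s) > 0"
    unfolding mm[symmetric] by (simp add: sum_power2_gt_zero_iff)
  moreover have "2 * (a * b) > 0" using a b by simp
  ultimately have pos: "a * b + s > 0" by (rule zero_less_mult_pos)
  let ?u = "vec3 (- m $ 2) (m $ 1) 0"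
  have "det2 p ?u = b * ((p $ 1)\<^sup>2 + (p $ 2)\<^sup>2) + a * s"
    by (simp add: det2_def m_def s_def power2_eq_square algebra_simps)
  also have "\<dots> = a * (a * b + s)" unfolding a(2)[symmetric] by (simp add: power2_eq_square algebra_simps)
  also have "\<dots> > 0" using a pos by simp
  finally have 1: "det2 p ?u > 0" .
  have "det2 q ?u = a * ((q $ 1)\<^sup>2 + (q $ 2)\<^sup>2) + b * s"
    by (simp add: det2_def m_def s_def power2_eq_square algebra_simps)
  also have "\<dots> = b * (a * b + s)" unfolding b(2)[symmetric] by (simp add: power2_eq_square algebra_simps)
  also have "\<dots> > 0" using b pos by simp
  finally show ?thesis using 1 that by blast
qed

context poly_link
begin

lemma dR_not_vertical: "k < length Ps \<Longrightarrow> \<not> (dR k t $ 1 = 0 \<and> dR k t $ 2 = 0)"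
  and dL_not_vertical: "k < length Ps \<Longrightarrow> \<not> (dL k t $ 1 = 0 \<and> dL k t $ 2 = 0)"
  unfolding dR_def dL_def by (intro edge_not_vertical; assumption)+

text \<open>By compactness, whatever projects close to a point of the diagram lies close to a point of its fibre.\<close>

lemma near_fibre:
  assumes k: "k < length Ps" and e: "e > 0"
  obtains \<eta> where "\<eta> > 0" "\<And>l s. l < length Ps \<Longrightarrow> \<bar>pt l s $ 1 - pt k t $ 1\<bar> < \<eta> \<Longrightarrow> \<bar>pt l s $ 2 - pt k t $ 2\<bar> < \<eta> \<Longrightarrow>
      \<exists>t' z. same_proj k t l t' \<and> \<bar>z\<bar> < e \<and> same_param l s l (t' + z)"
proof -
  have "\<exists>\<eta>>0. \<forall>s. \<bar>pt l s $ 1 - pt k t $ 1\<bar> < \<eta> \<and> \<bar>pt l s $ 2 - pt k t $ 2\<bar> < \<eta> \<longrightarrow>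
      (\<exists>t' z. same_proj k t l t' \<and> \<bar>z\<bar> < e \<and> same_param l s l (t' + z))" if l: "l < length Ps" for l
  proof -
    define S where "S = {0..of_int (len l)} - (\<Union>t'\<in>{t'. same_proj k t l t'}. ball t' e)"
    define D where "D s = \<bar>pt l s $ 1 - pt k t $ 1\<bar> + \<bar>pt l s $ 2 - pt k t $ 2\<bar>" for s
    have "compact S"
      unfolding S_def by (intro compact_diff compact_Icc open_UN) auto
    moreover have "continuous_on S D"
      unfolding D_def by (intro continuous_intros continuous_on_pt)
    moreover have pos: "0 < D s" if "s \<in> S" for s
    proof -
      have "\<not> same_proj k t l s" using that e by (auto simp: S_def)
      then show ?thesis by (auto simp: same_proj_def D_def)
    qed
    ultimately obtain \<eta> where \<eta>: "\<eta> > 0" "\<And>s. s \<in> S \<Longrightarrow> \<eta> \<le> D s"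
    proof (cases "S = {}")
      case True
      then show thesis using that[of 1] by simp
    next
      case False
      then obtain s0 where "s0 \<in> S" "\<And>s. s \<in> S \<Longrightarrow> D s0 \<le> D s"
        using continuous_attains_inf[OF \<open>compact S\<close> _ \<open>continuous_on S D\<close>] by metis
      then show thesis using that[of "D s0"] pos by blast
    qed
    show ?thesis
    proof (rule exI[of _ "\<eta> / 2"], intro conjI allI impI; (elim conjE)?)
      show "\<eta> / 2 > 0" using \<eta>(1) by simp
      fix s assume s: "\<bar>pt l s $ 1 - pt k t $ 1\<bar> < \<eta> / 2" "\<bar>pt l s $ 2 - pt k t $ 2\<bar> < \<eta> / 2"
      have "pt l (red l s) = pt l s" using same_paramD[OF red_same] by blast
      then have "D (red l s) < \<eta>" using s by (simp add: D_def)
      then have "red l s \<notin> S" using \<eta>(2) by force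
      then obtain t' where "same_proj k t l t'" "\<bar>red l s - t'\<bar> < e"
        using red_bounds[OF l, of s] by (auto simp: S_def dist_real_def abs_minus_commute)
      moreover have "same_param l s l (t' + (red l s - t'))"
        using same_param_sym[OF red_same] by simp
      ultimately show "\<exists>t' z. same_proj k t l t' \<and> \<bar>z\<bar> < e \<and> same_param l s l (t' + z)" by blast
    qed
  qed
  then obtain \<eta> where \<eta>: "\<And>l. l < length Ps \<Longrightarrow> \<eta> l > 0"
    "\<And>l s. l < length Ps \<Longrightarrow> \<bar>pt l s $ 1 - pt k t $ 1\<bar> < \<eta> l \<Longrightarrow> \<bar>pt l s $ 2 - pt k t $ 2\<bar> < \<eta> l \<Longrightarrow>
      \<exists>t' z. same_proj k t l t' \<and> \<bar>z\<bar> < e \<and> same_param l s l (t' + z)"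
    by metis
  let ?M = "Min (\<eta> ` {..<length Ps})"
  have fin: "finite (\<eta> ` {..<length Ps})" "\<eta> ` {..<length Ps} \<noteq> {}" using k by auto
  show ?thesis
  proof (rule that)
    show "?M > 0" using fin \<eta>(1) by (simp add: Min_gr_iff)
    fix l s assume l: "l < length Ps" and s: "\<bar>pt l s $ 1 - pt k t $ 1\<bar> < ?M" "\<bar>pt l s $ 2 - pt k t $ 2\<bar> < ?M"
    have "?M \<le> \<eta> l" using l fin by (intro Min_le) auto
    then show "\<exists>t' z. same_proj k t l t' \<and> \<bar>z\<bar> < e \<and> same_param l s l (t' + z)"
      using s by (intro \<eta>(2) l) linarith+
  qed
qed

end

section \<open>Jumps along a polygonal link\<close>

text \<open>
  A polygonal link in regular position and an arc attached to it.  The position of the arc relative to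
  the projection is arbitrary.
\<close>

locale diagram = poly_link Ps + link_arc P Om F for Ps P Om F +
  assumes P_eq: "P = (\<Union>k<length Ps. range (pt k))" and fin: "finite (P \<inter> Om)"
begin

lemma pt_in_P: "k < length Ps \<Longrightarrow> pt k t \<in> P"
  unfolding P_eq by blast

lemma in_PE: assumes "p \<in> P" obtains l s where "l < length Ps" "p = pt l s"
  using assms unfolding P_eq by blast

lemma near_off_arc:
  assumes k: "k < length Ps"
  obtains \<delta> where "\<delta> > 0" "\<And>z. 0 < \<bar>z\<bar> \<Longrightarrow> \<bar>z\<bar> < \<delta> \<Longrightarrow> pt k (t + z) \<notin> Om"
proof -
  let ?X = "P \<inter> Om - {pt k t}"
  have "finite ?X" using fin by blast
  then have "open (- ?X)" by (intro open_Compl finite_imp_closed)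
  then have "open (pt k -` (- ?X))" by (rule open_vimage[OF _ continuous_on_pt])
  moreover have "t \<in> pt k -` (- ?X)" by blast
  ultimately obtain e where e: "e > 0" "ball t e \<subseteq> pt k -` (- ?X)"
    using open_contains_ball by metis
  show ?thesis
  proof (rule that)
    show "min e 1 > 0" using e(1) by simp
    fix z :: real assume z: "0 < \<bar>z\<bar>" "\<bar>z\<bar> < min e 1"
    have "pt k (t + z) \<noteq> pt k t"
    proof
      assume "pt k (t + z) = pt k t"
      then have "same_param k (t + z) k t" by (rule pt_inj[OF k k])
      then have "t + z = t" by (rule same_param_range[OF k]) (use z len_ge[OF k] in auto)
      then show False using z by simp
    qed
    then show "pt k (t + z) \<notin> Om"
    proof -
      assume ne: "pt k (t + z) \<noteq> pt k t"
      have "t + z \<in> ball t e" using z by (simp add: dist_real_def)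
      then have "pt k (t + z) \<notin> ?X" using e(2) by blast
      then show ?thesis using ne pt_in_P[OF k] by blast
    qed
  qed
qed

text \<open>
  Over and under a small parallelogram around a point of the projection, the link consists of the strand
  through that point and of pieces close to the other points of the fibre.
\<close>

lemma column:
  fixes k t u
  defines "\<psi> \<equiv> bent_chart (pt k t) (dL k t) (dR k t) u"
  assumes k: "k < length Ps" and det: "det2 (dL k t) u > 0" "det2 (dR k t) u > 0" and e0: "e0 > 0"
  obtains \<delta> where "\<delta> > 0" "\<And>z. \<bar>z\<bar> < \<delta> \<Longrightarrow> pt k (t + z) = \<psi> (vec3 0 0 z)"
    "\<And>z. 0 < z \<Longrightarrow> z < \<delta> \<Longrightarrow> dR k (t + z) = dR k t" "\<And>z. - \<delta> < z \<Longrightarrow> z < 0 \<Longrightarrow> dR k (t + z) = dL k t"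
    "\<And>v l s. \<bar>v $ 2\<bar> < \<delta> \<Longrightarrow> \<bar>v $ 3\<bar> < \<delta> \<Longrightarrow> l < length Ps \<Longrightarrow> pt l s $ 1 = \<psi> v $ 1 \<Longrightarrow> pt l s $ 2 = \<psi> v $ 2 \<Longrightarrow>
       v $ 2 = 0 \<and> pt l s = \<psi> (vec3 0 0 (v $ 3)) \<or>
       (\<exists>t' z. same_proj k t l t' \<and> \<not> same_param k t l t' \<and> \<bar>z\<bar> < e0 \<and> pt l s = pt l (t' + z))"
proof -
  obtain e where e: "e > 0"
    "\<And>z. \<bar>z\<bar> < e \<Longrightarrow> pt k (t + z) = pt k t + min z 0 *\<^sub>R dL k t + max z 0 *\<^sub>R dR k t"
    "\<And>z. 0 < z \<Longrightarrow> z < e \<Longrightarrow> dR k (t + z) = dR k t \<and> t + z \<notin> \<int>"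
    "\<And>z. - e < z \<Longrightarrow> z < 0 \<Longrightarrow> dR k (t + z) = dL k t \<and> t + z \<notin> \<int>"
    by (rule pt_local[of k t]) blast
  have ax: "pt k (t + z) = \<psi> (vec3 0 0 z)" if "\<bar>z\<bar> < e" for z
    using e(2)[OF that] by (simp add: \<psi>_def bent_chart_def)
  obtain \<eta> where \<eta>: "\<eta> > 0" "\<And>l s. l < length Ps \<Longrightarrow> \<bar>pt l s $ 1 - pt k t $ 1\<bar> < \<eta> \<Longrightarrow> \<bar>pt l s $ 2 - pt k t $ 2\<bar> < \<eta> \<Longrightarrow>
      \<exists>t' z. same_proj k t l t' \<and> \<bar>z\<bar> < min e e0 \<and> same_param l s l (t' + z)"
    using near_fibre[OF k, of "min e e0" t] e(1) e0 by auto
  let ?N = "{v. \<bar>\<psi> v $ 1 - pt k t $ 1\<bar> < \<eta> \<and> \<bar>\<psi> v $ 2 - pt k t $ 2\<bar> < \<eta>}"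
  have "open ?N"
    unfolding \<psi>_def by (intro open_Collect_conj open_Collect_less continuous_intros continuous_on_bent_chart)
  moreover have "0 \<in> ?N" using \<eta>(1) by (simp add: \<psi>_def)
  ultimately obtain \<delta> where \<delta>: "\<delta> > 0" "fat_box 0 0 \<delta> \<subseteq> ?N" by (rule fat_box_in_open)
  have inj: "\<psi> v = \<psi> w \<Longrightarrow> v = w" for v w
    using inj_bent_chart[OF det, of "pt k t"] unfolding \<psi>_def by (rule injD)
  have shift: "\<psi> (vec3 a (v $ 2) (v $ 3)) = \<psi> v + (a - v $ 1) *\<^sub>R e3" for a v
    by (simp add: \<psi>_def bent_chart_def algebra_simps)
  show ?thesis
  proof (rule that)
    show "min \<delta> e > 0" using \<delta>(1) e(1) by simp
    show "pt k (t + z) = \<psi> (vec3 0 0 z)" if "\<bar>z\<bar> < min \<delta> e" for z using ax that by simp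
    show "dR k (t + z) = dR k t" if "0 < z" "z < min \<delta> e" for z using e(3) that by simp
    show "dR k (t + z) = dL k t" if "- min \<delta> e < z" "z < 0" for z using e(4)[of z] that by linarith
    fix v l s assume v: "\<bar>v $ 2\<bar> < min \<delta> e" "\<bar>v $ 3\<bar> < min \<delta> e" and l: "l < length Ps"
      and p: "pt l s $ 1 = \<psi> v $ 1" "pt l s $ 2 = \<psi> v $ 2"
    have "vec3 0 (v $ 2) (v $ 3) \<in> fat_box 0 0 \<delta>"
      using v \<delta>(1) by (auto simp: ibox_def forall_3 abs_less_iff)
    then have "vec3 0 (v $ 2) (v $ 3) \<in> ?N" using \<delta>(2) by blast
    then have "\<bar>pt l s $ 1 - pt k t $ 1\<bar> < \<eta>" "\<bar>pt l s $ 2 - pt k t $ 2\<bar> < \<eta>"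
      unfolding p by (simp_all add: shift)
    then obtain t' z where tz: "same_proj k t l t'" "\<bar>z\<bar> < min e e0" "same_param l s l (t' + z)"
      using \<eta>(2)[OF l] by blast
    have pz: "pt l s = pt l (t' + z)" using same_paramD[OF tz(3)] by blast
    show "v $ 2 = 0 \<and> pt l s = \<psi> (vec3 0 0 (v $ 3)) \<or>
       (\<exists>t' z. same_proj k t l t' \<and> \<not> same_param k t l t' \<and> \<bar>z\<bar> < e0 \<and> pt l s = pt l (t' + z))"
    proof (cases "same_param k t l t'")
      case False
      then show ?thesis using tz pz by auto
    next
      case True
      then obtain m :: int where m: "k = l" "t = t' + of_int (m * len k)" by (auto simp: same_param_def)
      have "pt l s = pt k (t' + z + of_int (m * len k))" unfolding pz pt_period using m(1) by simp
      also have "t' + z + of_int (m * len k) = t + z" using m(2) by simp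
      also have "pt k (t + z) = \<psi> (vec3 0 0 z)" using tz(2) by (intro ax) simp
      finally have q: "pt l s = \<psi> (vec3 0 0 z)" .
      define x where "x = \<psi> v $ 3 - pt l s $ 3"
      have "\<psi> (vec3 x 0 z) = \<psi> (vec3 0 0 z) + x *\<^sub>R e3"
        using shift[of x "vec3 0 0 z"] by simp
      also have "\<dots> = \<psi> v" using p unfolding q[symmetric] by (simp add: vec3_eq_iff x_def)
      finally have "vec3 x 0 z = v" by (rule inj)
      then have "v $ 2 = 0" "v $ 3 = z" by auto
      then show ?thesis using q by simp
    qed
  qed
qed

definition visible :: "nat \<Rightarrow> real \<Rightarrow> bool" where
  "visible k t \<longleftrightarrow> (\<forall>l<length Ps. \<forall>t'. same_proj k t l t' \<longrightarrow> \<not> same_param k t l t' \<longrightarrow> pt l t' $ 3 < pt k t $ 3)"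

text \<open>
  At most one other strand passes below, and it stays below by a definite amount.
\<close>

lemma visible_gap:
  assumes k: "k < length Ps" and v: "visible k t"
  obtains e0 g where "e0 > 0" "g > 0"
    "\<And>l t' z. l < length Ps \<Longrightarrow> same_proj k t l t' \<Longrightarrow> \<not> same_param k t l t' \<Longrightarrow> \<bar>z\<bar> < e0 \<Longrightarrow>
       pt l (t' + z) $ 3 < pt k t $ 3 - g"
proof (cases "\<exists>l t'. l < length Ps \<and> same_proj k t l t' \<and> \<not> same_param k t l t'")
  case False
  then show ?thesis using that[of 1 1] by auto
next
  case True
  then obtain l t' where l: "l < length Ps" "same_proj k t l t'" "\<not> same_param k t l t'" by blast
  define g where "g = (pt k t $ 3 - pt l t' $ 3) / 2"
  have g: "g > 0" using v l by (auto simp: visible_def g_def)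
  have "continuous_on UNIV (\<lambda>s. pt l s $ 3)" by (intro continuous_on_component continuous_on_pt)
  then have "open {s. pt l s $ 3 < pt k t $ 3 - g}"
    by (intro open_Collect_less continuous_on_const)
  moreover have "t' \<in> {s. pt l s $ 3 < pt k t $ 3 - g}" using g by (simp add: g_def field_simps)
  ultimately obtain e where e: "e > 0" "ball t' e \<subseteq> {s. pt l s $ 3 < pt k t $ 3 - g}"
    using open_contains_ball by metis
  show ?thesis
  proof (rule that[OF e(1) g])
    fix l2 t2 z assume l2: "l2 < length Ps" "same_proj k t l2 t2" "\<not> same_param k t l2 t2" and z: "\<bar>z\<bar> < e"
    have "same_param l2 t2 l t'" by (rule fibre_two[OF k l2(1) l(1) l2(2) l(2) l2(3) l(3)])
    then obtain m :: int where m: "l2 = l" "t2 = t' + of_int (m * len l2)" by (auto simp: same_param_def)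
    have "pt l2 (t2 + z) = pt l ((t' + z) + of_int (m * len l))" using m by (simp add: algebra_simps)
    also have "\<dots> = pt l (t' + z)" by (rule pt_period)
    finally have "pt l2 (t2 + z) = pt l (t' + z)" .
    moreover have "t' + z \<in> ball t' e" using z by (simp add: dist_real_def)
    ultimately show "pt l2 (t2 + z) $ 3 < pt k t $ 3 - g" using e(2) by auto
  qed
qed

text \<open>The colour of the diagram at the parameter \<open>s\<close>, for the orientation given by the parametrisation.\<close>

definition Mer :: "nat \<Rightarrow> real \<Rightarrow> quat \<Rightarrow> bool" where
  "Mer k s x \<longleftrightarrow> (\<forall>u. det2 (dR k s) u > 0 \<longrightarrow> mer (pt k s) u x)"

text \<open>
  Away from the vertex the link is straight, so the colour computed with the sideways direction \<open>u\<close> of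
  the chart is the same for all directions on that side of the link.
\<close>

lemma tube_direction:
  assumes \<psi>: "\<psi> = bent_chart a d1 d2 u" and det: "det2 d1 u > 0" "det2 d2 u > 0" and \<delta>: "\<delta> > 0"
    and P: "\<And>v. v \<in> cyl \<delta> \<delta> \<Longrightarrow> \<psi> v \<in> P \<longleftrightarrow> v \<in> z_axis"
    and z: "0 < \<bar>z\<bar>" "\<bar>z\<bar> < \<delta>" and O: "\<psi> (vec3 0 0 z) \<notin> Om"
    and m: "mer (\<psi> (vec3 0 0 z)) u x" and u': "det2 (if z < 0 then d1 else d2) u' > 0"
  shows "mer (\<psi> (vec3 0 0 z)) u' x"
proof (rule mer_direction[OF O _ _ _ _ u' m])
  let ?V = "cyl \<delta> \<delta> \<inter> {v. 0 < z * v $ 3}"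
  have "open ?V" by (intro open_Int open_cyl open_Collect_less continuous_intros)
  moreover have "inj_on \<psi> ?V" unfolding \<psi> by (rule inj_on_subset[OF inj_bent_chart[OF det]]) simp
  moreover have "continuous_on ?V \<psi>" unfolding \<psi> by (rule continuous_on_bent_chart)
  ultimately show "open (\<psi> ` ?V)" by (intro invariance_of_domain)
  have "vec3 0 0 z \<in> ?V" using z \<delta> by (auto simp: cyl_def zero_less_mult_iff)
  then show "\<psi> (vec3 0 0 z) \<in> \<psi> ` ?V" by blast
  show "det2 (if z < 0 then d1 else d2) u > 0" using det by simp
  fix p assume p: "p \<in> \<psi> ` ?V" "p \<in> P"
  then obtain v where v: "p = \<psi> v" "v \<in> cyl \<delta> \<delta>" "0 < z * v $ 3" by blast
  then have "v \<in> z_axis" using P p(2) by blast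
  then have "v = vec3 0 0 (v $ 3)" by (simp add: z_axis_def vec3_eq_iff)
  then have "p = \<psi> (vec3 0 0 (v $ 3))" using v(1) by simp
  also have "\<dots> = \<psi> (vec3 0 0 z) + (v $ 3 - z) *\<^sub>R (if z < 0 then d1 else d2)"
    using v(3) z(1) by (cases "z < 0") (auto simp: \<psi> bent_chart_def zero_less_mult_iff algebra_simps)
  finally show "\<exists>t. p = \<psi> (vec3 0 0 z) + t *\<^sub>R (if z < 0 then d1 else d2)" by blast
qed

text \<open>
  A direction on the positive side of both edges at \<open>t\<close> gives a chart that follows the link and is not
  covered by other strands.
\<close>

lemma jump_at_visible:
  assumes k: "k < length Ps" and v: "visible k t"
  obtains x \<delta> where "x \<in> S1_B" "\<delta> > 0" "\<And>z. - \<delta> < z \<Longrightarrow> z < 0 \<Longrightarrow> Mer k (t + z) x"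
    "\<And>z. 0 < z \<Longrightarrow> z < \<delta> \<Longrightarrow> Mer k (t + z) (if pt k t \<in> Om then - x else x)"
proof -
  obtain u where u: "det2 (dL k t) u > 0" "det2 (dR k t) u > 0"
    using side_vector[OF dL_not_vertical[OF k] dR_not_vertical[OF k]] not_folded[OF k] by metis
  define \<psi> where "\<psi> = bent_chart (pt k t) (dL k t) (dR k t) u"
  obtain e0 g where g: "e0 > 0" "g > 0"
    "\<And>l t' z. l < length Ps \<Longrightarrow> same_proj k t l t' \<Longrightarrow> \<not> same_param k t l t' \<Longrightarrow> \<bar>z\<bar> < e0 \<Longrightarrow>
       pt l (t' + z) $ 3 < pt k t $ 3 - g"
    by (rule visible_gap[OF k v]) blast
  obtain \<delta>1 where \<delta>1: "\<delta>1 > 0" "\<And>z. \<bar>z\<bar> < \<delta>1 \<Longrightarrow> pt k (t + z) = \<psi> (vec3 0 0 z)"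
    "\<And>z. 0 < z \<Longrightarrow> z < \<delta>1 \<Longrightarrow> dR k (t + z) = dR k t" "\<And>z. - \<delta>1 < z \<Longrightarrow> z < 0 \<Longrightarrow> dR k (t + z) = dL k t"
    "\<And>v l s. \<bar>v $ 2\<bar> < \<delta>1 \<Longrightarrow> \<bar>v $ 3\<bar> < \<delta>1 \<Longrightarrow> l < length Ps \<Longrightarrow> pt l s $ 1 = \<psi> v $ 1 \<Longrightarrow> pt l s $ 2 = \<psi> v $ 2 \<Longrightarrow>
       v $ 2 = 0 \<and> pt l s = \<psi> (vec3 0 0 (v $ 3)) \<or>
       (\<exists>t' z. same_proj k t l t' \<and> \<not> same_param k t l t' \<and> \<bar>z\<bar> < e0 \<and> pt l s = pt l (t' + z))"
    by (rule column[OF k u g(1), folded \<psi>_def]) blast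
  obtain \<delta>2 where \<delta>2: "\<delta>2 > 0" "\<And>z. 0 < \<bar>z\<bar> \<Longrightarrow> \<bar>z\<bar> < \<delta>2 \<Longrightarrow> pt k (t + z) \<notin> Om"
    by (rule near_off_arc[OF k, of t]) blast
  have "open {v. pt k t $ 3 - g < \<psi> v $ 3}"
    unfolding \<psi>_def by (intro open_Collect_less continuous_intros continuous_on_bent_chart)
  moreover have "0 \<in> {v. pt k t $ 3 - g < \<psi> v $ 3}" using g(2) by (simp add: \<psi>_def)
  ultimately obtain \<delta>3 where \<delta>3: "\<delta>3 > 0" "fat_box 0 0 \<delta>3 \<subseteq> {v. pt k t $ 3 - g < \<psi> v $ 3}"
    by (rule fat_box_in_open)
  define \<delta> where "\<delta> = min \<delta>1 (min \<delta>2 \<delta>3)"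
  have \<delta>: "\<delta> > 0" "\<delta> \<le> \<delta>1" "\<delta> \<le> \<delta>2" "\<delta> \<le> \<delta>3" using \<delta>1(1) \<delta>2(1) \<delta>3(1) by (auto simp: \<delta>_def)
  have above: "pt k t $ 3 - g < \<psi> v $ 3" if "v \<in> cyl \<delta> \<delta>" for v
  proof -
    have "v \<in> fat_box 0 0 \<delta>3"
      using cyl_bounds[OF \<delta>(1) that] \<delta>(4) by (auto simp: ibox_def forall_3 abs_less_iff)
    then show ?thesis using \<delta>3(2) by blast
  qed
  have pts: "v $ 2 = 0 \<and> p = \<psi> (vec3 0 0 (v $ 3)) \<or> p $ 3 < \<psi> v $ 3"
    if v: "v \<in> cyl \<delta> \<delta>" and p: "p \<in> P" "p $ 1 = \<psi> v $ 1" "p $ 2 = \<psi> v $ 2" for v p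
  proof -
    obtain l s where ls: "l < length Ps" "p = pt l s" using p(1) by (rule in_PE)
    have vb: "\<bar>v $ 2\<bar> < \<delta>1" "\<bar>v $ 3\<bar> < \<delta>1" using cyl_bounds[OF \<delta>(1) v] \<delta>(2) by auto
    from \<delta>1(5)[OF vb ls(1)] p(2,3) consider "v $ 2 = 0 \<and> p = \<psi> (vec3 0 0 (v $ 3))"
      | t' z where "same_proj k t l t'" "\<not> same_param k t l t'" "\<bar>z\<bar> < e0" "p = pt l (t' + z)"
      unfolding ls(2) by blast
    then show ?thesis
    proof cases
      case 2
      then have "p $ 3 < pt k t $ 3 - g" using g(3)[OF ls(1)] by simp
      then show ?thesis using above[OF v] by simp
    qed blast
  qed
  have lift: "\<psi> v = \<psi> (vec3 0 0 (v $ 3)) + v $ 1 *\<^sub>R e3" if "v $ 2 = 0" for v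
    using that by (simp add: \<psi>_def bent_chart_def)
  have Piff: "\<psi> v \<in> P \<longleftrightarrow> v \<in> z_axis" if v: "v \<in> cyl \<delta> \<delta>" for v
  proof
    assume "\<psi> v \<in> P"
    then have "v $ 2 = 0 \<and> \<psi> v = \<psi> (vec3 0 0 (v $ 3))" using pts[OF v, of "\<psi> v"] by auto
    then show "v \<in> z_axis" using lift[of v] by (simp add: z_axis_def vec3_eq_iff)
  next
    assume "v \<in> z_axis"
    then have "v = vec3 0 0 (v $ 3)" by (simp add: z_axis_def vec3_eq_iff)
    then have "\<psi> v = pt k (t + v $ 3)" using \<delta>1(2)[of "v $ 3"] cyl_bounds(3)[OF \<delta>(1) v] \<delta>(2) by simp
    then show "\<psi> v \<in> P" using pt_in_P[OF k] by simp
  qed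
  have Omax: "\<psi> (vec3 0 0 z) \<notin> Om" if "0 < \<bar>z\<bar>" "\<bar>z\<bar> < \<delta>" for z
    using \<delta>1(2)[of z] \<delta>2(2)[of z] that \<delta> by simp
  have Om: "v = 0" if "v \<in> cyl \<delta> \<delta>" "v \<in> z_axis" "\<psi> v \<in> Om" for v
  proof -
    have e: "v = vec3 0 0 (v $ 3)" using that(2) by (simp add: z_axis_def vec3_eq_iff)
    then have "v $ 3 = 0" using Omax[of "v $ 3"] that(3) cyl_bounds(3)[OF \<delta>(1) that(1)] by auto
    then show ?thesis using e by (simp add: vec3_eq_iff)
  qed
  have vis: "\<psi> v \<in> T" if v: "v \<in> cyl \<delta> \<delta>" "v $ 1 > 0" for v
    unfolding T_def
  proof (intro CollectI ballI impI)
    fix p assume "p \<in> P" "p $ 1 = \<psi> v $ 1 \<and> p $ 2 = \<psi> v $ 2"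
    then have "v $ 2 = 0 \<and> p = \<psi> (vec3 0 0 (v $ 3)) \<or> p $ 3 < \<psi> v $ 3" by (intro pts[OF v(1)]) auto
    then show "p $ 3 < \<psi> v $ 3" using lift[of v] v(2) by auto
  qed
  note conv = tube_direction[OF \<psi>_def u \<delta>(1) Piff]
  show ?thesis
  proof (rule jump_visible[OF u \<delta>(1), of "pt k t", folded \<psi>_def, OF Piff Om vis])
    fix x x' assume x: "x \<in> S1_B" "x' = (if pt k t \<in> Om then - x else x)"
      and m: "\<And>z. - \<delta> < z \<Longrightarrow> z < 0 \<Longrightarrow> mer (\<psi> (vec3 0 0 z)) u x"
        "\<And>z. 0 < z \<Longrightarrow> z < \<delta> \<Longrightarrow> mer (\<psi> (vec3 0 0 z)) u x'"
    show thesis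
    proof (rule that[OF x(1) \<delta>(1)])
      fix z assume z: "- \<delta> < z" "z < 0"
      then have z': "0 < \<bar>z\<bar>" "\<bar>z\<bar> < \<delta>" "\<bar>z\<bar> < \<delta>1" "- \<delta>1 < z" using \<delta> by auto
      have "mer (\<psi> (vec3 0 0 z)) u' x" if "det2 (dR k (t + z)) u' > 0" for u'
        using that \<delta>1(4)[OF z'(4) z(2)] z by (intro conv[OF _ z'(1,2) Omax[OF z'(1,2)] m(1)[OF z]]) auto
      then show "Mer k (t + z) x" unfolding Mer_def \<delta>1(2)[OF z'(3)] by blast
    next
      fix z assume z: "0 < z" "z < \<delta>"
      then have z': "0 < \<bar>z\<bar>" "\<bar>z\<bar> < \<delta>" "\<bar>z\<bar> < \<delta>1" "z < \<delta>1" using \<delta> by auto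
      have "mer (\<psi> (vec3 0 0 z)) u' x'" if "det2 (dR k (t + z)) u' > 0" for u'
        using that \<delta>1(3)[OF z(1) z'(4)] z by (intro conv[OF _ z'(1,2) Omax[OF z'(1,2)] m(2)[OF z]]) auto
      then show "Mer k (t + z) (if pt k t \<in> Om then - x else x)"
        unfolding Mer_def \<delta>1(2)[OF z'(3)] x(2)[symmetric] by blast
    qed
  qed
qed

text \<open>
  The sideways direction of the chart is chosen parallel to the upper strand, which becomes a coordinate
  line.  The colour of the upper strand is read off at the parameter \<open>t' + z0\<close> shortly before the
  crossing, away from the arc.
\<close>

lemma jump_at_under:
  assumes k: "k < length Ps" and l: "l < length Ps" and sp: "same_proj k t l t'" and under: "pt k t $ 3 < pt l t' $ 3"
    and K: "K \<in> S1_B" "\<delta>K > 0" "\<And>z. - \<delta>K < z \<Longrightarrow> z < 0 \<Longrightarrow> Mer l (t' + z) K"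
  shows "\<exists>x \<delta>. x \<in> S1_B \<and> \<delta> > 0 \<and> (\<forall>z. - \<delta> < z \<and> z < 0 \<longrightarrow> Mer k (t + z) x) \<and>
    (\<forall>z. 0 < z \<and> z < \<delta> \<longrightarrow> Mer k (t + z) (if pt k t \<in> Om then - (K * x * qcnj K) else K * x * qcnj K))"
proof -
  have n: "\<not> same_param k t l t'" using under same_paramD by fastforce
  note tr = transversal[OF k l sp n]
  define d w where "d = dR k t" and "w = dR l t'"
  have dd: "dL k t = d" "dR k t = d" and ww: "dL l t' = w" "dR l t' = w"
    using dL_eq_dR tr by (auto simp: d_def w_def)
  \<comment> \<open>the sign of the crossing\<close>
  define \<sigma> where "\<sigma> = sgn (det2 d w)"
  have \<sigma>: "\<sigma> = 1 \<or> \<sigma> = - 1" "\<sigma> * \<sigma> = 1" using tr(3) by (auto simp: \<sigma>_def sgn_if d_def w_def)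
  define u where "u = \<sigma> *\<^sub>R w"
  have det: "det2 d u > 0"
  proof -
    have "det2 d u = \<sigma> * det2 d w" by (simp add: det2_def u_def algebra_simps)
    then show ?thesis using tr(3) by (auto simp: \<sigma>_def sgn_if d_def w_def)
  qed
  define h where "h = pt l t' $ 3 - pt k t $ 3"
  have h: "h > 0" using under by (simp add: h_def)
  define \<psi> where "\<psi> = bent_chart (pt k t) d d u"
  obtain el where el: "el > 0"
    "\<And>z. \<bar>z\<bar> < el \<Longrightarrow> pt l (t' + z) = pt l t' + min z 0 *\<^sub>R dL l t' + max z 0 *\<^sub>R dR l t'"
    "\<And>z. 0 < z \<Longrightarrow> z < el \<Longrightarrow> dR l (t' + z) = dR l t' \<and> t' + z \<notin> \<int>"
    "\<And>z. - el < z \<Longrightarrow> z < 0 \<Longrightarrow> dR l (t' + z) = dL l t' \<and> t' + z \<notin> \<int>"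
    by (rule pt_local[of l t']) blast
  have over: "pt l (t' + z) = \<psi> (vec3 h (- (\<sigma> * z)) 0)" if "\<bar>z\<bar> < el" for z
  proof -
    have "min z 0 *\<^sub>R w + max z 0 *\<^sub>R w = z *\<^sub>R w"
      by (cases "z \<le> 0") (simp_all add: min_def max_def)
    then have "pt l (t' + z) = pt l t' + z *\<^sub>R w"
      using el(2)[OF that] unfolding ww by (simp add: add.assoc)
    moreover have "pt l t' = pt k t + h *\<^sub>R e3"
      using sp by (simp add: vec3_eq_iff same_proj_def h_def)
    moreover have "(\<sigma> * z) *\<^sub>R u = z *\<^sub>R w" using \<sigma>(2) by (simp add: u_def mult.assoc mult.left_commute[of \<sigma> z])
    ultimately show ?thesis by (simp add: \<psi>_def bent_chart_straight)
  qed
  have u2: "det2 (dL k t) u > 0" "det2 (dR k t) u > 0" using det dd by auto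
  obtain \<delta>1 where \<delta>1: "\<delta>1 > 0" "\<And>z. \<bar>z\<bar> < \<delta>1 \<Longrightarrow> pt k (t + z) = \<psi> (vec3 0 0 z)"
    "\<And>z. 0 < z \<Longrightarrow> z < \<delta>1 \<Longrightarrow> dR k (t + z) = d" "\<And>z. - \<delta>1 < z \<Longrightarrow> z < 0 \<Longrightarrow> dR k (t + z) = d"
    "\<And>v l s. \<bar>v $ 2\<bar> < \<delta>1 \<Longrightarrow> \<bar>v $ 3\<bar> < \<delta>1 \<Longrightarrow> l < length Ps \<Longrightarrow> pt l s $ 1 = \<psi> v $ 1 \<Longrightarrow> pt l s $ 2 = \<psi> v $ 2 \<Longrightarrow>
       v $ 2 = 0 \<and> pt l s = \<psi> (vec3 0 0 (v $ 3)) \<or>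
       (\<exists>t' z. same_proj k t l t' \<and> \<not> same_param k t l t' \<and> \<bar>z\<bar> < el \<and> pt l s = pt l (t' + z))"
    by (rule column[OF k u2 el(1), unfolded dd, folded \<psi>_def]) blast
  obtain \<delta>2 where \<delta>2: "\<delta>2 > 0" "\<And>z. 0 < \<bar>z\<bar> \<Longrightarrow> \<bar>z\<bar> < \<delta>2 \<Longrightarrow> pt k (t + z) \<notin> Om"
    by (rule near_off_arc[OF k, of t]) blast
  obtain \<delta>3 where \<delta>3: "\<delta>3 > 0" "\<And>z. 0 < \<bar>z\<bar> \<Longrightarrow> \<bar>z\<bar> < \<delta>3 \<Longrightarrow> pt l (t' + z) \<notin> Om"
    by (rule near_off_arc[OF l, of t']) blast
  define \<delta> where "\<delta> = min (min \<delta>1 \<delta>2) (min el (h / 2))"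
  have \<delta>: "\<delta> > 0" "\<delta> \<le> \<delta>1" "\<delta> \<le> \<delta>2" "\<delta> \<le> el" "\<delta> < h"
    using \<delta>1(1) \<delta>2(1) el(1) h by (auto simp: \<delta>_def)
  have inj: "\<psi> v = \<psi> v' \<Longrightarrow> v = v'" for v v'
    using inj_bent_chart[OF det det, of "pt k t"] unfolding \<psi>_def by (rule injD)
  have Piff: "\<psi> v \<in> P \<longleftrightarrow> v $ 1 = 0 \<and> v $ 2 = 0 \<or> v $ 1 = h \<and> v $ 3 = 0"
    if v: "- \<delta> < v $ 1" "\<bar>v $ 2\<bar> < \<delta>" "\<bar>v $ 3\<bar> < \<delta>" for v
  proof
    assume "\<psi> v \<in> P"
    then obtain l2 s where ls: "l2 < length Ps" "\<psi> v = pt l2 s" by (rule in_PE)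
    have vb: "\<bar>v $ 2\<bar> < \<delta>1" "\<bar>v $ 3\<bar> < \<delta>1" using v \<delta>(2) by auto
    have "pt l2 s $ 1 = \<psi> v $ 1" "pt l2 s $ 2 = \<psi> v $ 2" using ls(2) by auto
    from \<delta>1(5)[OF vb ls(1) this] consider "v $ 2 = 0" "pt l2 s = \<psi> (vec3 0 0 (v $ 3))"
      | t2 z where "same_proj k t l2 t2" "\<not> same_param k t l2 t2" "\<bar>z\<bar> < el" "pt l2 s = pt l2 (t2 + z)"
      by blast
    then show "v $ 1 = 0 \<and> v $ 2 = 0 \<or> v $ 1 = h \<and> v $ 3 = 0"
    proof cases
      case 1
      then have "v = vec3 0 0 (v $ 3)" using ls(2) inj by metis
      then show ?thesis by (simp add: vec3_eq_iff)
    next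
      case 2
      have "same_param l2 t2 l t'" by (rule fibre_two[OF k ls(1) l 2(1) sp 2(2) n])
      then obtain m :: int where m: "l2 = l" "t2 = t' + of_int (m * len l2)" by (auto simp: same_param_def)
      have "pt l2 (t2 + z) = pt l ((t' + z) + of_int (m * len l))" using m by (simp add: algebra_simps)
      also have "\<dots> = pt l (t' + z)" by (rule pt_period)
      also have "\<dots> = \<psi> (vec3 h (- (\<sigma> * z)) 0)" by (rule over[OF 2(3)])
      finally have "v = vec3 h (- (\<sigma> * z)) 0" using 2(4) ls(2) inj by metis
      then show ?thesis by (simp add: vec3_eq_iff)
    qed
  next
    assume "v $ 1 = 0 \<and> v $ 2 = 0 \<or> v $ 1 = h \<and> v $ 3 = 0"
    then show "\<psi> v \<in> P"
    proof
      assume "v $ 1 = 0 \<and> v $ 2 = 0"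
      then have "v = vec3 0 0 (v $ 3)" by (simp add: vec3_eq_iff)
      then have "\<psi> v = pt k (t + v $ 3)" using \<delta>1(2)[of "v $ 3"] v \<delta>(2) by simp
      then show ?thesis using pt_in_P[OF k] by simp
    next
      assume "v $ 1 = h \<and> v $ 3 = 0"
      moreover have "- (\<sigma> * - (\<sigma> * v $ 2)) = v $ 2" using \<sigma>(2) by (simp flip: mult.assoc)
      ultimately have e: "v = vec3 h (- (\<sigma> * - (\<sigma> * v $ 2))) 0" by (simp add: vec3_eq_iff)
      have "\<bar>- (\<sigma> * v $ 2)\<bar> < el" using \<sigma>(1) v \<delta>(4) by auto
      from over[OF this] e have "\<psi> v = pt l (t' + - (\<sigma> * v $ 2))" by simp
      then show ?thesis using pt_in_P[OF l] by simp
    qed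
  qed
  have Omax: "\<psi> (vec3 0 0 z) \<notin> Om" if "0 < \<bar>z\<bar>" "\<bar>z\<bar> < \<delta>" for z
    using \<delta>1(2)[of z] \<delta>2(2)[of z] that \<delta> by simp
  have Om: "v = 0" if "v \<in> cyl \<delta> \<delta>" "v \<in> z_axis" "\<psi> v \<in> Om" for v
  proof -
    have e: "v = vec3 0 0 (v $ 3)" using that(2) by (simp add: z_axis_def vec3_eq_iff)
    then have "v $ 3 = 0" using Omax[of "v $ 3"] that(3) cyl_bounds(3)[OF \<delta>(1) that(1)] by auto
    then show ?thesis using e by (simp add: vec3_eq_iff)
  qed
  define z0 where "z0 = - (min (min \<delta> el) (min \<delta>K \<delta>3) / 2)"
  have z0: "z0 < 0" "- \<delta> < z0" "- el < z0" "- \<delta>K < z0" "- \<delta>3 < z0"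
    using \<delta>(1) el(1) K(2) \<delta>3(1) by (auto simp: z0_def)
  define c where "c = - (\<sigma> * z0)"
  have c: "\<bar>c\<bar> < \<delta>" using z0 \<sigma>(1) by (auto simp: c_def)
  have bc: "\<psi> (vec3 h c 0) = pt l (t' + z0)" using over[of z0] z0 by (simp add: c_def)
  have cO: "\<psi> (vec3 h c 0) \<notin> Om" unfolding bc using \<delta>3(2)[of z0] z0 by simp
  have \<tau>: "- \<sigma> = 1 \<or> - \<sigma> = - 1" using \<sigma>(1) by auto
  have "dR l (t' + z0) = w" using el(4)[of z0] z0 ww by simp
  moreover have "det2 w (- \<sigma> *\<^sub>R d) > 0"
  proof -
    have "det2 w (- \<sigma> *\<^sub>R d) = det2 d u" by (simp add: det2_def u_def algebra_simps)
    then show ?thesis using det by simp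
  qed
  ultimately have m: "mer (\<psi> (vec3 h c 0)) (- \<sigma> *\<^sub>R d) K"
    using K(3)[of z0] z0 unfolding bc Mer_def by simp
  obtain x where x: "x \<in> S1_B" "\<And>z. - \<delta> < z \<Longrightarrow> z < 0 \<Longrightarrow> mer (\<psi> (vec3 0 0 z)) u x"
    "\<And>z. 0 < z \<Longrightarrow> z < \<delta> \<Longrightarrow> mer (\<psi> (vec3 0 0 z)) u (if pt k t \<in> Om then - (K * x * qcnj K) else K * x * qcnj K)"
    using jump_under[OF \<psi>_def det \<delta>(1,5) Piff Om c cO \<tau> m K(1)] by blast
  have Pcyl: "\<psi> v \<in> P \<longleftrightarrow> v \<in> z_axis" if v: "v \<in> cyl \<delta> \<delta>" for v
    using Piff[of v] cyl_bounds[OF \<delta>(1) v] \<delta>(5) by (auto simp: z_axis_def abs_less_iff)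
  note conv = tube_direction[OF \<psi>_def det det \<delta>(1) Pcyl]
  have "Mer k (t + z) x" if z: "- \<delta> < z" "z < 0" for z
  proof -
    have z': "0 < \<bar>z\<bar>" "\<bar>z\<bar> < \<delta>" "\<bar>z\<bar> < \<delta>1" "- \<delta>1 < z" using \<delta> z by auto
    have "mer (\<psi> (vec3 0 0 z)) u' x" if "det2 (dR k (t + z)) u' > 0" for u'
      using that \<delta>1(4)[OF z'(4) z(2)] z by (intro conv[OF _ z'(1,2) Omax[OF z'(1,2)] x(2)[OF z]]) auto
    then show ?thesis unfolding Mer_def \<delta>1(2)[OF z'(3)] by blast
  qed
  moreover have "Mer k (t + z) (if pt k t \<in> Om then - (K * x * qcnj K) else K * x * qcnj K)" if z: "0 < z" "z < \<delta>" for z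
  proof -
    have z': "0 < \<bar>z\<bar>" "\<bar>z\<bar> < \<delta>" "\<bar>z\<bar> < \<delta>1" "z < \<delta>1" using \<delta> z by auto
    have "mer (\<psi> (vec3 0 0 z)) u' (if pt k t \<in> Om then - (K * x * qcnj K) else K * x * qcnj K)"
      if "det2 (dR k (t + z)) u' > 0" for u'
      using that \<delta>1(3)[OF z(1) z'(4)] z by (intro conv[OF _ z'(1,2) Omax[OF z'(1,2)] x(3)[OF z]]) auto
    then show ?thesis unfolding Mer_def \<delta>1(2)[OF z'(3)] by blast
  qed
  ultimately show ?thesis using x(1) \<delta>(1) by blast
qed

end

section \<open>A vanishing minor\<close>

lemma insert_index_image: "r < n \<Longrightarrow> bij_betw (insert_index r) {..<n - 1} ({..<n} - {r})"
proof (rule bij_betwI[where g = "\<lambda>i. if i < r then i else i - 1"])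
qed (auto simp: insert_index_def split: if_splits)

text \<open>
  A vanishing minor gives a relation between the rows other than \<open>r\<close>, valid in all columns other than
  \<open>c\<close>.  It is valid in column \<open>c\<close> as well, because the columns add up to zero.  Dividing by the greatest
  common divisor makes one of its coefficients odd.
\<close>

lemma odd_row_relation:
  fixes M :: "int mat"
  assumes M: "M \<in> carrier_mat n n" and rows: "\<And>i. i < n \<Longrightarrow> (\<Sum>j<n. M $$ (i, j)) = 0"
    and rc: "r < n" "c < n" and det: "Determinant.det (mat_delete M r c) = 0"
  obtains w :: "nat \<Rightarrow> int" where "w r = 0" "\<exists>i<n. odd (w i)" "\<And>j. j < n \<Longrightarrow> (\<Sum>i<n. w i * M $$ (i, j)) = 0"
proof -
  obtain n' where n': "n = Suc n'" using rc by (cases n) auto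
  have D: "mat_delete M r c \<in> carrier_mat n' n'" using mat_delete_carrier[OF M] n' by simp
  then have DT: "transpose_mat (mat_delete M r c) \<in> carrier_mat n' n'" by simp
  have "Determinant.det (transpose_mat (mat_delete M r c)) = 0"
    using det Determinant.det_transpose[OF D] by simp
  then obtain v where v: "v \<in> carrier_vec n'" "v \<noteq> 0\<^sub>v n'" "transpose_mat (mat_delete M r c) *\<^sub>v v = 0\<^sub>v n'"
    using Determinant.det_0_iff_vec_prod_zero[OF DT] by blast
  have vj: "(\<Sum>i<n'. vec_index v i * M $$ (insert_index r i, insert_index c j)) = 0" if j: "j < n'" for j
  proof -
    have "vec_index (transpose_mat (mat_delete M r c) *\<^sub>v v) j = 0" using v(3) j by simp
    moreover have "vec_index (transpose_mat (mat_delete M r c) *\<^sub>v v) j =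
        (\<Sum>i<n'. mat_delete M r c $$ (i, j) * vec_index v i)"
      using carrier_matD[OF D] carrier_vecD[OF v(1)] j
      by (simp add: mult_mat_vec_def scalar_prod_def lessThan_atLeast0)
    moreover have "mat_delete M r c $$ (i, j) = M $$ (insert_index r i, insert_index c j)" if "i < n'" for i
      using mat_delete_index[of M n' r c i j] M rc n' j that by simp
    ultimately show ?thesis by (simp add: mult.commute)
  qed
  define w0 where "w0 i = (if i = r then 0 else vec_index v (if i < r then i else i - 1))" for i
  have ins: "w0 (insert_index r i) = vec_index v i" for i
    by (auto simp: w0_def insert_index_def)
  have sum_ins: "(\<Sum>i<n. w0 i * f i) = (\<Sum>i<n'. vec_index v i * f (insert_index r i))" for f :: "nat \<Rightarrow> int"
  proof -
    have "(\<Sum>i<n. w0 i * f i) = (\<Sum>i\<in>{..<n} - {r}. w0 i * f i)"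
      by (rule sum.mono_neutral_right) (auto simp: w0_def)
    also have "\<dots> = (\<Sum>i<n'. w0 (insert_index r i) * f (insert_index r i))"
      using sum.reindex_bij_betw[OF insert_index_image[OF rc(1)], of "\<lambda>i. w0 i * f i"] n' by simp
    finally show ?thesis by (simp add: ins)
  qed
  have col: "(\<Sum>i<n. w0 i * M $$ (i, j)) = 0" if "j < n" "j \<noteq> c" for j
  proof -
    have "j \<in> insert_index c ` {..<n'}"
      using insert_index_image[OF rc(2)] that n' by (simp add: bij_betw_def)
    then obtain j' where "j' < n'" "j = insert_index c j'" by auto
    then show ?thesis using vj by (simp add: sum_ins)
  qed
  have "(\<Sum>j<n. \<Sum>i<n. w0 i * M $$ (i, j)) = (\<Sum>i<n. w0 i * (\<Sum>j<n. M $$ (i, j)))"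
    by (subst sum.swap) (simp add: sum_distrib_left)
  also have "\<dots> = 0" using rows by simp
  finally have "(\<Sum>j<n. \<Sum>i<n. w0 i * M $$ (i, j)) = 0" .
  moreover have "(\<Sum>j<n. \<Sum>i<n. w0 i * M $$ (i, j)) = (\<Sum>j\<in>{c}. \<Sum>i<n. w0 i * M $$ (i, j))"
    by (rule sum.mono_neutral_right) (use rc col in auto)
  ultimately have w0: "(\<Sum>i<n. w0 i * M $$ (i, j)) = 0" if "j < n" for j
    using col that by (cases "j = c") auto
  define g where "g = Gcd (w0 ` {..<n})"
  have "\<exists>i<n'. vec_index v i \<noteq> 0" using v(1,2) by (metis carrier_vecD eq_vecI index_zero_vec)
  then obtain i0 where "i0 < n'" "w0 (insert_index r i0) \<noteq> 0" using ins by metis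
  moreover have "insert_index r i0 < n" using \<open>i0 < n'\<close> n' by (simp add: insert_index_def)
  ultimately have g0: "g \<noteq> 0" unfolding g_def by (auto simp: Gcd_0_iff)
  have gd: "g dvd w0 i" if "i < n" for i using that by (simp add: g_def)
  define w where "w i = (if i < n then w0 i div g else 0)" for i
  have gw: "w0 i = g * w i" if "i < n" for i using gd[OF that] that by (simp add: w_def)
  show ?thesis
  proof (rule that)
    show "w r = 0" by (simp add: w_def w0_def)
    show "\<exists>i<n. odd (w i)"
    proof (rule ccontr)
      assume "\<not> ?thesis"
      then have "g * 2 dvd w0 i" if "i < n" for i using gw[OF that] that by (metis dvd_triv_left mult_dvd_mono dvd_refl)
      then have "g * 2 dvd g" unfolding g_def by (intro Gcd_greatest) auto
      then obtain k where "g = g * 2 * k" by (rule dvdE)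
      then have "2 * k = 1" using g0 by simp
      then show False by presburger
    qed
    fix j assume "j < n"
    have "g * (\<Sum>i<n. w i * M $$ (i, j)) = (\<Sum>i<n. w0 i * M $$ (i, j))"
      by (simp add: sum_distrib_left gw mult.assoc)
    then show "(\<Sum>i<n. w i * M $$ (i, j)) = 0" using w0[OF \<open>j < n\<close>] g0 by simp
  qed
qed

section \<open>Angles\<close>

lemma S1_B_angle: "x \<in> S1_B \<Longrightarrow> \<exists>\<theta>. x = quatJ * exp_I \<theta>"
  by (auto simp: S1_B_def)

lemma quatJ_exp_I_eq_iff: "quatJ * exp_I a = quatJ * exp_I b \<longleftrightarrow> (\<exists>n::int. a = b + 2 * pi * n)"
  unfolding quatJ_exp_I by (auto simp: sin_cos_eq_iff[symmetric])

lemma quatJ_exp_I_uminus: "- (quatJ * exp_I a) = quatJ * exp_I (a + pi)"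
  unfolding quatJ_exp_I by (simp add: uminus_quat_def)

text \<open>
  Conjugation within \<open>S1_B\<close> is the reflection of angles.
\<close>

lemma quatJ_exp_I_conj:
  "(quatJ * exp_I a) * (quatJ * exp_I b) * qcnj (quatJ * exp_I a) = quatJ * exp_I (2 * a - b)"
proof -
  have "cos (2 * a - b) = (cos a * cos a - sin a * sin a) * cos b + 2 * sin a * cos a * sin b"
    "sin (2 * a - b) = 2 * sin a * cos a * cos b - (cos a * cos a - sin a * sin a) * sin b"
    by (simp_all add: cos_diff sin_diff cos_double sin_double power2_eq_square)
  then show ?thesis
    unfolding quatJ_exp_I by (simp add: times_quat_def qcnj_def algebra_simps)
qed

text \<open>A Wirtinger relation up to sign becomes a Fox relation modulo \<open>\<pi>\<close>, and the sign becomes a parity.\<close>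

lemma angle_relation:
  assumes "x = quatJ * exp_I a" "y = quatJ * exp_I b" "z = quatJ * exp_I c"
    and "z = (if s then - (x * y * qcnj x) else x * y * qcnj x)"
  shows "\<exists>m::int. 2 * a - b - c = pi * of_int m \<and> (odd m \<longleftrightarrow> s)"
proof -
  have "quatJ * exp_I c = quatJ * exp_I (2 * a - b + (if s then pi else 0))"
    using assms by (auto simp: quatJ_exp_I_conj quatJ_exp_I_uminus)
  then obtain n :: int where "c = 2 * a - b + (if s then pi else 0) + 2 * pi * n"
    unfolding quatJ_exp_I_eq_iff by blast
  then have "2 * a - b - c = pi * of_int (- 2 * n - (if s then 1 else 0))"
    by (simp add: algebra_simps)
  then show ?thesis by (intro exI[of _ "- 2 * n - (if s then 1 else 0)"]) auto
qed

section \<open>Colouring the diagram\<close>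

context diagram
begin

text \<open>
  The colour may be undefined at vertices, crossings and ends of the arc, but it is constant shortly
  before and shortly after every parameter.
\<close>

definition left_germ :: "nat \<Rightarrow> real \<Rightarrow> quat \<Rightarrow> bool" where
  "left_germ k t x \<longleftrightarrow> (\<exists>\<delta>>0. \<forall>z. - \<delta> < z \<and> z < 0 \<longrightarrow> Mer k (t + z) x)"
definition right_germ :: "nat \<Rightarrow> real \<Rightarrow> quat \<Rightarrow> bool" where
  "right_germ k t x \<longleftrightarrow> (\<exists>\<delta>>0. \<forall>z. 0 < z \<and> z < \<delta> \<longrightarrow> Mer k (t + z) x)"

definition lval :: "nat \<Rightarrow> real \<Rightarrow> quat" where "lval k t = (THE x. left_germ k t x)"
definition rval :: "nat \<Rightarrow> real \<Rightarrow> quat" where "rval k t = (THE x. right_germ k t x)"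

lemma Mer_unique:
  assumes k: "k < length Ps" and "Mer k s x" "Mer k s y" shows "x = y"
proof -
  let ?u = "vec3 (- dR k s $ 2) (dR k s $ 1) 0"
  have "det2 (dR k s) ?u = (dR k s $ 1)\<^sup>2 + (dR k s $ 2)\<^sup>2" by (simp add: det2_def power2_eq_square)
  then have "det2 (dR k s) ?u > 0" using dR_not_vertical[OF k, of s] by (simp add: sum_power2_gt_zero_iff)
  then show ?thesis using assms(2,3) mer_unique unfolding Mer_def by blast
qed

lemma left_germ_unique: "k < length Ps \<Longrightarrow> left_germ k t x \<Longrightarrow> left_germ k t y \<Longrightarrow> x = y"
proof -
  assume k: "k < length Ps" and "left_germ k t x" "left_germ k t y"
  then obtain a b where ab: "a > 0" "b > 0" "\<And>z. - a < z \<Longrightarrow> z < 0 \<Longrightarrow> Mer k (t + z) x"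
    "\<And>z. - b < z \<Longrightarrow> z < 0 \<Longrightarrow> Mer k (t + z) y" unfolding left_germ_def by blast
  define z where "z = - min a b / 2"
  have z: "- a < z" "- b < z" "z < 0" using ab(1,2) by (auto simp: z_def min_def)
  show ?thesis by (rule Mer_unique[OF k ab(3)[OF z(1,3)] ab(4)[OF z(2,3)]])
qed

lemma right_germ_unique: "k < length Ps \<Longrightarrow> right_germ k t x \<Longrightarrow> right_germ k t y \<Longrightarrow> x = y"
proof -
  assume k: "k < length Ps" and "right_germ k t x" "right_germ k t y"
  then obtain a b where ab: "a > 0" "b > 0" "\<And>z. 0 < z \<Longrightarrow> z < a \<Longrightarrow> Mer k (t + z) x"
    "\<And>z. 0 < z \<Longrightarrow> z < b \<Longrightarrow> Mer k (t + z) y" unfolding right_germ_def by blast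
  define z where "z = min a b / 2"
  have z: "z < a" "z < b" "0 < z" using ab(1,2) by (auto simp: z_def min_def)
  show ?thesis by (rule Mer_unique[OF k ab(3)[OF z(3,1)] ab(4)[OF z(3,2)]])
qed

lemma lval_eq: "k < length Ps \<Longrightarrow> left_germ k t x \<Longrightarrow> lval k t = x"
  unfolding lval_def using left_germ_unique by blast

lemma rval_eq: "k < length Ps \<Longrightarrow> right_germ k t x \<Longrightarrow> rval k t = x"
  unfolding rval_def using right_germ_unique by blast

lemma visible_jump:
  assumes k: "k < length Ps" and v: "visible k t"
  shows "left_germ k t (lval k t)" "right_germ k t (rval k t)" "lval k t \<in> S1_B"
    "rval k t = (if pt k t \<in> Om then - lval k t else lval k t)"
proof -
  have "\<exists>x. x \<in> S1_B \<and> left_germ k t x \<and> right_germ k t (if pt k t \<in> Om then - x else x)"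
    by (rule jump_at_visible[OF k v]) (unfold left_germ_def right_germ_def, blast)
  then obtain x where x: "x \<in> S1_B" "left_germ k t x" "right_germ k t (if pt k t \<in> Om then - x else x)" by blast
  show "left_germ k t (lval k t)" "right_germ k t (rval k t)" "lval k t \<in> S1_B"
    "rval k t = (if pt k t \<in> Om then - lval k t else lval k t)"
    using x lval_eq[OF k x(2)] rval_eq[OF k x(3)] by simp_all
qed

text \<open>
  There are no triple points.
\<close>

lemma over_visible:
  assumes k: "k < length Ps" and l: "l < length Ps" and sp: "same_proj k t l t'" and under: "pt k t $ 3 < pt l t' $ 3"
  shows "visible l t'"
  unfolding visible_def
proof (intro allI impI)
  fix m r assume m: "m < length Ps" and s: "same_proj l t' m r" "\<not> same_param l t' m r"
  have n: "\<not> same_param l t' k t" using under same_paramD by fastforce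
  have "same_proj l t' k t" using sp by (simp add: same_proj_def)
  then have "same_param m r k t" using fibre_two[OF l m k s(1) _ s(2) n] by blast
  then show "pt m r $ 3 < pt l t' $ 3" using under same_paramD by fastforce
qed

lemma under_jump:
  assumes k: "k < length Ps" and l: "l < length Ps" and sp: "same_proj k t l t'" and under: "pt k t $ 3 < pt l t' $ 3"
  defines "K \<equiv> lval l t'"
  shows "left_germ k t (lval k t)" "right_germ k t (rval k t)" "lval k t \<in> S1_B" "K \<in> S1_B"
    "rval k t = (if pt k t \<in> Om then - (K * lval k t * qcnj K) else K * lval k t * qcnj K)"
proof -
  have v: "visible l t'" by (rule over_visible[OF k l sp under])
  show KB: "K \<in> S1_B" using visible_jump[OF l v] by (simp add: K_def)
  have "left_germ l t' K" using visible_jump[OF l v] by (simp add: K_def)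
  then obtain \<delta> where \<delta>: "\<delta> > 0" "\<And>z. - \<delta> < z \<Longrightarrow> z < 0 \<Longrightarrow> Mer l (t' + z) K"
    unfolding left_germ_def by blast
  obtain x where x: "x \<in> S1_B" "left_germ k t x"
    "right_germ k t (if pt k t \<in> Om then - (K * x * qcnj K) else K * x * qcnj K)"
    using jump_at_under[OF k l sp under KB \<delta>] unfolding left_germ_def right_germ_def by metis
  show "left_germ k t (lval k t)" "right_germ k t (rval k t)" "lval k t \<in> S1_B"
    "rval k t = (if pt k t \<in> Om then - (K * lval k t * qcnj K) else K * lval k t * qcnj K)"
    using x lval_eq[OF k x(2)] rval_eq[OF k x(3)] by simp_all
qed

lemma not_visibleE:
  assumes k: "k < length Ps" and v: "\<not> visible k t"
  obtains l t' where "l < length Ps" "same_proj k t l t'" "pt k t $ 3 < pt l t' $ 3"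
proof -
  obtain l t' where l: "l < length Ps" "same_proj k t l t'" "\<not> same_param k t l t'" "\<not> pt l t' $ 3 < pt k t $ 3"
    using v by (auto simp: visible_def)
  have "pt l t' $ 3 \<noteq> pt k t $ 3"
  proof
    assume "pt l t' $ 3 = pt k t $ 3"
    then have "pt k t = pt l t'" using l(2) by (simp add: vec3_eq_iff same_proj_def)
    then show False using pt_inj[OF k l(1)] l(3) by blast
  qed
  then show ?thesis using l by (intro that[of l t']) auto
qed

lemma germs:
  assumes k: "k < length Ps"
  shows "left_germ k t (lval k t)" "right_germ k t (rval k t)" "lval k t \<in> S1_B" "rval k t \<in> S1_B"
proof -
  have "left_germ k t (lval k t) \<and> right_germ k t (rval k t) \<and> lval k t \<in> S1_B \<and> rval k t \<in> S1_B"
  proof (cases "visible k t")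
    case True
    then show ?thesis using visible_jump[OF k True] S1_B_uminus by auto
  next
    case False
    then obtain l t' where l: "l < length Ps" "same_proj k t l t'" "pt k t $ 3 < pt l t' $ 3"
      by (rule not_visibleE[OF k])
    note j = under_jump[OF k l]
    have "lval l t' \<in> BDset" using j(4) by blast
    then have "lval l t' * lval k t * qcnj (lval l t') \<in> S1_B" by (rule S1_B_conj[OF j(3)])
    then show ?thesis using j S1_B_uminus by auto
  qed
  then show "left_germ k t (lval k t)" "right_germ k t (rval k t)" "lval k t \<in> S1_B" "rval k t \<in> S1_B" by auto
qed

lemma dR_period: "dR k (t + of_int (m * len k)) = dR k t"
proof -
  have "\<lfloor>t + of_int (m * len k)\<rfloor> = \<lfloor>t\<rfloor> + m * len k" by (rule floor_shift)
  moreover have "edge k (\<lfloor>t\<rfloor> + m * len k) = edge k \<lfloor>t\<rfloor>"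
  proof -
    have "\<lfloor>t\<rfloor> + m * len k + 1 = (\<lfloor>t\<rfloor> + 1) + m * len k" by simp
    then show ?thesis unfolding edge_def by (simp only: vert_period)
  qed
  ultimately show ?thesis by (simp add: dR_def)
qed

lemma Mer_period: "Mer k (t + of_int (m * len k)) x \<longleftrightarrow> Mer k t x"
  unfolding Mer_def dR_period pt_period ..

lemma rval_period: "rval k (t + of_int (m * len k)) = rval k t"
proof -
  have "Mer k (t + of_int (m * len k) + z) x \<longleftrightarrow> Mer k (t + z) x" for z x
    using Mer_period[of k "t + z" m x] by (simp add: algebra_simps)
  then show ?thesis unfolding rval_def right_germ_def by simp
qed

lemma rval_near:
  assumes k: "k < length Ps"
  shows "\<exists>\<delta>>0. \<forall>s. t < s \<and> s < t + \<delta> \<longrightarrow> rval k s = rval k t"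
    "\<exists>\<delta>>0. \<forall>s. t - \<delta> < s \<and> s < t \<longrightarrow> rval k s = lval k t"
proof -
  obtain \<delta> where \<delta>: "\<delta> > 0" "\<And>z. 0 < z \<Longrightarrow> z < \<delta> \<Longrightarrow> Mer k (t + z) (rval k t)"
    using germs(2)[OF k] unfolding right_germ_def by blast
  have "rval k s = rval k t" if s: "t < s" "s < t + \<delta>" for s
  proof (rule rval_eq[OF k])
    have "Mer k (s + z) (rval k t)" if "0 < z" "z < t + \<delta> - s" for z
      using \<delta>(2)[of "s - t + z"] that s by simp
    then show "right_germ k s (rval k t)"
      unfolding right_germ_def using s by (intro exI[of _ "t + \<delta> - s"]) auto
  qed
  with \<delta>(1) show "\<exists>\<delta>>0. \<forall>s. t < s \<and> s < t + \<delta> \<longrightarrow> rval k s = rval k t" by blast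
  obtain \<delta> where \<delta>: "\<delta> > 0" "\<And>z. - \<delta> < z \<Longrightarrow> z < 0 \<Longrightarrow> Mer k (t + z) (lval k t)"
    using germs(1)[OF k] unfolding left_germ_def by blast
  have "rval k s = lval k t" if s: "t - \<delta> < s" "s < t" for s
  proof (rule rval_eq[OF k])
    have "Mer k (s + z) (lval k t)" if "0 < z" "z < t - s" for z
      using \<delta>(2)[of "s - t + z"] that s by simp
    then show "right_germ k s (lval k t)"
      unfolding right_germ_def using s by (intro exI[of _ "t - s"]) auto
  qed
  with \<delta>(1) show "\<exists>\<delta>>0. \<forall>s. t - \<delta> < s \<and> s < t \<longrightarrow> rval k s = lval k t" by blast
qed

text \<open>Under these conditions the colour is locally constant, and intervals are connected.\<close>

lemma rval_const:
  assumes k: "k < length Ps" and ab: "a < b" and v: "\<And>t. a < t \<Longrightarrow> t < b \<Longrightarrow> visible k t \<and> pt k t \<notin> Om"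
  shows "lval k b = rval k a"
proof -
  have loc: "\<forall>\<^sub>F s in at t within {a<..<b}. rval k t = rval k s" if t: "t \<in> {a<..<b}" for t
  proof -
    obtain \<delta>1 where \<delta>1: "\<delta>1 > 0" "\<And>s. t < s \<Longrightarrow> s < t + \<delta>1 \<Longrightarrow> rval k s = rval k t"
      using rval_near(1)[OF k] by blast
    obtain \<delta>2 where \<delta>2: "\<delta>2 > 0" "\<And>s. t - \<delta>2 < s \<Longrightarrow> s < t \<Longrightarrow> rval k s = lval k t"
      using rval_near(2)[OF k] by blast
    have e: "lval k t = rval k t" using visible_jump(4)[OF k, of t] v[of t] t by simp
    have "rval k s = rval k t" if "dist s t < min \<delta>1 \<delta>2" for s
      using \<delta>1(2)[of s] \<delta>2(2)[of s] e that by (cases "s < t"; cases "s = t") (auto simp: dist_real_def)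
    note m = this
    have p: "min \<delta>1 \<delta>2 > 0" using \<delta>1(1) \<delta>2(1) by simp
    show ?thesis
      unfolding eventually_at
    proof (intro exI conjI ballI impI)
      show "min \<delta>1 \<delta>2 > 0" by (rule p)
      fix s assume "s \<noteq> t \<and> dist s t < min \<delta>1 \<delta>2"
      then show "rval k t = rval k s" using m[of s] by argo
    qed
  qed
  obtain \<delta>1 where \<delta>1: "\<delta>1 > 0" "\<And>s. a < s \<Longrightarrow> s < a + \<delta>1 \<Longrightarrow> rval k s = rval k a"
    using rval_near(1)[OF k] by blast
  obtain \<delta>2 where \<delta>2: "\<delta>2 > 0" "\<And>s. b - \<delta>2 < s \<Longrightarrow> s < b \<Longrightarrow> rval k s = lval k b"
    using rval_near(2)[OF k] by blast
  define s1 s2 where "s1 = a + min \<delta>1 (b - a) / 2" and "s2 = b - min \<delta>2 (b - a) / 2"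
  have s1: "a < s1" "s1 < a + \<delta>1" "s1 < b" and s2: "b - \<delta>2 < s2" "s2 < b" "a < s2"
    using \<delta>1(1) \<delta>2(1) ab by (auto simp: s1_def s2_def min_def field_simps)
  have "rval k s1 = rval k s2"
    by (rule connected_local_const[of "{a<..<b}"]) (use s1 s2 loc in auto)
  then show ?thesis using \<delta>1(2)[OF s1(1,2)] \<delta>2(2)[OF s2(1,2)] by simp
qed

lemma rval_arc:
  assumes k: "k < length Ps" and ab: "a < b" and v: "\<And>t. a < t \<Longrightarrow> t < b \<Longrightarrow> visible k t"
    and one: "\<And>s t. a < s \<Longrightarrow> s < b \<Longrightarrow> a < t \<Longrightarrow> t < b \<Longrightarrow> pt k s \<in> Om \<Longrightarrow> pt k t \<in> Om \<Longrightarrow> s = t"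
  shows "lval k b = (if \<exists>t. a < t \<and> t < b \<and> pt k t \<in> Om then - rval k a else rval k a)"
proof (cases "\<exists>t. a < t \<and> t < b \<and> pt k t \<in> Om")
  case False
  then have "lval k b = rval k a" by (intro rval_const[OF k ab]) (use v in auto)
  then show ?thesis unfolding if_not_P[OF False] .
next
  case True
  then obtain t where t: "a < t" "t < b" "pt k t \<in> Om" by blast
  have "lval k t = rval k a"
  proof (rule rval_const[OF k t(1)])
    fix s assume s: "a < s" "s < t"
    then show "visible k s \<and> pt k s \<notin> Om" using v[of s] one[of s t] t by auto
  qed
  moreover have "lval k b = rval k t"
  proof (rule rval_const[OF k t(2)])
    fix s assume s: "t < s" "s < b"
    then show "visible k s \<and> pt k s \<notin> Om" using v[of s] one[of s t] t by auto
  qed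
  moreover have "rval k t = - lval k t" using visible_jump(4)[OF k v[OF t(1,2)]] t(3) by simp
  ultimately show ?thesis using True by simp
qed

end

section \<open>Fox relations around a connecting arc\<close>

context diagram
begin

lemma crosses_under_iff:
  "crosses_under Ps (k, s) (l, t) \<longleftrightarrow> (k, s) \<in> params Ps \<and> (l, t) \<in> params Ps \<and> same_proj k s l t \<and> pt k s $ 3 < pt l t $ 3"
proof -
  have "link_point Ps (k, s) = pt k s" if "(k, s) \<in> params Ps" for k s
    using that pt_link_point by (simp add: params_iff)
  then show ?thesis
    by (auto simp: crosses_under_def proj_fibre_def xy_proj_def same_proj_def)
qed

lemma undercrossings_iff: "(k, s) \<in> undercrossings Ps \<longleftrightarrow> (k, s) \<in> params Ps \<and> \<not> visible k s"
proof
  assume "(k, s) \<in> undercrossings Ps"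
  then obtain l t where lt: "crosses_under Ps (k, s) (l, t)" by (auto simp: undercrossings_def)
  then have c: "(k, s) \<in> params Ps" "l < length Ps" "same_proj k s l t" "pt k s $ 3 < pt l t $ 3"
    by (auto simp: crosses_under_iff params_iff)
  then have "\<not> same_param k s l t" using same_paramD by fastforce
  then show "(k, s) \<in> params Ps \<and> \<not> visible k s"
    using c unfolding visible_def by fastforce
next
  assume a: "(k, s) \<in> params Ps \<and> \<not> visible k s"
  then have k: "k < length Ps" by (simp add: params_iff)
  obtain l t where l: "l < length Ps" "same_proj k s l t" "pt k s $ 3 < pt l t $ 3"
    using not_visibleE[OF k] a by blast
  have "pt l (red l t) = pt l t" using same_paramD[OF red_same] by blast
  then have "crosses_under Ps (k, s) (l, red l t)"
    using a l red_in_params by (auto simp: crosses_under_iff same_proj_def)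
  then show "(k, s) \<in> undercrossings Ps" by (auto simp: undercrossings_def)
qed

lemma over_point_crosses:
  assumes "(k, s) \<in> undercrossings Ps"
  shows "crosses_under Ps (k, s) (over_point Ps (k, s))"
proof -
  obtain v where v: "crosses_under Ps (k, s) v" using assms by (auto simp: undercrossings_def)
  have uniq: "v' = v" if "crosses_under Ps (k, s) v'" for v'
  proof -
    obtain l t l' t' where vv: "v = (l, t)" "v' = (l', t')" by fastforce
    have a: "k < length Ps" "l < length Ps" "same_proj k s l t" "\<not> same_param k s l t"
      using v same_paramD unfolding vv crosses_under_iff params_iff by fastforce+
    have b: "l' < length Ps" "same_proj k s l' t'" "\<not> same_param k s l' t'"
      using that same_paramD unfolding vv crosses_under_iff params_iff by fastforce+
    have sp: "same_param l' t' l t" by (rule fibre_two[OF a(1) b(1) a(2) b(2) a(3) b(3) a(4)])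
    then have "l' = l" using same_paramD by blast
    moreover have "t' = t"
      using same_param_range[OF a(2), of t' t] sp v that unfolding vv crosses_under_iff params_iff \<open>l' = l\<close>
      by (auto simp: abs_less_iff)
    ultimately show ?thesis using vv by simp
  qed
  show ?thesis unfolding over_point_def by (rule theI[where P = "crosses_under Ps (k, s)", OF v]) (fact uniq)
qed

lemma visible_period: "visible k (t + of_int (m * len k)) \<longleftrightarrow> visible k t"
proof -
  have "same_param k (t + of_int (m * len k)) k t" by (auto simp: same_param_def)
  then have "same_param k (t + of_int (m * len k)) l t' \<longleftrightarrow> same_param k t l t'" for l t'
    using same_param_trans same_param_sym by blast
  then show ?thesis unfolding visible_def same_proj_def pt_period by simp
qed

definition U :: "nat \<Rightarrow> real set" where "U k = {s. (k, s) \<in> undercrossings Ps}"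

lemma U_range: "s \<in> U k \<Longrightarrow> k < length Ps \<and> 0 \<le> s \<and> s < of_int (len k)"
  unfolding U_def undercrossings_iff params_iff by blast

definition before :: "nat \<Rightarrow> real \<Rightarrow> real" where
  "before k t = (if \<exists>s\<in>U k. s < t then Max {s \<in> U k. s < t} else Max (U k))"

lemma arc_before_eq: "arc_before Ps (k, t) = (k, before k t)"
proof -
  have "({s \<in> U k. s < t} \<noteq> {}) \<longleftrightarrow> (\<exists>s\<in>U k. s < t)" by blast
  then show ?thesis
    unfolding arc_before_def before_def Let_def fst_conv snd_conv U_def[of k, symmetric] by (simp only:)
qed

end

text \<open>
  Every component meets the connecting arc in one point, at the parameter \<open>\<tau> k\<close>.
\<close>

locale crossing_diagram = diagram +
  fixes \<tau> :: "nat \<Rightarrow> real"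
  assumes U_finite: "finite (undercrossings Ps)"
    and U_ne: "\<And>k. k < length Ps \<Longrightarrow> \<exists>s. (k, s) \<in> undercrossings Ps"
    and \<tau>: "\<And>k. k < length Ps \<Longrightarrow> 0 \<le> \<tau> k" "\<And>k. k < length Ps \<Longrightarrow> \<tau> k < of_int (len k)"
      "\<And>k. k < length Ps \<Longrightarrow> pt k (\<tau> k) \<in> Om"
    and \<tau>_unique: "\<And>k t. k < length Ps \<Longrightarrow> pt k t \<in> Om \<Longrightarrow> same_param k t k (\<tau> k)"
begin

lemma finite_U: "finite (U k)"
proof -
  have "U k = (\<lambda>s. (k, s)) -` undercrossings Ps" by (auto simp: U_def)
  then show ?thesis using U_finite by (simp add: finite_vimageI inj_on_def)
qed

lemma before_less:
  assumes "\<exists>s\<in>U k. s < t"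
  shows "before k t \<in> U k" "before k t < t" "\<And>s. s \<in> U k \<Longrightarrow> s < t \<Longrightarrow> s \<le> before k t"
proof -
  let ?E = "{s \<in> U k. s < t}"
  have E: "finite ?E" "?E \<noteq> {}" using assms finite_U by auto
  have "Max ?E \<in> ?E" by (rule Max_in[OF E])
  moreover have b: "before k t = Max ?E" using assms by (simp add: before_def)
  ultimately show "before k t \<in> U k" "before k t < t" by auto
  show "s \<le> before k t" if "s \<in> U k" "s < t" for s
    unfolding b using that E by (intro Max_ge) auto
qed

lemma before_wrap:
  assumes k: "k < length Ps" and n: "\<not> (\<exists>s\<in>U k. s < t)"
  shows "before k t \<in> U k" "\<And>s. s \<in> U k \<Longrightarrow> s \<le> before k t" "t \<le> before k t"
proof -
  have E: "finite (U k)" "U k \<noteq> {}" using U_ne[OF k] finite_U by (auto simp: U_def)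
  have b: "before k t = Max (U k)" using n by (simp add: before_def)
  show m: "before k t \<in> U k" unfolding b by (rule Max_in[OF E])
  show "s \<le> before k t" if "s \<in> U k" for s unfolding b using that E by (intro Max_ge)
  show "t \<le> before k t" using n m by force
qed

lemma before_in_U: "k < length Ps \<Longrightarrow> before k t \<in> U k"
  using before_less(1) before_wrap(1) by blast

text \<open>
  Whether the connecting arc ends on the arc of the diagram that arrives at \<open>t\<close>, where the endpoint \<open>t\<close>
  is excluded in \<open>hit\<close> and included in \<open>hit'\<close>.  If there is no undercrossing before \<open>t\<close> in the
  period, the arc of the diagram began in the previous period.
\<close>

definition hit :: "nat \<Rightarrow> real \<Rightarrow> bool" where
  "hit k t \<longleftrightarrow> (if \<exists>s\<in>U k. s < t then before k t < \<tau> k \<and> \<tau> k < t else \<tau> k < t \<or> before k t < \<tau> k)"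

definition hit' :: "nat \<Rightarrow> real \<Rightarrow> bool" where
  "hit' k t \<longleftrightarrow> (if \<exists>s\<in>U k. s < t then before k t < \<tau> k \<and> \<tau> k \<le> t else \<tau> k \<le> t \<or> before k t < \<tau> k)"

lemma hit'_eq: "k < length Ps \<Longrightarrow> hit' k t \<longleftrightarrow> (hit k t \<noteq> (\<tau> k = t))"
  using before_less(2)[of k t] before_wrap(3)[of k t] unfolding hit_def hit'_def by force

lemma Om_iff:
  assumes k: "k < length Ps" and t: "0 \<le> t" "t < of_int (len k)"
  shows "pt k t \<in> Om \<longleftrightarrow> t = \<tau> k"
  using \<tau>_unique[OF k, of t] same_param_range[OF k, of t "\<tau> k"] \<tau>[OF k] t by (auto simp: abs_less_iff)

lemma Om_close:
  assumes k: "k < length Ps" and "pt k s \<in> Om" "pt k t \<in> Om" "\<bar>s - t\<bar> < of_int (len k)"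
  shows "s = t"
proof -
  have "same_param k s k t"
    using \<tau>_unique[OF k assms(2)] \<tau>_unique[OF k assms(3)] same_param_trans same_param_sym by blast
  then show ?thesis using assms(4) by (rule same_param_range[OF k])
qed

lemma visible_iff: "k < length Ps \<Longrightarrow> 0 \<le> t \<Longrightarrow> t < of_int (len k) \<Longrightarrow> visible k t \<longleftrightarrow> t \<notin> U k"
  by (auto simp: U_def undercrossings_iff params_iff)

text \<open>
  The colour at the end of an arc of the diagram is the one at its beginning, up to the sign that it
  receives if the connecting arc ends on it.
\<close>

lemma lval_before:
  assumes k: "k < length Ps" and t: "0 \<le> t" "t < of_int (len k)"
  shows "lval k t = (if hit k t then - rval k (before k t) else rval k (before k t))"
proof (cases "\<exists>s\<in>U k. s < t")
  case True
  let ?b = "before k t"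
  note b = before_less[OF True]
  have b0: "0 \<le> ?b" using U_range[OF b(1)] by simp
  have "lval k t = (if \<exists>r. ?b < r \<and> r < t \<and> pt k r \<in> Om then - rval k ?b else rval k ?b)"
  proof (rule rval_arc[OF k b(2)])
    fix r assume r: "?b < r" "r < t"
    then have "r \<notin> U k" using b(3)[of r] by auto
    then show "visible k r" using visible_iff[OF k, of r] r b0 t by auto
  next
    fix r s assume "?b < r" "r < t" "?b < s" "s < t" "pt k r \<in> Om" "pt k s \<in> Om"
    then show "r = s" using b0 t by (intro Om_close[OF k]) (auto simp: abs_less_iff)
  qed
  moreover have "(\<exists>r. ?b < r \<and> r < t \<and> pt k r \<in> Om) \<longleftrightarrow> hit k t"
  proof
    assume "\<exists>r. ?b < r \<and> r < t \<and> pt k r \<in> Om"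
    then obtain r where r: "?b < r" "r < t" "pt k r \<in> Om" by blast
    then have "r = \<tau> k" using Om_iff[OF k, of r] b0 t by auto
    then show "hit k t" using r True by (simp add: hit_def)
  next
    assume "hit k t"
    then show "\<exists>r. ?b < r \<and> r < t \<and> pt k r \<in> Om" using True \<tau>(3)[OF k] by (auto simp: hit_def)
  qed
  ultimately show ?thesis by simp
next
  case False
  let ?b = "before k t"
  note b = before_wrap[OF k False]
  let ?n = "real_of_int (len k)"
  let ?a = "?b + of_int (-1 * len k)"
  have bn: "0 \<le> ?b" "?b < ?n" using U_range[OF b(1)] by auto
  have a: "?a = ?b - ?n" by simp
  have per: "pt k (r + of_int (1 * len k)) = pt k r" "visible k (r + of_int (1 * len k)) \<longleftrightarrow> visible k r" for r
    by (rule pt_period, rule visible_period)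
  have per': "pt k (r + ?n) = pt k r" "visible k (r + ?n) \<longleftrightarrow> visible k r" for r
    using per[of r] by simp_all
  have "lval k t = (if \<exists>r. ?a < r \<and> r < t \<and> pt k r \<in> Om then - rval k ?a else rval k ?a)"
  proof (rule rval_arc[OF k])
    show "?a < t" unfolding a using bn t by simp
    fix r assume r: "?a < r" "r < t"
    show "visible k r"
    proof (cases "0 \<le> r")
      case True
      then have "r \<notin> U k" using False r by auto
      then show ?thesis using visible_iff[OF k True] r t by auto
    next
      case neg: False
      then have "r + ?n \<notin> U k" using b(2)[of "r + ?n"] r unfolding a by auto
      then show ?thesis using visible_iff[OF k, of "r + ?n"] per'(2)[of r] r neg bn unfolding a by auto
    qed
  next
    fix r s assume "?a < r" "r < t" "?a < s" "s < t" "pt k r \<in> Om" "pt k s \<in> Om"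
    then show "r = s" using b(3) by (intro Om_close[OF k]) (auto simp: abs_less_iff)
  qed
  moreover have "(\<exists>r. ?a < r \<and> r < t \<and> pt k r \<in> Om) \<longleftrightarrow> hit k t"
  proof
    assume "\<exists>r. ?a < r \<and> r < t \<and> pt k r \<in> Om"
    then obtain r where r: "?a < r" "r < t" "pt k r \<in> Om" by blast
    show "hit k t"
    proof (cases "0 \<le> r")
      case True
      then have "r = \<tau> k" using Om_iff[OF k True] r t by auto
      then show ?thesis using r False by (simp add: hit_def)
    next
      case neg: False
      then have "r + ?n = \<tau> k" using Om_iff[OF k, of "r + ?n"] r per'(1)[of r] bn unfolding a by auto
      then show ?thesis using r False unfolding a by (auto simp: hit_def)
    qed
  next
    assume "hit k t"
    then consider "\<tau> k < t" | "?b < \<tau> k" using False by (auto simp: hit_def)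
    then show "\<exists>r. ?a < r \<and> r < t \<and> pt k r \<in> Om"
    proof cases
      case 1
      then show ?thesis using \<tau>[OF k] bn unfolding a by (intro exI[of _ "\<tau> k"]) auto
    next
      case 2
      have "pt k (\<tau> k - ?n) \<in> Om" using \<tau>(3)[OF k] per'(1)[of "\<tau> k - ?n"] by simp
      then show ?thesis using 2 \<tau>[OF k] t unfolding a by (intro exI[of _ "\<tau> k - ?n"]) auto
    qed
  qed
  moreover have "rval k ?a = rval k ?b" by (rule rval_period)
  ultimately show ?thesis by simp
qed

text \<open>
  The arcs of the diagram, with their final endpoints, partition the component, and the connecting arc
  ends on one of them.
\<close>

lemma hit_once:
  assumes k: "k < length Ps"
  shows "\<exists>!s. s \<in> U k \<and> hit' k s"
proof -
  have U: "finite (U k)" "U k \<noteq> {}" using U_ne[OF k] finite_U by (auto simp: U_def)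
  show ?thesis
  proof (cases "\<exists>s\<in>U k. \<tau> k \<le> s")
    case True
    let ?S = "{s \<in> U k. \<tau> k \<le> s}"
    define s where "s = Min ?S"
    have S: "finite ?S" "?S \<noteq> {}" using True U by auto
    have s: "s \<in> U k" "\<tau> k \<le> s" using Min_in[OF S] by (auto simp: s_def)
    have smin: "s \<le> r" if "r \<in> U k" "\<tau> k \<le> r" for r unfolding s_def using that S by (intro Min_le) auto
    show ?thesis
    proof (rule ex1I)
      have "hit' k s"
      proof (cases "\<exists>r\<in>U k. r < s")
        case True
        have "before k s < \<tau> k" using before_less[OF True] smin by force
        then show ?thesis using True s(2) by (simp add: hit'_def)
      qed (use s(2) in \<open>simp add: hit'_def\<close>)
      then show "s \<in> U k \<and> hit' k s" using s(1) by blast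
      fix r assume r: "r \<in> U k \<and> hit' k r"
      show "r = s"
      proof (cases "\<exists>q\<in>U k. q < r")
        case True
        then have h: "before k r < \<tau> k" "\<tau> k \<le> r" using r by (auto simp: hit'_def)
        have "s \<le> r" using smin r h(2) by blast
        moreover have "\<not> s < r" using before_less(3)[OF True s(1)] h(1) s(2) by auto
        ultimately show ?thesis by simp
      next
        case False
        then have "r \<le> s" using s(1) by force
        moreover have "\<tau> k \<le> r \<or> before k r < \<tau> k" using r False by (auto simp: hit'_def)
        moreover have "s \<le> before k r" using before_wrap(2)[OF k False s(1)] .
        ultimately have "\<tau> k \<le> r" using s(2) by linarith
        then have "s \<le> r" using smin r by blast
        then show ?thesis using \<open>r \<le> s\<close> by simp
      qed
    qed
  next
    case none: False
    define s where "s = Min (U k)"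
    have s: "s \<in> U k" unfolding s_def by (rule Min_in[OF U])
    have smin: "s \<le> r" if "r \<in> U k" for r unfolding s_def using that U by (intro Min_le)
    have low: "r < \<tau> k" if "r \<in> U k" for r using none that by force
    show ?thesis
    proof (rule ex1I)
      have no: "\<not> (\<exists>r\<in>U k. r < s)" using smin by force
      have "before k s < \<tau> k" by (rule low[OF before_in_U[OF k]])
      then show "s \<in> U k \<and> hit' k s" using s no by (simp add: hit'_def)
      fix r assume r: "r \<in> U k \<and> hit' k r"
      have "\<not> (\<exists>q\<in>U k. q < r)"
      proof
        assume "\<exists>q\<in>U k. q < r"
        then have "\<tau> k \<le> r" using r by (simp add: hit'_def)
        then show False using low r by force
      qed
      then have "\<not> s < r" using s by blast
      then show "r = s" using smin r by force
    qed
  qed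
qed

lemma before_inj:
  assumes k: "k < length Ps" and s: "s \<in> U k" "s' \<in> U k" "before k s = before k s'"
  shows "s = s'"
proof -
  have False if ss: "s \<in> U k" "s' \<in> U k" "s < s'" "before k s = before k s'" for s s'
  proof -
    have E: "\<exists>r\<in>U k. r < s'" using ss by blast
    note b' = before_less[OF E]
    have "s \<le> before k s'" using b'(3)[OF ss(1,3)] .
    moreover have "before k s < s \<or> s' \<le> before k s"
    proof (cases "\<exists>r\<in>U k. r < s")
      case True
      then show ?thesis using before_less(2) by blast
    next
      case False
      then show ?thesis using before_wrap(2)[OF k False ss(2)] by blast
    qed
    ultimately show False using ss(4) b'(2) by linarith
  qed
  then show ?thesis using s by (metis linorder_neqE)
qed

lemma rval_angle: obtains \<theta> where "\<And>k s. k < length Ps \<Longrightarrow> rval k s = quatJ * exp_I (\<theta> (k, s))"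
proof -
  have "\<forall>p. \<exists>\<theta>. fst p < length Ps \<longrightarrow> rval (fst p) (snd p) = quatJ * exp_I \<theta>"
    using germs(4) S1_B_angle by blast
  then obtain \<theta> where "\<forall>p. fst p < length Ps \<longrightarrow> rval (fst p) (snd p) = quatJ * exp_I (\<theta> p)" by metis
  then show ?thesis using that[of \<theta>] by auto
qed

text \<open>
  The sign in the relation has two sources: an end of the connecting arc on the incoming arc of the
  diagram, and one at the crossing itself.
\<close>

lemma fox_relation:
  assumes \<theta>: "\<And>k s. k < length Ps \<Longrightarrow> rval k s = quatJ * exp_I (\<theta> (k, s))"
    and u: "(k, s) \<in> undercrossings Ps"
  shows "\<exists>m::int. 2 * \<theta> (arc_before Ps (over_point Ps (k, s))) - \<theta> (arc_before Ps (k, s)) - \<theta> (k, s) = pi * of_int m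
    \<and> (odd m \<longleftrightarrow> hit' k s)"
proof -
  obtain l t where o: "over_point Ps (k, s) = (l, t)" by fastforce
  have c: "k < length Ps" "0 \<le> s" "s < of_int (len k)" "l < length Ps" "0 \<le> t" "t < of_int (len l)"
     "same_proj k s l t" "pt k s $ 3 < pt l t $ 3"
    using over_point_crosses[OF u] unfolding o crosses_under_iff params_iff by auto
  let ?X = "rval l (before l t)" and ?Y = "rval k (before k s)"
  have K: "lval l t \<doteq> ?X" using lval_before[OF c(4,5,6)] by (auto simp: eqpm_def)
  have Y: "lval k s = (if hit k s then - ?Y else ?Y)" by (rule lval_before[OF c(1-3)])
  have "rval k s = (if pt k s \<in> Om then - (lval l t * lval k s * qcnj (lval l t)) else lval l t * lval k s * qcnj (lval l t))"
    by (rule under_jump(5)[OF c(1,4,7,8)])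
  also have "lval l t * lval k s * qcnj (lval l t) = ?X * lval k s * qcnj ?X" by (rule eqpm_conj[OF K])
  finally have "rval k s = (if hit' k s then - (?X * ?Y * qcnj ?X) else ?X * ?Y * qcnj ?X)"
    using hit'_eq[OF c(1)] Om_iff[OF c(1-3)] Y by (auto split: if_splits)
  from angle_relation[OF \<theta>[OF c(4)] \<theta>[OF c(1)] \<theta>[OF c(1)] this] show ?thesis
    unfolding o arc_before_eq .
qed

lemma arc_before_in: "(k, s) \<in> params Ps \<Longrightarrow> arc_before Ps (k, s) \<in> undercrossings Ps"
  using before_in_U[of k s] by (simp add: arc_before_eq U_def params_iff)

lemma over_in_params: "(k, s) \<in> undercrossings Ps \<Longrightarrow> over_point Ps (k, s) \<in> params Ps"
  using over_point_crosses[of k s] by (cases "over_point Ps (k, s)") (simp add: crosses_under_iff)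

lemma fox_sum:
  fixes f :: "param \<Rightarrow> real"
  assumes u: "u \<in> undercrossings Ps"
  shows "(\<Sum>a\<in>undercrossings Ps. of_int (fox_entry Ps u a) * f a) =
     2 * f (arc_before Ps (over_point Ps u)) - f (arc_before Ps u) - f u"
proof -
  obtain k s where ks: "u = (k, s)" by fastforce
  have in1: "arc_before Ps u \<in> undercrossings Ps"
    using u arc_before_in undercrossings_iff unfolding ks by blast
  have in2: "arc_before Ps (over_point Ps u) \<in> undercrossings Ps"
    using over_in_params[of k s] u arc_before_in unfolding ks by (cases "over_point Ps (k, s)") auto
  have d: "(\<Sum>a\<in>undercrossings Ps. of_bool (a = b) * f a) = f b" if "b \<in> undercrossings Ps" for b
  proof -
    have "(\<Sum>a\<in>undercrossings Ps. of_bool (a = b) * f a) = (\<Sum>a\<in>undercrossings Ps. if a = b then f a else 0)"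
      by (rule sum.cong) auto
    then show ?thesis using sum.delta[OF U_finite, of b f] that by simp
  qed
  have "(\<Sum>a\<in>undercrossings Ps. of_int (fox_entry Ps u a) * f a) =
    (\<Sum>a\<in>undercrossings Ps. 2 * (of_bool (a = arc_before Ps (over_point Ps u)) * f a)
       - of_bool (a = arc_before Ps u) * f a - of_bool (a = u) * f a)"
    by (rule sum.cong) (simp_all add: fox_entry_def algebra_simps)
  also have "\<dots> = 2 * f (arc_before Ps (over_point Ps u)) - f (arc_before Ps u) - f u"
    using d[OF in1] d[OF in2] d[OF u] by (simp add: sum_subtractf flip: sum_distrib_left)
  finally show ?thesis .
qed

text \<open>
  Modulo 2 the over arc disappears from the matrix, and the column of an arc of the diagram contains only
  its two ends.  So a relation between the rows has coefficients of the same parity at neighbouring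
  undercrossings of a component.
\<close>

lemma parity_constant:
  fixes W :: "param \<Rightarrow> int"
  assumes col: "\<And>a. a \<in> undercrossings Ps \<Longrightarrow> (\<Sum>u\<in>undercrossings Ps. W u * fox_entry Ps u a) = 0"
    and s: "s \<in> U k" "s' \<in> U k"
  shows "even (W (k, s)) \<longleftrightarrow> even (W (k, s'))"
proof -
  have k: "k < length Ps" using U_range s by blast
  have step: "even (W (k, s)) \<longleftrightarrow> even (W (k, before k s))" if s: "s \<in> U k" for s
  proof -
    let ?UC = "undercrossings Ps" and ?a = "(k, before k s)"
    have ks: "(k, s) \<in> ?UC" "?a \<in> ?UC" using s before_in_U[OF k, of s] by (auto simp: U_def)
    have inj: "?a = arc_before Ps u \<longleftrightarrow> u = (k, s)" if "u \<in> ?UC" for u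
    proof (cases u)
      case (Pair l r)
      then show ?thesis using before_inj[OF k _ s, of r] that by (auto simp: arc_before_eq U_def)
    qed
    have "(\<Sum>u\<in>?UC. W u * fox_entry Ps u ?a) =
      2 * (\<Sum>u\<in>?UC. W u * of_bool (?a = arc_before Ps (over_point Ps u)))
        - (\<Sum>u\<in>?UC. W u * of_bool (?a = arc_before Ps u)) - (\<Sum>u\<in>?UC. W u * of_bool (?a = u))"
      unfolding fox_entry_def right_diff_distrib sum_subtractf sum_distrib_left by (simp add: mult.left_commute)
    moreover have "(\<Sum>u\<in>?UC. W u * of_bool (?a = arc_before Ps u)) = (\<Sum>u\<in>?UC. if u = (k, s) then W u else 0)"
      by (rule sum.cong) (auto simp: inj)
    moreover have "\<dots> = W (k, s)" using sum.delta[OF U_finite, of "(k, s)" W] ks by simp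
    moreover have "(\<Sum>u\<in>?UC. W u * of_bool (?a = u)) = (\<Sum>u\<in>?UC. if u = ?a then W u else 0)"
      by (rule sum.cong) auto
    moreover have "\<dots> = W ?a" using sum.delta[OF U_finite, of ?a W] ks by simp
    ultimately have "W (k, s) + W ?a = 2 * (\<Sum>u\<in>?UC. W u * of_bool (?a = arc_before Ps (over_point Ps u)))"
      using col[OF ks(2)] by simp
    then have "even (W (k, s) + W ?a)" by simp
    then show ?thesis by simp
  qed
  define m where "m = Min (U k)"
  have m: "m \<in> U k" unfolding m_def by (rule Min_in) (use finite_U s in auto)
  have "even (W (k, s)) \<longleftrightarrow> even (W (k, m))" if "s \<in> U k" for s
  proof (rule ccontr)
    assume n: "\<not> ?thesis"
    let ?S = "{s \<in> U k. even (W (k, s)) \<noteq> even (W (k, m))}"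
    have S: "finite ?S" "?S \<noteq> {}" using n that finite_U by auto
    define r where "r = Min ?S"
    have r: "r \<in> U k" "even (W (k, r)) \<noteq> even (W (k, m))" using Min_in[OF S] by (auto simp: r_def)
    have "m \<le> r" unfolding m_def using r(1) finite_U by (intro Min_le)
    then have "m < r" using r(2) by (cases "m = r") auto
    then have E: "\<exists>q\<in>U k. q < r" using m by blast
    have "before k r \<in> ?S" using before_less(1)[OF E] step[OF r(1)] r(2) by auto
    then have "r \<le> before k r" unfolding r_def by (rule Min_le[OF S(1)])
    then show False using before_less(2)[OF E] by simp
  qed
  then show ?thesis using s by blast
qed

text \<open>
  A vanishing minor gives integer coefficients \<open>W\<close> of a relation between the rows, not all even, and zero
  at one crossing.  With two components, \<open>W\<close> is odd exactly at the undercrossings of one of them.  The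
  Fox relations of the angles with right-hand sides \<open>\<pi> m u\<close> combine to \<open>\<Sum>u. W u * m u = 0\<close>.  But exactly
  one of these products is odd, because the connecting arc ends only once on that component.
\<close>

theorem fox_contradiction:
  assumes two: "length Ps = 2" and us: "distinct us" "set us = undercrossings Ps"
    and rc: "r < length us" "c < length us"
    and det: "Determinant.det (mat_delete (fox_matrix Ps us) r c) = 0"
  shows False
proof -
  let ?n = "length us" and ?UC = "undercrossings Ps"
  have bij: "bij_betw ((!) us) {..<?n} ?UC" using bij_betw_nth[OF us(1) refl, of ?UC] us(2) by simp
  have row: "(\<Sum>a\<in>?UC. fox_entry Ps u a) = 0" if "u \<in> ?UC" for u
    using fox_sum[OF that, of "\<lambda>_. 1"] by (simp flip: of_int_sum)
  obtain w where w: "w r = 0" "\<exists>i<?n. odd (w i)"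
    "\<And>j. j < ?n \<Longrightarrow> (\<Sum>i<?n. w i * fox_matrix Ps us $$ (i, j)) = 0"
  proof (rule odd_row_relation[OF _ _ rc det])
    show "fox_matrix Ps us \<in> carrier_mat ?n ?n" by (simp add: fox_matrix_def)
    fix i assume i: "i < ?n"
    then have "(\<Sum>j<?n. fox_matrix Ps us $$ (i, j)) = (\<Sum>j<?n. fox_entry Ps (us ! i) (us ! j))"
      by (simp add: fox_matrix_def)
    also have "\<dots> = (\<Sum>a\<in>?UC. fox_entry Ps (us ! i) a)" by (rule sum.reindex_bij_betw[OF bij])
    also have "\<dots> = 0" using row i us(2) nth_mem by blast
    finally show "(\<Sum>j<?n. fox_matrix Ps us $$ (i, j)) = 0" .
  qed blast
  define W where "W u = w (the_inv_into {..<?n} ((!) us) u)" for u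
  have W: "W (us ! i) = w i" if "i < ?n" for i
    using that bij by (simp add: W_def bij_betw_def the_inv_into_f_f)
  have col: "(\<Sum>u\<in>?UC. W u * fox_entry Ps u a) = 0" if a: "a \<in> ?UC" for a
  proof -
    obtain j where j: "j < ?n" "a = us ! j" using a us(2) by (metis in_set_conv_nth)
    have "(\<Sum>u\<in>?UC. W u * fox_entry Ps u a) = (\<Sum>i<?n. W (us ! i) * fox_entry Ps (us ! i) a)"
      by (rule sum.reindex_bij_betw[OF bij, symmetric])
    also have "\<dots> = (\<Sum>i<?n. w i * fox_matrix Ps us $$ (i, j))"
      by (rule sum.cong) (use j W in \<open>auto simp: fox_matrix_def\<close>)
    finally show ?thesis using w(3)[OF j(1)] by simp
  qed
  note par = parity_constant[of W, OF col]
  obtain k0 s0 where k0: "(k0, s0) \<in> ?UC" "odd (W (k0, s0))"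
    using w(2) W us(2) nth_mem by (metis surj_pair)
  obtain k1 s1 where k1: "(k1, s1) \<in> ?UC" "even (W (k1, s1))"
    using w(1) W[OF rc(1)] us(2) nth_mem[OF rc(1)] by (metis surj_pair even_zero)
  have U0: "s0 \<in> U k0" "s1 \<in> U k1" using k0 k1 by (auto simp: U_def)
  have "k0 \<noteq> k1" using par[OF _ U0(1), of s1] U0 k0 k1 by blast
  have odd_W: "odd (W (k, s)) \<longleftrightarrow> k = k0" if "(k, s) \<in> ?UC" for k s
  proof -
    have sU: "s \<in> U k" using that by (simp add: U_def)
    have "k = k0 \<or> k = k1"
      using U_range[OF sU] U_range[OF U0(1)] U_range[OF U0(2)] \<open>k0 \<noteq> k1\<close> two by linarith
    then show ?thesis using par[OF _ sU] U0 k0(2) k1(2) \<open>k0 \<noteq> k1\<close> by blast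
  qed
  obtain \<theta> where \<theta>: "\<And>k s. k < length Ps \<Longrightarrow> rval k s = quatJ * exp_I (\<theta> (k, s))"
    using rval_angle by blast
  have "\<exists>m::int. 2 * \<theta> (arc_before Ps (over_point Ps u)) - \<theta> (arc_before Ps u) - \<theta> u = pi * of_int m
      \<and> (odd m \<longleftrightarrow> hit' (fst u) (snd u))" if "u \<in> ?UC" for u
    using fox_relation[of \<theta> "fst u" "snd u"] \<theta> that by simp
  then obtain m :: "param \<Rightarrow> int" where
    m: "\<And>u. u \<in> ?UC \<Longrightarrow> 2 * \<theta> (arc_before Ps (over_point Ps u)) - \<theta> (arc_before Ps u) - \<theta> u = pi * of_int (m u)"
      "\<And>u. u \<in> ?UC \<Longrightarrow> odd (m u) \<longleftrightarrow> hit' (fst u) (snd u)" by metis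
  have "pi * of_int (\<Sum>u\<in>?UC. W u * m u) = (\<Sum>u\<in>?UC. of_int (W u) * (\<Sum>a\<in>?UC. of_int (fox_entry Ps u a) * \<theta> a))"
    by (simp add: fox_sum m(1) sum_distrib_left mult.left_commute)
  also have "\<dots> = (\<Sum>a\<in>?UC. \<Sum>u\<in>?UC. of_int (W u * fox_entry Ps u a) * \<theta> a)"
    unfolding sum_distrib_left by (subst sum.swap) (simp add: mult.assoc)
  also have "\<dots> = (\<Sum>a\<in>?UC. of_int (\<Sum>u\<in>?UC. W u * fox_entry Ps u a) * \<theta> a)"
    by (simp add: sum_distrib_right)
  also have "\<dots> = 0" by (simp only: col of_int_0 mult_zero_left sum.neutral_const cong: sum.cong)
  finally have zero: "(\<Sum>u\<in>?UC. W u * m u) = 0" using pi_gt_zero by (simp del: of_int_sum)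
  have "k0 < length Ps" using U_range[OF U0(1)] by blast
  then obtain s where s: "s \<in> U k0" "hit' k0 s" "\<And>s'. s' \<in> U k0 \<Longrightarrow> hit' k0 s' \<Longrightarrow> s' = s"
    using hit_once by metis
  have "{u \<in> ?UC. odd (W u * m u)} = {(k0, s)}"
  proof (intro equalityI subsetI)
    fix u assume "u \<in> {u \<in> ?UC. odd (W u * m u)}"
    then show "u \<in> {(k0, s)}" using odd_W[of "fst u" "snd u"] m(2)[of u] s(3)[of "snd u"]
      by (cases u) (auto simp: U_def)
  next
    fix u assume "u \<in> {(k0, s)}"
    then show "u \<in> {u \<in> ?UC. odd (W u * m u)}" using odd_W m(2) s(1,2) by (auto simp: U_def)
  qed
  moreover have "even (\<Sum>u\<in>?UC. W u * m u)" using zero by simp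
  ultimately show False using even_sum_iff[OF U_finite, of "\<lambda>u. W u * m u"] by simp
qed

end

section \<open>Charts of the 3-sphere\<close>

definition open_chart :: "(real^3 \<Rightarrow> real^4) \<Rightarrow> bool" where
  "open_chart \<phi> \<longleftrightarrow> openin (top_of_set S3) (range \<phi>) \<and> (\<exists>\<psi>. homeomorphism UNIV (range \<phi>) \<phi> \<psi>)"

lemma chart_at_iff: "chart_at x \<phi> \<longleftrightarrow> open_chart \<phi> \<and> \<phi> 0 = x"
  by (simp add: chart_at_def open_chart_def conj_assoc)

lemma open_chartD:
  assumes "open_chart \<phi>"
  shows "continuous_on UNIV \<phi>" "inj \<phi>" "range \<phi> \<subseteq> S3"
proof -
  obtain \<psi> where \<psi>: "homeomorphism UNIV (range \<phi>) \<phi> \<psi>" using assms by (auto simp: open_chart_def)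
  show "continuous_on UNIV \<phi>" using \<psi> by (rule homeomorphism_cont1)
  show "inj \<phi>" by (rule inj_on_inverseI[of _ \<psi>]) (use homeomorphism_apply1[OF \<psi>] in auto)
  show "range \<phi> \<subseteq> S3" using assms openin_imp_subset unfolding open_chart_def by blast
qed

lemma open_chart_image:
  assumes \<phi>: "open_chart \<phi>" and W: "open W"
  shows "openin (top_of_set S3) (\<phi> ` W)"
proof -
  obtain \<psi> where \<psi>: "homeomorphism UNIV (range \<phi>) \<phi> \<psi>" using \<phi> by (auto simp: open_chart_def)
  have "openin (top_of_set (range \<phi>)) (\<phi> ` W)"
    using W by (intro homeomorphism_imp_open_map[OF \<psi>]) simp
  then show ?thesis using \<phi> openin_trans by (auto simp: open_chart_def)
qed

lemma open_chart_compose: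
  fixes h :: "real^3 \<Rightarrow> real^3"
  assumes \<phi>: "open_chart \<phi>" and h: "continuous_on UNIV h" "inj h"
  shows "open_chart (\<phi> \<circ> h)"
proof -
  obtain \<psi> where \<psi>: "homeomorphism UNIV (range \<phi>) \<phi> \<psi>" using \<phi> by (auto simp: open_chart_def)
  obtain k where k: "homeomorphism UNIV (range h) h k"
    using invariance_of_domain_homeomorphism[OF open_UNIV h(1) _ h(2)] by auto
  have "homeomorphism (range h) (\<phi> ` range h) \<phi> \<psi>"
    by (rule homeomorphism_of_subsets[OF \<psi>]) auto
  from homeomorphism_compose[OF k this]
  have "homeomorphism UNIV (range (\<phi> \<circ> h)) (\<phi> \<circ> h) (k \<circ> \<psi>)" by (simp add: image_comp)
  moreover have "open (range h)" using invariance_of_domain[OF h(1) open_UNIV h(2)] .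
  then have "openin (top_of_set S3) (range (\<phi> \<circ> h))"
    unfolding image_comp[symmetric] by (rule open_chart_image[OF \<phi>])
  ultimately show ?thesis by (auto simp: open_chart_def)
qed

lemma scaled_squash: "c > 0 \<Longrightarrow> continuous_on UNIV (\<lambda>v. c *\<^sub>R squash v)" "c > 0 \<Longrightarrow> inj (\<lambda>v. c *\<^sub>R squash v)"
  using continuous_on_squash inj_squash by (auto intro!: continuous_intros simp: inj_def)

lemma open_chart_shrink:
  assumes \<phi>: "open_chart \<phi>" and W: "openin (top_of_set S3) W" "\<phi> 0 \<in> W"
  obtains c where "c > 0" "\<And>v. \<phi> (c *\<^sub>R squash v) \<in> W" "open_chart (\<phi> \<circ> (\<lambda>v. c *\<^sub>R squash v))"
proof -
  have "continuous_on UNIV \<phi>" "\<phi> \<in> UNIV \<rightarrow> S3" using open_chartD[OF \<phi>] by auto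
  then have "openin (top_of_set UNIV) (UNIV \<inter> \<phi> -` W)"
    using W(1) by (intro continuous_openin_preimage) auto
  then have "open (\<phi> -` W)" by simp
  then obtain e where e: "e > 0" "ball 0 e \<subseteq> \<phi> -` W" using W(2) open_contains_ball by blast
  show ?thesis
  proof (rule that[OF e(1)])
    fix v
    have "norm (e *\<^sub>R squash v) < e" using norm_squash[of v] e(1) by (simp add: mult_less_cancel_left1)
    then have "e *\<^sub>R squash v \<in> ball 0 e" by simp
    then show "\<phi> (e *\<^sub>R squash v) \<in> W" using e(2) by blast
  qed (rule open_chart_compose[OF \<phi> scaled_squash[OF e(1)]])
qed

text \<open>
  A chart \<open>\<phi>\<close> of the sphere, shrunk to lie within a chart \<open>\<Phi>\<close>, becomes a chart of \<open>\<real>\<^sup>3\<close>.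
\<close>

lemma chart_transition:
  assumes \<Phi>: "open_chart \<Phi>" and \<phi>: "chart_at (\<Phi> x) \<phi>" and W: "open W" "x \<in> W"
  obtains c \<chi>' where "c > 0" "continuous_on UNIV \<chi>'" "inj \<chi>'" "\<chi>' 0 = x" "range \<chi>' \<subseteq> W"
    "\<And>v. \<Phi> (\<chi>' v) = \<phi> (c *\<^sub>R squash v)"
proof -
  obtain \<Psi> where \<Psi>: "homeomorphism UNIV (range \<Phi>) \<Phi> \<Psi>" using \<Phi> by (auto simp: open_chart_def)
  have \<phi>': "open_chart \<phi>" "\<phi> 0 = \<Phi> x" using \<phi> by (auto simp: chart_at_iff)
  obtain c where c: "c > 0" "\<And>v. \<phi> (c *\<^sub>R squash v) \<in> \<Phi> ` W" "open_chart (\<phi> \<circ> (\<lambda>v. c *\<^sub>R squash v))"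
    using open_chart_shrink[OF \<phi>'(1) open_chart_image[OF \<Phi> W(1)]] \<phi>'(2) W(2) by auto
  let ?h = "\<lambda>v. \<Psi> (\<phi> (c *\<^sub>R squash v))"
  note d = open_chartD[OF c(3)]
  have \<Phi>h: "\<Phi> (?h v) = \<phi> (c *\<^sub>R squash v)" for v
    using c(2)[of v] by (intro homeomorphism_apply2[OF \<Psi>]) auto
  show ?thesis
  proof (rule that[of c ?h])
    have "continuous_on UNIV (\<Psi> \<circ> (\<phi> \<circ> (\<lambda>v. c *\<^sub>R squash v)))"
      by (rule continuous_on_compose[OF d(1) continuous_on_subset[OF homeomorphism_cont2[OF \<Psi>]]])
        (use c(2) in auto)
    then show "continuous_on UNIV ?h" by (simp add: comp_def)
    show "inj ?h"
    proof (rule injI)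
      fix v w assume "?h v = ?h w"
      then have "\<phi> (c *\<^sub>R squash v) = \<phi> (c *\<^sub>R squash w)" using \<Phi>h by metis
      then show "v = w" using d(2) by (auto simp: inj_def)
    qed
    show "?h 0 = x" using \<phi>'(2) homeomorphism_apply1[OF \<Psi>] by simp
    show "range ?h \<subseteq> W"
    proof (intro image_subsetI)
      fix v
      obtain w where "w \<in> W" "\<phi> (c *\<^sub>R squash v) = \<Phi> w" using c(2) by blast
      then show "?h v \<in> W" using homeomorphism_apply1[OF \<Psi>] by simp
    qed
  qed (fact c(1), fact \<Phi>h)
qed

section \<open>Stereographic projection\<close>

lemma vector_4 [simp]:
  "(vector [x, y, z, w] :: 'a::zero^4) $ 1 = x" "(vector [x, y, z, w] :: 'a::zero^4) $ 2 = y"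
  "(vector [x, y, z, w] :: 'a::zero^4) $ 3 = z" "(vector [x, y, z, w] :: 'a::zero^4) $ 4 = w"
  unfolding vector_def by simp_all

lemma vec4_eq_iff: "(x::real^4) = y \<longleftrightarrow> x $ 1 = y $ 1 \<and> x $ 2 = y $ 2 \<and> x $ 3 = y $ 3 \<and> x $ 4 = y $ 4"
  by (simp add: Finite_Cartesian_Product.vec_eq_iff forall_4)

lemma norm_vec4: "(norm (x::real^4))\<^sup>2 = (x $ 1)\<^sup>2 + (x $ 2)\<^sup>2 + (x $ 3)\<^sup>2 + (x $ 4)\<^sup>2"
  unfolding power2_norm_eq_inner inner_vec_def sum_4 by (simp add: power2_eq_square)

lemma norm_vec3: "(norm (x::real^3))\<^sup>2 = (x $ 1)\<^sup>2 + (x $ 2)\<^sup>2 + (x $ 3)\<^sup>2"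
  unfolding power2_norm_eq_inner inner_vec_def sum_3 by (simp add: power2_eq_square)

definition stereographic :: "real^4 \<Rightarrow> real^3" where
  "stereographic y = (1 / (1 - y $ 4)) *\<^sub>R vec3 (y $ 1) (y $ 2) (y $ 3)"

lemma S3_iff: "y \<in> S3 \<longleftrightarrow> (norm y)\<^sup>2 = 1"
  using norm_ge_zero[of y] by (auto simp: S3_def power2_eq_1_iff simp del: norm_ge_zero)

lemma inv_stereographic_nth:
  "inv_stereographic v $ 1 = 2 * v $ 1 / ((norm v)\<^sup>2 + 1)" "inv_stereographic v $ 2 = 2 * v $ 2 / ((norm v)\<^sup>2 + 1)"
  "inv_stereographic v $ 3 = 2 * v $ 3 / ((norm v)\<^sup>2 + 1)" "inv_stereographic v $ 4 = ((norm v)\<^sup>2 - 1) / ((norm v)\<^sup>2 + 1)"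
  by (simp_all add: inv_stereographic_def Let_def)

lemma continuous_on_inv_stereographic: "continuous_on UNIV inv_stereographic"
proof -
  have n: "(norm v)\<^sup>2 + 1 \<noteq> 0" for v :: "real^3" using zero_le_power2[of "norm v"] by linarith
  have "continuous_on UNIV (\<lambda>v. inv_stereographic v $ i)" for i
    using exhaust_4[of i]
    by (elim disjE; simp only: inv_stereographic_nth) (intro continuous_intros ballI n)+
  then have "continuous_on UNIV (\<lambda>v. \<chi> i. inv_stereographic v $ i)" by (intro continuous_on_vec_lambda)
  then show ?thesis by (simp add: vec_nth_inverse)
qed

lemma inv_stereographic_in_S3: "inv_stereographic v \<in> S3"
proof -
  let ?n = "(norm v)\<^sup>2"
  have n: "?n + 1 \<noteq> 0" using zero_le_power2[of "norm v"] by linarith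
  have "(norm (inv_stereographic v))\<^sup>2 = (4 * ((v $ 1)\<^sup>2 + (v $ 2)\<^sup>2 + (v $ 3)\<^sup>2) + (?n - 1)\<^sup>2) / (?n + 1)\<^sup>2"
    unfolding norm_vec4 inv_stereographic_nth power_divide by (simp add: add_divide_distrib power_mult_distrib)
  also have "\<dots> = (4 * ?n + (?n - 1)\<^sup>2) / (?n + 1)\<^sup>2" by (simp add: norm_vec3)
  also have "4 * ?n + (?n - 1)\<^sup>2 = (?n + 1)\<^sup>2" by (simp add: power2_eq_square algebra_simps)
  also have "(?n + 1)\<^sup>2 / (?n + 1)\<^sup>2 = 1" using n by simp
  finally show ?thesis by (simp add: S3_iff)
qed

lemma stereographic_inv: "stereographic (inv_stereographic v) = v"
proof -
  let ?n = "(norm v)\<^sup>2"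
  have n: "?n + 1 \<noteq> 0" using zero_le_power2[of "norm v"] by linarith
  then have "1 - inv_stereographic v $ 4 = 2 / (?n + 1)"
    unfolding inv_stereographic_nth by (simp add: field_simps)
  then show ?thesis using n
    by (simp add: stereographic_def vec3_eq_iff inv_stereographic_nth)
qed

lemma inv_stereographic_stereographic:
  assumes y: "y \<in> S3" "y $ 4 \<noteq> 1"
  shows "inv_stereographic (stereographic y) = y"
proof -
  define d where "d = 1 - y $ 4"
  have d: "d \<noteq> 0" "y $ 4 = 1 - d" using y(2) by (auto simp: d_def)
  have n: "(norm (stereographic y))\<^sup>2 = ((y $ 1)\<^sup>2 + (y $ 2)\<^sup>2 + (y $ 3)\<^sup>2) / d\<^sup>2"
    unfolding norm_vec3 stereographic_def d_def by (simp add: power_divide add_divide_distrib)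
  have "(y $ 1)\<^sup>2 + (y $ 2)\<^sup>2 + (y $ 3)\<^sup>2 = 1 - (1 - d)\<^sup>2"
    using y(1) unfolding S3_iff norm_vec4 d(2) by simp
  also have "\<dots> = d * (2 - d)" by (simp add: power2_eq_square algebra_simps)
  finally have "(norm (stereographic y))\<^sup>2 = (2 - d) / d" unfolding n using d(1) by (simp add: power2_eq_square)
  then have n1: "(norm (stereographic y))\<^sup>2 + 1 = 2 / d" "(norm (stereographic y))\<^sup>2 - 1 = (2 - 2 * d) / d"
    using d(1) by (simp_all add: field_simps)
  have "stereographic y $ 1 = y $ 1 / d" "stereographic y $ 2 = y $ 2 / d" "stereographic y $ 3 = y $ 3 / d"
    by (simp_all add: stereographic_def d_def)
  then show ?thesis
    unfolding vec4_eq_iff inv_stereographic_nth n1 d(2) using d(1) by (simp add: field_simps)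
qed

lemma open_chart_inv_stereographic: "open_chart inv_stereographic"
proof -
  have r: "range inv_stereographic = {y \<in> S3. y $ 4 \<noteq> 1}"
  proof (intro equalityI subsetI)
    fix y assume "y \<in> range inv_stereographic"
    then obtain v where "y = inv_stereographic v" by blast
    moreover have "inv_stereographic v $ 4 \<noteq> 1"
      unfolding inv_stereographic_nth using zero_le_power2[of "norm v"]
      by (simp add: field_simps)
    ultimately show "y \<in> {y \<in> S3. y $ 4 \<noteq> 1}" using inv_stereographic_in_S3 by blast
  next
    fix y assume "y \<in> {y \<in> S3. y $ 4 \<noteq> 1}"
    then show "y \<in> range inv_stereographic" using inv_stereographic_stereographic by (metis (mono_tags) mem_Collect_eq rangeI)
  qed
  have "{y \<in> S3. y $ 4 \<noteq> 1} = S3 \<inter> {y. y $ 4 \<noteq> 1}" by blast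
  moreover have "open {y::real^4. y $ 4 \<noteq> 1}"
    by (intro open_Collect_neq continuous_intros)
  ultimately have "openin (top_of_set S3) (range inv_stereographic)" unfolding r by auto
  moreover have "homeomorphism UNIV (range inv_stereographic) inv_stereographic stereographic"
  proof (rule homeomorphismI)
    show "continuous_on (range inv_stereographic) stereographic"
      unfolding stereographic_def r by (intro continuous_intros) auto
  qed (use continuous_on_inv_stereographic stereographic_inv in auto)
  ultimately show ?thesis by (auto simp: open_chart_def)
qed

section \<open>The complement of the link and the arc\<close>

text \<open>
  A connected set is not a disjoint union of two or more, but finitely many, nonempty closed sets.
\<close>

lemma connected_finite_closed_cover:
  fixes C :: "'k \<Rightarrow> 'a::topological_space set"
  assumes S: "connected S" "S = (\<Union>k\<in>K. C k)" "S \<noteq> {}" and fin: "finite K"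
    and C: "\<And>k. k \<in> K \<Longrightarrow> closed (C k)" "\<And>k. k \<in> K \<Longrightarrow> C k \<noteq> {}"
      "\<And>k l. k \<in> K \<Longrightarrow> l \<in> K \<Longrightarrow> k \<noteq> l \<Longrightarrow> C k \<inter> C l = {}"
  shows "\<exists>k. K = {k}"
proof -
  obtain k where k: "k \<in> K" using S(2,3) by blast
  let ?R = "\<Union>l\<in>K - {k}. C l"
  have "closed ?R" using fin C(1) by (intro closed_UN) auto
  moreover have "C k \<inter> ?R = {}" using C(3) k by blast
  moreover have "S \<subseteq> C k \<union> ?R" using S(2) by blast
  ultimately have "C k \<inter> S = {} \<or> ?R \<inter> S = {}"
    using connected_closedD[OF S(1), of "C k" ?R] C(1)[OF k] by blast
  then have "?R = {}" using C(2)[OF k] S(2) k by blast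
  then have "K = {k}" using C(2) k by blast
  then show ?thesis ..
qed

text \<open>
  The assumptions of the theorem, together with a representation whose existence is to be refuted.
\<close>

locale link_rep =
  fixes L1 L2 \<omega> :: "(real^4) set" and x0 :: "real^4" and \<rho>
  assumes link: "two_component_link L1 L2" and arc: "connecting_arc L1 L2 \<omega>"
    and x0: "x0 \<in> S3 - (L1 \<union> L2 \<union> \<omega>)" and \<rho>: "\<rho> \<in> BD_representations {L1, L2} \<omega> x0"
begin

abbreviation "L \<equiv> L1 \<union> L2"
abbreviation "X \<equiv> L1 \<union> L2 \<union> \<omega>"

lemma components:
  shows "compact L1" "compact L2" "connected L1" "connected L2" "L1 \<noteq> {}" "L2 \<noteq> {}" "L1 \<inter> L2 = {}" "L \<subseteq> S3"
proof -
  have h: "L1 homeomorphic sphere (0::complex) 1" "L2 homeomorphic sphere (0::complex) 1"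
    and "L1 \<inter> L2 = {}" "L \<subseteq> S3"
    using link by (auto simp: two_component_link_def)
  then show "L1 \<inter> L2 = {}" "L \<subseteq> S3" by auto
  have "connected (sphere (0::complex) 1)" by (rule connected_sphere) simp
  then show "connected L1" "connected L2"
    by (simp_all only: homeomorphic_connectedness[OF h(1)] homeomorphic_connectedness[OF h(2)])
  show "compact L1" using homeomorphic_compactness[OF h(1)] by (blast intro: compact_sphere)
  show "compact L2" using homeomorphic_compactness[OF h(2)] by (blast intro: compact_sphere)
  have e: "\<not> ({} :: (real^4) set) homeomorphic sphere (0::complex) 1"
    unfolding homeomorphic_empty by simp
  show "L1 \<noteq> {}" using h(1) e by blast
  show "L2 \<noteq> {}" using h(2) e by blast
qed

lemma arc_path: "\<omega> \<subseteq> S3" "\<exists>g. arc g \<and> path_image g = \<omega> \<and> pathstart g \<in> L1 \<and> pathfinish g \<in> L2 \<and>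
    \<omega> \<inter> L = {pathstart g, pathfinish g}"
  using arc by (simp_all only: connecting_arc_def simp_thms)

lemma arc_ends: obtains p q where "p \<in> L1" "q \<in> L2" "\<omega> \<inter> L = {p, q}"
  using arc_path(2) by blast

lemma compact_\<omega>: "compact \<omega>"
proof -
  obtain g where "arc g" "path_image g = \<omega>" using arc_path(2) by blast
  then show ?thesis using compact_path_image arc_imp_path by blast
qed

lemma closed_parts: "closed L1" "closed L2" "closed \<omega>" "closed X"
  using components(1,2) compact_\<omega> by (auto intro: compact_imp_closed)

lemma charts:
  shows "x \<in> L \<Longrightarrow> \<exists>\<phi>. chart_at x \<phi> \<and> range \<phi> \<inter> L = \<phi> ` z_axis"
    and "x \<in> \<omega> - L \<Longrightarrow> \<exists>\<phi>. chart_at x \<phi> \<and> range \<phi> \<inter> X = \<phi> ` z_axis"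
    and "x \<in> \<omega> \<inter> L \<Longrightarrow> \<exists>\<phi>. chart_at x \<phi> \<and> range \<phi> \<inter> L = \<phi> ` z_axis \<and> range \<phi> \<inter> \<omega> = \<phi> ` x_ray"
proof -
  have "\<forall>x\<in>L. \<exists>\<phi>. flat_chart L x \<phi>" using link unfolding two_component_link_def by (elim conjE)
  then show "x \<in> L \<Longrightarrow> \<exists>\<phi>. chart_at x \<phi> \<and> range \<phi> \<inter> L = \<phi> ` z_axis" by (simp only: flat_chart_def)
  have "\<forall>x\<in>\<omega> - L. \<exists>\<phi>. flat_chart X x \<phi>" using arc unfolding connecting_arc_def by (elim conjE)
  then show "x \<in> \<omega> - L \<Longrightarrow> \<exists>\<phi>. chart_at x \<phi> \<and> range \<phi> \<inter> X = \<phi> ` z_axis" by (simp only: flat_chart_def)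
  have "\<forall>x\<in>\<omega> \<inter> L. \<exists>\<phi>. chart_at x \<phi> \<and> range \<phi> \<inter> L = \<phi> ` z_axis \<and> range \<phi> \<inter> \<omega> = \<phi> ` x_ray"
    using arc unfolding connecting_arc_def by (elim conjE)
  then show "x \<in> \<omega> \<inter> L \<Longrightarrow> \<exists>\<phi>. chart_at x \<phi> \<and> range \<phi> \<inter> L = \<phi> ` z_axis \<and> range \<phi> \<inter> \<omega> = \<phi> ` x_ray"
    by (rule bspec)
qed

lemma flat_chart_cases:
  assumes x: "x \<in> X"
  obtains \<phi> where "chart_at x \<phi>" "\<phi> -` X = z_axis \<or> \<phi> -` X = z_axis \<union> x_ray"
proof -
  have pre: "\<phi> -` Y = A" if "chart_at x \<phi>" "range \<phi> \<inter> Y = \<phi> ` A" for \<phi> Y A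
    using that open_chartD(2)[of \<phi>] by (auto simp: chart_at_iff inj_def)
  consider "x \<in> L - \<omega>" | "x \<in> \<omega> - L" | "x \<in> \<omega> \<inter> L" using x by blast
  then show ?thesis
  proof cases
    case 1
    then obtain \<phi> where \<phi>: "chart_at x \<phi>" "range \<phi> \<inter> L = \<phi> ` z_axis"
      using charts(1)[of x] by blast
    have "openin (top_of_set S3) (S3 - \<omega>)" using closed_parts(3) by (simp add: Diff_eq openin_open_Int open_Compl)
    moreover have "\<phi> 0 \<in> S3 - \<omega>" using 1 \<phi>(1) components(8) by (auto simp: chart_at_iff)
    moreover have "open_chart \<phi>" using \<phi>(1) by (simp add: chart_at_iff)
    ultimately obtain c where c: "c > 0" "\<And>v. \<phi> (c *\<^sub>R squash v) \<in> S3 - \<omega>" "open_chart (\<phi> \<circ> (\<lambda>v. c *\<^sub>R squash v))"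
      using open_chart_shrink[of \<phi> "S3 - \<omega>"] by blast
    let ?\<phi> = "\<phi> \<circ> (\<lambda>v. c *\<^sub>R squash v)"
    have "?\<phi> v \<in> X \<longleftrightarrow> v \<in> z_axis" for v
    proof -
      have "?\<phi> v \<in> X \<longleftrightarrow> c *\<^sub>R squash v \<in> \<phi> -` L" using c(2)[of v] by simp
      also have "\<dots> \<longleftrightarrow> v \<in> z_axis" unfolding pre[OF \<phi>] using c(1) by simp
      finally show ?thesis .
    qed
    then have "?\<phi> -` X = z_axis" by blast
    moreover have "chart_at x ?\<phi>" using c(3) \<phi>(1) by (simp add: chart_at_iff)
    ultimately show ?thesis by (intro that[of ?\<phi>] disjI1)
  next
    case 2
    then obtain \<phi> where \<phi>: "chart_at x \<phi>" "range \<phi> \<inter> X = \<phi> ` z_axis"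
      using charts(2)[of x] by blast
    then show ?thesis by (intro that[OF \<phi>(1)] disjI1 pre)
  next
    case 3
    then obtain \<phi> where \<phi>: "chart_at x \<phi>" "range \<phi> \<inter> L = \<phi> ` z_axis" "range \<phi> \<inter> \<omega> = \<phi> ` x_ray"
      using charts(3)[of x] by blast
    have "\<phi> -` X = z_axis \<union> x_ray"
      unfolding vimage_Un[of \<phi> L \<omega>] pre[OF \<phi>(1,2)] pre[OF \<phi>(1,3)] ..
    then show ?thesis by (intro that[OF \<phi>(1)] disjI2)
  qed
qed

text \<open>
  The link together with the arc is locally flat, or locally a line with a ray attached, so it does not
  separate the sphere.
\<close>

lemma path_connected_complement: "path_connected (S3 - X)"
proof -
  have con: "connected (S3 - X)"
  proof (rule connected_diff_thin[where S = S3])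
    show "connected S3" unfolding S3_def by (rule connected_sphere) simp
    have "X = S3 \<inter> X" using components(8) arc_path(1) by blast
    then show "closedin (top_of_set S3) X" using closed_parts(4) by (metis closedin_closed_Int)
    fix x assume "x \<in> S3 \<inter> X"
    then obtain \<phi> where \<phi>: "chart_at x \<phi>" "\<phi> -` X = z_axis \<or> \<phi> -` X = z_axis \<union> x_ray"
      using flat_chart_cases by blast
    then have o: "open_chart \<phi>" "\<phi> 0 = x" by (auto simp: chart_at_iff)
    have "range \<phi> - X = \<phi> ` (- (\<phi> -` X))" by blast
    moreover have "connected (- (\<phi> -` X))"
      using \<phi>(2) connected_Compl_z_axis connected_Compl_z_axis_x_ray by metis
    then have "connected (\<phi> ` (- (\<phi> -` X)))"
      using open_chartD(1)[OF o(1)] by (intro connected_continuous_image) (auto elim: continuous_on_subset)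
    ultimately show "\<exists>N. openin (top_of_set S3) N \<and> x \<in> N \<and> N \<subseteq> S3 \<and> connected (N - X)"
      using o open_chart_image[OF o(1) open_UNIV] open_chartD(3)[OF o(1)] by (metis rangeI)
    fix N assume N: "openin (top_of_set S3) N" "x \<in> N"
    then obtain c where c: "c > 0" "\<And>v. \<phi> (c *\<^sub>R squash v) \<in> N"
      using open_chart_shrink[OF o(1)] o(2) by metis
    have "vec3 0 1 0 \<notin> z_axis" "vec3 0 1 0 \<notin> x_ray" by (auto simp: z_axis_def x_ray_def)
    then have "c *\<^sub>R squash (vec3 0 1 0) \<notin> z_axis \<union> x_ray"
      using squash_z_axis[of c] squash_x_ray[of c] c(1) by simp
    then have "\<phi> (c *\<^sub>R squash (vec3 0 1 0)) \<notin> X" using \<phi>(2) by blast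
    then show "N - X \<noteq> {}" using c(2) by blast
  qed simp
  have op: "openin (top_of_set S3) (S3 - X)"
    using closed_parts(4) by (simp only: Diff_eq openin_open_Int open_Compl)
  have "locally path_connected (S3 - X)"
    by (rule locally_open_subset[OF _ op]) (simp add: S3_def locally_path_connected_sphere)
  from path_component_eq_connected_component[OF this] show ?thesis
    using con by (simp add: path_connected_component connected_iff_connected_component)
qed

text \<open>
  The prescribed values on meridians become conditions on the circles of charts.  The axis of a chart
  that avoids the arc lies on one of the two components, since it is connected.
\<close>

lemma path_rep_complement:
  obtains F where "path_rep (S3 - X) F"
    "\<And>\<phi>. open_chart \<phi> \<Longrightarrow> \<phi> -` L = {} \<Longrightarrow> \<phi> -` \<omega> = z_axis \<Longrightarrow> F (\<phi> \<circ> unit_circle) = - 1"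
    "\<And>\<phi>. open_chart \<phi> \<Longrightarrow> \<phi> -` L = z_axis \<Longrightarrow> \<phi> -` \<omega> = {} \<Longrightarrow> F (\<phi> \<circ> unit_circle) \<in> S1_B"
proof -
  have X: "\<Union>{L1, L2} \<union> \<omega> = X" by auto
  have r: "\<rho> \<in> hom (fundamental_group (S3 - X) x0) BD" "\<And>K \<mu>. K \<in> {L1, L2} \<Longrightarrow> \<mu> \<in> meridians X K x0 \<Longrightarrow> \<rho> \<mu> \<in> S1_B"
      "\<And>\<mu>. \<mu> \<in> meridians X \<omega> x0 \<Longrightarrow> \<rho> \<mu> = -1"
    using \<rho> unfolding BD_representations_def X Let_def by blast+
  obtain F where F: "path_rep (S3 - X) F"
    "\<And>l. path l \<Longrightarrow> path_image l \<subseteq> S3 - X \<Longrightarrow> pathfinish l = pathstart l \<Longrightarrow>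
       \<exists>q. path q \<and> path_image q \<subseteq> S3 - X \<and> pathstart q = x0 \<and> pathfinish q = pathstart l \<and>
           F l = \<rho> (loop_class (S3 - X) (q +++ l +++ reversepath q))"
    by (rule path_rep_of_hom[OF r(1) path_connected_complement x0]) blast
  have mer: "\<exists>\<mu>\<in>meridians X A x0. F (\<phi> \<circ> unit_circle) = \<rho> \<mu>"
    if \<phi>: "open_chart \<phi>" "\<phi> -` X = z_axis" and A: "\<phi> ` z_axis \<subseteq> A" for \<phi> A
  proof -
    let ?l = "\<phi> \<circ> unit_circle"
    have uc: "unit_circle t \<notin> z_axis" for t
    proof
      assume "unit_circle t \<in> z_axis"
      then have "(sin (2 * pi * t))\<^sup>2 + (cos (2 * pi * t))\<^sup>2 = 0" by (simp add: z_axis_def unit_circle_def)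
      then show False by simp
    qed
    have l: "path ?l"
    proof (rule path_continuous_image)
      show "path unit_circle" unfolding path_def unit_circle_def by (intro continuous_intros)
      show "continuous_on (path_image unit_circle) \<phi>"
        by (rule continuous_on_subset[OF open_chartD(1)[OF \<phi>(1)] subset_UNIV])
    qed
    have "path_image ?l \<subseteq> S3 - X"
      unfolding path_image_def
    proof (rule image_subsetI)
      fix t
      have "unit_circle t \<notin> \<phi> -` X" unfolding \<phi>(2) by (rule uc)
      then show "?l t \<in> S3 - X" using open_chartD(3)[OF \<phi>(1)] by auto
    qed
    moreover have "pathfinish ?l = pathstart ?l"
      by (simp add: pathfinish_def pathstart_def unit_circle_def)
    ultimately obtain q where q: "path q" "path_image q \<subseteq> S3 - X" "pathstart q = x0" "pathfinish q = pathstart ?l"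
        "F ?l = \<rho> (loop_class (S3 - X) (q +++ ?l +++ reversepath q))"
      using F(2)[OF l] by blast
    have "range \<phi> \<inter> X = \<phi> ` (\<phi> -` X)" by blast
    then have "flat_chart X (\<phi> 0) \<phi>" using \<phi> by (simp only: flat_chart_def chart_at_iff)
    moreover have "pathfinish q = \<phi> (unit_circle 0)" using q(4) by (simp add: pathstart_def)
    ultimately have "loop_class (S3 - X) (q +++ ?l +++ reversepath q) \<in> meridians X A x0"
      unfolding meridians_def mem_Collect_eq using A q(1-3) by blast
    then show ?thesis using q(5) by blast
  qed
  show ?thesis
  proof (rule that[OF F(1)])
    fix \<phi> assume \<phi>: "open_chart \<phi>" "\<phi> -` L = {}" "\<phi> -` \<omega> = z_axis"
    then have "\<phi> -` X = z_axis" "\<phi> ` z_axis \<subseteq> \<omega>" by blast+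
    then show "F (\<phi> \<circ> unit_circle) = - 1" using mer[OF \<phi>(1)] r(3) by metis
  next
    fix \<phi> assume \<phi>: "open_chart \<phi>" "\<phi> -` L = z_axis" "\<phi> -` \<omega> = {}"
    then have a: "\<phi> -` X = z_axis" "\<phi> ` z_axis \<subseteq> L" by blast+
    have "z_axis = range (\<lambda>t. vec3 0 0 t)"
      by (auto simp: z_axis_def image_iff vec3_eq_iff)
    moreover have "connected (range (\<lambda>t. vec3 0 0 t))"
      by (intro connected_continuous_image continuous_intros connected_UNIV)
    ultimately have "connected z_axis" by simp
    then have "connected (\<phi> ` z_axis)"
      using open_chartD(1)[OF \<phi>(1)] by (intro connected_continuous_image) (auto elim: continuous_on_subset)
    then have "L1 \<inter> \<phi> ` z_axis = {} \<or> L2 \<inter> \<phi> ` z_axis = {}"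
      by (rule connected_closedD) (use a(2) components(7) closed_parts(1,2) in auto)
    then have "\<phi> ` z_axis \<subseteq> L1 \<or> \<phi> ` z_axis \<subseteq> L2" using a(2) by blast
    then show "F (\<phi> \<circ> unit_circle) \<in> S1_B" using mer[OF \<phi>(1) a(1)] r(2) by (metis insertCI)
  qed
qed

text \<open>
  A chart that contains the link carries the representation, and all charts of the link and of the arc,
  over to \<open>\<real>\<^sup>3\<close>.  The arc may leave the chart, so the part of it in \<open>\<real>\<^sup>3\<close> is closed,
  but perhaps not compact.
\<close>

lemma link_arc_vimage:
  assumes \<Phi>: "open_chart \<Phi>" and L: "L \<subseteq> range \<Phi>"
  obtains F where "link_arc (\<Phi> -` L) (\<Phi> -` \<omega>) F"
proof -
  obtain \<Psi> where \<Psi>: "homeomorphism UNIV (range \<Phi>) \<Phi> \<Psi>" using \<Phi> by (auto simp: open_chart_def)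
  note \<Phi>' = open_chartD[OF \<Phi>]
  obtain F where F: "path_rep (S3 - X) F"
    "\<And>\<phi>. open_chart \<phi> \<Longrightarrow> \<phi> -` L = {} \<Longrightarrow> \<phi> -` \<omega> = z_axis \<Longrightarrow> F (\<phi> \<circ> unit_circle) = - 1"
    "\<And>\<phi>. open_chart \<phi> \<Longrightarrow> \<phi> -` L = z_axis \<Longrightarrow> \<phi> -` \<omega> = {} \<Longrightarrow> F (\<phi> \<circ> unit_circle) \<in> S1_B"
    by (rule path_rep_complement) blast
  have axis: "\<phi> (c *\<^sub>R squash v) \<in> Y \<longleftrightarrow> c *\<^sub>R squash v \<in> A"
    if "chart_at x \<phi>" "range \<phi> \<inter> Y = \<phi> ` A" for x \<phi> Y A c v
    using that open_chartD(2)[of \<phi>] by (auto simp: chart_at_iff inj_def)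
  have "link_arc (\<Phi> -` L) (\<Phi> -` \<omega>) (\<lambda>p. F (\<Phi> \<circ> p))"
  proof
    have "\<Phi> -` L = \<Psi> ` L"
    proof (intro equalityI subsetI)
      fix v assume "v \<in> \<Phi> -` L"
      then show "v \<in> \<Psi> ` L" using homeomorphism_apply1[OF \<Psi>, of v] by (metis UNIV_I imageI vimageD)
    next
      fix v assume "v \<in> \<Psi> ` L"
      then show "v \<in> \<Phi> -` L" using homeomorphism_apply2[OF \<Psi>] L by auto
    qed
    moreover have "compact (\<Psi> ` L)"
      using homeomorphism_cont2[OF \<Psi>] components(1,2) L
      by (intro compact_continuous_image) (auto elim: continuous_on_subset)
    ultimately show "compact (\<Phi> -` L)" by simp
    show "closed (\<Phi> -` \<omega>)" using closed_parts(3) \<Phi>'(1) by (rule closed_vimage)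
    show "path_rep (- (\<Phi> -` L \<union> \<Phi> -` \<omega>)) (\<lambda>p. F (\<Phi> \<circ> p))"
      by (rule path_rep_pullback[OF F(1)]) (use \<Phi>'(1,3) in \<open>auto elim: continuous_on_subset\<close>)
  next
    fix x W assume x: "x \<in> \<Phi> -` \<omega> - \<Phi> -` L" and W: "open W" "x \<in> W" "W \<inter> \<Phi> -` L = {}"
    then obtain \<phi> where \<phi>: "chart_at (\<Phi> x) \<phi>" "range \<phi> \<inter> X = \<phi> ` z_axis"
      using charts(2)[of "\<Phi> x"] by blast
    obtain c \<chi>' where \<chi>: "c > 0" "continuous_on UNIV \<chi>'" "inj \<chi>'" "\<chi>' 0 = x" "range \<chi>' \<subseteq> W"
      "\<And>v. \<Phi> (\<chi>' v) = \<phi> (c *\<^sub>R squash v)" by (rule chart_transition[OF \<Phi> \<phi>(1) W(1,2)]) blast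
    have "\<chi>' v \<in> \<Phi> -` \<omega> \<longleftrightarrow> v \<in> z_axis" for v
    proof -
      have "\<Phi> (\<chi>' v) \<notin> L" using \<chi>(5) W(3) by blast
      then have "\<Phi> (\<chi>' v) \<in> \<omega> \<longleftrightarrow> \<Phi> (\<chi>' v) \<in> X" by blast
      then show ?thesis using axis[OF \<phi>, of c v] squash_z_axis[of c v] \<chi>(1,6) by simp
    qed
    then have "\<chi>' -` \<Phi> -` \<omega> = z_axis" by blast
    then show "\<exists>\<phi>. continuous_on UNIV \<phi> \<and> inj \<phi> \<and> \<phi> 0 = x \<and> range \<phi> \<subseteq> W \<and> \<phi> -` \<Phi> -` \<omega> = z_axis"
      using \<chi>(2-5) by blast
  next
    fix x W assume x: "x \<in> \<Phi> -` L \<inter> \<Phi> -` \<omega>" and W: "open W" "x \<in> W"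
    then obtain \<phi> where \<phi>: "chart_at (\<Phi> x) \<phi>" "range \<phi> \<inter> L = \<phi> ` z_axis" "range \<phi> \<inter> \<omega> = \<phi> ` x_ray"
      using charts(3)[of "\<Phi> x"] by blast
    obtain c \<chi>' where \<chi>: "c > 0" "continuous_on UNIV \<chi>'" "inj \<chi>'" "\<chi>' 0 = x" "range \<chi>' \<subseteq> W"
      "\<And>v. \<Phi> (\<chi>' v) = \<phi> (c *\<^sub>R squash v)" by (rule chart_transition[OF \<Phi> \<phi>(1) W]) blast
    have "\<Phi> (\<chi>' v) \<in> L \<longleftrightarrow> v \<in> z_axis" "\<Phi> (\<chi>' v) \<in> \<omega> \<longleftrightarrow> v \<in> x_ray" for v
      using axis[OF \<phi>(1,2), of c v] axis[OF \<phi>(1,3), of c v] squash_z_axis[of c v] squash_x_ray[of c v] \<chi>(1,6)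
      by simp_all
    then have "\<chi>' -` \<Phi> -` L = z_axis" "\<chi>' -` \<Phi> -` \<omega> = x_ray" by blast+
    then show "\<exists>\<phi>. continuous_on UNIV \<phi> \<and> inj \<phi> \<and> \<phi> 0 = x \<and> range \<phi> \<subseteq> W \<and>
        \<phi> -` \<Phi> -` L = z_axis \<and> \<phi> -` \<Phi> -` \<omega> = x_ray"
      using \<chi>(2-5) by blast
  next
    fix \<phi> :: "real^3 \<Rightarrow> real^3"
    assume \<phi>: "continuous_on UNIV \<phi>" "inj \<phi>" and "\<phi> -` \<Phi> -` L = {}" "\<phi> -` \<Phi> -` \<omega> = z_axis"
    then have "F ((\<Phi> \<circ> \<phi>) \<circ> unit_circle) = - 1"
      by (intro F(2) open_chart_compose[OF \<Phi>]) (auto simp: vimage_comp)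
    then show "F (\<Phi> \<circ> (\<phi> \<circ> unit_circle)) = - 1" by (simp add: comp_assoc)
  next
    fix \<phi> :: "real^3 \<Rightarrow> real^3"
    assume \<phi>: "continuous_on UNIV \<phi>" "inj \<phi>" and "\<phi> -` \<Phi> -` L = z_axis" "\<phi> -` \<Phi> -` \<omega> = {}"
    then have "F ((\<Phi> \<circ> \<phi>) \<circ> unit_circle) \<in> S1_B"
      by (intro F(3) open_chart_compose[OF \<Phi>]) (auto simp: vimage_comp)
    then show "F (\<Phi> \<circ> (\<phi> \<circ> unit_circle)) \<in> S1_B" by (simp add: comp_assoc)
  qed
  then show ?thesis by (rule that)
qed

end

section \<open>Links with determinant zero\<close>

context poly_link
begin

lemma range_pt: assumes k: "k < length Ps" shows "range (pt k) = pt k ` {0..of_int (len k)}"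
proof (intro equalityI subsetI)
  fix x assume "x \<in> range (pt k)"
  then obtain t where "x = pt k t" by blast
  then have "x = pt k (red k t)" using same_paramD[OF red_same] by simp
  then show "x \<in> pt k ` {0..of_int (len k)}" using red_bounds[OF k, of t] by auto
qed auto

lemma compact_connected_range_pt:
  assumes k: "k < length Ps" shows "compact (range (pt k))" "connected (range (pt k))"
  unfolding range_pt[OF k]
  by (intro compact_continuous_image connected_continuous_image continuous_on_pt compact_Icc connected_Icc)+

end

context link_rep
begin

text \<open>
  The polygons are the connected components of the link, so there are two of them, and each contains
  one end of the arc.
\<close>

lemma no_vanishing_minor:
  assumes Ps: "embedded_polygonal_link Ps" "regular_position Ps" "every_component_passes_under Ps"
    and \<Phi>: "open_chart \<Phi>" and eq: "\<Phi> ` link_point Ps ` params Ps = L"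
    and us: "distinct us" "set us = undercrossings Ps" and rc: "r < length us" "c < length us"
    and det: "Determinant.det (mat_delete (fox_matrix Ps us) r c) = 0"
  shows False
proof -
  interpret poly_link Ps by unfold_locales (fact Ps)+
  note \<Phi>' = open_chartD[OF \<Phi>]
  have "L \<subseteq> range \<Phi>" using eq by (metis image_mono subset_UNIV)
  then obtain F where F: "link_arc (\<Phi> -` L) (\<Phi> -` \<omega>) F" using link_arc_vimage[OF \<Phi>] by metis
  obtain p q where pq: "p \<in> L1" "q \<in> L2" "\<omega> \<inter> L = {p, q}" using arc_ends by metis
  have P_eq: "\<Phi> -` L = (\<Union>k<length Ps. range (pt k))"
    unfolding eq[symmetric] inj_vimage_image_eq[OF \<Phi>'(2)] by (rule image_link_point)
  have "finite (\<Phi> -` L \<inter> \<Phi> -` \<omega>)"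
    unfolding vimage_Int[symmetric] Int_commute[of L] pq(3) by (intro finite_vimageI \<Phi>'(2)) simp
  then interpret diagram Ps "\<Phi> -` L" "\<Phi> -` \<omega>" F
    by (intro diagram.intro diagram_axioms.intro F poly_link_axioms P_eq)
  define n where "n = length Ps"
  define C where "C k = \<Phi> ` range (pt k)" for k
  have cont: "continuous_on S \<Phi>" for S by (rule continuous_on_subset[OF \<Phi>'(1) subset_UNIV])
  have C: "compact (C k)" "connected (C k)" "C k \<noteq> {}" if "k < n" for k
    using compact_connected_range_pt[of k] that unfolding C_def n_def
    by (auto intro: compact_continuous_image connected_continuous_image cont)
  have disj: "C k \<inter> C l = {}" if "k < n" "l < n" "k \<noteq> l" for k l
  proof -
    have False if "\<Phi> (pt k s) = \<Phi> (pt l t)" for s t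
      using pt_inj[of k l s t] same_paramD[of k s l t] \<open>k < n\<close> \<open>l < n\<close> \<open>k \<noteq> l\<close> injD[OF \<Phi>'(2) that] by (simp add: n_def)
    then show ?thesis unfolding C_def by blast
  qed
  have cover: "L = (\<Union>k<n. C k)"
    unfolding C_def eq[symmetric] image_link_point n_def by blast
  have in_cover: "\<exists>k<n. x \<in> C k" if "x \<in> L" for x
  proof -
    have "x \<in> (\<Union>k<n. C k)" using that by (simp only: cover)
    then show ?thesis by blast
  qed
  have one: "C k \<subseteq> L1 \<or> C k \<subseteq> L2" if "k < n" for k
  proof -
    have sub: "C k \<subseteq> L" using cover that by blast
    have "L1 \<inter> C k = {} \<or> L2 \<inter> C k = {}"
      by (rule connected_closedD[OF C(2)[OF that] _ sub closed_parts(1,2)]) (use components(7) in blast)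
    then show ?thesis using sub by blast
  qed
  have part: "\<exists>k<n. C k = A \<and> (\<forall>l<n. C l \<subseteq> A \<longrightarrow> l = k)"
    if A: "connected A" "A \<noteq> {}" "A \<subseteq> L" and sep: "\<And>k. k < n \<Longrightarrow> C k \<subseteq> A \<or> C k \<inter> A = {}" for A
  proof -
    let ?K = "{k \<in> {..<n}. C k \<subseteq> A}"
    have K: "A = (\<Union>k\<in>?K. C k)"
    proof (intro equalityI subsetI)
      fix x assume x: "x \<in> A"
      then obtain k where k: "k < n" "x \<in> C k" using in_cover A(3) by blast
      then have "C k \<subseteq> A" using sep[of k] x by blast
      then show "x \<in> (\<Union>k\<in>?K. C k)" using k by blast
    qed blast
    have "\<exists>k. ?K = {k}"
    proof (rule connected_finite_closed_cover[OF A(1) K A(2)])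
      show "closed (C k)" "C k \<noteq> {}" if "k \<in> ?K" for k
        using C(1,3)[of k] that by (auto intro: compact_imp_closed)
      show "C k \<inter> C l = {}" if "k \<in> ?K" "l \<in> ?K" "k \<noteq> l" for k l
        using disj that by blast
    qed simp
    then obtain k where k: "?K = {k}" by blast
    have "A = C k" using K unfolding k by simp
    moreover have "k \<in> ?K" unfolding k by simp
    moreover have "l = k" if "l < n" "C l \<subseteq> A" for l
    proof -
      have "l \<in> ?K" using that by simp
      then show ?thesis unfolding k by simp
    qed
    ultimately show ?thesis by blast
  qed
  obtain k1 where k1: "k1 < n" "C k1 = L1" "\<And>l. l < n \<Longrightarrow> C l \<subseteq> L1 \<Longrightarrow> l = k1"
  proof -
    have "C k \<subseteq> L1 \<or> C k \<inter> L1 = {}" if "k < n" for k using one[OF that] components(7) by blast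
    then show ?thesis using part[OF components(3,5)] that by blast
  qed
  obtain k2 where k2: "k2 < n" "C k2 = L2" "\<And>l. l < n \<Longrightarrow> C l \<subseteq> L2 \<Longrightarrow> l = k2"
  proof -
    have "C k \<subseteq> L2 \<or> C k \<inter> L2 = {}" if "k < n" for k using one[OF that] components(7) by blast
    then show ?thesis using part[OF components(4,6)] that by blast
  qed
  have kk: "{..<n} = {k1, k2}" using k1(1,3) k2(1,3) one by blast
  have "k1 \<noteq> k2" using k1(2) k2(2) components(5,7) by auto
  then have "card {..<n} = 2" unfolding kk by simp
  then have two: "length Ps = 2" by (simp add: n_def)
  have end_in: "\<exists>!x. x \<in> C k \<inter> \<omega>" if k: "k < n" for k
  proof -
    have "L1 \<inter> \<omega> = {p}" "L2 \<inter> \<omega> = {q}" using pq components(7) by blast+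
    moreover have "k = k1 \<or> k = k2" using k kk by blast
    ultimately have "C k \<inter> \<omega> = {p} \<or> C k \<inter> \<omega> = {q}" using k1(2) k2(2) by metis
    then show ?thesis by (elim disjE) simp_all
  qed
  have "\<exists>t. 0 \<le> t \<and> t < of_int (len k) \<and> \<Phi> (pt k t) \<in> \<omega> \<and>
      (\<forall>s. \<Phi> (pt k s) \<in> \<omega> \<longrightarrow> same_param k s k t)" if k: "k < length Ps" for k
  proof -
    have k': "k < n" using k by (simp add: n_def)
    obtain t where t: "\<Phi> (pt k t) \<in> \<omega>" using end_in[OF k'] unfolding C_def by blast
    have eq: "pt k (red k t) = pt k t" using same_paramD[OF red_same] by blast
    have "same_param k s k (red k t)" if s: "\<Phi> (pt k s) \<in> \<omega>" for s
    proof -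
      have "\<Phi> (pt k s) = \<Phi> (pt k (red k t))" using end_in[OF k'] s t unfolding C_def eq by blast
      then have "pt k s = pt k (red k t)" by (rule injD[OF \<Phi>'(2)])
      then show ?thesis by (rule pt_inj[OF k k])
    qed
    then show ?thesis using red_bounds[OF k, of t] t eq by (intro exI[of _ "red k t"]) simp
  qed
  then obtain \<tau> where \<tau>: "\<And>k. k < length Ps \<Longrightarrow> 0 \<le> \<tau> k" "\<And>k. k < length Ps \<Longrightarrow> \<tau> k < of_int (len k)"
    "\<And>k. k < length Ps \<Longrightarrow> \<Phi> (pt k (\<tau> k)) \<in> \<omega>"
    "\<And>k s. k < length Ps \<Longrightarrow> \<Phi> (pt k s) \<in> \<omega> \<Longrightarrow> same_param k s k (\<tau> k)" by metis
  interpret crossing_diagram Ps "\<Phi> -` L" "\<Phi> -` \<omega>" F \<tau>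
  proof
    show "finite (undercrossings Ps)" using us(2) by (metis List.finite_set)
    show "\<exists>s. (k, s) \<in> undercrossings Ps" if "k < length Ps" for k
      using Ps(3) that by (simp add: every_component_passes_under_def)
  qed (use \<tau> in auto)
  show False by (rule fox_contradiction[OF two us rc det])
qed

text \<open>
  The chart is the inverse of stereographic projection followed by the inverse of the end of the
  isotopy that carries the link to the polygonal link.
\<close>

lemma no_vanishing_determinant: "\<not> is_link_det L 0"
proof
  assume "is_link_det L 0"
  then obtain Ps us r c where
    Ps: "embedded_polygonal_link Ps" "regular_position Ps" "every_component_passes_under Ps"
    and iso: "ambient_isotopic L (inv_stereographic ` link_point Ps ` params Ps)"
    and us: "distinct us" "set us = undercrossings Ps" and rc: "r < length us" "c < length us"
    and det: "0 = \<bar>Determinant.det (mat_delete (fox_matrix Ps us) r c)\<bar>"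
    unfolding is_link_det_def by metis
  from iso obtain H where H: "\<forall>t\<in>{0..1::real}. \<exists>g. homeomorphism S3 S3 (H t) g"
      "H 1 ` L = inv_stereographic ` link_point Ps ` params Ps"
    unfolding ambient_isotopic_def by blast
  then obtain g where g: "homeomorphism S3 S3 (H 1) g" by force
  have "open_chart (g \<circ> inv_stereographic)"
  proof -
    obtain \<psi> where \<psi>: "homeomorphism UNIV (range inv_stereographic) inv_stereographic \<psi>"
      and o: "openin (top_of_set S3) (range inv_stereographic)"
      using open_chart_inv_stereographic by (auto simp: open_chart_def)
    note gs = homeomorphism_symD[OF g]
    have "homeomorphism (range inv_stereographic) (g ` range inv_stereographic) g (H 1)"
      by (rule homeomorphism_of_subsets[OF gs]) (use open_chartD(3)[OF open_chart_inv_stereographic] in auto)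
    from homeomorphism_compose[OF \<psi> this] show ?thesis
      using homeomorphism_imp_open_map[OF gs o] by (auto simp: open_chart_def image_comp)
  qed
  moreover have "g ` H 1 ` L = L"
  proof -
    have "g (H 1 x) = x" if "x \<in> L" for x
      using that components(8) by (intro homeomorphism_apply1[OF g]) blast
    then show ?thesis by (simp add: image_image)
  qed
  then have "(g \<circ> inv_stereographic) ` link_point Ps ` params Ps = L"
    unfolding H(2) by (simp add: image_image)
  ultimately show False
    by (rule no_vanishing_minor[OF Ps _ _ us rc]) (use det in simp)
qed

end

theorem theorem4p4:
  fixes L1 L2 \<omega> :: "(real^4) set" and x0 :: "real^4"
  assumes "two_component_link L1 L2"
    and "is_link_det (L1 \<union> L2) 0"
    and "connecting_arc L1 L2 \<omega>"
    and "x0 \<in> S3 - (L1 \<union> L2 \<union> \<omega>)"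
  shows "R_B {L1, L2} \<omega> x0 = {}"
proof -
  have "\<rho> \<notin> BD_representations {L1, L2} \<omega> x0" for \<rho>
  proof
    assume "\<rho> \<in> BD_representations {L1, L2} \<omega> x0"
    then interpret link_rep L1 L2 \<omega> x0 \<rho> using assms by unfold_locales
    show False using no_vanishing_determinant assms(2) by contradiction
  qed
  then have "BD_representations {L1, L2} \<omega> x0 = {}" by blast
  then show ?thesis by (simp add: R_B_def quotient_def)
qed

end
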